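(* Let $p$ be a prime and let $K$ be a finite extension of $\mathbb{Q}_p$ contained in $\bar{\mathbb{Q}}_p$, with valuation ring $\mathcal{O}_K$, maximal ideal $\mathcal{P}_K$ and residue field of cardinality $q$. Fix a uniformising parameter $\pi$ of $K$ and let $P(X)=X^q+\sum_{i=2}^{q-1}a_iX^i+\pi X\in\mathcal{O}_K[X]$ be a Lubin-Tate polynomial of degree $q$ with respect to $\pi$. Let $K_{\pi,2}$ be the second Lubin-Tate extension of $K$ with respect to $\pi$ and let $M_{\pi,2}$ be the unique subextension of $K_{\pi,2}/K$ with $[M_{\pi,2}:K]=q$ (a maximal abelian totally, weakly and wildly ramified extension of $K$). Let $\mathcal{A}_{M_{\pi,2}/K}$ be the unique fractional ideal of $M_{\pi,2}$ whose square is the inverse different of $M_{\pi,2}/K$. Let $\pi'$ be another uniformising parameter of $K$ with $\pi\equiv\pi'\bmod\mathcal{P}_K^3$, let $Q\in\mathcal{O}_K[X]$ be a Lubin-Tate polynomial with respect to $\pi'$, let $\{\omega_i\}_{i>0}$ be a coherent set of roots associated to $Q$, and let $$\mathcal{E}^{Q}_{P,2}(X)=\exp_{F_P}\left(\omega_2(X-X^q)+\frac{\omega_1(X^q-X^{q^2})}{\pi}\right).$$ If $v_p(a_{q-1})=v_p(\pi)$, then: 1. The element $\mathrm{Tr}_{K_{\pi,2}/M_{\pi,2}}(\mathcal{E}^{Q}_{P,2}(1))$ is a uniformising parameter of $M_{\pi,2}$ and a generator of the valuation ring $\mathcal{O}_{M_{\pi,2}}$ over its associated order in the extension $M_{\pi,2}/K$.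 2. If $p$ is odd, then the elements $$\frac{\mathrm{Tr}_{K_{\pi,2}/M_{\pi,2}}(\mathcal{E}^{Q}_{P,2}(1))}{\pi}\quad\text{and}\quad\frac{\mathrm{Tr}_{K_{\pi,2}/M_{\pi,2}}(\mathcal{E}^{Q}_{P,2}(1))+q}{\pi}$$ are both generators of $\mathcal{A}_{M_{\pi,2}/K}$ over $\mathcal{O}_K[\mathrm{Gal}(M_{\pi,2}/K)]$.
   Context: $\bar{\mathbb{Q}}_p$ is a fixed algebraic closure of $\mathbb{Q}_p$, $\mathbb{C}_p$ its completion, and $v_p$ the valuation on $\mathbb{C}_p$ with $v_p(p)=1$. A polynomial $P\in\mathcal{O}_K[X]$ is a Lubin-Tate polynomial with respect to the uniformising parameter $\pi$ if $P(X)\equiv \pi X \bmod X^2\mathcal{O}_K[X]$ and $P(X)\equiv X^q\bmod \pi\mathcal{O}_K[X]$. In the hypothesis on $a_{q-1}$, $a_{q-1}$ denotes the coefficient of $X^{q-1}$ in $P$ (so when $q=2$ it is $\pi$). $F_P(X,Y)\in\mathcal{O}_K[[X,Y]]$ is the unique one-dimensional commutative formal group with $P(F_P(X,Y))=F_P(P(X),P(Y))$, and $\exp_{F_P}\in XK[[X]]$ is the unique power series with $\exp_{F_P}(X)\equiv X\bmod X^2K[[X]]$ and $\exp_{F_P}(X+Y)=F_P(\exp_{F_P}(X),\exp_{F_P}(Y))$. $K_{\pi,2}=K(\{x\in\mathbb{C}_p: v_p(x)>0,\ P(P(x))=0\})$; it depends only on $\pi$, and $K_{\pi,2}/K$ is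 abelian, totally ramified of degree $q(q-1)$. Coherent set of roots associated to $Q$: a sequence $\{\omega_i\}_{i>0}$ of elements of $\bar{\mathbb{Q}}_p$ with $v_p(\omega_i)>0$, such that $\omega_1\neq0$, $Q(\omega_1)=0$ and $Q(\omega_{i+1})=\omega_i$ for all $i\ge1$. $\mathcal{E}^{Q}_{P,2}(1)$ is the value at $X=1$ of the power series $\mathcal{E}^{Q}_{P,2}(X)$ expanded in powers of $X$; this series has coefficients in $\mathcal{O}_K[\omega_2]$ and converges on $\{x\in\mathbb{C}_p:v_p(x)>c\}$ for some $c<0$, and $\mathcal{E}^{Q}_{P,2}(1)\in K_{\pi,2}$. For a finite Galois extension $L/K$ with group $G$, the associated order of $\mathcal{O}_L$ is $\mathfrak{A}_{L/K}=\{\lambda\in K[G]:\lambda\mathcal{O}_L\subset\mathcal{O}_L\}$; $x\in\mathcal{O}_L$ is a generator of $\mathcal{O}_L$ over it if $\mathcal{O}_L=\mathfrak{A}_{L/K}\,x$. An extension is weakly ramified if its second ramification group (lower numbering) is trivial. *)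

theory Defs
  imports
    "HOL-Analysis.Analysis"
    "HOL-Computational_Algebra.Computational_Algebra"
    "HOL-Algebra.Algebra"
    "HOL-Algebra.Algebraic_Closure_Type"
begin

unbundle no vec_syntax
unbundle Formal_Power_Series.fps_syntax

section \<open>Non-archimedean fields and \<open>\<complex>\<^sub>p\<close>\<close>

text \<open>
  A field with an additive real-valued valuation, carrying the topology of that valuation.
  The base of the exponential in \<open>dist_val\<close> affects neither the topology nor completeness.
\<close>

class nonarch_valued_field = field_char_0 + metric_space +
  fixes val :: "'a \<Rightarrow> ereal"
  assumes val_eq_infty_iff: "val x = \<infinity> \<longleftrightarrow> x = 0"
    and val_neq_minus_infty: "val x \<noteq> - \<infinity>"
    and val_mult: "val (x * y) = val x + val y"
    and val_add_ge: "min (val x) (val y) \<le> val (x + y)"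
    and dist_val: "dist x y = (if x = y then 0 else exp (- real_of_ereal (val (x - y))))"

text \<open>
  All fields below are subfields, given as sets, of one ambient field (which will be \<open>\<complex>\<^sub>p\<close>).
\<close>

abbreviation ambient :: "'a::ring_1 ring"
  where "ambient \<equiv> ring_of_type_algebra"

abbreviation subring_struct :: "'a::ring_1 set \<Rightarrow> 'a ring"
  where "subring_struct S \<equiv> ambient\<lparr>carrier := S\<rparr>"

text \<open>
  If \<open>val p = 1\<close> then \<open>val\<close> restricts to the \<open>p\<close>-adic valuation on \<open>\<rat>\<close>, so the closure of
  \<open>\<rat>\<close> in a complete ambient field is its completion \<open>\<rat>\<^sub>p\<close>.
\<close>

definition Qp :: "'a::nonarch_valued_field set"
  where "Qp = closure \<rat>"

definition Qp_bar :: "'a::nonarch_valued_field set"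
  where "Qp_bar = {x. (ring.algebraic ambient over Qp) x}"

text \<open>
  The type is a model of \<open>\<complex>\<^sub>p\<close>: it is complete, and it contains an algebraic closure of
  \<open>\<rat>\<^sub>p\<close> as a dense subset. This determines it up to isometric isomorphism.
\<close>

definition is_Cp :: "nat \<Rightarrow> 'a::nonarch_valued_field itself \<Rightarrow> bool"
  where "is_Cp p T \<longleftrightarrow>
    Factorial_Ring.prime p \<and> val (of_nat p :: 'a) = 1 \<and>
    complete (UNIV :: 'a set) \<and>
    algebraic_closure (subring_struct (Qp_bar :: 'a set)) Qp \<and>
    closure (Qp_bar :: 'a set) = UNIV"

section \<open>Valuation rings and fractional ideals\<close>

definition val_ring :: "'a::nonarch_valued_field set \<Rightarrow> 'a set"
  where "val_ring L = {x \<in> L. 0 \<le> val x}"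

definition max_ideal :: "'a::nonarch_valued_field set \<Rightarrow> 'a set"
  where "max_ideal L = {x \<in> L. 0 < val x}"

abbreviation residue_field :: "'a::nonarch_valued_field set \<Rightarrow> 'a set ring"
  where "residue_field L \<equiv> subring_struct (val_ring L) Quot max_ideal L"

definition uniformizer :: "'a::nonarch_valued_field set \<Rightarrow> 'a \<Rightarrow> bool"
  where "uniformizer L t \<longleftrightarrow> t \<in> L \<and> max_ideal L = PIdl\<^bsub>subring_struct (val_ring L)\<^esub> t"

definition fractional_ideal :: "'a::nonarch_valued_field set \<Rightarrow> 'a set \<Rightarrow> bool"
  where "fractional_ideal L I \<longleftrightarrow>
    additive_subgroup I ambient \<and> I \<subseteq> L \<and> I \<noteq> {0} \<and>
    (\<forall>a\<in>val_ring L. \<forall>x\<in>I. a * x \<in> I) \<and>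
    (\<exists>d\<in>val_ring L. d \<noteq> 0 \<and> (\<forall>x\<in>I. d * x \<in> val_ring L))"

text \<open>
  The library's \<open>ideal_prod\<close> only refers to the operations of the ring, so it computes
  products of fractional ideals as well.
\<close>

abbreviation fideal_prod :: "'a::ring_1 set \<Rightarrow> 'a set \<Rightarrow> 'a set"
  where "fideal_prod I J \<equiv> ideal_prod ambient I J"

section \<open>Galois action\<close>

text \<open>
  Automorphisms are taken extensional on \<open>L\<close>, so that each one is represented by exactly one
  function.
\<close>

definition Gal :: "'a::ring_1 set \<Rightarrow> 'a set \<Rightarrow> ('a \<Rightarrow> 'a) set"
  where "Gal K L =
    {\<sigma> \<in> ring_iso (subring_struct L) (subring_struct L). \<sigma> \<in> extensional L \<and> (\<forall>x\<in>K. \<sigma> x = x)}"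

text \<open>This is the trace of \<open>L/K\<close> when \<open>L/K\<close> is a finite Galois extension.\<close>

definition gal_trace :: "'a::ring_1 set \<Rightarrow> 'a set \<Rightarrow> 'a \<Rightarrow> 'a"
  where "gal_trace K L x = (\<Sum>\<sigma>\<in>Gal K L. \<sigma> x)"

definition inverse_different :: "'a::nonarch_valued_field set \<Rightarrow> 'a set \<Rightarrow> 'a set"
  where "inverse_different K L = {x \<in> L. \<forall>y\<in>val_ring L. gal_trace K L (x * y) \<in> val_ring K}"

text \<open>
  Elements of the group ring \<open>R[Gal(L/K)]\<close> are represented by their coefficient functions;
  only the action of the group ring on \<open>L\<close> is needed.
\<close>

definition group_ring :: "'a::ring_1 set \<Rightarrow> 'a set \<Rightarrow> 'a set \<Rightarrow> (('a \<Rightarrow> 'a) \<Rightarrow> 'a) set"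
  where "group_ring R K L = Gal K L \<rightarrow>\<^sub>E R"

definition group_ring_act :: "'a::ring_1 set \<Rightarrow> 'a set \<Rightarrow> (('a \<Rightarrow> 'a) \<Rightarrow> 'a) \<Rightarrow> 'a \<Rightarrow> 'a"
  where "group_ring_act K L l x = (\<Sum>\<sigma>\<in>Gal K L. l \<sigma> * \<sigma> x)"

definition associated_order ::
    "'a::nonarch_valued_field set \<Rightarrow> 'a set \<Rightarrow> (('a \<Rightarrow> 'a) \<Rightarrow> 'a) set"
  where "associated_order K L =
    {l \<in> group_ring K K L. \<forall>x\<in>val_ring L. group_ring_act K L l x \<in> val_ring L}"

definition is_generator ::
    "'a::ring_1 set \<Rightarrow> 'a set \<Rightarrow> (('a \<Rightarrow> 'a) \<Rightarrow> 'a) set \<Rightarrow> 'a set \<Rightarrow> 'a \<Rightarrow> bool"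
  where "is_generator K L \<Lambda> I x \<longleftrightarrow> x \<in> I \<and> I = (\<lambda>l. group_ring_act K L l x) ` \<Lambda>"

section \<open>Power series in several variables\<close>

text \<open>
  A series in \<open>X, Y\<close> is an \<open>'a fps fps\<close>, one in \<open>X, Y, Z\<close> an \<open>'a fps fps fps\<close>; the outermost
  type constructor belongs to \<open>X\<close>, so \<open>F $ i $ j\<close> is the coefficient of \<open>X\<^sup>iY\<^sup>j\<close>. All identities
  between series are stated in three variables.
\<close>

definition var_X :: "'a::comm_ring_1 fps fps fps" where "var_X = fps_X"
definition var_Y :: "'a::comm_ring_1 fps fps fps" where "var_Y = fps_const fps_X"
definition var_Z :: "'a::comm_ring_1 fps fps fps" where "var_Z = fps_const (fps_const fps_X)"

text \<open>
  The substitutions \<open>f(G)\<close> and \<open>F(G, H)\<close>, for \<open>G\<close> and \<open>H\<close> without constant term. The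
  coefficient of \<open>X\<^sup>aY\<^sup>bZ\<^sup>c\<close> in \<open>G\<^sup>iH\<^sup>j\<close> then vanishes for \<open>i + j > a + b + c\<close>, so that the sums
  below contain all nonzero terms.
\<close>

definition subst1 :: "'a::comm_ring_1 fps \<Rightarrow> 'a fps fps fps \<Rightarrow> 'a fps fps fps"
  where "subst1 f G = Abs_fps (\<lambda>a. Abs_fps (\<lambda>b. Abs_fps (\<lambda>c.
    \<Sum>i\<le>a + b + c. f $ i * (G ^ i) $ a $ b $ c)))"

definition subst2 ::
    "'a::comm_ring_1 fps fps \<Rightarrow> 'a fps fps fps \<Rightarrow> 'a fps fps fps \<Rightarrow> 'a fps fps fps"
  where "subst2 F G H = Abs_fps (\<lambda>a. Abs_fps (\<lambda>b. Abs_fps (\<lambda>c.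
    \<Sum>i\<le>a + b + c. \<Sum>j\<le>a + b + c. F $ i $ j * (G ^ i * H ^ j) $ a $ b $ c)))"

section \<open>Lubin-Tate formal groups\<close>

definition lubin_tate_poly :: "'a::nonarch_valued_field set \<Rightarrow> nat \<Rightarrow> 'a \<Rightarrow> 'a poly \<Rightarrow> bool"
  where "lubin_tate_poly K q \<pi> P \<longleftrightarrow>
    (\<forall>i. poly.coeff P i \<in> val_ring K) \<and>
    poly.coeff P 0 = 0 \<and> poly.coeff P 1 = \<pi> \<and>
    (\<forall>i. poly.coeff (P - Polynomial.monom 1 q) i \<in> (\<lambda>a. \<pi> * a) ` val_ring K)"

definition comm_formal_group :: "'a::comm_ring_1 set \<Rightarrow> 'a fps fps \<Rightarrow> bool"
  where "comm_formal_group R F \<longleftrightarrow>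
    (\<forall>i j. F $ i $ j \<in> R) \<and>
    subst2 F var_X 0 = var_X \<and> subst2 F 0 var_Y = var_Y \<and>
    subst2 F (subst2 F var_X var_Y) var_Z = subst2 F var_X (subst2 F var_Y var_Z) \<and>
    subst2 F var_X var_Y = subst2 F var_Y var_X"

text \<open>\<open>F\<close> is the formal group \<open>F\<^sub>P\<close> of which the Lubin-Tate polynomial \<open>P\<close> is an endomorphism.\<close>

definition lubin_tate_group :: "'a::nonarch_valued_field set \<Rightarrow> 'a poly \<Rightarrow> 'a fps fps \<Rightarrow> bool"
  where "lubin_tate_group K P F \<longleftrightarrow>
    comm_formal_group (val_ring K) F \<and>
    subst1 (fps_of_poly P) (subst2 F var_X var_Y) =
      subst2 F (subst1 (fps_of_poly P) var_X) (subst1 (fps_of_poly P) var_Y)"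

definition formal_exp :: "'a::comm_ring_1 set \<Rightarrow> 'a fps fps \<Rightarrow> 'a fps \<Rightarrow> bool"
  where "formal_exp K F e \<longleftrightarrow>
    (\<forall>i. e $ i \<in> K) \<and> e $ 0 = 0 \<and> e $ 1 = 1 \<and>
    subst1 e (var_X + var_Y) = subst2 F (subst1 e var_X) (subst1 e var_Y)"

text \<open>The field \<open>K\<^bsub>\<pi>,2\<^esub>\<close>, generated by the \<open>[\<pi>\<^sup>2]\<close>-torsion of the formal group of \<open>P\<close>.\<close>

definition lubin_tate_ext2 :: "'a::nonarch_valued_field set \<Rightarrow> 'a poly \<Rightarrow> 'a set"
  where "lubin_tate_ext2 K P =
    generate_field ambient (K \<union> {x. 0 < val x \<and> poly P (poly P x) = 0})"

definition coherent_roots :: "'a::nonarch_valued_field poly \<Rightarrow> (nat \<Rightarrow> 'a) \<Rightarrow> bool"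
  where "coherent_roots Q \<omega> \<longleftrightarrow>
    (\<forall>i\<ge>1. \<omega> i \<in> Qp_bar \<and> 0 < val (\<omega> i)) \<and>
    \<omega> 1 \<noteq> 0 \<and> poly Q (\<omega> 1) = 0 \<and> (\<forall>i\<ge>1. poly Q (\<omega> (Suc i)) = \<omega> i)"

text \<open>The power series \<open>\<E>\<^bsup>Q\<^esup>\<^bsub>P,2\<^esub>(X)\<close>, where \<open>e\<close> is the exponential of \<open>F\<^sub>P\<close>.\<close>

definition E2_series :: "nat \<Rightarrow> 'a::field \<Rightarrow> 'a fps \<Rightarrow> (nat \<Rightarrow> 'a) \<Rightarrow> 'a fps"
  where "E2_series q \<pi> e \<omega> =
    e oo (fps_const (\<omega> 2) * (fps_X - fps_X ^ q)
          + fps_const (\<omega> 1 / \<pi>) * (fps_X ^ q - fps_X ^ (q ^ 2)))"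

definition E2_value :: "nat \<Rightarrow> 'a::nonarch_valued_field \<Rightarrow> 'a fps \<Rightarrow> (nat \<Rightarrow> 'a) \<Rightarrow> 'a"
  where "E2_value q \<pi> e \<omega> = suminf (fps_nth (E2_series q \<pi> e \<omega>))"

end

theory Submission
  imports Defs
begin

text \<open>
  Let \<open>u\<close> be the value of the exponential series at \<open>1\<close>. Hazewinkel's functional equation lemma,
  applied over \<open>\<O>\<^sub>K[T]\<close> with the Frobenius lift \<open>T \<mapsto> Q(T)\<close>, shows that the series is integral; its
  coefficients tend to \<open>0\<close>, and \<open>u\<close> is a primitive \<open>[\<pi>\<^sup>2]\<close>-torsion point of \<open>F\<^sub>P\<close> close to \<open>\<omega>\<^sub>2\<close>.
  Hence \<open>K\<^bsub>\<pi>,2\<^esub> = K(u)\<close>, and the conjugates of \<open>u\<close> are the \<open>[a](u)\<close> for units \<open>a\<close>. Newton's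
  identities for \<open>P\<close> and \<open>P \<circ> P\<close> modulo \<open>\<pi>\<^sup>2\<close> show that the trace of \<open>u\<close> to \<open>K\<close> has the absolute value
  of the coefficient of \<open>X\<^bsup>q-1\<^esup>\<close> in \<open>P\<close>, that is, of \<open>\<pi>\<close>, while elements of absolute value at most
  \<open>\<bar>u\<bar>\<^sup>q\<close> have trace in \<open>\<pi>\<^sup>2\<O>\<^sub>K\<close>. Consequently \<open>t\<close> is a uniformizer of \<open>M\<close>, the inverse different is
  \<open>(t/\<pi>)\<^sup>2\<O>\<^sub>M\<close>, and its square root is \<open>A = (t/\<pi>)\<O>\<^sub>M\<close>.

  An element \<open>x\<close> of \<open>A\<close> whose trace is a unit satisfies \<open>A = \<O>\<^sub>K[G]x\<close>: since \<open>G\<close> is a group of order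
  \<open>q\<close>, an element of \<open>\<O>\<^sub>K[G]\<close> that is nonzero modulo \<open>\<pi>\<close> and maps \<open>x\<close> into the maximal ideal would
  yield one whose coefficients are all congruent modulo \<open>\<pi>\<close>, that is, a unit multiple of the trace.
  This applies to \<open>t/\<pi>\<close> and \<open>(t + q)/\<pi>\<close>. Finally \<open>\<O>\<^sub>M = \<O>\<^sub>K + \<O>\<^sub>K[G]t\<close>, and \<open>\<O>\<^sub>K\<close> is obtained
  from \<open>t\<close> by multiples of the trace divided by the trace of \<open>t\<close>, which preserve \<open>\<O>\<^sub>M\<close>.
\<close>

text \<open>Integrality cannot be tested at \<open>\<omega>2\<close> itself: the ring generated by
  \<open>\<omega>2\<close> over the valuation ring of \<open>K\<close> is ramified and has no
  Frobenius lift fixing \<open>K\<close>. Over polynomials in a free variable \<open>T\<close> such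
  a lift exists, and integrality survives the substitution \<open>T = \<omega>2\<close>. The value
  at \<open>X = 1\<close> is likewise not \<open>e\<close> of the value of its argument, which is
  \<open>0\<close>: the coefficients of the argument lie outside the open disc of radius
  \<open>nv \<omega>1\<close> on which \<open>e\<close> converges. Only after two applications of
  \<open>P\<close>, which multiply the argument by \<open>\<pi> ^ 2\<close>, may substitution and
  summation be exchanged. This yields torsion, while the part linear in \<open>T\<close> keeps
  \<open>u\<close> near \<open>\<omega>2\<close>, hence nonzero. The formal group serves only to
  show that the inverse \<open>l\<close> of \<open>e\<close> satisfies
  \<open>l(P) = \<pi> l\<close>. No general theory of extensions of valuations is invoked: the
  powers of \<open>u\<close> below \<open>d\<close> are orthogonal over \<open>K\<close>, which
  gives degree, closedness, inverses and isometry of the Galois group. The hypothesis on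
  \<open>poly.coeff P (q - 1)\<close> enters once, since that coefficient is minus the sum of the
  roots of \<open>P\<close>.\<close>

section \<open>The absolute value attached to the valuation\<close>

definition nv :: "'a::nonarch_valued_field \<Rightarrow> real"
  where "nv x = dist x 0"

lemma nv_0 [simp]: "nv 0 = 0"
  by (simp add: nv_def)

lemma val_finite: "x \<noteq> 0 \<Longrightarrow> \<bar>val x\<bar> \<noteq> \<infinity>"
  using val_eq_infty_iff val_neq_minus_infty by auto

lemma nv_exp: "x \<noteq> 0 \<Longrightarrow> nv x = exp (- real_of_ereal (val x))"
  by (simp add: nv_def dist_val)

lemma nv_nonneg [simp]: "0 \<le> nv x"
  by (simp add: nv_def)

lemma nv_eq_0_iff [simp]: "nv x = 0 \<longleftrightarrow> x = 0"
  by (simp add: nv_def)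

lemma nv_le_0_iff [simp]: "nv x \<le> 0 \<longleftrightarrow> x = 0"
  by (simp add: nv_def)

lemma nv_pos_iff [simp]: "0 < nv x \<longleftrightarrow> x \<noteq> 0"
  by (simp add: nv_def)

lemma nv_mult: "nv (x * y) = nv x * nv y"
proof (cases "x = 0 \<or> y = 0")
  case False
  then show ?thesis
    using val_finite[of x] val_finite[of y]
    by (simp add: nv_exp val_mult real_of_ereal_add exp_diff exp_minus divide_inverse)
qed auto

lemma nv_1 [simp]: "nv (1::'a::nonarch_valued_field) = 1"
  using nv_mult[of "1::'a" 1] by simp

lemma nv_uminus [simp]: "nv (- x) = nv x"
proof -
  have "nv (-1::'a) * nv (-1::'a) = 1" by (simp flip: nv_mult)
  then have "nv (-1::'a) = 1"
    by (metis nv_nonneg abs_of_nonneg power2_eq_square real_sqrt_abs real_sqrt_one)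
  then show ?thesis using nv_mult[of "-1" x] by simp
qed

lemma nv_le_iff_val:
  fixes x y :: "'a::nonarch_valued_field"
  shows "nv x \<le> nv y \<longleftrightarrow> val y \<le> val x"
proof (cases "x = 0 \<or> y = 0")
  case True
  have [simp]: "val (0::'a) = \<infinity>" by (simp add: val_eq_infty_iff)
  then show ?thesis using True by (auto simp: val_eq_infty_iff)
next
  case False
  then show ?thesis using val_finite[of x] val_finite[of y]
    by (cases "val x"; cases "val y") (auto simp: nv_exp)
qed

lemma nv_less_iff_val:
  fixes x y :: "'a::nonarch_valued_field"
  shows "nv x < nv y \<longleftrightarrow> val y < val x"
  using nv_le_iff_val[of y x] by (simp add: linorder_not_le[symmetric])

lemma nv_eq_iff_val:
  fixes x y :: "'a::nonarch_valued_field"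
  shows "nv x = nv y \<longleftrightarrow> val x = val y"
  using nv_le_iff_val[of y x] nv_le_iff_val[of x y] by auto

lemma val_1 [simp]: "val (1::'a::nonarch_valued_field) = 0"
proof -
  have "val (1::'a) = val (1::'a) + val (1::'a)" using val_mult[of "1::'a" 1] by simp
  then show ?thesis using val_finite[of "1::'a"] by (cases "val (1::'a)") auto
qed

lemma val_nonneg_iff: "0 \<le> val x \<longleftrightarrow> nv x \<le> 1"
  using nv_le_iff_val[of x 1] by simp

lemma val_pos_iff: "0 < val x \<longleftrightarrow> nv x < 1"
  using nv_less_iff_val[of x 1] by simp

lemma nv_add_le_max: "nv (x + y) \<le> max (nv x) (nv y)"
proof (cases "val x \<le> val y")
  case True
  then have "val x \<le> val (x + y)" using val_add_ge[of x y] by (simp add: min_def)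
  then show ?thesis by (simp add: nv_le_iff_val le_max_iff_disj)
next
  case False
  then have "val y \<le> val (x + y)" using val_add_ge[of x y] by (simp add: min_def)
  then show ?thesis by (simp add: nv_le_iff_val le_max_iff_disj)
qed

lemma nv_add_le: "nv x \<le> r \<Longrightarrow> nv y \<le> r \<Longrightarrow> nv (x + y) \<le> r"
  using nv_add_le_max[of x y] by simp

lemma nv_diff_le: "nv x \<le> r \<Longrightarrow> nv y \<le> r \<Longrightarrow> nv (x - y) \<le> r"
  using nv_add_le[of x r "-y"] by simp

lemma nv_add_less: "nv x < r \<Longrightarrow> nv y < r \<Longrightarrow> nv (x + y) < r"
  using nv_add_le_max[of x y] by simp

lemma nv_diff_less: "nv x < r \<Longrightarrow> nv y < r \<Longrightarrow> nv (x - y) < r"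
  using nv_add_less[of x r "-y"] by simp

lemma nv_minus_commute: "nv (x - y) = nv (y - x)"
  by (metis minus_diff_eq nv_uminus)

lemma nv_add_eq: "nv y < nv x \<Longrightarrow> nv (x + y) = nv x"
proof -
  assume a: "nv y < nv x"
  have "nv (x + y) \<le> nv x" using a nv_add_le_max[of x y] by simp
  moreover have "nv x \<le> max (nv (x + y)) (nv y)" using nv_add_le_max[of "x + y" "- y"] by simp
  ultimately show ?thesis using a by (auto simp: max_def split: if_splits)
qed

lemma nv_eq_if_close: "nv (x - y) < nv y \<Longrightarrow> nv x = nv y"
  using nv_add_eq[of "x - y" y] by simp

lemma nv_power: "nv (x ^ n) = nv x ^ n"
  by (induction n) (auto simp: nv_mult)

lemma nv_inverse: "nv (inverse x) = inverse (nv x)"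
proof (cases "x = 0")
  case False
  then have "nv x * nv (inverse x) = 1" by (simp flip: nv_mult)
  then show ?thesis by (simp add: inverse_unique)
qed auto

lemma nv_divide: "nv (x / y) = nv x / nv y"
  by (simp add: divide_inverse nv_mult nv_inverse)

lemma nv_sum_le: "(\<And>i. i \<in> I \<Longrightarrow> nv (f i) \<le> r) \<Longrightarrow> 0 \<le> r \<Longrightarrow> nv (\<Sum>i\<in>I. f i) \<le> r"
  by (induction I rule: infinite_finite_induct) (auto intro!: nv_add_le)

lemma nv_sum_less: "(\<And>i. i \<in> I \<Longrightarrow> nv (f i) < r) \<Longrightarrow> 0 < r \<Longrightarrow> nv (\<Sum>i\<in>I. f i) < r"
  by (induction I rule: infinite_finite_induct) (auto intro!: nv_add_less)

lemma nv_of_nat_le_1: "nv (of_nat n) \<le> 1"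
  by (induction n) (auto intro!: nv_add_le)

lemma dist_eq_nv: "dist x y = nv (x - y)"
  by (simp add: nv_def dist_val)

lemma tendsto_nv_iff: "(f \<longlongrightarrow> l) F \<longleftrightarrow> ((\<lambda>n. nv (f n - l)) \<longlongrightarrow> 0) F"
  by (simp add: tendsto_dist_iff[of f] dist_eq_nv)

lemma nv_sum_dominant:
  assumes "finite I" "j \<in> I" "\<And>i. i \<in> I \<Longrightarrow> i \<noteq> j \<Longrightarrow> nv (f i) < nv (f j)"
  shows "nv (\<Sum>i\<in>I. f i) = nv (f j)"
proof (cases "f j = 0")
  case True
  have "i = j" if "i \<in> I" for i
  proof (rule ccontr)
    assume "i \<noteq> j"
    from assms(3)[OF that this] have "nv (f i) < 0" by (simp only: True nv_0)
    then show False using nv_nonneg[of "f i"] by linarith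
  qed
  then have "I = {j}" using assms(2) by blast
  then show ?thesis by simp
next
  case False
  have "(\<Sum>i\<in>I. f i) = f j + (\<Sum>i\<in>I - {j}. f i)"
    using assms by (simp add: sum.remove)
  moreover have "nv (\<Sum>i\<in>I - {j}. f i) < nv (f j)"
    using False assms by (intro nv_sum_less) auto
  ultimately show ?thesis by (simp add: nv_add_eq)
qed

declare One_nat_def [simp del]

section \<open>Integrality of formal exponentials\<close>

text \<open>Homomorphisms are applied coefficientwise to series; those that occur are the identity,
  the constants \<open>c \<mapsto> [:c:]\<close>, substitution of \<open>Q\<close>, and evaluation
  at \<open>\<omega>2\<close>.\<close>

locale unital_ring_hom =
  fixes h :: "'b::comm_ring_1 \<Rightarrow> 'c::comm_ring_1"
  assumes hom_add: "h (x + y) = h x + h y"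
    and hom_mult: "h (x * y) = h x * h y"
    and hom_1: "h 1 = 1"
begin

lemma hom_0: "h 0 = 0"
  using hom_add[of 0 0] by simp

lemma hom_uminus: "h (- x) = - h x"
  using hom_add[of x "- x"] hom_0 by (simp add: eq_neg_iff_add_eq_0 add.commute)

lemma hom_diff: "h (x - y) = h x - h y"
  using hom_add[of x "- y"] hom_uminus by simp

lemma hom_sum: "h (sum f A) = (\<Sum>x\<in>A. h (f x))"
  by (induction A rule: infinite_finite_induct) (auto simp: hom_0 hom_add)

end

definition fps_map :: "('b \<Rightarrow> 'c) \<Rightarrow> 'b fps \<Rightarrow> 'c fps"
  where "fps_map h f = Abs_fps (\<lambda>n. h (f $ n))"

lemma fps_map_nth [simp]: "fps_map h f $ n = h (f $ n)"
  by (simp add: fps_map_def)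

context unital_ring_hom
begin

lemma fps_map_mult: "fps_map h (f * g) = fps_map h f * fps_map h g"
  by (rule fps_ext) (simp add: fps_mult_nth hom_sum hom_mult)

lemma fps_map_1: "fps_map h 1 = 1"
  by (rule fps_ext) (simp add: hom_0 hom_1)

lemma fps_map_power: "fps_map h (f ^ n) = fps_map h f ^ n"
  by (induction n) (auto simp: fps_map_1 fps_map_mult)

lemma fps_map_compose: "fps_map h (f oo g) = fps_map h f oo fps_map h g"
  by (rule fps_ext) (simp add: fps_compose_nth hom_sum hom_mult flip: fps_map_power)

lemma fps_map_const: "fps_map h (fps_const c) = fps_const (h c)"
  by (rule fps_ext) (simp add: hom_0)

end

lemma fps_mult_nth_eq_0:
  fixes a b :: "'b::comm_ring_1 fps"
  assumes "\<And>j. j < n \<Longrightarrow> a $ j = 0" "b $ 0 = 0"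
  shows "(a * b) $ n = 0"
  unfolding fps_mult_nth by (intro sum.neutral ballI) (metis assms mult_not_zero atLeastAtMost_iff
      diff_self_eq_0 le_neq_implies_less)

lemma fps_power_nth_cong:
  fixes f g :: "'b::comm_ring_1 fps"
  assumes "\<And>j. j \<le> n \<Longrightarrow> f $ j = g $ j"
  shows "(f ^ i) $ n = (g ^ i) $ n"
proof -
  have "(f ^ i - g ^ i) $ n = 0"
    unfolding power_diff_sumr2 fps_mult_nth by (intro sum.neutral) (use assms in auto)
  then show ?thesis by simp
qed

text \<open>If one of at least two factors contributes its coefficient of degree \<open>n\<close>,
  another contributes its constant term \<open>0\<close>. So the nonlinear part of a composition
  depends only on lower coefficients, and the inductions on the degree below rest on this.\<close>

lemma fps_power_nth_cong_less:
  fixes f g :: "'b::comm_ring_1 fps"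
  assumes "\<And>j. j < n \<Longrightarrow> f $ j = g $ j" "f $ 0 = 0" "g $ 0 = 0" "2 \<le> i"
  shows "(f ^ i) $ n = (g ^ i) $ n"
proof -
  have "(\<Sum>k<i. g ^ (i - Suc k) * f ^ k) $ 0 = (\<Sum>k<i. (g $ 0) ^ (i - Suc k) * (f $ 0) ^ k)"
    by (simp add: fps_sum_nth fps_power_zeroth)
  also have "\<dots> = 0"
    by (rule sum.neutral) (use assms in \<open>auto simp: power_0_left\<close>)
  finally have "(f ^ i - g ^ i) $ n = 0"
    unfolding power_diff_sumr2 by (intro fps_mult_nth_eq_0) (use assms in auto)
  then show ?thesis by simp
qed

text \<open>Turns bounds known only below degree \<open>n\<close> into membership of a whole series
  in an ideal, to which closure under products applies.\<close>

definition fps_trunc :: "nat \<Rightarrow> 'b::zero fps \<Rightarrow> 'b fps"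
  where "fps_trunc n f = Abs_fps (\<lambda>j. if j < n then f $ j else 0)"

lemma fps_trunc_nth [simp]: "fps_trunc n f $ j = (if j < n then f $ j else 0)"
  by (simp add: fps_trunc_def)

lemma fps_compose_nth_split:
  fixes f g :: "'b::comm_ring_1 fps"
  assumes "f $ 0 = 0"
  shows "(f oo g) $ n = f $ 1 * g $ n * of_bool (n \<noteq> 0) + (\<Sum>i\<in>{2..n}. f $ i * (g ^ i) $ n)"
proof (cases n)
  case (Suc m)
  have "{0..n} = insert 0 (insert 1 {2..n})" using Suc by auto
  then show ?thesis using assms Suc by (simp add: fps_compose_nth)
qed (use assms in \<open>simp add: fps_compose_nth\<close>)

text \<open>
  The hypotheses on \<open>P\<close> are those of a Lubin-Tate series, those on \<open>l\<close> those of the logarithm of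
  its formal group, and \<open>\<phi>\<close> lifts the Frobenius of \<open>R/\<rho>R\<close>.
\<close>

locale frobenius_lift = phi: unital_ring_hom \<phi>
  for \<phi> :: "'b::idom \<Rightarrow> 'b" +
  fixes R :: "'b set" and \<rho> :: 'b and q :: nat and P l :: "'b fps"
  assumes R_1: "1 \<in> R" and R_diff: "x \<in> R \<Longrightarrow> y \<in> R \<Longrightarrow> x - y \<in> R"
    and R_mult: "x \<in> R \<Longrightarrow> y \<in> R \<Longrightarrow> x * y \<in> R"
    and pi_R: "\<rho> \<in> R" and pi_nz: "\<rho> \<noteq> 0"
    and phi_pi: "\<phi> \<rho> = \<rho>" and phi_R: "x \<in> R \<Longrightarrow> \<phi> x \<in> R"
    and phi_frob: "x \<in> R \<Longrightarrow> \<phi> x - x ^ q \<in> (\<lambda>y. \<rho> * y) ` R"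
    and q_ge2: "2 \<le> q"
    and binom_q: "0 < j \<Longrightarrow> j < q \<Longrightarrow> of_nat (q choose j) \<in> (\<lambda>y. \<rho> * y) ` R"
    and P_R: "P $ i \<in> R" and P_0: "P $ 0 = 0" and P_1: "P $ 1 = \<rho>"
    and P_q: "P $ q - 1 \<in> (\<lambda>y. \<rho> * y) ` R"
    and P_nq: "i \<noteq> q \<Longrightarrow> P $ i \<in> (\<lambda>y. \<rho> * y) ` R"
    and l_0: "l $ 0 = 0" and l_1: "l $ 1 = 1"
    and phi_l: "\<phi> (l $ i) = l $ i"
    and l_denom: "\<exists>D. \<rho> ^ D * l $ i \<in> R"
    and l_P: "l oo P = fps_const \<rho> * l"
begin

definition I :: "nat \<Rightarrow> 'b set" where "I n = (\<lambda>y. \<rho> ^ n * y) ` R"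
definition J :: "nat \<Rightarrow> 'b fps set" where "J n = {f. \<forall>k. f $ k \<in> I n}"

lemma R_0: "0 \<in> R" using R_diff[OF R_1 R_1] by simp
lemma R_pow: "x \<in> R \<Longrightarrow> x ^ n \<in> R" by (induction n) (auto simp: R_1 R_mult)

lemma I_0 [simp]: "I 0 = R" by (simp add: I_def)
lemma zero_I: "0 \<in> I n" unfolding I_def using R_0 by force
lemma I_diff: "x \<in> I n \<Longrightarrow> y \<in> I n \<Longrightarrow> x - y \<in> I n"
  unfolding I_def by (auto simp flip: right_diff_distrib intro!: imageI R_diff)
lemma I_uminus: "x \<in> I n \<Longrightarrow> - x \<in> I n" using I_diff[OF zero_I] by simp
lemma I_add: "x \<in> I n \<Longrightarrow> y \<in> I n \<Longrightarrow> x + y \<in> I n" using I_diff[OF _ I_uminus] by force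
lemma I_mult:
  assumes "x \<in> I m" "y \<in> I n" shows "x * y \<in> I (m + n)"
proof -
  obtain a b where "x = \<rho> ^ m * a" "y = \<rho> ^ n * b" "a \<in> R" "b \<in> R"
    using assms by (auto simp: I_def)
  then have "x * y = \<rho> ^ (m + n) * (a * b)" "a * b \<in> R" by (auto simp: power_add R_mult)
  then show ?thesis unfolding I_def by blast
qed
lemma I_sum: "(\<And>i. i \<in> A \<Longrightarrow> f i \<in> I n) \<Longrightarrow> sum f A \<in> I n"
  by (induction A rule: infinite_finite_induct) (auto simp: zero_I I_add)
lemma I_mono:
  assumes "m \<le> n" shows "I n \<subseteq> I m"
proof
  fix x assume "x \<in> I n"
  then obtain a where "x = \<rho> ^ n * a" "a \<in> R" by (auto simp: I_def)
  then have "x = \<rho> ^ m * (\<rho> ^ (n - m) * a)" using assms by (simp flip: power_add mult.assoc)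
  then show "x \<in> I m" unfolding I_def using \<open>a \<in> R\<close> R_mult R_pow pi_R by blast
qed
lemma I_1: "I 1 = (\<lambda>y. \<rho> * y) ` R" by (simp add: I_def)
lemma pi_pow_I: "\<rho> ^ n \<in> I n" unfolding I_def using R_1 by force
lemma I_cancel: "\<rho> ^ m * x \<in> I (m + n) \<Longrightarrow> x \<in> I n"
  unfolding I_def using pi_nz by (auto simp: power_add mult.assoc)

lemma J_diff: "f \<in> J n \<Longrightarrow> g \<in> J n \<Longrightarrow> f - g \<in> J n" by (simp add: J_def I_diff)
lemma J_add: "f \<in> J n \<Longrightarrow> g \<in> J n \<Longrightarrow> f + g \<in> J n" by (simp add: J_def I_add)
lemma zero_J: "0 \<in> J n" by (simp add: J_def zero_I)
lemma one_J: "1 \<in> J 0" by (simp add: J_def R_1 R_0)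
lemma J_mult: "f \<in> J m \<Longrightarrow> g \<in> J n \<Longrightarrow> f * g \<in> J (m + n)"
  unfolding J_def by (auto simp: fps_mult_nth intro!: I_sum I_mult)
lemma J_sum: "(\<And>i. i \<in> A \<Longrightarrow> f i \<in> J n) \<Longrightarrow> sum f A \<in> J n"
  by (induction A rule: infinite_finite_induct) (auto simp: zero_J J_add)
lemma J_power: "f \<in> J 0 \<Longrightarrow> f ^ n \<in> J 0"
  by (induction n) (auto simp: one_J dest: J_mult[of _ 0 _ 0])
lemma J_mono: "m \<le> n \<Longrightarrow> f \<in> J n \<Longrightarrow> f \<in> J m" using I_mono by (auto simp: J_def)
lemma J_mult_0: "f \<in> J 0 \<Longrightarrow> g \<in> J n \<Longrightarrow> f * g \<in> J n" using J_mult[of f 0 g n] by simp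
lemma J_mult_0': "f \<in> J n \<Longrightarrow> g \<in> J 0 \<Longrightarrow> f * g \<in> J n" using J_mult[of f n g 0] by simp
lemma J_const: "c \<in> I n \<Longrightarrow> fps_const c \<in> J n" by (simp add: J_def zero_I)
lemma P_J: "P \<in> J 0" by (simp add: J_def P_R)

lemma J_compose: "f \<in> J n \<Longrightarrow> g \<in> J 0 \<Longrightarrow> f oo g \<in> J n"
proof -
  assume f: "f \<in> J n" and g: "g \<in> J 0"
  have "f $ i * (g ^ i) $ k \<in> I (n + 0)" for i k
    using f J_power[OF g, of i] by (intro I_mult) (auto simp: J_def)
  then show ?thesis by (auto simp: J_def fps_compose_nth intro!: I_sum)
qed

lemma q_I: "of_nat q \<in> I 1"
  using binom_q[of 1] q_ge2 by (simp add: I_1) (simp add: One_nat_def)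

lemma power_diff_J: "f \<in> J 0 \<Longrightarrow> g \<in> J 0 \<Longrightarrow> f - g \<in> J r \<Longrightarrow> f ^ i - g ^ i \<in> J r"
  unfolding power_diff_sumr2 by (intro J_mult_0' J_sum J_mult_0 J_power)

text \<open>Away from degree \<open>q\<close> the coefficients of \<open>P\<close> supply the extra
  factor \<open>\<rho>\<close>. In degree \<open>q\<close>, \<open>f ^ q - g ^ q\<close> is
  \<open>f - g\<close> times a sum of \<open>q\<close> terms, each congruent to
  \<open>g ^ (q - 1)\<close> modulo \<open>\<rho>\<close>, and \<open>q\<close> is itself divisible
  by \<open>\<rho>\<close>.\<close>

lemma compose_P_cong:
  assumes f: "f \<in> J 0" and g: "g \<in> J 0" and fg: "f - g \<in> J r" and r: "1 \<le> r"
  shows "(P oo f) - (P oo g) \<in> J (Suc r)"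
proof -
  have q: "f ^ q - g ^ q \<in> J (Suc r)"
  proof -
    define S where "S = (\<Sum>i<q. g ^ (q - Suc i) * f ^ i)"
    have "g ^ (q - Suc i) * (f ^ i - g ^ i) \<in> J 1" for i
      using J_mono[OF r power_diff_J[OF f g fg]] g by (intro J_mult_0 J_power)
    then have "(\<Sum>i<q. g ^ (q - Suc i) * (f ^ i - g ^ i)) \<in> J 1" by (intro J_sum)
    moreover have "(\<Sum>i<q. g ^ (q - Suc i) * g ^ i) = (\<Sum>i<q. g ^ (q - 1))"
      by (intro sum.cong) (auto simp: One_nat_def simp flip: power_add)
    ultimately have "S - of_nat q * g ^ (q - 1) \<in> J 1"
      by (simp add: S_def right_diff_distrib sum_subtractf)
    moreover have "of_nat q * g ^ (q - 1) \<in> J 1"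
      using q_I g by (metis J_const J_mult_0' J_power fps_of_nat)
    ultimately have "S \<in> J 1" using J_add by fastforce
    then show ?thesis using J_mult[OF fg, of S 1] by (simp add: power_diff_sumr2 S_def One_nat_def)
  qed
  have "P $ i * (f ^ i - g ^ i) $ n \<in> I (Suc r)" for i n
  proof (cases "i = q")
    case True
    then show ?thesis using q P_R I_mult[of _ 0 _ "Suc r"] by (auto simp: J_def)
  next
    case False
    have "P $ i \<in> I 1" using P_nq[OF False] by (simp add: I_1)
    moreover have "(f ^ i - g ^ i) $ n \<in> I r"
      using power_diff_J[OF f g fg, of i] unfolding J_def by blast
    ultimately show ?thesis using I_mult[of "P $ i" 1 "(f ^ i - g ^ i) $ n" r] by (simp add: One_nat_def)
  qed
  then have "(\<Sum>i=0..n. P $ i * (f ^ i - g ^ i) $ n) \<in> I (Suc r)" for n by (intro I_sum)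
  then show ?thesis by (simp add: J_def fps_compose_nth right_diff_distrib sum_subtractf)
qed

text \<open>Extends \<open>\<phi>\<close> to series by \<open>X \<mapsto> X ^ q\<close>; on
  \<open>J 0\<close> it agrees with the \<open>q\<close>-th power modulo
  \<open>\<rho>\<close>.\<close>

definition Phi :: "'b fps \<Rightarrow> 'b fps"
  where "Phi f = fps_map \<phi> f oo fps_X ^ q"

lemma Phi_nth: "Phi f $ n = (if q dvd n then \<phi> (f $ (n div q)) else 0)"
proof -
  have "Phi f $ n = (\<Sum>i=0..n. if n = q * i then \<phi> (f $ i) else 0)"
    unfolding Phi_def fps_compose_nth
    by (intro sum.cong) (auto simp: fps_X_power_nth simp flip: power_mult)
  also have "\<dots> = (if q dvd n then \<phi> (f $ (n div q)) else 0)"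
  proof (cases "q dvd n")
    case True
    then obtain k where "n = q * k" by auto
    moreover have "(\<Sum>i=0..n. if n = q * i then \<phi> (f $ i) else 0)
        = (\<Sum>i=0..n. if i = k then \<phi> (f $ i) else 0)"
      using calculation q_ge2 by (intro sum.cong) auto
    moreover have "k \<le> n" using calculation q_ge2 by simp
    ultimately show ?thesis using q_ge2 by simp
  qed (auto intro!: sum.neutral)
  finally show ?thesis .
qed

lemma Phi_diff: "Phi (f - g) = Phi f - Phi g"
  by (rule fps_ext) (simp add: Phi_nth phi.hom_diff)

lemma Phi_add: "Phi (f + g) = Phi f + Phi g"
  by (rule fps_ext) (simp add: Phi_nth phi.hom_add)

lemma Phi_J: "f \<in> J 0 \<Longrightarrow> Phi f \<in> J 0"
  by (simp add: J_def Phi_nth phi_R R_0)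

lemma frob_add: "f \<in> J 0 \<Longrightarrow> g \<in> J 0 \<Longrightarrow> (f + g) ^ q - (f ^ q + g ^ q) \<in> J 1"
proof -
  assume f: "f \<in> J 0" and g: "g \<in> J 0"
  have "{..q} = insert 0 (insert q {1..<q})" using q_ge2 by auto
  then have "(f + g) ^ q - (f ^ q + g ^ q) = (\<Sum>k\<in>{1..<q}. of_nat (q choose k) * f ^ k * g ^ (q - k))"
    using q_ge2 by (simp add: binomial_ring)
  also have "\<dots> \<in> J 1"
  proof (intro J_sum J_mult_0' J_power f g)
    fix k assume "k \<in> {1..<q}"
    then have "of_nat (q choose k) \<in> I 1" using binom_q by (simp add: I_1)
    then show "of_nat (q choose k) \<in> J 1" using J_const by (simp flip: fps_of_nat)
  qed
  finally show ?thesis .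
qed

text \<open>Both terms are additive modulo \<open>\<rho>\<close>, so monomials suffice, and there
  \<open>phi_frob\<close> applies to the coefficient. Truncation keeps the sum of monomials
  finite.\<close>

lemma power_q_Phi:
  assumes f: "f \<in> J 0" shows "f ^ q - Phi f \<in> J 1"
proof -
  have tr: "fps_trunc N f \<in> J 0" for N using f by (simp add: J_def R_0)
  have *: "fps_trunc N f ^ q - Phi (fps_trunc N f) \<in> J 1" for N
  proof (induction N)
    case 0
    have "fps_trunc 0 f = 0" by (rule fps_ext) simp
    moreover have "Phi 0 = 0" by (rule fps_ext) (simp add: Phi_nth phi.hom_0)
    ultimately show ?case using q_ge2 zero_J by (simp add: power_0_left)
  next
    case (Suc N)
    let ?c = "f $ N" let ?m = "fps_const ?c * fps_X ^ N"
    have s: "fps_trunc (Suc N) f = fps_trunc N f + ?m"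
      by (rule fps_ext) (auto simp: less_Suc_eq fps_X_power_nth)
    have c: "?c \<in> R" using f by (simp add: J_def)
    have m: "?m \<in> J 0" using c by (auto simp: J_def fps_X_power_nth R_0)
    have mq: "?m ^ q - Phi ?m = fps_const (?c ^ q - \<phi> ?c) * fps_X ^ (N * q)"
    proof -
      have "Phi ?m = fps_const (\<phi> ?c) * fps_X ^ (N * q)"
        using q_ge2 by (intro fps_ext) (auto simp: Phi_nth fps_X_power_nth phi.hom_0)
      then show ?thesis by (simp add: power_mult_distrib fps_const_power power_mult left_diff_distrib
            flip: fps_const_sub)
    qed
    have "?c ^ q - \<phi> ?c \<in> I 1" using I_uminus[of "\<phi> ?c - ?c ^ q" 1] phi_frob[OF c] by (simp add: I_1)
    then have "?m ^ q - Phi ?m \<in> J 1"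
      unfolding mq by (auto simp: J_def fps_X_power_nth zero_I)
    from J_add[OF this J_add[OF Suc frob_add[OF tr m, of N]]]
    show ?case unfolding s Phi_add by (simp add: algebra_simps)
  qed
  show ?thesis unfolding J_def
  proof (intro CollectI allI)
    fix n
    have "(f ^ q - Phi f) $ n = (fps_trunc (Suc n) f ^ q - Phi (fps_trunc (Suc n) f)) $ n"
      using fps_power_nth_cong[of n f "fps_trunc (Suc n) f" q]
      by (auto simp: Phi_nth less_Suc_eq_le div_le_dividend)
    then show "(f ^ q - Phi f) $ n \<in> I 1" using *[of "Suc n"] by (simp add: J_def)
  qed
qed

lemma compose_P_Phi:
  assumes f: "f \<in> J 0" and f0: "f $ 0 = 0" shows "(P oo f) - Phi f \<in> J 1"
proof -
  have "((P oo f) - f ^ q) $ n \<in> I 1" for n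
  proof -
    have z: "(f ^ q) $ n = 0" if "n < q"
      using f0 that by (simp add: startsby_zero_power_prefix)
    have "(f ^ q) $ n = (\<Sum>i=0..n. (if i = q then 1 else 0) * (f ^ i) $ n)"
      using z by (cases "n < q") (auto simp: sum.delta if_distrib[of "\<lambda>x. x * _"] cong: if_cong)
    then have "((P oo f) - f ^ q) $ n = (\<Sum>i=0..n. (P $ i - (if i = q then 1 else 0)) * (f ^ i) $ n)"
      by (simp add: fps_compose_nth left_diff_distrib sum_subtractf)
    also have "\<dots> \<in> I 1"
    proof (rule I_sum)
      fix i
      have "P $ i - (if i = q then 1 else 0) \<in> I 1" using P_q P_nq by (simp add: I_1)
      from I_mult[OF this, of "(f ^ i) $ n" 0]
      show "(P $ i - (if i = q then 1 else 0)) * (f ^ i) $ n \<in> I 1"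
        using J_power[OF f, of i] by (simp add: J_def)
    qed
    finally show ?thesis .
  qed
  then have "(P oo f) - f ^ q \<in> J 1" by (simp add: J_def)
  from J_add[OF this power_q_Phi[OF f]] show ?thesis by simp
qed

definition P_iter :: "nat \<Rightarrow> 'b fps \<Rightarrow> 'b fps" where "P_iter k f = ((oo) P ^^ k) f"

lemma P_iter_0: "P_iter 0 f = f" by (simp add: P_iter_def)
lemma P_iter_Suc: "P_iter (Suc k) f = P oo P_iter k f" by (simp add: P_iter_def)

lemma P_iter_J: "f \<in> J 0 \<Longrightarrow> P_iter k f \<in> J 0"
  by (induction k) (auto simp: P_iter_0 P_iter_Suc intro!: J_compose P_J)

lemma P_iter_nth_0: "f $ 0 = 0 \<Longrightarrow> P_iter k f $ 0 = 0"
  by (induction k) (auto simp: P_iter_0 P_iter_Suc P_0 fps_compose_nth)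

lemma P_iter_cong:
  assumes "f \<in> J 0" "g \<in> J 0" "f - g \<in> J 1"
  shows "P_iter k f - P_iter k g \<in> J (Suc k)"
  by (induction k) (use assms in \<open>auto simp: P_iter_0 P_iter_Suc One_nat_def intro!: compose_P_cong P_iter_J\<close>)

lemma l_P_iter: "f $ 0 = 0 \<Longrightarrow> l oo P_iter k f = fps_const (\<rho> ^ k) * (l oo f)"
proof (induction k)
  case (Suc k)
  have "l oo P_iter (Suc k) f = (l oo P) oo P_iter k f"
    unfolding P_iter_Suc by (rule fps_compose_assoc) (use Suc P_0 P_iter_nth_0 in auto)
  also have "\<dots> = fps_const \<rho> * (l oo P_iter k f)"
    unfolding l_P using Suc P_iter_nth_0 by (simp add: fps_compose_mult_distrib fps_const_compose)
  finally show ?case using Suc by (simp add: fps_const_mult[symmetric] mult.assoc del: fps_const_mult)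
qed (simp add: P_iter_0)

text \<open>In degree \<open>Suc N\<close>, composition with \<open>P\<close> multiplies the
  coefficient by \<open>\<rho>\<close>, up to an error built from lower coefficients, which lie in
  \<open>I D\<close> from the index \<open>k0\<close> on. After \<open>D\<close> further iterations
  the factor \<open>\<rho> ^ D\<close> has accumulated.\<close>

lemma P_iter_small:
  assumes f: "f \<in> J 0" and f0: "f $ 0 = 0"
  shows "\<exists>k0. \<forall>k\<ge>k0. \<forall>n\<le>N. P_iter k f $ n \<in> I D"
proof (induction N)
  case 0
  then show ?case using P_iter_nth_0[OF f0] zero_I by auto
next
  case (Suc N)
  then obtain k0 where k0: "\<And>k n. k \<ge> k0 \<Longrightarrow> n \<le> N \<Longrightarrow> P_iter k f $ n \<in> I D" by blast
  have step: "P_iter (Suc k) f $ Suc N - \<rho> * P_iter k f $ Suc N \<in> I D" if k: "k \<ge> k0" for k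
  proof -
    define c where "c = P_iter k f"
    let ?c' = "fps_trunc (Suc N) c"
    have c: "c $ 0 = 0" "c \<in> J 0" unfolding c_def using P_iter_nth_0[OF f0] P_iter_J[OF f] by auto
    have "?c' \<in> J D" using k0[OF k] zero_I by (auto simp: J_def c_def)
    moreover from this have "?c' \<in> J 0" by (rule J_mono[rotated]) simp
    moreover have "?c' ^ i = ?c' * ?c' ^ (i - 1)" if "1 \<le> i" for i using that by (cases i) auto
    ultimately have pw: "?c' ^ i \<in> J D" if "1 \<le> i" for i
      using that J_mult_0'[of ?c' D "?c' ^ (i - 1)"] by (auto intro!: J_power)
    have "P $ i * (c ^ i) $ Suc N \<in> I D" if "i \<in> {2..Suc N}" for i
    proof -
      have "(c ^ i) $ Suc N = (?c' ^ i) $ Suc N"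
        using that c by (intro fps_power_nth_cong_less) auto
      then show ?thesis using pw[of i] that I_mult[of "P $ i" 0 _ D] P_R by (auto simp: J_def)
    qed
    then have "(\<Sum>i\<in>{2..Suc N}. P $ i * (c ^ i) $ Suc N) \<in> I D" by (rule I_sum)
    then show ?thesis unfolding P_iter_Suc c_def[symmetric] fps_compose_nth_split[OF P_0] P_1 by simp
  qed
  have it: "\<exists>y\<in>I D. P_iter (k0 + j) f $ Suc N = \<rho> ^ j * P_iter k0 f $ Suc N + y" for j
  proof (induction j)
    case 0
    then show ?case using zero_I by (intro bexI[of _ 0]) auto
  next
    case (Suc j)
    then obtain y where y: "y \<in> I D" "P_iter (k0 + j) f $ Suc N = \<rho> ^ j * P_iter k0 f $ Suc N + y"
      by auto
    from step[of "k0 + j"] obtain z where z: "z \<in> I D"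
      "P_iter (Suc (k0 + j)) f $ Suc N - \<rho> * P_iter (k0 + j) f $ Suc N = z" by auto
    have "\<rho> * y + z \<in> I D" using I_mult[of \<rho> 0 y D] y z pi_R by (auto intro!: I_add)
    moreover have "P_iter (k0 + Suc j) f $ Suc N = \<rho> ^ Suc j * P_iter k0 f $ Suc N + (\<rho> * y + z)"
      using y(2) z(2) by (simp add: algebra_simps)
    ultimately show ?case by blast
  qed
  show ?case
  proof (intro exI[of _ "k0 + D"] allI impI)
    fix k n assume k: "k0 + D \<le> k" and n: "n \<le> Suc N"
    show "P_iter k f $ n \<in> I D"
    proof (cases "n = Suc N")
      case True
      obtain y where "y \<in> I D" "P_iter k f $ Suc N = \<rho> ^ (k - k0) * P_iter k0 f $ Suc N + y"
        using it[of "k - k0"] k by auto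
      moreover have "\<rho> ^ (k - k0) * P_iter k0 f $ Suc N \<in> I D"
        using I_mult[of "\<rho> ^ (k - k0)" "k - k0" "P_iter k0 f $ Suc N" 0] pi_pow_I P_iter_J[OF f, of k0] k
          subsetD[OF I_mono[of D "k - k0"]] by (auto simp: J_def)
      ultimately show ?thesis using True by (auto intro!: I_add)
    qed (use n k k0 in auto)
  qed
qed

lemma l_denom_uniform: "\<exists>D. \<forall>n\<le>N. \<rho> ^ D * l $ n \<in> R"
proof (induction N)
  case 0
  then show ?case using l_0 R_0 by auto
next
  case (Suc N)
  then obtain D where D: "\<And>n. n \<le> N \<Longrightarrow> \<rho> ^ D * l $ n \<in> R" by blast
  obtain D' where D': "\<rho> ^ D' * l $ Suc N \<in> R" using l_denom by blast
  have "\<rho> ^ (D + D') * l $ n \<in> R" if "n \<le> Suc N" for n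
    using that D[of n] D' R_mult[OF R_pow[OF pi_R, of D'] D[of n]] R_mult[OF R_pow[OF pi_R, of D] D']
    by (cases "n = Suc N") (auto simp: power_add mult.assoc mult.left_commute)
  then show ?case by blast
qed

text \<open>Compares \<open>\<rho>\<^sup>k l(f) = l(P\<^sup>k(f))\<close> for large \<open>k\<close>, where the denominators of \<open>l\<close> are harmless.\<close>

lemma l_cong:
  assumes f: "f \<in> J 0" "f $ 0 = 0" and g: "g \<in> J 0" "g $ 0 = 0" and fg: "f - g \<in> J 1"
  shows "(l oo f) - (l oo g) \<in> J 1"
  unfolding J_def
proof (intro CollectI allI)
  fix N
  obtain D where D: "\<And>n. n \<le> N \<Longrightarrow> \<rho> ^ D * l $ n \<in> R" using l_denom_uniform by blast
  obtain k1 where k1: "\<And>k n. k \<ge> k1 \<Longrightarrow> n \<le> N \<Longrightarrow> P_iter k f $ n \<in> I D"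
    using P_iter_small[OF f] by blast
  obtain k2 where k2: "\<And>k n. k \<ge> k2 \<Longrightarrow> n \<le> N \<Longrightarrow> P_iter k g $ n \<in> I D"
    using P_iter_small[OF g] by blast
  define k where "k = max k1 k2"
  define c where "c = P_iter k f"
  define d where "d = P_iter k g"
  have cd: "c - d \<in> J (Suc k)" unfolding c_def d_def by (rule P_iter_cong) (use f g fg in auto)
  have sm: "c $ n \<in> I D" "d $ n \<in> I D" if "n \<le> N" for n
    using k1[of k n] k2[of k n] that by (auto simp: k_def c_def d_def)
  have cJ: "c \<in> J 0" "d \<in> J 0" "c $ 0 = 0" "d $ 0 = 0"
    using P_iter_J P_iter_nth_0 f g by (auto simp: c_def d_def)
  \<comment> \<open>Divided by \<open>c - d\<close>, the difference of \<open>i\<close>-th powers is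
    a sum of products that still have a factor in \<open>J D\<close>, as \<open>i \<ge> 2\<close>.
    This factor absorbs the denominator of \<open>l $ i\<close>.\<close>
  have tm: "l $ i * (c ^ i - d ^ i) $ N \<in> I (Suc k)" if i: "i \<in> {2..N}" for i
  proof -
    let ?c = "fps_trunc (Suc N) c" and ?d = "fps_trunc (Suc N) d"
    have tD: "?c \<in> J D" "?d \<in> J D" using sm zero_I by (auto simp: J_def)
    have t0: "?c \<in> J 0" "?d \<in> J 0" using cJ R_0 by (auto simp: J_def)
    have t_diff: "?c - ?d \<in> J (Suc k)" using cd zero_I by (auto simp: J_def)
    have "?d ^ (i - Suc j) * ?c ^ j \<in> J D" if j: "j < i" for j
    proof (cases j)
      case 0
      then have "?d ^ (i - Suc j) * ?c ^ j = ?d * ?d ^ (i - 2)"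
        using i by (cases i; cases "i - 1") auto
      then show ?thesis using tD t0 by (auto intro!: J_mult_0' J_power)
    next
      case (Suc j')
      then have "?d ^ (i - Suc j) * ?c ^ j = ?c * (?d ^ (i - Suc j) * ?c ^ j')" by simp
      also have "\<dots> \<in> J D"
        using tD t0 by (intro J_mult_0' J_mult_0[OF J_power] J_power)
      finally show ?thesis .
    qed
    then have S: "(\<Sum>j<i. ?d ^ (i - Suc j) * ?c ^ j) \<in> J D" by (intro J_sum) auto
    have "(c ^ i - d ^ i) $ N = (?c ^ i - ?d ^ i) $ N"
      using fps_power_nth_cong[of N c ?c i] fps_power_nth_cong[of N d ?d i] by auto
    moreover have "?c ^ i - ?d ^ i \<in> J (Suc k + D)"
      unfolding power_diff_sumr2 by (rule J_mult[OF t_diff S])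
    ultimately have "(c ^ i - d ^ i) $ N \<in> I (Suc k + D)" by (auto simp: J_def)
    then obtain y where y: "y \<in> R" "(c ^ i - d ^ i) $ N = \<rho> ^ (Suc k + D) * y" by (auto simp: I_def)
    have "l $ i * (c ^ i - d ^ i) $ N = \<rho> ^ Suc k * ((\<rho> ^ D * l $ i) * y)"
      unfolding y(2) by (simp add: power_add mult_ac)
    moreover have "(\<rho> ^ D * l $ i) * y \<in> R" using D[of i] i y R_mult[of "\<rho> ^ D * l $ i" y] by auto
    ultimately show ?thesis unfolding I_def by blast
  qed
  have "((l oo c) - (l oo d)) $ N = (c - d) $ N * of_bool (N \<noteq> 0) + (\<Sum>i\<in>{2..N}. l $ i * (c ^ i - d ^ i) $ N)"
    using fps_compose_nth_split[OF l_0] l_1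
    by (simp add: algebra_simps sum_subtractf)
  also have "\<dots> \<in> I (Suc k)"
    using cd tm by (auto simp: J_def zero_I intro!: I_add I_sum)
  finally have "((l oo c) - (l oo d)) $ N \<in> I (Suc k)" .
  \<comment> \<open>Passing to the iterates multiplied both values of \<open>l\<close> by
    \<open>\<rho> ^ k\<close>; of the \<open>k + 1\<close> powers gained, one survives.\<close>
  then have "\<rho> ^ k * ((l oo f) - (l oo g)) $ N \<in> I (k + 1)"
    using l_P_iter f(2) g(2) by (simp add: c_def d_def right_diff_distrib One_nat_def)
  then show "((l oo f) - (l oo g)) $ N \<in> I 1" by (rule I_cancel)
qed

lemma Phi_l: "f $ 0 = 0 \<Longrightarrow> Phi (l oo f) = l oo Phi f"
proof -
  assume f0: "f $ 0 = 0"
  have "fps_map \<phi> l = l" by (rule fps_ext) (simp add: phi_l)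
  then have "Phi (l oo f) = (l oo fps_map \<phi> f) oo fps_X ^ q"
    by (simp add: Phi_def phi.fps_map_compose)
  also have "\<dots> = l oo Phi f"
    unfolding Phi_def using q_ge2 f0
    by (intro fps_compose_assoc[symmetric]) (auto simp: phi.hom_0)
  finally show ?thesis .
qed

text \<open>The two terms are \<open>l\<close> applied to \<open>P oo f\<close> and to
  \<open>Phi f\<close>, and these arguments agree modulo \<open>\<rho>\<close>.\<close>

lemma l_functional:
  assumes f: "f \<in> J 0" "f $ 0 = 0"
  shows "fps_const \<rho> * (l oo f) - Phi (l oo f) \<in> J 1"
proof -
  have "fps_const \<rho> * (l oo f) = (l oo P) oo f"
    unfolding l_P using f by (simp add: fps_compose_mult_distrib fps_const_compose)
  also have "\<dots> = l oo (P oo f)"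
    by (rule fps_compose_assoc[symmetric]) (use f P_0 in auto)
  finally have *: "fps_const \<rho> * (l oo f) - Phi (l oo f) = (l oo (P oo f)) - (l oo Phi f)"
    using Phi_l f by simp
  show ?thesis unfolding *
    by (rule l_cong) (use f P_0 compose_P_Phi in
        \<open>auto simp: Phi_nth phi.hom_0 fps_compose_nth intro!: J_compose P_J Phi_J\<close>)
qed

text \<open>Removing the contribution of the truncation \<open>a\<close> leaves a series
  \<open>z\<close> that vanishes below degree \<open>n\<close> and has \<open>n\<close>-th
  coefficient \<open>w $ n\<close>. Since \<open>Phi\<close> moves coefficients to higher degrees,
  the congruence for \<open>z\<close> in degree \<open>n\<close> says that
  \<open>\<rho> * w $ n\<close> lies in \<open>I 1\<close>.\<close>

theorem functional_equation:
  assumes w: "l oo w = y" "w $ 0 = 0" and y: "fps_const \<rho> * y - Phi y \<in> J 1"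
  shows "w $ n \<in> R"
proof (induction n rule: less_induct)
  case (less n)
  show ?case
  proof (cases "n = 0")
    case True
    then show ?thesis using w R_0 by simp
  next
    case n: False
    define a where "a = fps_trunc n w"
    have a: "a \<in> J 0" "a $ 0 = 0" using less w R_0 by (auto simp: a_def J_def)
    define z where "z = y - (l oo a)"
    have "(w ^ i) $ j = (a ^ i) $ j" if "j < n" for i j
      using that by (intro fps_power_nth_cong) (auto simp: a_def)
    then have z_low: "z $ j = 0" if "j < n" for j
      using that by (simp add: z_def fps_compose_nth flip: w(1))
    have "(w ^ i) $ n = (a ^ i) $ n" if "i \<in> {2..n}" for i
      using that w(2) a(2) by (intro fps_power_nth_cong_less) (auto simp: a_def)
    then have z_n: "z $ n = w $ n"
      unfolding z_def w(1)[symmetric] fps_sub_nth fps_compose_nth_split[OF l_0] using n l_1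
      by (simp add: a_def)
    have "fps_const \<rho> * z - Phi z = (fps_const \<rho> * y - Phi y) - (fps_const \<rho> * (l oo a) - Phi (l oo a))"
      by (simp add: z_def Phi_diff algebra_simps)
    also have "\<dots> \<in> J 1" by (intro J_diff y l_functional a)
    finally have "(fps_const \<rho> * z - Phi z) $ n \<in> I 1" by (simp add: J_def)
    moreover have "Phi z $ n = 0"
      using z_low[of "n div q"] n q_ge2 by (simp add: Phi_nth phi.hom_0)
    ultimately have "\<rho> ^ 1 * w $ n \<in> I (1 + 0)" using z_n by simp
    then show ?thesis using I_cancel[of 1 "w $ n" 0] by simp
  qed
qed

end

section \<open>The logarithm of a formal group\<close>

text \<open>Modulo \<open>Z\<close> and \<open>Y\<^sup>2\<close>, a series \<open>f\<close> is \<open>Y0 f + Y1 f Y\<close>, so \<open>Y1\<close> is the derivative in \<open>Y\<close> at \<open>0\<close>.\<close>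

definition Y0 :: "'b::comm_ring_1 fps fps fps \<Rightarrow> 'b fps"
  where "Y0 f = Abs_fps (\<lambda>a. f $ a $ 0 $ 0)"

definition Y1 :: "'b::comm_ring_1 fps fps fps \<Rightarrow> 'b fps"
  where "Y1 f = Abs_fps (\<lambda>a. f $ a $ 1 $ 0)"

lemma Y0_nth: "Y0 f $ a = f $ a $ 0 $ 0" by (simp add: Y0_def)
lemma Y1_nth: "Y1 f $ a = f $ a $ 1 $ 0" by (simp add: Y1_def)

lemma Y0_mult: "Y0 (f * g) = Y0 f * Y0 g"
  by (rule fps_ext) (simp add: Y0_nth fps_mult_nth fps_sum_nth)

lemma Y1_mult: "Y1 (f * g) = Y0 f * Y1 g + Y1 f * Y0 g"
  by (rule fps_ext) (simp add: Y0_nth Y1_nth fps_mult_nth[of f] fps_mult_nth[of "Y0 f"]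
      fps_mult_nth[of "Y1 f"] fps_sum_nth fps_mult_nth_1 fps_mult_nth_0 sum.distrib)

lemma Y0_1: "Y0 1 = 1" by (rule fps_ext) (simp add: Y0_nth)
lemma Y1_1: "Y1 1 = 0" by (rule fps_ext) (simp add: Y1_nth)

lemma Y0_power: "Y0 (f ^ n) = Y0 f ^ n"
  by (induction n) (auto simp: Y0_1 Y0_mult)

lemma Y1_power: "Y1 (f ^ n) = of_nat n * Y0 f ^ (n - 1) * Y1 f"
proof (induction n)
  case (Suc n)
  then show ?case by (cases n) (auto simp: Y1_mult Y0_power Y0_1 Y0_mult algebra_simps)
qed (simp add: Y1_1)

lemma Y0_subst1:
  assumes "Y0 G $ 0 = 0" shows "Y0 (subst1 f G) = f oo Y0 G"
proof (rule fps_ext)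
  fix a
  show "Y0 (subst1 f G) $ a = (f oo Y0 G) $ a"
    using Y0_power[of G] by (simp add: Y0_nth subst1_def fps_compose_nth atLeast0AtMost fps_eq_iff)
qed

text \<open>This is the chain rule at \<open>Y = 0\<close>, where \<open>G\<close> reduces to
  \<open>X\<close>.\<close>

lemma Y1_subst1_X:
  assumes "Y0 G = fps_X" shows "Y1 (subst1 f G) = fps_deriv f * Y1 G"
proof (rule fps_ext)
  fix a
  have *: "(G ^ i) $ a $ 1 $ 0 = of_nat i * (if i - 1 \<le> a then Y1 G $ (a - (i - 1)) else 0)" for i
    using Y1_power[of G i] unfolding assms fps_eq_iff
    by (simp add: Y1_nth mult.assoc fps_X_power_mult_nth flip: fps_of_nat)
  have "Y1 (subst1 f G) $ a = (\<Sum>i\<le>Suc a. f $ i * (of_nat i * (if i - 1 \<le> a then Y1 G $ (a - (i - 1)) else 0)))"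
    unfolding Y1_nth[of "subst1 f G"] Suc_eq_plus1 by (simp add: subst1_def *)
  also have "\<dots> = (\<Sum>i\<le>a. f $ Suc i * (of_nat (Suc i) * Y1 G $ (a - i)))"
    by (subst sum.atMost_Suc_shift) simp
  also have "\<dots> = (fps_deriv f * Y1 G) $ a"
    by (simp add: fps_mult_nth atLeast0AtMost algebra_simps One_nat_def)
  finally show "Y1 (subst1 f G) $ a = (fps_deriv f * Y1 G) $ a" .
qed

text \<open>As \<open>B\<close> vanishes at \<open>Y = 0\<close>, only the terms
  \<open>j = 0\<close> and \<open>j = 1\<close> of \<open>F\<close> survive to first order in
  \<open>Y\<close>.\<close>

lemma Y_subst2:
  assumes A: "Y1 A = 0" "Y0 A $ 0 = 0" and B: "Y0 B = 0" "Y1 B = fps_const b"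
  shows "Y0 (subst2 F A B) = Abs_fps (\<lambda>i. F $ i $ 0) oo Y0 A"
    and "Y1 (subst2 F A B) = fps_const b * (Abs_fps (\<lambda>i. F $ i $ 1) oo Y0 A)"
proof -
  have c0: "(A ^ i * B ^ j) $ a $ 0 $ 0 = of_bool (j = 0) * (Y0 A ^ i) $ a" for i j a
    using Y0_mult[of "A ^ i" "B ^ j"] unfolding Y0_power B fps_eq_iff
    by (auto simp: Y0_nth power_0_left)
  then have c0': "F $ i $ j * (A ^ i * B ^ j) $ a $ 0 $ 0 = (if j = 0 then F $ i $ 0 * (Y0 A ^ i) $ a else 0)"
    for i j a by simp
  have "Y1 (A ^ i * B ^ j) = fps_const (of_bool (j = 1) * b) * Y0 A ^ i" for i j
  proof (cases "j \<le> 1")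
    case True
    then consider "j = 0" | "j = 1" by linarith
    then show ?thesis by cases (simp_all add: Y1_mult Y0_power Y1_power A B)
  next
    case False
    then show ?thesis by (simp add: Y1_mult Y0_power Y1_power A B power_0_left)
  qed
  then have c1: "(A ^ i * B ^ j) $ a $ 1 $ 0 = of_bool (j = 1) * b * (Y0 A ^ i) $ a" for i j a
    unfolding fps_eq_iff by (simp add: Y1_nth)
  then have c1': "F $ i $ j * (A ^ i * B ^ j) $ a $ 1 $ 0 = (if j = 1 then b * (F $ i $ 1 * (Y0 A ^ i) $ a) else 0)"
    for i j a by simp
  show "Y0 (subst2 F A B) = Abs_fps (\<lambda>i. F $ i $ 0) oo Y0 A"
  proof (rule fps_ext)
    fix a
    have "Y0 (subst2 F A B) $ a
        = (\<Sum>i\<le>a. \<Sum>j\<le>a. if j = 0 then F $ i $ 0 * (Y0 A ^ i) $ a else 0)"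
      unfolding Y0_nth[of "subst2 F A B"] by (simp add: subst2_def c0')
    then show "Y0 (subst2 F A B) $ a = (Abs_fps (\<lambda>i. F $ i $ 0) oo Y0 A) $ a"
      by (simp add: fps_compose_nth atLeast0AtMost del: of_bool_eq_iff)
  qed
  show "Y1 (subst2 F A B) = fps_const b * (Abs_fps (\<lambda>i. F $ i $ 1) oo Y0 A)"
  proof (rule fps_ext)
    fix a
    \<comment> \<open>\<open>subst2\<close> sums up to the total degree \<open>a + 1\<close>, one
      more than composition does in degree \<open>a\<close>; the surplus power vanishes.\<close>
    have z: "(Y0 A ^ Suc a) $ a = 0"
      using A(2) by (intro startsby_zero_power_prefix[rule_format]) auto
    have "Y1 (subst2 F A B) $ a
        = (\<Sum>i\<le>a + 1. \<Sum>j\<le>a + 1. if j = 1 then b * (F $ i $ 1 * (Y0 A ^ i) $ a) else 0)"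
      unfolding Y1_nth[of "subst2 F A B"] by (simp add: subst2_def c1')
    also have "\<dots> = (\<Sum>i\<le>Suc a. b * (F $ i $ 1 * (Y0 A ^ i) $ a))"
      unfolding Suc_eq_plus1 by (intro sum.cong refl) simp
    also have "\<dots> = (\<Sum>i\<le>a. b * (F $ i $ 1 * (Y0 A ^ i) $ a))"
      using z by simp
    finally show "Y1 (subst2 F A B) $ a = (fps_const b * (Abs_fps (\<lambda>i. F $ i $ 1) oo Y0 A)) $ a"
      by (simp add: fps_compose_nth atLeast0AtMost sum_distrib_left)
  qed
qed

lemma Y0_var_X: "Y0 var_X = fps_X" and Y1_var_X: "Y1 var_X = 0"
  and Y0_var_Y: "Y0 var_Y = 0" and Y1_var_Y: "Y1 var_Y = 1"
  by (auto simp: fps_eq_iff Y0_nth Y1_nth var_X_def var_Y_def fps_X_def)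

lemma Y0_add: "Y0 (f + g) = Y0 f + Y0 g" and Y1_add: "Y1 (f + g) = Y1 f + Y1 g"
  by (auto simp: fps_eq_iff Y0_nth Y1_nth)

lemma Y1_subst1_var_X: "Y1 (subst1 f var_X) = 0"
  by (subst Y1_subst1_X) (auto simp: Y0_var_X Y1_var_X)

lemma Y_subst1_var_Y:
  fixes f :: "'a::comm_ring_1 fps"
  assumes "f $ 0 = 0"
  shows "Y0 (subst1 f var_Y) = 0" "Y1 (subst1 f var_Y) = fps_const (f $ 1)"
proof -
  show "Y0 (subst1 f var_Y) = 0"
    using assms by (subst Y0_subst1) (auto simp: Y0_var_Y fps_eq_iff fps_compose_nth power_0_left
        fps_compose_0_right)
  show "Y1 (subst1 f var_Y) = fps_const (f $ 1)"
  proof (rule fps_ext)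
    fix a
    have "(var_Y ^ i :: 'a fps fps fps) $ a $ 1 $ 0 = (if i = 1 \<and> a = 0 then 1 else 0)" for i
      using Y1_power[of "var_Y :: 'a fps fps fps" i] unfolding fps_eq_iff Y0_var_Y Y1_var_Y
      by (cases "i \<le> 1"; cases i) (auto simp: Y1_nth power_0_left One_nat_def)
    then have "f $ i * (var_Y ^ i :: 'a fps fps fps) $ a $ 1 $ 0 = (if i = 1 then (if a = 0 then f $ 1 else 0) else 0)"
      for i by simp
    then have "Y1 (subst1 f var_Y) $ a = (\<Sum>i\<le>a+1. if i = 1 then (if a = 0 then f $ 1 else 0) else 0)"
      unfolding Y1_nth[of "subst1 f var_Y"] by (simp add: subst1_def)
    then show "Y1 (subst1 f var_Y) $ a = fps_const (f $ 1) $ a"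
      by simp
  qed
qed

text \<open>
  Differentiating the identities for \<open>e\<close> and \<open>P\<close> in \<open>Y\<close> at \<open>0\<close> gives \<open>e' = w(e)\<close> and
  \<open>P' w = \<pi> w(P)\<close> with \<open>w = \<partial>F/\<partial>Y(X, 0)\<close>, so \<open>l' = 1/w\<close> for the inverse \<open>l\<close> of \<open>e\<close>.
\<close>

proposition formal_log_of_group:
  fixes P e :: "'a::field_char_0 fps"
  assumes FX: "subst2 F var_X 0 = var_X" and FY: "subst2 F 0 var_Y = var_Y"
    and P0: "P $ 0 = 0"
    and FP: "subst1 P (subst2 F var_X var_Y) = subst2 F (subst1 P var_X) (subst1 P var_Y)"
    and e0: "e $ 0 = 0" and e1: "e $ 1 = 1"
    and Fe: "subst1 e (var_X + var_Y) = subst2 F (subst1 e var_X) (subst1 e var_Y)"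
  shows "fps_inv e oo P = fps_const (P $ 1) * fps_inv e"
proof -
  define w where "w = Abs_fps (\<lambda>i. F $ i $ 1)"
  have z: "Y1 0 = 0" "Y0 0 = 0" by (auto simp: fps_eq_iff Y0_nth Y1_nth)
  have u: "fps_deriv e = w oo e"
  proof -
    have "Y1 (subst1 e (var_X + var_Y)) = fps_deriv e"
      by (subst Y1_subst1_X) (auto simp: Y0_add Y1_add Y0_var_X Y1_var_X Y0_var_Y Y1_var_Y)
    moreover have "Y1 (subst2 F (subst1 e var_X) (subst1 e var_Y)) = w oo e"
      using e0 e1 unfolding w_def
      by (subst Y_subst2(2)) (auto simp: Y1_subst1_var_X Y_subst1_var_Y Y0_subst1 Y0_var_X)
    ultimately show ?thesis using Fe by simp
  qed
  have v: "fps_deriv P * w = fps_const (P $ 1) * (w oo P)"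
  proof -
    have F0: "Abs_fps (\<lambda>i. F $ i $ 0) = fps_X"
    proof -
      have "Y0 (subst2 F var_X 0) = Abs_fps (\<lambda>i. F $ i $ 0) oo fps_X"
        by (subst Y_subst2(1)[where b = 0]) (auto simp: Y0_var_X Y1_var_X z)
      then show ?thesis using FX by (simp add: Y0_var_X)
    qed
    have "Y1 (subst1 P (subst2 F var_X var_Y)) = fps_deriv P * Y1 (subst2 F var_X var_Y)"
      by (rule Y1_subst1_X, subst Y_subst2(1)[where b = 1])
        (auto simp: Y0_var_X Y1_var_X Y0_var_Y Y1_var_Y F0)
    also have "Y1 (subst2 F var_X var_Y) = w"
      unfolding w_def
      by (subst Y_subst2(2)[where b = 1]) (auto simp: Y0_var_X Y1_var_X Y0_var_Y Y1_var_Y)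
    finally have "Y1 (subst1 P (subst2 F var_X var_Y)) = fps_deriv P * w" .
    moreover have "Y1 (subst2 F (subst1 P var_X) (subst1 P var_Y)) = fps_const (P $ 1) * (w oo P)"
      using P0 unfolding w_def
      by (subst Y_subst2(2)) (auto simp: Y1_subst1_var_X Y_subst1_var_Y Y0_subst1 Y0_var_X)
    ultimately show ?thesis using FP by simp
  qed
  have w0: "w $ 0 = 1"
  proof -
    have "Y1 (subst2 F 0 var_Y) = fps_const 1 * (w oo 0)"
      unfolding w_def by (subst Y_subst2(2)[where b = 1]) (auto simp: z Y0_var_Y Y1_var_Y)
    then have "Y1 (subst2 F 0 var_Y) $ 0 = w $ 0" by (simp add: fps_compose_0_right)
    then show ?thesis unfolding FY by (simp add: Y1_var_Y)
  qed
  define l where "l = fps_inv e"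
  have l0: "l $ 0 = 0" by (simp add: l_def fps_inv_def)
  have le: "l oo e = fps_X" "e oo l = fps_X" unfolding l_def using e0 e1 by (auto intro: fps_inv fps_inv_right)
  have "fps_deriv (l oo e) = (fps_deriv l * w) oo e"
    using e0 by (simp add: fps_compose_deriv u fps_compose_mult_distrib)
  then have "1 = (fps_deriv l * w) oo e" by (simp add: le)
  then have "(1 :: 'a fps) oo l = ((fps_deriv l * w) oo e) oo l" by simp
  also have "\<dots> = fps_deriv l * w"
    using fps_compose_assoc[OF l0 e0, of "fps_deriv l * w"] le by simp
  finally have lw: "fps_deriv l * w = 1" by simp
  have "(fps_deriv l oo P) * (w oo P) = 1"
    using arg_cong[OF lw, of "\<lambda>f. f oo P"] P0 by (simp add: fps_compose_mult_distrib)
  then have "fps_deriv (l oo P) * w = fps_const (P $ 1)"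
    using P0 v by (simp add: fps_compose_deriv mult.assoc mult.left_commute)
  then have "fps_deriv (l oo P) * w = fps_deriv (fps_const (P $ 1) * l) * w"
    by (simp add: lw mult.assoc)
  \<comment> \<open>The series \<open>w\<close> has constant term \<open>1\<close>, so it can be
    cancelled. In characteristic zero, equal derivatives and equal constant terms then
    suffice.\<close>
  then have "fps_deriv (l oo P) = fps_deriv (fps_const (P $ 1) * l)"
    using w0 by auto
  then have "l oo P = fps_const (P $ 1) * l"
    unfolding fps_deriv_eq_iff using P0 l0 by (simp add: fps_compose_nth)
  then show ?thesis by (simp add: l_def)
qed

text \<open>With linear coefficient \<open>1\<close> no division occurs, so the inverse series stays
  over any subfield containing the coefficients of \<open>e\<close>; see
  \<open>fps_inv_mem\<close>.\<close>

lemma fps_inv_nth: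
  fixes e :: "'a::field fps"
  assumes "e $ 0 = 0" "e $ 1 = 1"
  shows "fps_inv e $ n = of_bool (n = 1) - (\<Sum>i<n. fps_inv e $ i * (e ^ i) $ n)"
proof -
  have "fps_inv e oo e = fps_X" using assms by (intro fps_inv) auto
  then have "of_bool (n = 1) = (\<Sum>i=0..n. fps_inv e $ i * (e ^ i) $ n)"
    by (auto simp: fps_compose_nth fps_eq_iff)
  also have "\<dots> = fps_inv e $ n * (e ^ n) $ n + (\<Sum>i<n. fps_inv e $ i * (e ^ i) $ n)"
    unfolding atLeast0AtMost by (simp add: add.commute flip: lessThan_Suc_atMost)
  also have "(e ^ n) $ n = 1"
    using assms startsby_zero_power_nth_same[of e n] by simp
  finally show ?thesis by simp
qed

section \<open>Discretely valued subfields with finite residue field\<close>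

lemma nv_mult_less_1: "nv x < 1 \<Longrightarrow> nv y \<le> 1 \<Longrightarrow> nv (x * y) < 1"
  using mult_left_le[of "nv y" "nv x"] by (simp add: nv_mult)

lemma nv_prod: "nv (prod f A) = (\<Prod>x\<in>A. nv (f x))"
  by (induction A rule: infinite_finite_induct) (auto simp: nv_mult)

locale set_subfield =
  fixes K :: "'a::field set"
  assumes one_mem: "1 \<in> K" and diff_mem: "x \<in> K \<Longrightarrow> y \<in> K \<Longrightarrow> x - y \<in> K"
    and mult_mem: "x \<in> K \<Longrightarrow> y \<in> K \<Longrightarrow> x * y \<in> K"
    and inverse_mem: "x \<in> K \<Longrightarrow> inverse x \<in> K"
begin

lemma zero_mem: "0 \<in> K" using diff_mem[OF one_mem one_mem] by simp
lemma uminus_mem: "x \<in> K \<Longrightarrow> - x \<in> K" using diff_mem[OF zero_mem] by simp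
lemma add_mem: "x \<in> K \<Longrightarrow> y \<in> K \<Longrightarrow> x + y \<in> K" using diff_mem[OF _ uminus_mem] by force
lemma divide_mem: "x \<in> K \<Longrightarrow> y \<in> K \<Longrightarrow> x / y \<in> K"
  by (simp add: divide_inverse mult_mem inverse_mem)
lemma power_mem: "x \<in> K \<Longrightarrow> x ^ n \<in> K" by (induction n) (auto simp: one_mem mult_mem)
lemma power_int_mem: "x \<in> K \<Longrightarrow> x powi n \<in> K"
  by (simp add: power_int_def power_mem inverse_mem)
lemma of_nat_mem: "of_nat n \<in> K" by (induction n) (auto simp: zero_mem one_mem add_mem)
lemma sum_mem: "(\<And>i. i \<in> A \<Longrightarrow> f i \<in> K) \<Longrightarrow> sum f A \<in> K"
  by (induction A rule: infinite_finite_induct) (auto simp: zero_mem add_mem)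
lemma prod_mem: "(\<And>i. i \<in> A \<Longrightarrow> f i \<in> K) \<Longrightarrow> prod f A \<in> K"
  by (induction A rule: infinite_finite_induct) (auto simp: one_mem mult_mem)

lemmas mems = zero_mem one_mem uminus_mem add_mem diff_mem mult_mem divide_mem inverse_mem
  power_mem power_int_mem of_nat_mem sum_mem prod_mem

lemma poly_mem: "(\<And>i. poly.coeff f i \<in> K) \<Longrightarrow> x \<in> K \<Longrightarrow> poly f x \<in> K"
  by (simp add: poly_altdef mems)

end

text \<open>Synthetic division by \<open>X - r\<close> lowers the degree and the number of approximate roots by one.\<close>

lemma approx_roots_coeffs_small:
  fixes f :: "'a::nonarch_valued_field poly"
  assumes "finite R" "Polynomial.degree f < card R"
    and "\<And>r. r \<in> R \<Longrightarrow> nv r \<le> 1" "\<And>r s. r \<in> R \<Longrightarrow> s \<in> R \<Longrightarrow> r \<noteq> s \<Longrightarrow> nv (r - s) = 1"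
    and "\<And>r. r \<in> R \<Longrightarrow> nv (poly f r) < 1"
  shows "nv (poly.coeff f i) < 1"
  using assms
proof (induction "card R" arbitrary: R f i)
  case 0
  then show ?case by simp
next
  case (Suc n)
  then obtain r where r: "r \<in> R" by fastforce
  define g where "g = synthetic_div f r"
  define c where "c = poly f r"
  have f: "f = [:c:] + [:- r, 1:] * g"
    using synthetic_div_correct'[of r f] by (simp add: g_def c_def add.commute)
  have c: "nv c < 1" using Suc.prems r by (simp add: c_def)
  have g: "nv (poly.coeff g i) < 1" for i
  proof (cases "Polynomial.degree f = 0")
    case True
    then have "g = 0" unfolding g_def by (simp add: synthetic_div_eq_0_iff)
    then show ?thesis by simp
  next
    case False
    show ?thesis
    proof (rule Suc.hyps(1)[of "R - {r}"])
      show "n = card (R - {r})" using Suc.hyps Suc.prems r by simp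
      show "Polynomial.degree g < card (R - {r})"
        using Suc.hyps Suc.prems r False by (simp add: g_def degree_synthetic_div)
      show "nv (poly g s) < 1" if s: "s \<in> R - {r}" for s
      proof -
        have "poly f s - c = (s - r) * poly g s" by (subst f) (simp add: algebra_simps)
        then have "nv (poly f s - c) = nv (poly g s)"
          using Suc.prems(4)[of s r] s r by (simp add: nv_mult)
        moreover have "nv (poly f s - c) < 1" using Suc.prems(5)[of s] s c by (intro nv_diff_less) auto
        ultimately show ?thesis by simp
      qed
    qed (use Suc.prems in auto)
  qed
  have "poly.coeff f i = poly.coeff [:c:] i + (case i of 0 \<Rightarrow> 0 | Suc j \<Rightarrow> poly.coeff g j) - r * poly.coeff g i"
    by (subst f) (simp add: coeff_pCons split: nat.split)
  also have "nv \<dots> < 1"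
  proof (intro nv_diff_less nv_add_less)
    show "nv (poly.coeff [:c:] i) < 1" using c by (auto simp: coeff_pCons split: nat.split)
    show "nv (case i of 0 \<Rightarrow> 0 | Suc j \<Rightarrow> poly.coeff g j) < 1" using g by (auto split: nat.split)
    show "nv (r * poly.coeff g i) < 1"
      using g[of i] Suc.prems(3)[OF r] nv_mult_less_1[of "poly.coeff g i" r] by (simp add: mult.commute)
  qed
  finally show ?case .
qed

text \<open>What is retained of a finite extension of \<open>Qp\<close>: closedness in a complete
  field, a uniformizer in the form of \<open>discrete\<close>, and residue classes handled through
  representatives instead of a quotient ring.\<close>

locale local_subfield = set_subfield K for K :: "'a::nonarch_valued_field set" +
  fixes \<pi> :: 'a and q :: nat
  assumes complete_C: "complete (UNIV :: 'a set)" and closed_K: "closed K"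
    and pi_K: "\<pi> \<in> K" and pi_lt_1: "nv \<pi> < 1" and pi_nz: "\<pi> \<noteq> 0"
    and discrete: "x \<in> K \<Longrightarrow> nv x < 1 \<Longrightarrow> nv x \<le> nv \<pi>"
    and residue_reps: "\<exists>R\<subseteq>K. finite R \<and> card R = q \<and> (\<forall>r\<in>R. nv r \<le> 1) \<and>
      (\<forall>r\<in>R. \<forall>s\<in>R. nv (r - s) < 1 \<longrightarrow> r = s) \<and> (\<forall>x\<in>K. nv x \<le> 1 \<longrightarrow> (\<exists>r\<in>R. nv (x - r) < 1))"
    and q_ge_2: "2 \<le> q"
begin

definition OK :: "'a set" where "OK = {x \<in> K. nv x \<le> 1}"

lemma O_iff: "x \<in> OK \<longleftrightarrow> x \<in> K \<and> nv x \<le> 1" by (simp add: OK_def)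
lemma O_one: "1 \<in> OK" by (simp add: O_iff mems)
lemma O_zero: "0 \<in> OK" by (simp add: O_iff mems)
lemma O_diff: "x \<in> OK \<Longrightarrow> y \<in> OK \<Longrightarrow> x - y \<in> OK" by (simp add: O_iff mems nv_diff_le)
lemma O_uminus: "x \<in> OK \<Longrightarrow> - x \<in> OK" by (simp add: O_iff mems)
lemma O_add: "x \<in> OK \<Longrightarrow> y \<in> OK \<Longrightarrow> x + y \<in> OK" by (simp add: O_iff mems nv_add_le)
lemma O_mult: "x \<in> OK \<Longrightarrow> y \<in> OK \<Longrightarrow> x * y \<in> OK" by (simp add: O_iff mems nv_mult mult_le_one)
lemma O_pi: "\<pi> \<in> OK" using pi_K pi_lt_1 by (simp add: O_iff)
lemma O_power: "x \<in> OK \<Longrightarrow> x ^ n \<in> OK" by (induction n) (auto simp: O_one O_mult)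
lemma mem_pi_O_iff: "x \<in> (\<lambda>a. \<pi> * a) ` OK \<longleftrightarrow> x \<in> K \<and> nv x < 1"
proof
  assume "x \<in> (\<lambda>a. \<pi> * a) ` OK"
  then obtain a where "x = \<pi> * a" "a \<in> OK" by (rule imageE)
  then have a: "x = \<pi> * a" "a \<in> K" "nv a \<le> 1" by (simp_all add: O_iff)
  then have "nv x \<le> nv \<pi>" using mult_left_mono[of "nv a" 1 "nv \<pi>"] by (simp add: nv_mult)
  then show "x \<in> K \<and> nv x < 1" using a pi_K pi_lt_1 by (simp add: mems)
next
  assume x: "x \<in> K \<and> nv x < 1"
  then have "nv x \<le> nv \<pi>" using discrete by blast
  then have "x / \<pi> \<in> OK" using x pi_K pi_nz by (simp add: O_iff mems nv_divide divide_le_eq)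
  moreover have "x = \<pi> * (x / \<pi>)" using pi_nz by simp
  ultimately show "x \<in> (\<lambda>a. \<pi> * a) ` OK" by blast
qed

text \<open>By \<open>discrete\<close>, dividing an element of absolute value below \<open>1\<close>
  by \<open>\<pi>\<close> does not lead beyond \<open>1\<close>, so finitely many divisions reach
  \<open>1\<close> exactly.\<close>

lemma nv_discrete:
  assumes "x \<in> K" "x \<noteq> 0"
  shows "\<exists>n. nv x = nv \<pi> powi n"
proof -
  have *: "\<exists>n::nat. nv x = nv \<pi> ^ n" if x: "x \<in> K" "x \<noteq> 0" "nv x \<le> 1" for x
  proof -
    obtain N where "nv \<pi> ^ N < nv x"
      using real_arch_pow_inv[of "nv x" "nv \<pi>"] x pi_lt_1 by auto
    then show ?thesis using x
    proof (induction N arbitrary: x)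
      case (Suc N)
      show ?case
      proof (cases "nv x < 1")
        case True
        then have "nv x \<le> nv \<pi>" using discrete Suc.prems by blast
        then have "nv (x / \<pi>) \<le> 1" using pi_nz by (simp add: nv_divide divide_le_eq)
        moreover have "nv \<pi> ^ N < nv (x / \<pi>)"
          using Suc.prems pi_nz by (simp add: nv_divide less_divide_eq mult.commute)
        ultimately obtain n where "nv (x / \<pi>) = nv \<pi> ^ n"
          using Suc.IH[of "x / \<pi>"] Suc.prems pi_K pi_nz by (auto simp: mems)
        then have "nv x = nv \<pi> ^ Suc n" using pi_nz by (simp add: nv_divide field_simps)
        then show ?thesis by blast
      next
        case False
        then have "nv x = nv \<pi> ^ 0" using Suc.prems by simp
        then show ?thesis by blast
      qed
    qed auto
  qed
  show ?thesis
  proof (cases "nv x \<le> 1")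
    case True
    then obtain n :: nat where "nv x = nv \<pi> ^ n" using * assms by blast
    then have "nv x = nv \<pi> powi int n" by simp
    then show ?thesis by blast
  next
    case False
    then have "nv (inverse x) \<le> 1" using assms by (simp add: nv_inverse inverse_le_1_iff)
    then obtain n :: nat where "nv (inverse x) = nv \<pi> ^ n"
      using *[of "inverse x"] assms by (auto simp: mems)
    then have "nv x = nv \<pi> powi (- int n)"
      by (metis inverse_inverse_eq nv_inverse power_int_minus power_int_of_nat)
    then show ?thesis by blast
  qed
qed

definition reps :: "'a set"
  where "reps = (SOME R. R \<subseteq> K \<and> finite R \<and> card R = q \<and> (\<forall>r\<in>R. nv r \<le> 1) \<and>
      (\<forall>r\<in>R. \<forall>s\<in>R. nv (r - s) < 1 \<longrightarrow> r = s) \<and> (\<forall>x\<in>K. nv x \<le> 1 \<longrightarrow> (\<exists>r\<in>R. nv (x - r) < 1)))"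

lemma reps: "reps \<subseteq> K" "finite reps" "card reps = q" "r \<in> reps \<Longrightarrow> nv r \<le> 1"
  "r \<in> reps \<Longrightarrow> s \<in> reps \<Longrightarrow> nv (r - s) < 1 \<Longrightarrow> r = s"
  "x \<in> K \<Longrightarrow> nv x \<le> 1 \<Longrightarrow> \<exists>r\<in>reps. nv (x - r) < 1"
  using someI_ex[OF residue_reps] unfolding reps_def[symmetric] by blast+

lemma reps_O: "r \<in> reps \<Longrightarrow> r \<in> OK" using reps by (auto simp: O_iff)

lemma reps_diff: "r \<in> reps \<Longrightarrow> s \<in> reps \<Longrightarrow> r \<noteq> s \<Longrightarrow> nv (r - s) = 1"
  using reps(5)[of r s] O_diff[of r s] reps_O by (force simp: O_iff)

definition rep :: "'a \<Rightarrow> 'a" where "rep x = (SOME r. r \<in> reps \<and> nv (x - r) < 1)"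

lemma rep: assumes "x \<in> OK" shows "rep x \<in> reps" "nv (x - rep x) < 1"
  using someI_ex[of "\<lambda>r. r \<in> reps \<and> nv (x - r) < 1"] reps(6)[of x] assms
  unfolding rep_def[symmetric] O_iff by blast+

lemma prod_cong_mod:
  assumes "finite A" "\<And>x. x \<in> A \<Longrightarrow> nv (f x) \<le> 1" "\<And>x. x \<in> A \<Longrightarrow> nv (g x) \<le> 1"
    "\<And>x. x \<in> A \<Longrightarrow> nv (f x - g x) < (1::real)"
  shows "nv (prod f A) \<le> 1 \<and> nv (prod f A - prod g A) < 1"
  using assms
proof (induction A rule: finite_induct)
  case (insert a A)
  have e: "prod f (insert a A) - prod g (insert a A)
      = f a * (prod f A - prod g A) + (f a - g a) * prod g A"
    using insert by (simp add: algebra_simps)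
  have g1: "nv (prod g A) \<le> 1"
    using insert nv_diff_le[of "prod f A" 1 "prod f A - prod g A"] by simp
  have "nv (f a * (prod f A - prod g A)) < 1"
    using insert nv_mult_less_1[of "prod f A - prod g A" "f a"] by (simp add: mult.commute)
  moreover have "nv ((f a - g a) * prod g A) < 1"
    using insert g1 by (intro nv_mult_less_1) auto
  ultimately have "nv (prod f (insert a A) - prod g (insert a A)) < 1"
    unfolding e by (rule nv_add_less)
  moreover have "nv (prod f (insert a A)) \<le> 1"
    using insert by (simp add: nv_mult mult_le_one)
  ultimately show ?case by blast
qed auto

text \<open>Fermat's argument: multiplication by a unit permutes the nonzero residue classes.\<close>

lemma frobenius:
  assumes c: "c \<in> OK" shows "nv (c ^ q - c) < 1"
proof (cases "nv c < 1")
  case True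
  have "nv (c ^ q) \<le> nv c" using q_ge_2 power_decreasing[of 1 q "nv c"] True by (simp add: nv_power)
  then show ?thesis using True by (intro nv_diff_less) auto
next
  case False
  then have c1: "nv c = 1" using c by (simp add: O_iff)
  define R' where "R' = {r \<in> reps. nv r = 1}"
  have fin: "finite R'" using reps by (simp add: R'_def)
  have "rep 0 \<in> reps" "nv (rep 0) < 1" using rep[OF O_zero] by auto
  have R': "R' = reps - {rep 0}"
  proof (intro Set.set_eqI iffI)
    fix r assume r: "r \<in> reps - {rep 0}"
    then have "\<not> nv (r - rep 0) < 1" using reps(5)[of r "rep 0"] \<open>rep 0 \<in> reps\<close> by blast
    then have "\<not> nv r < 1" using nv_diff_less[of r 1 "rep 0"] \<open>nv (rep 0) < 1\<close> by blast
    moreover have "nv r \<le> 1" using r reps(4) by simp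
    ultimately show "r \<in> R'" using r by (simp add: R'_def)
  qed (use \<open>nv (rep 0) < 1\<close> in \<open>auto simp: R'_def\<close>)
  then have card: "card R' = q - 1" using \<open>rep 0 \<in> reps\<close> reps by simp
  define f where "f = (\<lambda>r. rep (c * r))"
  have OK: "c * r \<in> OK" if "r \<in> R'" for r using that c reps_O by (auto simp: R'_def O_mult)
  have f: "f r \<in> R'" "nv (c * r - f r) < 1" if "r \<in> R'" for r
  proof -
    show 1: "nv (c * r - f r) < 1" using rep OK[OF that] by (simp add: f_def)
    have "nv (c * r) = 1" using that c1 by (simp add: R'_def nv_mult)
    then have "nv (f r) = 1" using nv_eq_if_close[of "f r" "c * r"] 1 by (simp add: nv_minus_commute)
    then show "f r \<in> R'" using rep OK[OF that] by (simp add: R'_def f_def)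
  qed
  have "inj_on f R'"
  proof (rule inj_onI)
    fix r s assume rs: "r \<in> R'" "s \<in> R'" "f r = f s"
    then have "nv ((c * r - f r) - (c * s - f s)) < 1" by (metis nv_diff_less f(2))
    moreover have "(c * r - f r) - (c * s - f s) = c * (r - s)" using rs by (simp add: algebra_simps)
    ultimately have "nv (r - s) < 1" using c1 by (simp add: nv_mult)
    then show "r = s" using rs reps(5) by (auto simp: R'_def)
  qed
  then have bij: "bij_betw f R' R'"
    using f fin by (simp add: bij_betw_def card_image card_subset_eq image_subset_iff)
  have "nv ((\<Prod>r\<in>R'. c * r) - (\<Prod>r\<in>R'. f r)) < 1"
    using fin f OK reps(4) by (intro prod_cong_mod[THEN conjunct2]) (auto simp: O_iff R'_def)
  also have "(\<Prod>r\<in>R'. f r) = (\<Prod>r\<in>R'. r)" by (rule prod.reindex_bij_betw[OF bij])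
  also have "(\<Prod>r\<in>R'. c * r) - (\<Prod>r\<in>R'. r) = (c ^ (q - 1) - 1) * (\<Prod>r\<in>R'. r)"
    by (simp add: prod.distrib card algebra_simps)
  finally have "nv (c ^ (q - 1) - 1) * nv (\<Prod>r\<in>R'. r) < 1" by (simp add: nv_mult)
  moreover have "nv (\<Prod>r\<in>R'. r) = 1"
    by (simp add: nv_prod R'_def)
  moreover have "c ^ q - c = c * (c ^ (q - 1) - 1)"
    using q_ge_2 by (cases q) (auto simp: algebra_simps)
  ultimately show ?thesis using c1 by (simp add: nv_mult)
qed

text \<open>The polynomial \<open>(1 + X) ^ q - X ^ q - 1\<close> has degree below \<open>q\<close>
  and, by \<open>frobenius\<close>, is small at \<open>q\<close> incongruent points, so all its
  coefficients are small. This avoids identifying \<open>q\<close> as a power of the residue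
  characteristic.\<close>

lemma binom_small:
  assumes j: "0 < j" "j < q" shows "nv (of_nat (q choose j) :: 'a) < 1"
proof -
  define f :: "'a poly" where "f = [:1, 1:] ^ q - Polynomial.monom 1 q - 1"
  have mq: "poly.coeff ([:1, 1:] ^ q :: 'a poly) q = 1"
    using lead_coeff_power[of "[:1, 1:] :: 'a poly" q] by (simp add: degree_linear_power)
  have "Polynomial.degree f < q"
  proof -
    have "Polynomial.degree f \<le> q"
      unfolding f_def using degree_linear_power[of "1::'a" q]
      by (intro degree_diff_le) (auto simp: degree_monom_le)
    moreover have "poly.coeff f q = 0" using q_ge_2 by (simp add: f_def mq)
    ultimately show ?thesis using q_ge_2
      by (metis le_neq_implies_less degree_0 leading_coeff_0_iff not_numeral_le_zero)
  qed
  moreover have "nv (poly f r) < 1" if r: "r \<in> reps" for r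
  proof -
    have e: "poly f r = ((1 + r) ^ q - (1 + r)) - (r ^ q - r)"
      by (simp add: f_def poly_monom poly_power)
    show ?thesis unfolding e
      by (rule nv_diff_less; intro frobenius O_add O_one reps_O r)
  qed
  ultimately have "nv (poly.coeff f j) < 1"
    using reps reps_diff by (intro approx_roots_coeffs_small[of reps]) auto
  moreover have "poly.coeff f j = of_nat (q choose j)"
    using j coeff_linear_poly_power[of j q 1 1] by (simp add: f_def)
  ultimately show ?thesis by simp
qed

lemma q_small: "nv (of_nat q :: 'a) < 1"
  using binom_small[of 1] q_ge_2 by simp (simp add: One_nat_def)

end

section \<open>Convergent series over an ultrametric field\<close>

lemma nv_tendsto_nv: "(f \<longlongrightarrow> a) F \<Longrightarrow> ((\<lambda>n. nv (f n)) \<longlongrightarrow> nv a) F"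
  unfolding nv_def by (intro tendsto_intros)

lemma nv_tendsto_0_iff: "(f \<longlongrightarrow> 0) F \<longleftrightarrow> ((\<lambda>n. nv (f n)) \<longlongrightarrow> 0) F"
  using tendsto_nv_iff[of f 0] by simp

lemma nv_tendsto_add:
  assumes "(f \<longlongrightarrow> a) F" "(g \<longlongrightarrow> b) F"
  shows "((\<lambda>n. f n + g n) \<longlongrightarrow> (a + b :: 'a::nonarch_valued_field)) F"
proof -
  have m: "((\<lambda>n. max (nv (f n - a)) (nv (g n - b))) \<longlongrightarrow> max 0 0) F"
    using assms by (intro tendsto_max) (simp_all add: tendsto_nv_iff)
  have le: "nv (f n + g n - (a + b)) \<le> max (nv (f n - a)) (nv (g n - b))" for n
    using nv_add_le_max[of "f n - a" "g n - b"] by (simp add: algebra_simps)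
  have "((\<lambda>n. nv (f n + g n - (a + b))) \<longlongrightarrow> 0) F"
    by (rule tendsto_sandwich[OF always_eventually always_eventually tendsto_const m[unfolded max.idem]])
      (intro allI nv_nonneg le)+
  then show ?thesis by (simp add: tendsto_nv_iff[of "\<lambda>n. f n + g n"])
qed

lemma nv_tendsto_cmult:
  assumes "(f \<longlongrightarrow> a) F"
  shows "((\<lambda>n. c * f n) \<longlongrightarrow> (c * a :: 'a::nonarch_valued_field)) F"
proof -
  have "((\<lambda>n. nv c * nv (f n - a)) \<longlongrightarrow> nv c * 0) F"
    using assms by (intro tendsto_intros) (simp add: tendsto_nv_iff)
  then show ?thesis by (simp add: tendsto_nv_iff[of "\<lambda>n. c * f n"] flip: nv_mult right_diff_distrib)
qed

lemma nv_tendsto_diff: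
  assumes "(f \<longlongrightarrow> a) F" "(g \<longlongrightarrow> b) F"
  shows "((\<lambda>n. f n - g n) \<longlongrightarrow> (a - b :: 'a::nonarch_valued_field)) F"
  using nv_tendsto_add[OF assms(1) nv_tendsto_cmult[OF assms(2), of "-1"]] by simp

lemma nv_tendsto_mult:
  assumes "(f \<longlongrightarrow> a) F" "(g \<longlongrightarrow> b) F"
  shows "((\<lambda>n. f n * g n) \<longlongrightarrow> (a * b :: 'a::nonarch_valued_field)) F"
proof -
  have "((\<lambda>n. nv (f n - a) * nv (g n)) \<longlongrightarrow> 0 * nv b) F"
    using assms by (intro tendsto_intros nv_tendsto_nv) (simp add: tendsto_nv_iff)
  then have "((\<lambda>n. (f n - a) * g n) \<longlongrightarrow> 0) F" by (simp add: nv_tendsto_0_iff nv_mult)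
  from nv_tendsto_add[OF this nv_tendsto_cmult[OF assms(2), of a]] show ?thesis
    by (simp add: algebra_simps)
qed

lemma nv_tendsto_sum:
  assumes "\<And>i. i \<in> I \<Longrightarrow> ((\<lambda>n. f i n) \<longlongrightarrow> (a i :: 'a::nonarch_valued_field)) F"
  shows "((\<lambda>n. \<Sum>i\<in>I. f i n) \<longlongrightarrow> (\<Sum>i\<in>I. a i)) F"
  using assms by (induction I rule: infinite_finite_induct) (auto intro: nv_tendsto_add)

lemma nv_tendsto_le:
  assumes "f \<longlonglongrightarrow> a" "\<And>n. n \<ge> N \<Longrightarrow> nv (f n) \<le> r" shows "nv a \<le> r"
  using nv_tendsto_nv[OF assms(1)] assms(2) by (intro LIMSEQ_le_const2) auto

text \<open>In a complete ultrametric field these are exactly the series that converge at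
  \<open>X = 1\<close>. They form a ring, on which \<open>fps_total\<close>, the value at
  \<open>1\<close>, is a homomorphism.\<close>

definition null_series :: "'a::nonarch_valued_field fps set"
  where "null_series = {f. fps_nth f \<longlonglongrightarrow> 0}"

definition fps_total :: "'a::nonarch_valued_field fps \<Rightarrow> 'a"
  where "fps_total f = suminf (fps_nth f)"

lemma null_series_iff: "f \<in> null_series \<longleftrightarrow> (\<forall>e>0. \<exists>N. \<forall>n\<ge>N. nv (f $ n) < e)"
  by (simp add: null_series_def nv_tendsto_0_iff[of "fps_nth f"] LIMSEQ_iff)

lemma null_series_bounded:
  assumes "f \<in> null_series" shows "\<exists>B>0. \<forall>n. nv (f $ n) \<le> B"
proof -
  have "convergent (\<lambda>n. nv (f $ n))"
    using assms by (auto simp: null_series_def nv_tendsto_0_iff convergent_def)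
  then have "Bseq (\<lambda>n. nv (f $ n))" by (rule convergent_imp_Bseq)
  then show ?thesis by (auto elim!: BseqE)
qed

text \<open>If \<open>i + j\<close> is large then one index is large; its factor is small and the
  other factor is bounded.\<close>

lemma null_series_products_small:
  assumes f: "f \<in> null_series" and g: "g \<in> null_series" and e: "0 < e"
  shows "\<exists>N. \<forall>i j. i + j \<ge> N \<longrightarrow> nv (f $ i * g $ j) < e"
proof -
  obtain B C where B: "B > 0" "\<And>n. nv (f $ n) \<le> B" and C: "C > 0" "\<And>n. nv (g $ n) \<le> C"
    using null_series_bounded f g by metis
  obtain M where M: "\<And>n. n \<ge> M \<Longrightarrow> nv (f $ n) < e / C"
    using f C e unfolding null_series_iff by (metis divide_pos_pos)
  obtain N where N: "\<And>n. n \<ge> N \<Longrightarrow> nv (g $ n) < e / B"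
    using g B e unfolding null_series_iff by (metis divide_pos_pos)
  have "nv (f $ i * g $ j) < e" if "i + j \<ge> M + N" for i j
  proof (cases "i \<ge> M")
    case True
    have "nv (f $ i) * nv (g $ j) \<le> nv (f $ i) * C" using C by (intro mult_left_mono) auto
    also have "\<dots> < e" using M[OF True] C by (simp add: less_divide_eq)
    finally show ?thesis by (simp add: nv_mult)
  next
    case False
    then have j: "j \<ge> N" using that by simp
    have "nv (f $ i) * nv (g $ j) \<le> B * nv (g $ j)" using B by (intro mult_right_mono) auto
    also have "\<dots> < e" using N[OF j] B by (simp add: less_divide_eq mult.commute)
    finally show ?thesis by (simp add: nv_mult)
  qed
  then show ?thesis by blast
qed

lemma null_series_add:
  assumes "f \<in> null_series" "g \<in> null_series" shows "f + g \<in> null_series"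
proof -
  have "fps_nth (f + g) = (\<lambda>n. f $ n + g $ n)" by (rule ext) simp
  then show ?thesis
    using nv_tendsto_add[of "fps_nth f" 0 sequentially "fps_nth g" 0] assms by (simp add: null_series_def)
qed

lemma null_series_const: "fps_const c \<in> null_series"
proof -
  have "\<forall>\<^sub>F n in sequentially. (0::'a) = fps_const c $ n"
    using eventually_gt_at_top[of 0] by eventually_elim simp
  then show ?thesis unfolding null_series_def by (auto intro: Lim_transform_eventually[OF tendsto_const])
qed

lemma null_series_mult:
  assumes f: "f \<in> null_series" and g: "g \<in> null_series" shows "f * g \<in> null_series"
  unfolding null_series_iff
proof (intro allI impI)
  fix e :: real assume e: "0 < e"
  then obtain N where N: "\<And>i j. i + j \<ge> N \<Longrightarrow> nv (f $ i * g $ j) < e"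
    using null_series_products_small[OF f g] by blast
  have "nv ((f * g) $ n) < e" if "n \<ge> N" for n
    unfolding fps_mult_nth using e that by (intro nv_sum_less N) auto
  then show "\<exists>N. \<forall>n\<ge>N. nv ((f * g) $ n) < e" by blast
qed

lemma null_series_power: "f \<in> null_series \<Longrightarrow> f ^ n \<in> null_series"
  using null_series_const[of 1] by (induction n) (auto intro: null_series_mult)

lemma null_series_sum: "(\<And>i. i \<in> I \<Longrightarrow> f i \<in> null_series) \<Longrightarrow> sum f I \<in> null_series"
  using null_series_const[of 0] by (induction I rule: infinite_finite_induct) (auto intro: null_series_add)

lemma fps_of_poly_compose:
  fixes g :: "'b::comm_ring_1 fps"
  assumes "g $ 0 = 0"
  shows "fps_of_poly P oo g = (\<Sum>i\<le>Polynomial.degree P. fps_const (poly.coeff P i) * g ^ i)"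
proof (rule fps_ext)
  fix n
  let ?t = "\<lambda>i. poly.coeff P i * (g ^ i) $ n"
  have "(fps_of_poly P oo g) $ n = (\<Sum>i\<in>{0..n}. ?t i)" by (simp add: fps_compose_nth)
  also have "\<dots> = (\<Sum>i\<in>{0..n} \<inter> {..Polynomial.degree P}. ?t i)"
    by (intro sum.mono_neutral_right) (auto simp: not_le coeff_eq_0)
  also have "\<dots> = (\<Sum>i\<le>Polynomial.degree P. ?t i)"
    using startsby_zero_power_prefix[OF assms] by (intro sum.mono_neutral_left) auto
  finally show "(fps_of_poly P oo g) $ n = (\<Sum>i\<le>Polynomial.degree P. fps_const (poly.coeff P i) * g ^ i) $ n"
    by (simp add: fps_sum_nth)
qed

context
  assumes complete: "complete (UNIV :: 'a::nonarch_valued_field set)"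
begin

lemma null_series_sums:
  fixes f :: "'a fps"
  assumes f: "f \<in> null_series" shows "fps_nth f sums fps_total f"
proof -
  let ?s = "\<lambda>N. \<Sum>n<N. f $ n"
  have "Cauchy ?s"
  proof (rule metric_CauchyI)
    fix e :: real assume e: "0 < e"
    then obtain N where N: "\<And>n. n \<ge> N \<Longrightarrow> nv (f $ n) < e" using f by (auto simp: null_series_iff)
    have *: "dist (?s m) (?s n) < e" if "N \<le> n" "n \<le> m" for m n
    proof -
      have "?s m - ?s n = sum (fps_nth f) {n..<m}"
        using that sum_diff_nat_ivl[of 0 n m "fps_nth f"] by (simp add: lessThan_atLeast0)
      also have "nv \<dots> < e" using e that by (intro nv_sum_less N) auto
      finally show ?thesis by (simp add: dist_eq_nv)
    qed
    show "\<exists>M. \<forall>m\<ge>M. \<forall>n\<ge>M. dist (?s m) (?s n) < e"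
      using * by (intro exI[of _ N]) (metis dist_commute nat_le_linear)
  qed
  then obtain L where "?s \<longlonglongrightarrow> L" using complete unfolding complete_def by auto
  then have "fps_nth f sums L" by (simp add: sums_def)
  then show ?thesis unfolding fps_total_def by (simp add: sums_iff)
qed

lemma null_series_tendsto: "f \<in> null_series \<Longrightarrow> (\<lambda>N. \<Sum>n<N. f $ n) \<longlonglongrightarrow> (fps_total f :: 'a)"
  using null_series_sums unfolding sums_def .

lemma fps_total_eqI: "(\<lambda>N. \<Sum>n<N. f $ n) \<longlonglongrightarrow> s \<Longrightarrow> fps_total f = (s :: 'a)"
  unfolding fps_total_def using sums_unique[of "fps_nth f" s] by (simp add: sums_def)

lemma fps_total_add:
  assumes "f \<in> null_series" "g \<in> null_series"
  shows "fps_total (f + g) = fps_total f + (fps_total g :: 'a)"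
  using nv_tendsto_add[OF assms[THEN null_series_tendsto]] by (intro fps_total_eqI) (simp add: sum.distrib)

lemma fps_total_const: "fps_total (fps_const c) = (c :: 'a)"
proof (rule fps_total_eqI)
  have "\<forall>\<^sub>F N in sequentially. c = (\<Sum>n<N. fps_const c $ n)"
    using eventually_gt_at_top[of 0] by eventually_elim (simp add: sum.delta)
  then show "(\<lambda>N. \<Sum>n<N. fps_const c $ n) \<longlonglongrightarrow> c" by (rule Lim_transform_eventually[OF tendsto_const])
qed

text \<open>The product of two partial sums runs over a square, the partial sum of the product over
  the triangle \<open>i + j < N\<close>. The remaining terms are uniformly small.\<close>

lemma fps_total_mult:
  fixes f g :: "'a fps"
  assumes f: "f \<in> null_series" and g: "g \<in> null_series"
  shows "fps_total (f * g) = fps_total f * fps_total g"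
proof (rule fps_total_eqI)
  let ?D = "\<lambda>N. (\<Sum>n<N. (f * g) $ n) - (\<Sum>i<N. f $ i) * (\<Sum>j<N. g $ j)"
  have "?D \<longlonglongrightarrow> 0"
    unfolding nv_tendsto_0_iff[of ?D] LIMSEQ_iff
  proof (intro allI impI)
    fix e :: real assume e: "0 < e"
    then obtain M where M: "\<And>i j. i + j \<ge> M \<Longrightarrow> nv (f $ i * g $ j) < e"
      using null_series_products_small[OF f g] by blast
    have "nv (?D N) < e" if "N \<ge> M" for N
    proof -
      let ?h = "\<lambda>(i, j). f $ i * g $ j" and ?Q = "{..<N} \<times> {..<N}" and ?T = "{(i, j). i + j < N}"
      have "(\<Sum>n<N. (f * g) $ n) = sum ?h ?T"
        by (simp add: sum.triangle_reindex fps_mult_nth atLeast0AtMost)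
      moreover have "(\<Sum>i<N. f $ i) * (\<Sum>j<N. g $ j) = sum ?h ?Q"
        by (simp add: sum_product sum.cartesian_product)
      moreover have "sum ?h ?Q = sum ?h (?Q - ?T) + sum ?h ?T"
        by (rule sum.subset_diff) auto
      ultimately have "?D N = - sum ?h (?Q - ?T)" by simp
      also have "nv \<dots> < e"
        unfolding nv_uminus using that by (intro nv_sum_less e) (auto intro!: M)
      finally show ?thesis .
    qed
    then show "\<exists>N0. \<forall>N\<ge>N0. norm (nv (?D N) - 0) < e" by auto
  qed
  from nv_tendsto_add[OF this nv_tendsto_mult[OF f[THEN null_series_tendsto] g[THEN null_series_tendsto]]]
  show "(\<lambda>N. \<Sum>n<N. (f * g) $ n) \<longlonglongrightarrow> fps_total f * fps_total g" by simp
qed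

lemma fps_total_power: "f \<in> null_series \<Longrightarrow> fps_total (f ^ n) = (fps_total f :: 'a) ^ n"
  using fps_total_const[of 1] by (induction n) (auto simp: fps_total_mult null_series_power)

lemma fps_total_sum:
  fixes f :: "'i \<Rightarrow> 'a fps"
  shows "(\<And>i. i \<in> I \<Longrightarrow> f i \<in> null_series) \<Longrightarrow> fps_total (sum f I) = (\<Sum>i\<in>I. fps_total (f i))"
  using fps_total_const[of 0]
  by (induction I rule: infinite_finite_induct) (auto simp: fps_total_add null_series_sum)

lemma fps_total_poly:
  fixes f :: "'a fps"
  assumes "f \<in> null_series" "f $ 0 = 0"
  shows "fps_of_poly P oo f \<in> null_series" "fps_total (fps_of_poly P oo f) = poly P (fps_total f)"
  unfolding fps_of_poly_compose[OF assms(2)] using assms(1)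
  by (simp_all add: null_series_sum null_series_mult null_series_const null_series_power fps_total_sum
      fps_total_mult fps_total_const fps_total_power poly_altdef)

lemma fps_total_approx:
  fixes f :: "'a fps"
  assumes "f \<in> null_series" "\<And>n. n \<ge> N \<Longrightarrow> nv (f $ n) \<le> r" "0 \<le> r"
  shows "nv (fps_total f - (\<Sum>n<N. f $ n)) \<le> r"
proof (rule nv_tendsto_le)
  show "(\<lambda>M. (\<Sum>n<M. f $ n) - (\<Sum>n<N. f $ n)) \<longlonglongrightarrow> fps_total f - (\<Sum>n<N. f $ n)"
    by (intro nv_tendsto_diff null_series_tendsto assms tendsto_const)
  fix M assume "N \<le> M"
  then have "(\<Sum>n<M. f $ n) - (\<Sum>n<N. f $ n) = sum (fps_nth f) {N..<M}"
    using sum_diff_nat_ivl[of 0 N M "fps_nth f"] by (simp add: lessThan_atLeast0)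
  then show "nv ((\<Sum>n<M. f $ n) - (\<Sum>n<N. f $ n)) \<le> r"
    using assms by (auto intro: nv_sum_le)
qed

end

section \<open>Values of integral series on the open unit disc\<close>

definition integral_series :: "'a::nonarch_valued_field fps set"
  where "integral_series = {f. \<forall>n. nv (f $ n) \<le> 1}"

lemma integral_seriesD: "f \<in> integral_series \<Longrightarrow> nv (f $ n) \<le> 1"
  by (simp add: integral_series_def)

lemma integral_series_mult: "f \<in> integral_series \<Longrightarrow> g \<in> integral_series \<Longrightarrow> f * g \<in> integral_series"
  by (auto simp: integral_series_def fps_mult_nth nv_mult mult_le_one intro!: nv_sum_le)

lemma integral_series_power: "f \<in> integral_series \<Longrightarrow> f ^ n \<in> integral_series"
proof (induction n)
  case (Suc n)
  then show ?case by (simp add: integral_series_mult)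
qed (simp add: integral_series_def)

lemma integral_series_compose: "f \<in> integral_series \<Longrightarrow> g \<in> integral_series \<Longrightarrow> f oo g \<in> integral_series"
  using integral_series_power[of g]
  by (auto simp: integral_series_def fps_compose_nth nv_mult mult_le_one intro!: nv_sum_le)

text \<open>Substituting \<open>x X\<close> for \<open>X\<close> reduces values at \<open>x\<close>
  to values at \<open>1\<close>.\<close>

definition fps_scale :: "'b::comm_ring_1 \<Rightarrow> 'b fps \<Rightarrow> 'b fps"
  where "fps_scale x f = Abs_fps (\<lambda>n. f $ n * x ^ n)"

definition fps_at :: "'a::nonarch_valued_field fps \<Rightarrow> 'a \<Rightarrow> 'a"
  where "fps_at f x = fps_total (fps_scale x f)"

lemma fps_scale_nth [simp]: "fps_scale x f $ n = f $ n * x ^ n"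
  by (simp add: fps_scale_def)

lemma fps_scale_mult: "fps_scale x (f * g) = fps_scale x f * fps_scale x g"
proof (rule fps_ext)
  fix n
  have "f $ i * g $ (n - i) * x ^ n = (f $ i * x ^ i) * (g $ (n - i) * x ^ (n - i))" if "i \<le> n" for i
    using that power_add[of x i "n - i"] by (simp add: mult_ac)
  then show "fps_scale x (f * g) $ n = (fps_scale x f * fps_scale x g) $ n"
    by (simp add: fps_mult_nth sum_distrib_right)
qed

lemma fps_scale_power: "fps_scale x (f ^ n) = fps_scale x f ^ n"
proof (induction n)
  case 0
  show ?case by (rule fps_ext) simp
qed (simp add: fps_scale_mult)

lemma nv_integral_scale: "f \<in> integral_series \<Longrightarrow> nv (fps_scale x f $ n) \<le> nv x ^ n"
  by (auto simp: nv_mult nv_power integral_series_def intro: mult_left_le_one_le)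

lemma fps_scale_null:
  assumes f: "f \<in> integral_series" and x: "nv x < 1" shows "fps_scale x f \<in> null_series"
proof -
  have "(\<lambda>n. nv x ^ n) \<longlonglongrightarrow> 0" using x by (intro LIMSEQ_realpow_zero) auto
  then have "(\<lambda>n. nv (fps_scale x f $ n)) \<longlonglongrightarrow> 0"
    by (rule tendsto_sandwich[OF _ _ tendsto_const, rotated 2])
      (use nv_integral_scale[OF f, of x] in \<open>auto simp del: fps_scale_nth\<close>)
  then show ?thesis
    unfolding null_series_def mem_Collect_eq nv_tendsto_0_iff[of "fps_nth (fps_scale x f)"] .
qed

context
  assumes complete: "complete (UNIV :: 'a::nonarch_valued_field set)"
begin

lemma fps_at_tendsto:
  "f \<in> integral_series \<Longrightarrow> nv x < 1 \<Longrightarrow> (\<lambda>N. \<Sum>n<N. f $ n * x ^ n) \<longlonglongrightarrow> fps_at f (x :: 'a)"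
  using null_series_tendsto[OF complete fps_scale_null, of f x] by (simp add: fps_at_def)

lemma fps_at_approx:
  assumes "f \<in> integral_series" "nv x < 1"
  shows "nv (fps_at f (x :: 'a) - (\<Sum>n<N. f $ n * x ^ n)) \<le> nv x ^ N"
proof -
  have "nv (fps_scale x f $ n) \<le> nv x ^ N" if "n \<ge> N" for n
    using nv_integral_scale[OF assms(1), of x n] power_decreasing[OF that, of "nv x"] assms(2)
    by simp
  then show ?thesis
    using fps_total_approx[OF complete fps_scale_null[OF assms], of N "nv x ^ N"] by (simp add: fps_at_def)
qed

lemma fps_at_poly:
  assumes "f \<in> integral_series" "f $ 0 = 0" "nv x < 1"
  shows "fps_at (fps_of_poly P oo f) (x :: 'a) = poly P (fps_at f x)"
proof -
  have "fps_scale x (fps_of_poly P oo f) = fps_of_poly P oo fps_scale x f"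
    by (rule fps_ext) (simp add: fps_compose_nth sum_distrib_right mult.assoc flip: fps_scale_power)
  then show ?thesis
    unfolding fps_at_def using assms fps_total_poly(2)[OF complete fps_scale_null] by simp
qed

lemma fps_at_power: "f \<in> integral_series \<Longrightarrow> nv x < 1 \<Longrightarrow> fps_at (f ^ n) x = fps_at f (x :: 'a) ^ n"
  unfolding fps_at_def fps_scale_power by (intro fps_total_power complete fps_scale_null)

lemma fps_at_le:
  assumes "f \<in> integral_series" "f $ 0 = 0" "nv x < 1" shows "nv (fps_at f (x :: 'a)) \<le> nv x"
  using fps_at_approx[OF assms(1,3), of 1] assms(2) by (simp add: One_nat_def)

text \<open>The partial sums of \<open>f oo g\<close> at \<open>x\<close> and of \<open>f\<close> at
  \<open>fps_at g x\<close> differ only by tails of the series \<open>g ^ i\<close> at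
  \<open>x\<close>, which are bounded by \<open>nv x ^ N\<close> uniformly in
  \<open>i\<close>.\<close>

lemma fps_at_compose:
  assumes f: "f \<in> integral_series" and g: "g \<in> integral_series" "g $ 0 = 0" and x: "nv x < 1"
  shows "fps_at (f oo g) x = fps_at f (fps_at g (x :: 'a))"
proof -
  let ?y = "fps_at g x"
  have y: "nv ?y < 1" using fps_at_le[OF g x] x by simp
  let ?A = "\<lambda>N. \<Sum>n<N. (f oo g) $ n * x ^ n" and ?B = "\<lambda>N. \<Sum>i<N. f $ i * ?y ^ i"
  have "nv (?B N - ?A N) \<le> nv x ^ N" for N
  proof -
    have "(f oo g) $ n = (\<Sum>i<N. f $ i * (g ^ i) $ n)" if "n < N" for n
      unfolding fps_compose_nth using that startsby_zero_power_prefix[OF g(2)]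
      by (intro sum.mono_neutral_left) auto
    then have "?A N = (\<Sum>n<N. \<Sum>i<N. f $ i * (g ^ i) $ n * x ^ n)"
      by (simp add: sum_distrib_right)
    also have "\<dots> = (\<Sum>i<N. f $ i * (\<Sum>n<N. (g ^ i) $ n * x ^ n))"
      by (subst sum.swap) (simp add: sum_distrib_left mult.assoc)
    finally have "?B N - ?A N = (\<Sum>i<N. f $ i * (fps_at (g ^ i) x - (\<Sum>n<N. (g ^ i) $ n * x ^ n)))"
      using g x by (simp add: fps_at_power right_diff_distrib sum_subtractf)
    also have "nv \<dots> \<le> nv x ^ N"
    proof (rule nv_sum_le)
      fix i
      show "nv (f $ i * (fps_at (g ^ i) x - (\<Sum>n<N. (g ^ i) $ n * x ^ n))) \<le> nv x ^ N"
        using fps_at_approx[OF integral_series_power[OF g(1)] x, of i N] integral_seriesD[OF f, of i]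
          mult_mono[of "nv (f $ i)" 1 _ "nv x ^ N"] by (simp add: nv_mult)
    qed simp
    finally show ?thesis .
  qed
  then have "(\<lambda>N. nv (?B N - ?A N)) \<longlonglongrightarrow> 0"
    using x by (intro tendsto_sandwich[OF _ _ tendsto_const LIMSEQ_realpow_zero]) auto
  then have "(\<lambda>N. ?B N - ?A N) \<longlonglongrightarrow> 0" by (simp add: nv_tendsto_0_iff[of "\<lambda>N. ?B N - ?A N"])
  from nv_tendsto_add[OF this fps_at_tendsto[OF integral_series_compose[OF f g(1)] x]]
  have "?B \<longlonglongrightarrow> fps_at (f oo g) x" by simp
  then show ?thesis using fps_at_tendsto[OF f y] LIMSEQ_unique by blast
qed

end

section \<open>Lubin-Tate series and their endomorphisms\<close>

lemma fps_inverse_compose_const: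
  fixes l e :: "'b::idom fps"
  assumes "l oo e = fps_X" "e oo l = fps_X" "l $ 0 = 0" "e $ 0 = 0" "y $ 0 = 0"
  shows "l oo (e oo y) = y" "e oo (l oo y) = y"
  using assms by (simp_all add: fps_compose_assoc)

lemma nv_mult_le: "nv x \<le> 1 \<Longrightarrow> nv y \<le> r \<Longrightarrow> nv (x * y) \<le> r"
  using mult_mono[of "nv x" 1 "nv y" r] by (simp add: nv_mult)

text \<open>Isolates the two terms of a Lubin-Tate polynomial that can dominate its value; applied
  with \<open>r = nv \<pi>\<close>.\<close>

lemma poly_decompose_bound:
  fixes f :: "'a::nonarch_valued_field poly"
  assumes f0: "poly.coeff f 0 = 0" and q: "2 \<le> q" and r: "0 \<le> r"
    and le: "\<And>i. i \<noteq> q \<Longrightarrow> nv (poly.coeff f i) \<le> r" and x: "nv x \<le> 1"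
  shows "nv (poly f x - (poly.coeff f 1 * x + poly.coeff f q * x ^ q)) \<le> r * nv x ^ 2"
proof -
  define N where "N = max q (Polynomial.degree f)"
  let ?t = "\<lambda>i. poly.coeff f i * x ^ i"
  have "poly f x = (\<Sum>i\<le>N. ?t i)"
    unfolding poly_altdef by (intro sum.mono_neutral_left) (auto simp: N_def coeff_eq_0 not_le)
  also have "\<dots> = ?t 0 + (?t 1 + (?t q + sum ?t ({..N} - {0, 1, q})))"
  proof -
    have "{..N} = insert 0 (insert 1 (insert q ({..N} - {0, 1, q})))"
      using q by (auto simp: N_def)
    then have "sum ?t {..N} = sum ?t (insert 0 (insert 1 (insert q ({..N} - {0, 1, q}))))" by presburger
    also have "\<dots> = ?t 0 + (?t 1 + (?t q + sum ?t ({..N} - {0, 1, q})))"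
      using q by (subst sum.insert; auto)+
    finally show ?thesis .
  qed
  finally have e: "poly f x - (poly.coeff f 1 * x + poly.coeff f q * x ^ q) = sum ?t ({..N} - {0, 1, q})"
    using f0 by simp
  show ?thesis unfolding e
  proof (rule nv_sum_le)
    fix i assume i: "i \<in> {..N} - {0, 1, q}"
    have "nv (?t i) = nv (poly.coeff f i) * nv x ^ i" by (simp add: nv_mult nv_power)
    also have "\<dots> \<le> r * nv x ^ 2"
      using i r x le[of i] by (intro mult_mono power_decreasing) auto
    finally show "nv (?t i) \<le> r * nv x ^ 2" .
  qed (use r in auto)
qed

text \<open>The formal group is represented by its logarithm \<open>l\<close> and exponential
  \<open>e\<close> alone; its endomorphisms are recovered from these as \<open>br a\<close>.\<close>

locale lubin_tate = local_subfield K \<pi> q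
  for K :: "'a::nonarch_valued_field set" and \<pi> :: 'a and q :: nat +
  fixes P :: "'a poly" and l e :: "'a fps"
  assumes P_K: "poly.coeff P i \<in> K" and P_0: "poly.coeff P 0 = 0" and P_1: "poly.coeff P 1 = \<pi>"
    and deg_P: "Polynomial.degree P = q" and P_q: "poly.coeff P q = 1"
    and P_small: "i \<noteq> q \<Longrightarrow> nv (poly.coeff P i) < 1"
    and l_K: "l $ i \<in> K" and l_0: "l $ 0 = 0" and l_1: "l $ 1 = 1"
    and e_0: "e $ 0 = 0" and e_1: "e $ 1 = 1"
    and le: "l oo e = fps_X" and el: "e oo l = fps_X"
    and lP: "l oo fps_of_poly P = fps_const \<pi> * l"
begin

lemma pi_nv_small: "x \<in> K \<Longrightarrow> nv x < 1 \<Longrightarrow> x \<in> (\<lambda>a. \<pi> * a) ` OK"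
  by (simp add: mem_pi_O_iff)

lemma l_denominator: "\<exists>D. \<pi> ^ D * l $ i \<in> OK"
proof (cases "l $ i = 0")
  case False
  obtain D where "nv \<pi> ^ D < inverse (nv (l $ i))"
    using real_arch_pow_inv[of "inverse (nv (l $ i))" "nv \<pi>"] False pi_lt_1 by auto
  then have "nv (\<pi> ^ D * l $ i) \<le> 1"
    using False by (simp add: nv_mult nv_power field_simps)
  then show ?thesis using l_K pi_K by (auto simp: O_iff mems)
qed (auto simp: O_zero)

text \<open>The residue field has \<open>q\<close> elements, so the identity is a lift of Frobenius
  on \<open>OK\<close>.\<close>

sublocale base: frobenius_lift id OK \<pi> q "fps_of_poly P" l
proof unfold_locales
  show "id x - x ^ q \<in> (\<lambda>y. \<pi> * y) ` OK" if "x \<in> OK" for x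
    using frobenius[OF that] that O_diff O_power
    by (intro pi_nv_small) (auto simp: nv_minus_commute O_iff)
  show "of_nat (q choose j) \<in> (\<lambda>y. \<pi> * y) ` OK" if "0 < j" "j < q" for j
    using binom_small[OF that] by (intro pi_nv_small) (auto simp: mems)
  show "fps_of_poly P $ i \<in> OK" for i
    using P_K[of i] P_small[of i] P_q by (cases "i = q") (auto simp: O_iff)
  show "fps_of_poly P $ i \<in> (\<lambda>y. \<pi> * y) ` OK" if "i \<noteq> q" for i
    using P_K[of i] P_small[OF that] by (intro pi_nv_small) auto
  show "fps_of_poly P $ q - 1 \<in> (\<lambda>y. \<pi> * y) ` OK"
    using P_q zero_mem by (intro pi_nv_small) auto
qed (use O_one O_diff O_mult O_pi pi_nz q_ge_2 P_0 P_1 l_0 l_1 l_denominator lP in auto)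

text \<open>\<open>br a\<close> is the endomorphism \<open>[a]\<close> of \<open>F\<^sub>P\<close>.\<close>

definition br :: "'a \<Rightarrow> 'a fps" where "br a = e oo (fps_const a * l)"

lemma cl_0: "(fps_const a * l) $ 0 = 0" by (simp add: l_0)

lemma l_br: "l oo br a = fps_const a * l"
  unfolding br_def by (rule fps_inverse_compose_const(1)[OF le el l_0 e_0 cl_0])

lemma br_0: "br a $ 0 = 0" by (simp add: br_def fps_compose_nth e_0)

lemma fps_compose_nth_1:
  fixes f g :: "'b::comm_ring_1 fps"
  assumes "f $ 0 = 0" shows "(f oo g) $ 1 = f $ 1 * g $ 1"
  using fps_compose_nth_split[OF assms, of g 1] by simp

lemma br_1: "br a $ 1 = a"
  unfolding br_def fps_compose_nth_1[OF e_0] by (simp add: e_1 l_1)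

text \<open>\<open>l_functional\<close> at \<open>f = X\<close> is the functional equation of
  \<open>l\<close> itself. As the Frobenius lift is the identity here, the equation is linear over
  \<open>OK\<close> and passes to \<open>a l\<close>.\<close>

lemma br_OK: assumes "a \<in> OK" shows "br a $ n \<in> OK"
proof (rule base.functional_equation[OF l_br br_0])
  have X: "fps_X \<in> base.J 0" using O_zero O_one by (auto simp: base.J_def fps_X_def)
  have "l oo fps_X = l" by simp
  then have "fps_const \<pi> * l - base.Phi l \<in> base.J 1"
    using base.l_functional[OF X] by simp
  then have "fps_const a * (fps_const \<pi> * l - base.Phi l) \<in> base.J 1"
    using assms by (intro base.J_mult_0 base.J_const) auto
  moreover have "base.Phi (fps_const a * l) = fps_const a * base.Phi l"
    by (rule fps_ext) (simp add: base.Phi_nth)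
  ultimately show "fps_const \<pi> * (fps_const a * l) - base.Phi (fps_const a * l) \<in> base.J 1"
    by (simp add: algebra_simps)
qed

lemma br_integral: "a \<in> OK \<Longrightarrow> br a \<in> integral_series"
  using br_OK by (auto simp: integral_series_def O_iff)

lemma l_compose_inj:
  assumes "f $ 0 = 0" "g $ 0 = 0" "l oo f = l oo g" shows "f = g"
  using fps_inverse_compose_const(2)[OF le el l_0 e_0] assms by metis

lemma br_mult: "br a oo br b = br (a * b)"
proof (rule l_compose_inj)
  have "l oo (br a oo br b) = (l oo br a) oo br b"
    by (rule fps_compose_assoc) (auto simp: br_0)
  also have "\<dots> = fps_const a * (l oo br b)"
    unfolding l_br[of a] by (simp add: fps_compose_mult_distrib br_0 fps_const_compose)
  finally show "l oo (br a oo br b) = l oo br (a * b)"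
    by (simp add: l_br mult.assoc[symmetric])
qed (auto simp: br_0 fps_compose_nth)

lemma br_pi: "br \<pi> = fps_of_poly P"
  by (rule l_compose_inj) (simp_all add: br_0 P_0 l_br lP)

lemma br_one: "br 1 = fps_X"
  by (rule l_compose_inj) (simp_all add: br_0 l_br)

definition act :: "'a \<Rightarrow> 'a \<Rightarrow> 'a" where "act a x = fps_at (br a) x"

lemma act_approx:
  assumes "a \<in> OK" "nv x < 1" shows "nv (act a x - a * x) \<le> nv x ^ 2"
proof -
  have "{..<2::nat} = {0, 1}" by auto
  then have "(\<Sum>n<2. br a $ n * x ^ n) = a * x" by (simp add: br_0 br_1)
  then show ?thesis
    using fps_at_approx[OF complete_C br_integral[OF assms(1)] assms(2), of 2] by (simp add: act_def)
qed

lemma act_le: "a \<in> OK \<Longrightarrow> nv x < 1 \<Longrightarrow> nv (act a x) \<le> nv x"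
  using fps_at_le[OF complete_C br_integral br_0] by (simp add: act_def)

lemma act_lt_1: "a \<in> OK \<Longrightarrow> nv x < 1 \<Longrightarrow> nv (act a x) < 1"
  using act_le by (meson le_less_trans)

lemma act_act: "a \<in> OK \<Longrightarrow> b \<in> OK \<Longrightarrow> nv x < 1 \<Longrightarrow> act a (act b x) = act (a * b) x"
  unfolding act_def br_mult[symmetric]
  by (rule fps_at_compose[symmetric, OF complete_C]) (auto simp: br_integral br_0)

lemma fps_X_integral: "fps_X \<in> integral_series"
  by (simp add: integral_series_def fps_X_def)

lemma act_pi: "nv x < 1 \<Longrightarrow> act \<pi> x = poly P x"
proof -
  assume x: "nv x < 1"
  have X: "fps_at fps_X x = x"
  proof -
    have "fps_scale x fps_X = fps_of_poly [:0, x:]" by (rule fps_ext) (simp add: coeff_pCons split: nat.split)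
    also have "\<dots> = fps_const x * fps_X" by (rule fps_ext) (auto simp: coeff_pCons split: nat.split)
    finally have s: "fps_scale x fps_X = fps_const x * fps_X" .
    have "(\<lambda>N. \<Sum>n<N. fps_X $ n * x ^ n) \<longlonglongrightarrow> x"
    proof (rule Lim_transform_eventually[OF tendsto_const])
      show "\<forall>\<^sub>F N in sequentially. x = (\<Sum>n<N. fps_X $ n * x ^ n)"
      proof (rule eventually_mono[OF eventually_gt_at_top[of 1]])
        fix N :: nat assume "1 < N"
        moreover have "fps_X $ n * x ^ n = (if n = 1 then x else 0)" for n by (simp add: fps_X_def)
        ultimately show "x = (\<Sum>n<N. fps_X $ n * x ^ n)" by simp
      qed
    qed
    then show ?thesis
      using fps_at_tendsto[OF complete_C fps_X_integral x] LIMSEQ_unique by blast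
  qed
  have "act \<pi> x = fps_at (fps_of_poly P oo fps_X) x" by (simp add: act_def br_pi)
  also have "\<dots> = poly P (fps_at fps_X x)"
    by (rule fps_at_poly[OF complete_C fps_X_integral _ x]) simp
  finally show ?thesis using X by simp
qed

lemma act_0: "a \<in> OK \<Longrightarrow> act a 0 = 0"
  using act_le[of a 0] by simp

lemma act_P: "a \<in> OK \<Longrightarrow> nv x < 1 \<Longrightarrow> poly P (act a x) = act a (poly P x)"
  using act_act[of \<pi> a x] act_act[of a \<pi> x] O_pi act_pi act_lt_1 by (simp add: mult.commute)

text \<open>The linear term produces \<open>a * (x - y)\<close> exactly. For
  \<open>n \<ge> 2\<close> the quotient of \<open>x ^ n - y ^ n\<close> by \<open>x - y\<close> is
  at most \<open>max (nv x) (nv y)\<close>.\<close>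

lemma act_diff:
  assumes a: "a \<in> OK" and x: "nv x < 1" and y: "nv y < 1"
  shows "nv (act a x - act a y - a * (x - y)) \<le> max (nv x) (nv y) * nv (x - y)"
proof -
  let ?m = "max (nv x) (nv y)"
  have lim: "(\<lambda>N. (\<Sum>n<N. br a $ n * x ^ n) - (\<Sum>n<N. br a $ n * y ^ n) - a * (x - y))
      \<longlonglongrightarrow> act a x - act a y - a * (x - y)"
    unfolding act_def by (intro nv_tendsto_diff fps_at_tendsto complete_C br_integral a x y tendsto_const)
  show ?thesis
  proof (rule nv_tendsto_le[OF lim])
    fix N :: nat assume N: "2 \<le> N"
    then have s: "{..<N} = insert 0 (insert 1 {2..<N})" by auto
    have "(\<Sum>n<N. br a $ n * x ^ n) - (\<Sum>n<N. br a $ n * y ^ n) - a * (x - y)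
        = (\<Sum>n\<in>{2..<N}. br a $ n * (x ^ n - y ^ n))"
      unfolding s by (simp add: br_0 br_1 algebra_simps sum_subtractf)
    also have "nv \<dots> \<le> ?m * nv (x - y)"
    proof (rule nv_sum_le)
      fix n assume n: "n \<in> {2..<N}"
      have "nv (\<Sum>i<n. y ^ (n - Suc i) * x ^ i) \<le> ?m"
      proof (rule nv_sum_le)
        fix i assume i: "i \<in> {..<n}"
        have "nv (y ^ (n - Suc i) * x ^ i) \<le> ?m ^ (n - Suc i) * ?m ^ i"
          by (auto simp: nv_mult nv_power le_max_iff_disj intro!: mult_mono power_mono zero_le_power)
        also have "\<dots> = ?m ^ (n - 1)" using i by (simp add: One_nat_def flip: power_add)
        also have "\<dots> \<le> ?m ^ 1" using n x y by (intro power_decreasing) (auto simp: le_max_iff_disj)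
        finally show "nv (y ^ (n - Suc i) * x ^ i) \<le> ?m" by simp
      qed (simp add: le_max_iff_disj)
      then have "nv (x ^ n - y ^ n) \<le> nv (x - y) * ?m"
        unfolding power_diff_sumr2 nv_mult by (intro mult_left_mono) auto
      then show "nv (br a $ n * (x ^ n - y ^ n)) \<le> ?m * nv (x - y)"
        using integral_seriesD[OF br_integral[OF a], of n] by (simp add: nv_mult_le mult.commute)
    qed (simp add: le_max_iff_disj)
    finally show "nv ((\<Sum>n<N. br a $ n * x ^ n) - (\<Sum>n<N. br a $ n * y ^ n) - a * (x - y)) \<le> ?m * nv (x - y)" .
  qed
qed

text \<open>For a unit \<open>a\<close> the error in \<open>act_diff\<close> is strictly smaller
  than \<open>a * (x - y)\<close>. Injectivity and nonvanishing of the action of units come from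
  here.\<close>

lemma act_unit_dilation:
  assumes "a \<in> OK" "nv a = 1" "nv x < 1" "nv y < 1"
  shows "nv (act a x - act a y) = nv (x - y)"
proof (cases "x = y")
  case False
  have "nv (act a x - act a y - a * (x - y)) < nv (a * (x - y))"
    using act_diff[OF assms(1,3,4)] False assms
    by (intro le_less_trans[OF act_diff[OF assms(1,3,4)]]) (simp add: nv_mult)
  then show ?thesis using nv_eq_if_close assms(2) by (fastforce simp: nv_mult)
qed simp

end

section \<open>The value of the exponential series at \<open>1\<close>\<close>

text \<open>Regroups a series in \<open>X\<close> over polynomials in \<open>T\<close> by powers of
  \<open>T\<close>; convergence at \<open>X = 1\<close> is proved for each power of \<open>T\<close>
  separately.\<close>

definition fps_swap :: "'b::comm_ring_1 poly fps \<Rightarrow> 'b fps fps"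
  where "fps_swap f = Abs_fps (\<lambda>m. Abs_fps (\<lambda>n. poly.coeff (f $ n) m))"

lemma fps_swap_nth [simp]: "fps_swap f $ m $ n = poly.coeff (f $ n) m"
  by (simp add: fps_swap_def)

lemma fps_swap_mult: "fps_swap (f * g) = fps_swap f * fps_swap g"
proof (intro fps_ext)
  fix m n
  have "fps_swap (f * g) $ m $ n = (\<Sum>i=0..n. \<Sum>j=0..m. poly.coeff (f $ i) j * poly.coeff (g $ (n - i)) (m - j))"
    by (simp add: fps_mult_nth coeff_sum coeff_mult atLeast0AtMost)
  also have "\<dots> = (fps_swap f * fps_swap g) $ m $ n"
    by (subst sum.swap) (simp add: fps_mult_nth fps_sum_nth)
  finally show "fps_swap (f * g) $ m $ n = (fps_swap f * fps_swap g) $ m $ n" .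
qed

lemma fps_swap_power: "fps_swap (f ^ i) = fps_swap f ^ i"
proof (induction i)
  case 0
  show ?case by (intro fps_ext) (auto simp: coeff_1)
qed (simp add: fps_swap_mult)

text \<open>A Gauss norm of radius \<open>s\<close>, with hypotheses only up to degree
  \<open>n\<close>. Both the radius \<open>1\<close> and the radius \<open>nv \<omega>1\<close>
  occur.\<close>

lemma fps_power_nth_bound:
  fixes f :: "'a::nonarch_valued_field fps"
  assumes "0 \<le> s" "0 \<le> B" "1 \<le> i" "\<And>j. j \<le> n \<Longrightarrow> nv (f $ j) * s ^ j \<le> B"
  shows "nv ((f ^ i) $ n) * s ^ n \<le> B ^ i"
  using assms(3,4)
proof (induction i arbitrary: n rule: nat_induct_at_least)
  case (Suc i)
  have "nv ((f ^ Suc i) $ n * 1) * s ^ n \<le> B ^ Suc i" if "s = 0" "n \<noteq> 0"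
    using that assms by (simp add: power_0_left)
  moreover have "nv ((f ^ Suc i) $ n) * s ^ n \<le> B ^ Suc i" if s: "s \<noteq> 0 \<or> n = 0"
  proof -
    have sn: "0 < s ^ n" using s assms(1) by (cases "n = 0") auto
    have "nv ((f ^ Suc i) $ n) \<le> B ^ Suc i / s ^ n"
      unfolding power_Suc fps_mult_nth
    proof (rule nv_sum_le)
      fix j assume j: "j \<in> {0..n}"
      have "nv ((f ^ i) $ (n - j)) * s ^ (n - j) \<le> B ^ i" using Suc.IH[of "n - j"] Suc.prems j by simp
      moreover have "nv (f $ j) * s ^ j \<le> B" using Suc.prems j by simp
      ultimately have "(nv (f $ j) * s ^ j) * (nv ((f ^ i) $ (n - j)) * s ^ (n - j)) \<le> B * B ^ i"
        using assms by (intro mult_mono) auto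
      moreover have "s ^ j * s ^ (n - j) = s ^ n" using j by (simp flip: power_add)
      ultimately have "nv (f $ j * (f ^ i) $ (n - j)) * s ^ n \<le> B * B ^ i"
        by (simp add: nv_mult mult_ac) (metis (no_types, lifting) mult.assoc mult.commute)
      then show "nv (f $ j * (f ^ i) $ (n - j)) \<le> B * B ^ i / s ^ n"
        using sn by (simp add: le_divide_eq)
    qed (use assms sn in auto)
    then show ?thesis using sn by (simp add: le_divide_eq)
  qed
  ultimately show ?case by (cases "s = 0 \<and> n \<noteq> 0") auto
qed auto

lemma unital_ring_hom_const: "unital_ring_hom (\<lambda>c::'b::comm_ring_1. [:c:])"
  by unfold_locales (auto simp: one_pCons)

lemma unital_ring_hom_pcompose: "unital_ring_hom (\<lambda>h. pcompose h Q)"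
  by unfold_locales (auto simp: pcompose_add pcompose_mult pcompose_1)

lemma unital_ring_hom_poly: "unital_ring_hom (\<lambda>h. poly h x)"
  by unfold_locales auto

text \<open>
  The universal series: \<open>T\<close> is the variable of the polynomials and is specialized to \<open>\<omega>\<^sub>2\<close>. The
  polynomials \<open>w\<^sub>k\<close> are ghost components; from \<open>k = 2\<close> on they are iterates of \<open>Q\<close> with its linear
  coefficient changed to \<open>\<pi>\<close>, so that \<open>w\<^sub>k/\<pi>\<^sup>k\<close> converges coefficientwise. This is where
  \<open>\<pi> \<equiv> \<pi>'\<close> modulo the cube of the maximal ideal is used.
\<close>

locale lubin_tate_pair = lubin_tate K \<pi> q P l e
  for K :: "'a::nonarch_valued_field set" and \<pi> :: 'a and q :: nat and P :: "'a poly" and l e :: "'a fps" +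
  fixes \<pi>' :: 'a and Q :: "'a poly" and \<omega>1 \<omega>2 :: 'a
  assumes Q_K: "poly.coeff Q i \<in> K" and Q_0: "poly.coeff Q 0 = 0" and Q_1: "poly.coeff Q 1 = \<pi>'"
    and Q_q: "nv (poly.coeff Q q - 1) < 1" and Q_small: "i \<noteq> q \<Longrightarrow> nv (poly.coeff Q i) < 1"
    and pi'_close: "nv (\<pi> - \<pi>') \<le> nv \<pi> ^ 3"
    and om_lt: "nv \<omega>1 < 1" "nv \<omega>2 < 1" and om1_nz: "\<omega>1 \<noteq> 0"
    and om1: "poly Q \<omega>1 = 0" and om2: "poly Q \<omega>2 = \<omega>1"
begin

text \<open>The ideal generated by \<open>\<pi> ^ n\<close> in the polynomial ring over
  \<open>OK\<close>.\<close>

definition PI :: "nat \<Rightarrow> 'a poly set"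
  where "PI n = {h. \<forall>i. poly.coeff h i \<in> K \<and> nv (poly.coeff h i) \<le> nv \<pi> ^ n}"

lemma PI_0: "0 \<in> PI n" by (simp add: PI_def mems)
lemma PI_add: "f \<in> PI n \<Longrightarrow> g \<in> PI n \<Longrightarrow> f + g \<in> PI n" by (simp add: PI_def mems nv_add_le)
lemma PI_diff: "f \<in> PI n \<Longrightarrow> g \<in> PI n \<Longrightarrow> f - g \<in> PI n" by (simp add: PI_def mems nv_diff_le)
lemma PI_sum: "(\<And>i. i \<in> A \<Longrightarrow> f i \<in> PI n) \<Longrightarrow> sum f A \<in> PI n"
  by (induction A rule: infinite_finite_induct) (auto simp: PI_0 PI_add)
lemma PI_mult:
  assumes "f \<in> PI m" "g \<in> PI n" shows "f * g \<in> PI (m + n)"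
  unfolding PI_def
proof (intro CollectI allI conjI)
  fix i
  show "poly.coeff (f * g) i \<in> K"
    unfolding coeff_mult using assms by (intro sum_mem mult_mem) (auto simp: PI_def)
  show "nv (poly.coeff (f * g) i) \<le> nv \<pi> ^ (m + n)"
    unfolding coeff_mult using assms
    by (intro nv_sum_le) (auto simp: PI_def nv_mult power_add intro!: mult_mono)
qed
lemma PI_mult_0: "f \<in> PI 0 \<Longrightarrow> g \<in> PI n \<Longrightarrow> f * g \<in> PI n" using PI_mult[of f 0 g n] by simp
lemma PI_one: "1 \<in> PI 0" by (auto simp: PI_def coeff_1 mems)
lemma PI_power: "f \<in> PI 0 \<Longrightarrow> f ^ n \<in> PI 0"
  by (induction n) (auto simp: PI_one PI_mult_0)
lemma PI_mono:
  assumes "f \<in> PI n" "m \<le> n" shows "f \<in> PI m"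
  using assms(1) power_decreasing[OF assms(2), of "nv \<pi>"] pi_lt_1 unfolding PI_def
  by (auto intro: order_trans)
lemma PI_const: "c \<in> K \<Longrightarrow> nv c \<le> nv \<pi> ^ n \<Longrightarrow> [:c:] \<in> PI n"
  by (auto simp: PI_def coeff_pCons mems split: nat.split)

lemma PI_image: "(\<lambda>h. [:\<pi>:] ^ n * h) ` PI 0 = PI n"
proof (intro equalityI subsetI)
  fix f assume "f \<in> (\<lambda>h. [:\<pi>:] ^ n * h) ` PI 0"
  then obtain h where h: "f = [:\<pi>:] ^ n * h" "h \<in> PI 0" by (rule imageE)
  have "[:\<pi>:] ^ n \<in> PI n"
    using pi_K by (simp add: poly_const_pow PI_const mems nv_power)
  then show "f \<in> PI n" using PI_mult[of "[:\<pi>:] ^ n" n h 0] h by simp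
next
  fix f assume f: "f \<in> PI n"
  have "nv (inverse (\<pi> ^ n) * c) \<le> 1" if "nv c \<le> nv \<pi> ^ n" for c
    unfolding nv_mult nv_inverse nv_power using that pi_nz by (simp add: field_simps)
  then have "Polynomial.smult (inverse (\<pi> ^ n)) f \<in> PI 0"
    using f pi_K by (simp add: PI_def mems)
  moreover have "f = [:\<pi>:] ^ n * Polynomial.smult (inverse (\<pi> ^ n)) f"
    using pi_nz by (simp add: poly_const_pow)
  ultimately show "f \<in> (\<lambda>h. [:\<pi>:] ^ n * h) ` PI 0" by blast
qed

lemma PI_1_image: "(\<lambda>h. [:\<pi>:] * h) ` PI 0 = PI 1"
  using PI_image[of 1] by simp

lemma PI_1I: "(\<And>i. poly.coeff f i \<in> K) \<Longrightarrow> (\<And>i. nv (poly.coeff f i) < 1) \<Longrightarrow> f \<in> PI 1"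
  using discrete by (simp add: PI_def)

lemma q_PI: "of_nat q \<in> PI 1"
  using q_small discrete[of "of_nat q"] by (auto simp: of_nat_poly mems intro!: PI_const)

lemma PI_power_diff: "f \<in> PI 0 \<Longrightarrow> g \<in> PI 0 \<Longrightarrow> f - g \<in> PI r \<Longrightarrow> f ^ i - g ^ i \<in> PI r"
  unfolding power_diff_sumr2
  using PI_mult[of "f - g" r _ 0] by (simp add: PI_mult_0 PI_power PI_sum)

lemma PI_power_q_diff:
  assumes f: "f \<in> PI 0" and g: "g \<in> PI 0" and fg: "f - g \<in> PI r" and r: "1 \<le> r"
  shows "f ^ q - g ^ q \<in> PI (r + 1)"
proof -
  define S where "S = (\<Sum>i<q. g ^ (q - Suc i) * f ^ i)"
  have "(\<Sum>i<q. g ^ (q - Suc i) * (f ^ i - g ^ i)) \<in> PI 1"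
    using PI_mono[OF PI_power_diff[OF f g fg] r] g by (intro PI_sum PI_mult_0 PI_power)
  moreover have "(\<Sum>i<q. g ^ (q - Suc i) * g ^ i) = (\<Sum>i<q. g ^ (q - 1))"
    by (intro sum.cong) (auto simp: One_nat_def simp flip: power_add)
  ultimately have "S - of_nat q * g ^ (q - 1) \<in> PI 1"
    by (simp add: S_def right_diff_distrib sum_subtractf)
  moreover have "of_nat q * g ^ (q - 1) \<in> PI 1"
    using PI_mult[OF q_PI PI_power[OF g]] by simp
  ultimately have "S \<in> PI 1" using PI_add by fastforce
  from PI_mult[OF fg this] show ?thesis by (simp add: power_diff_sumr2 S_def)
qed

lemma PI_frob_add:
  assumes f: "f \<in> PI 0" and g: "g \<in> PI 0" shows "(f + g) ^ q - (f ^ q + g ^ q) \<in> PI 1"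
proof -
  have "{..q} = insert 0 (insert q {1..<q})" using q_ge_2 by auto
  then have "(f + g) ^ q - (f ^ q + g ^ q) = (\<Sum>k\<in>{1..<q}. of_nat (q choose k) * f ^ k * g ^ (q - k))"
    using q_ge_2 by (simp add: binomial_ring)
  also have "\<dots> \<in> PI 1"
  proof (rule PI_sum)
    fix k assume "k \<in> {1..<q}"
    then have "of_nat (q choose k) \<in> PI 1"
      using binom_small[of k] discrete[of "of_nat (q choose k)"]
      by (auto simp: of_nat_poly mems intro!: PI_const)
    moreover have "f ^ k * g ^ (q - k) \<in> PI 0" using f g by (intro PI_mult_0 PI_power)
    ultimately show "of_nat (q choose k) * f ^ k * g ^ (q - k) \<in> PI 1"
      using PI_mult[of "of_nat (q choose k)" 1 "f ^ k * g ^ (q - k)" 0] by (simp add: mult.assoc)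
  qed
  finally show ?thesis .
qed

lemma Q_PI: "Q \<in> PI 0"
proof -
  have "nv (poly.coeff Q i) \<le> 1" for i
    using Q_small[of i] nv_add_le[of "poly.coeff Q q - 1" 1 1] Q_q by (cases "i = q") auto
  then show ?thesis using Q_K by (simp add: PI_def)
qed

lemma T_PI: "[:0, 1:] \<in> PI 0"
  by (auto simp: PI_def coeff_pCons mems split: nat.split)

lemma Q_cong: "Q - [:0, 1:] ^ q \<in> PI 1"
proof (rule PI_1I)
  have T: "poly.coeff ([:0, 1:] ^ q :: 'a poly) i = of_bool (i = q)" for i
    by (simp add: monom_altdef[of "1::'a" q, simplified, symmetric])
  show "poly.coeff (Q - [:0, 1:] ^ q) i \<in> K" for i using Q_K by (simp add: T mems)
  show "nv (poly.coeff (Q - [:0, 1:] ^ q) i) < 1" for i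
    using Q_q Q_small[of i] by (cases "i = q") (auto simp: T)
qed

lemma PI_pcompose:
  assumes "h \<in> PI n" "g \<in> PI 0" shows "pcompose h g \<in> PI n"
  unfolding pcompose_altdef poly_altdef
proof (rule PI_sum)
  fix i
  have "[:poly.coeff h i:] \<in> PI n" using assms(1) by (intro PI_const) (auto simp: PI_def)
  then show "poly.coeff (map_poly (\<lambda>x. [:x:]) h) i * g ^ i \<in> PI n"
    using PI_mult[of "[:poly.coeff h i:]" n "g ^ i" 0] PI_power[OF assms(2)]
    by (simp add: coeff_map_poly)
qed

text \<open>Horner's scheme: modulo \<open>\<pi>\<close> a constant equals its \<open>q\<close>-th
  power, \<open>Q\<close> equals \<open>T ^ q\<close>, and the \<open>q\<close>-th power is
  additive.\<close>

lemma pcompose_Q_frob: "h \<in> PI 0 \<Longrightarrow> pcompose h Q - h ^ q \<in> PI 1"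
proof (induction h)
  case 0
  then show ?case using q_ge_2 PI_0 by (simp add: power_0_left)
next
  case (pCons c h)
  have c: "c \<in> OK" using pCons.prems unfolding PI_def O_iff by (auto dest: spec[of _ 0])
  have h: "h \<in> PI 0" using pCons.prems unfolding PI_def by (auto simp: coeff_pCons dest: spec[of _ "Suc _"])
  have cP: "[:c:] \<in> PI 0" using c by (auto simp: O_iff intro!: PI_const)
  have Th: "[:0, 1:] * h \<in> PI 0" by (intro PI_mult_0 T_PI h)
  have e: "pCons c h = [:c:] + [:0, 1:] * h" by simp
  have "nv (c - c ^ q) < 1" using frobenius[OF c] by (simp add: nv_minus_commute)
  then have 1: "[:c:] - [:c:] ^ q \<in> PI 1"
    using c discrete[of "c - c ^ q"] by (auto simp: poly_const_pow O_iff mems intro!: PI_const)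
  have 2: "Q * pcompose h Q - [:0, 1:] ^ q * h ^ q \<in> PI 1"
  proof -
    have "(Q - [:0, 1:] ^ q) * pcompose h Q \<in> PI 1"
      using PI_mult[OF Q_cong PI_pcompose[OF h Q_PI]] by simp
    moreover have "[:0, 1:] ^ q * (pcompose h Q - h ^ q) \<in> PI 1"
      by (intro PI_mult_0 PI_power T_PI pCons.IH h)
    ultimately have "(Q - [:0, 1:] ^ q) * pcompose h Q + [:0, 1:] ^ q * (pcompose h Q - h ^ q) \<in> PI 1"
      by (rule PI_add)
    then show ?thesis by (simp add: algebra_simps)
  qed
  have 3: "([:c:] + [:0, 1:] * h) ^ q - ([:c:] ^ q + ([:0, 1:] * h) ^ q) \<in> PI 1"
    by (rule PI_frob_add[OF cP Th])
  have "pcompose (pCons c h) Q - (pCons c h) ^ q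
      = (([:c:] - [:c:] ^ q) + (Q * pcompose h Q - [:0, 1:] ^ q * h ^ q))
        - (([:c:] + [:0, 1:] * h) ^ q - ([:c:] ^ q + ([:0, 1:] * h) ^ q))"
    unfolding e pcompose_add pcompose_mult by (simp add: power_mult_distrib[symmetric] pcompose_pCons del: mult_pCons_left)
  also have "\<dots> \<in> PI 1" by (intro PI_diff[OF PI_add[OF 1 2] 3])
  finally show ?case .
qed

definition lT :: "'a poly fps" where "lT = fps_map (\<lambda>c. [:c:]) l"
definition eT :: "'a poly fps" where "eT = fps_map (\<lambda>c. [:c:]) e"

lemma T_nth: "lT $ n = [:l $ n:]" "eT $ n = [:e $ n:]" by (simp_all add: lT_def eT_def)

lemma lT_eT: "lT oo eT = fps_X" "eT oo lT = fps_X"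
proof -
  interpret c: unital_ring_hom "\<lambda>c::'a. [:c:]" by (rule unital_ring_hom_const)
  have X: "fps_map (\<lambda>c::'a. [:c:]) fps_X = fps_X"
    by (rule fps_ext) (auto simp: fps_X_def one_pCons)
  show "lT oo eT = fps_X" "eT oo lT = fps_X"
    unfolding lT_def eT_def c.fps_map_compose[symmetric] le el X by simp_all
qed

sublocale univ: frobenius_lift "\<lambda>h. pcompose h Q" "PI 0" "[:\<pi>:]" q
  "fps_map (\<lambda>c. [:c:]) (fps_of_poly P)" lT
proof (intro frobenius_lift.intro frobenius_lift_axioms.intro unital_ring_hom_pcompose)
  interpret c: unital_ring_hom "\<lambda>c::'a. [:c:]" by (rule unital_ring_hom_const)
  show "pcompose x Q - x ^ q \<in> (\<lambda>y. [:\<pi>:] * y) ` PI 0" if "x \<in> PI 0" for x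
    unfolding PI_1_image by (rule pcompose_Q_frob[OF that])
  show "of_nat (q choose j) \<in> (\<lambda>y. [:\<pi>:] * y) ` PI 0" if "0 < j" "j < q" for j
    unfolding PI_1_image
    using binom_small[OF that] discrete[of "of_nat (q choose j)"]
    by (auto simp: of_nat_poly mems intro!: PI_const)
  show "fps_map (\<lambda>c. [:c:]) (fps_of_poly P) $ i \<in> PI 0" for i
    using P_K[of i] P_small[of i] P_q by (cases "i = q") (auto simp: mems intro!: PI_const)
  show "fps_map (\<lambda>c. [:c:]) (fps_of_poly P) $ i \<in> (\<lambda>y. [:\<pi>:] * y) ` PI 0" if "i \<noteq> q" for i
    unfolding PI_1_image using P_K[of i] P_small[OF that] discrete by (auto intro!: PI_const)
  show "fps_map (\<lambda>c. [:c:]) (fps_of_poly P) $ q - 1 \<in> (\<lambda>y. [:\<pi>:] * y) ` PI 0"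
    unfolding PI_1_image using P_q PI_0 by (simp flip: one_pCons)
  show "\<exists>D. [:\<pi>:] ^ D * lT $ i \<in> PI 0" for i
  proof -
    obtain D where "\<pi> ^ D * l $ i \<in> OK" using l_denominator by blast
    then have "[:\<pi> ^ D * l $ i:] \<in> PI 0" by (intro PI_const) (auto simp: O_iff)
    then show ?thesis by (intro exI[of _ D]) (simp add: T_nth poly_const_pow mult.commute)
  qed
  show "lT oo fps_map (\<lambda>c. [:c:]) (fps_of_poly P) = fps_const [:\<pi>:] * lT"
    unfolding lT_def c.fps_map_compose[symmetric] lP c.fps_map_mult c.fps_map_const by simp
  show "[:\<pi>:] \<in> PI 0" using O_pi by (auto simp: O_iff intro!: PI_const)
qed (use pi_nz q_ge_2 P_0 P_1 l_0 l_1 PI_one PI_diff PI_mult_0 PI_pcompose[OF _ Q_PI] in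
    \<open>auto simp: T_nth one_pCons\<close>)

lemma univ_I: "univ.I n = PI n"
  unfolding univ.I_def by (rule PI_image)

end

section \<open>Ghost components and the universal series\<close>

lemma smult_sum_right: "Polynomial.smult c (sum f A) = (\<Sum>i\<in>A. Polynomial.smult c (f i))"
  by (induction A rule: infinite_finite_induct) (auto simp: smult_add_right)

lemma T_pcompose: "pcompose [:0, 1:] h = (h :: 'b::comm_ring_1 poly)"
  by (simp add: pcompose_pCons)

context lubin_tate_pair
begin

definition Qt :: "'a poly" where "Qt = Q + [:0, \<pi> - \<pi>':]"

lemma pi'_K: "\<pi>' \<in> K" using Q_K[of 1] Q_1 by simp

lemma nv_pi': "nv \<pi>' = nv \<pi>"
proof (rule nv_eq_if_close)
  have "nv \<pi> ^ 3 < nv \<pi> ^ 1" using pi_lt_1 pi_nz by (intro power_strict_decreasing) auto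
  then show "nv (\<pi>' - \<pi>) < nv \<pi>" using pi'_close by (simp add: nv_minus_commute)
qed

lemma Qt_coeff: "poly.coeff Qt i = (if i = 1 then \<pi> else poly.coeff Q i)"
  by (cases i) (auto simp: Qt_def coeff_pCons Q_1[unfolded One_nat_def] One_nat_def split: nat.split)

lemma Qt_PI: "Qt \<in> PI 0"
proof -
  have "nv (poly.coeff Qt i) \<le> 1" for i
    using Q_PI pi_lt_1 by (simp add: Qt_coeff PI_def)
  then show ?thesis using Q_K pi_K by (simp add: PI_def Qt_coeff)
qed

lemma pcompose_Qt_cong:
  assumes f: "f \<in> PI 0" and g: "g \<in> PI 0" and fg: "f - g \<in> PI r" and r: "1 \<le> r"
  shows "pcompose Qt f - pcompose Qt g \<in> PI (r + 1)"
proof -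
  have "pcompose Qt f - pcompose Qt g
      = (\<Sum>i\<le>Polynomial.degree Qt. [:poly.coeff Qt i:] * (f ^ i - g ^ i))"
  proof -
    have *: "pcompose Qt h = (\<Sum>i\<le>Polynomial.degree Qt. [:poly.coeff Qt i:] * h ^ i)" for h
      unfolding pcompose_altdef poly_altdef
      by (simp add: degree_map_poly coeff_map_poly)
    show ?thesis unfolding * by (simp add: right_diff_distrib sum_subtractf)
  qed
  also have "\<dots> \<in> PI (r + 1)"
  proof (rule PI_sum)
    fix i
    show "[:poly.coeff Qt i:] * (f ^ i - g ^ i) \<in> PI (r + 1)"
    proof (cases "i = q")
      case True
      have "[:poly.coeff Qt q:] \<in> PI 0" using Qt_PI by (intro PI_const) (auto simp: PI_def)
      then show ?thesis unfolding True by (rule PI_mult_0) (rule PI_power_q_diff[OF f g fg r])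
    next
      case False
      have "poly.coeff Qt i \<in> K" "nv (poly.coeff Qt i) < 1"
        using Q_small[OF False] pi_lt_1 Q_K pi_K by (auto simp: Qt_coeff)
      then have "[:poly.coeff Qt i:] \<in> PI 1" using discrete by (intro PI_const) auto
      from PI_mult[OF this PI_power_diff[OF f g fg, of i]] show ?thesis by (simp add: add.commute)
    qed
  qed
  finally show ?thesis .
qed

text \<open>The first two steps use \<open>Q\<close> itself, so that \<open>\<omega>2\<close> goes
  to \<open>\<omega>1\<close> and then to \<open>0\<close>. Since \<open>Qt\<close> fixes
  \<open>0\<close>, all later values at \<open>\<omega>2\<close> vanish, which leaves the two
  summands of \<open>E2_series\<close>.\<close>

fun w :: "nat \<Rightarrow> 'a poly"
  where "w 0 = [:0, 1:]"
  | "w (Suc k) = pcompose (if k < 2 then Q else Qt) (w k)"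

lemma w_PI: "w k \<in> PI 0"
  by (induction k) (use T_PI Q_PI Qt_PI in \<open>auto intro!: PI_pcompose\<close>)

text \<open>Dwork's congruences. The only new error arises between \<open>w 2\<close> and
  \<open>w 3\<close>, where \<open>Q\<close> is replaced by \<open>Qt\<close>: it is
  \<open>(\<pi> - \<pi>') w 2\<close>, divisible by exactly the required \<open>\<pi> ^ 3\<close>.
  Each later step gains one power by \<open>pcompose_Qt_cong\<close>.\<close>

lemma w_frob: "w (Suc k) - pcompose (w k) Q \<in> PI (Suc k)"
proof (induction k)
  case 0
  then show ?case using PI_0 by (simp add: T_pcompose)
next
  case (Suc k)
  consider "k = 0" | "k = 1" | "k \<ge> 2" by linarith
  then show ?case
  proof cases
    case 1
    then show ?thesis using PI_0 by simp
  next
    case 2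
    have "w 3 - pcompose (w 2) Q = [:\<pi> - \<pi>':] * w 2"
    proof -
      have w2: "w 2 = pcompose Q Q" by (simp add: numeral_2_eq_2)
      have "w 3 = pcompose Qt (w 2)" by (simp add: numeral_3_eq_3 numeral_2_eq_2)
      also have "\<dots> = pcompose Q (w 2) + [:\<pi> - \<pi>':] * w 2"
        by (simp add: Qt_def pcompose_add pcompose_pCons)
      finally show ?thesis by (simp add: w2 pcompose_assoc[symmetric])
    qed
    also have "\<dots> \<in> PI (3 + 0)"
      using pi'_close pi_K pi'_K w_PI by (intro PI_mult PI_const) (auto simp: mems)
    finally show ?thesis using 2 by (simp add: numeral_3_eq_3 numeral_2_eq_2)
  next
    case 3
    have "w (Suc (Suc k)) - pcompose (w (Suc k)) Q
        = pcompose Qt (w (Suc k)) - pcompose Qt (pcompose (w k) Q)"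
      using 3 by (simp add: pcompose_assoc)
    also have "\<dots> \<in> PI (Suc k + 1)"
      by (rule pcompose_Qt_cong[OF w_PI PI_pcompose[OF w_PI Q_PI] Suc]) simp
    finally show ?thesis by (simp only: Suc_eq_plus1)
  qed
qed

definition z :: "nat \<Rightarrow> 'a poly" where "z k = Polynomial.smult (inverse (\<pi> ^ k)) (w k)"

text \<open>This is the sum of all \<open>z k * (X ^ (q ^ k) - X ^ (q ^ Suc k))\<close>, collected
  by powers of \<open>X\<close>. At \<open>T = \<omega>2\<close> only \<open>k = 0\<close> and
  \<open>k = 1\<close> remain and form the argument of \<open>e\<close> in \<open>E2_series\<close>.
  The differences of consecutive \<open>z k\<close> make the coefficients tend to
  \<open>0\<close>.\<close>

definition Y :: "'a poly fps"
  where "Y = Abs_fps (\<lambda>n. \<Sum>k\<le>n. if n = q ^ k then z k - (if k = 0 then 0 else z (k - 1)) else 0)"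

lemma q_pow_eq: "q ^ j = q ^ k \<longleftrightarrow> j = k" using q_ge_2 by simp

lemma le_q_pow: "k \<le> q ^ k"
  using q_ge_2 power_mono[of 2 q k] less_exp[of k] by (meson le_trans less_imp_le zero_le)

lemma Y_pow: "Y $ (q ^ k) = z k - (if k = 0 then 0 else z (k - 1))"
proof -
  have "Y $ (q ^ k) = (\<Sum>j\<le>q ^ k. if j = k then z k - (if k = 0 then 0 else z (k - 1)) else 0)"
    unfolding Y_def by (auto simp: q_pow_eq intro!: sum.cong)
  then show ?thesis using le_q_pow[of k] by simp
qed

lemma Y_other: "(\<And>k. n \<noteq> q ^ k) \<Longrightarrow> Y $ n = 0"
  by (simp add: Y_def)

lemma Y_0: "Y $ 0 = 0" using q_ge_2 by (intro Y_other) auto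

lemma Y_1: "Y $ 1 = [:0, 1:]" using Y_pow[of 0] by (simp add: z_def)

lemma z_frob: "[:\<pi>:] * z (Suc k) - pcompose (z k) Q \<in> PI 1"
proof -
  have "[:\<pi>:] * z (Suc k) - pcompose (z k) Q
      = Polynomial.smult (inverse (\<pi> ^ k)) (w (Suc k) - pcompose (w k) Q)"
  proof -
    have "inverse (\<pi> ^ Suc k) * \<pi> = inverse (\<pi> ^ k)" using pi_nz by simp
    then have "[:\<pi>:] * z (Suc k) = Polynomial.smult (inverse (\<pi> ^ k)) (w (Suc k))"
      unfolding z_def by (simp del: w.simps power_Suc)
    then show ?thesis by (simp add: z_def pcompose_smult smult_diff_right del: w.simps)
  qed
  also have "\<dots> \<in> PI 1"
  proof -
    have "nv (inverse (\<pi> ^ k) * c) \<le> nv \<pi> ^ 1" if "nv c \<le> nv \<pi> ^ Suc k" for c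
      unfolding nv_mult nv_inverse nv_power using that pi_nz by (simp add: field_simps)
    then show ?thesis using w_frob[of k] pi_K unfolding PI_def by (auto simp: mems)
  qed
  finally show ?thesis .
qed

text \<open>In degree \<open>q ^ k\<close> with \<open>k \<ge> 2\<close> the coefficient is a
  difference of two consecutive expressions from \<open>z_frob\<close>; in degree \<open>q\<close>
  the second of them is replaced by \<open>\<pi> z 0\<close>, and in degree \<open>1\<close> only
  \<open>\<pi> T\<close> occurs.\<close>

lemma Y_functional: "fps_const [:\<pi>:] * Y - univ.Phi Y \<in> univ.J 1"
  unfolding univ.J_def
proof (intro CollectI allI, unfold univ_I)
  fix n
  have sm: "[:\<pi>:] * h \<in> PI 1" if "h \<in> PI 0" for h using that PI_1_image by blast
  show "(fps_const [:\<pi>:] * Y - univ.Phi Y) $ n \<in> PI 1"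
  proof (cases "\<exists>k. n = q ^ k")
    case True
    then obtain k where k: "n = q ^ k" by blast
    show ?thesis
    proof (cases k)
      case 0
      then have "univ.Phi Y $ n = 0" using k q_ge_2 by (simp add: univ.Phi_nth)
      then show ?thesis using k 0 Y_1 sm[OF T_PI] by (simp del: mult_pCons_left)
    next
      case (Suc j)
      have "n div q = q ^ j" "q dvd n" using k Suc q_ge_2 by auto
      then have "univ.Phi Y $ n = pcompose (Y $ (q ^ j)) Q" by (simp add: univ.Phi_nth)
      then have e: "(fps_const [:\<pi>:] * Y - univ.Phi Y) $ n = [:\<pi>:] * Y $ (q ^ Suc j) - pcompose (Y $ (q ^ j)) Q"
        using k Suc by simp
      show ?thesis
      proof (cases j)
        case 0
        have "[:\<pi>:] * Y $ (q ^ Suc j) - pcompose (Y $ (q ^ j)) Q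
            = ([:\<pi>:] * z (Suc 0) - pcompose (z 0) Q) - [:\<pi>:] * z 0"
          unfolding Y_pow 0 by (simp add: algebra_simps smult_diff_right)
        also have "\<dots> \<in> PI 1" by (rule PI_diff[OF z_frob sm]) (simp add: z_def T_PI)
        finally show ?thesis unfolding e .
      next
        case (Suc i)
        have "[:\<pi>:] * Y $ (q ^ Suc j) - pcompose (Y $ (q ^ j)) Q
            = ([:\<pi>:] * z (Suc j) - pcompose (z j) Q) - ([:\<pi>:] * z (Suc i) - pcompose (z i) Q)"
          unfolding Y_pow Suc by (simp add: pcompose_diff algebra_simps smult_diff_right)
        also have "\<dots> \<in> PI 1" by (rule PI_diff[OF z_frob z_frob])
        finally show ?thesis unfolding e .
      qed
    qed
  next
    case False
    have "Y $ (n div q) = 0" if "q dvd n"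
    proof (rule Y_other)
      fix k
      show "n div q \<noteq> q ^ k"
      proof
        assume "n div q = q ^ k"
        then have "n = q ^ Suc k" using that by (metis dvd_mult_div_cancel power_Suc)
        then show False using False by blast
      qed
    qed
    moreover have "Y $ n = 0" using False by (intro Y_other) blast
    ultimately show ?thesis using PI_0 by (simp add: univ.Phi_nth)
  qed
qed

definition U :: "'a poly fps" where "U = eT oo Y"

lemma U_0: "U $ 0 = 0" by (simp add: U_def fps_compose_nth T_nth e_0)

lemma U_PI: "U $ n \<in> PI 0"
proof (rule univ.functional_equation[OF _ U_0 Y_functional])
  show "lT oo U = Y"
    unfolding U_def by (rule fps_inverse_compose_const(1)[OF lT_eT]) (auto simp: T_nth l_0 e_0 Y_0)
qed

definition E :: "'a fps" where "E = E2_series q \<pi> e (\<lambda>i. if i = 1 then \<omega>1 else \<omega>2)"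

definition g :: "'a fps"
  where "g = fps_const \<omega>2 * (fps_X - fps_X ^ q) + fps_const (\<omega>1 / \<pi>) * (fps_X ^ q - fps_X ^ (q ^ 2))"

lemma E_eq: "E = e oo g" by (simp add: E_def E2_series_def g_def)

lemma g_0: "g $ 0 = 0" using q_ge_2 by (simp add: g_def fps_X_power_nth)

lemma w_om: "poly (w k) \<omega>2 = (if k = 0 then \<omega>2 else if k = 1 then \<omega>1 else 0)"
proof (induction k)
  case (Suc k)
  have "poly Qt 0 = 0" "poly Q 0 = 0" using Q_0 by (simp_all add: poly_0_coeff_0 Qt_coeff)
  then show ?case
    using Suc om1 om2 by (cases "k = 0"; cases "k = 1") (simp_all add: poly_pcompose One_nat_def)
qed simp

lemma z_om: "poly (z k) \<omega>2 = (if k = 0 then \<omega>2 else if k = 1 then \<omega>1 / \<pi> else 0)"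
  by (simp add: z_def w_om divide_inverse mult.commute)

lemma Y_om: "fps_map (\<lambda>h. poly h \<omega>2) Y = g"
proof (rule fps_ext)
  fix n
  have gn: "g $ n = \<omega>2 * (of_bool (n = q ^ 0) - of_bool (n = q ^ 1))
      + \<omega>1 / \<pi> * (of_bool (n = q ^ 1) - of_bool (n = q ^ 2))" for n
    by (simp add: g_def fps_X_power_nth)
  show "fps_map (\<lambda>h. poly h \<omega>2) Y $ n = g $ n"
  proof (cases "\<exists>k. n = q ^ k")
    case True
    then obtain k where k: "n = q ^ k" by blast
    have "poly (Y $ (q ^ k)) \<omega>2 = poly (z k) \<omega>2 - (if k = 0 then 0 else poly (z (k - 1)) \<omega>2)"
      unfolding Y_pow by simp
    then show ?thesis
      unfolding k gn q_pow_eq fps_map_nth z_om by auto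
  next
    case False
    then have n: "n \<noteq> q ^ k" for k by blast
    show ?thesis unfolding gn fps_map_nth Y_other[OF n] using n[of 0] n[of 1] n[of 2] by simp
  qed
qed

lemma E_nth: "E $ n = poly (U $ n) \<omega>2"
proof -
  interpret p: unital_ring_hom "\<lambda>h. poly h \<omega>2" by (rule unital_ring_hom_poly)
  have "fps_map (\<lambda>h. poly h \<omega>2) eT = e" by (rule fps_ext) (simp add: T_nth)
  then have "fps_map (\<lambda>h. poly h \<omega>2) U = E"
    unfolding U_def p.fps_map_compose E_eq Y_om by simp
  then show ?thesis by (metis fps_map_nth)
qed

lemma z_coeff_0: "poly.coeff (z k) 0 = 0"
proof -
  have "poly.coeff (w k) 0 = 0"
    by (induction k) (simp_all add: pcompose_coeff_0 poly_0_coeff_0 Qt_coeff Q_0)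
  then show ?thesis by (simp add: z_def)
qed

text \<open>In \<open>Qt (w k)\<close> with \<open>w k = \<pi> ^ k z k\<close>, the linear
  coefficient \<open>\<pi>\<close> of \<open>Qt\<close> reproduces \<open>z k\<close> after division
  by \<open>\<pi> ^ Suc k\<close>. With the coefficient \<open>\<pi>'\<close> of \<open>Q\<close> it
  would give \<open>\<pi>' / \<pi>\<close> times \<open>z k\<close> and not cancel.\<close>

lemma z_step:
  assumes k: "2 \<le> k"
  shows "z (Suc k) - z k = (\<Sum>i\<in>{2..Polynomial.degree Qt}. Polynomial.smult (poly.coeff Qt i * \<pi> powi (int i * int k - int (Suc k))) (z k ^ i))"
proof -
  have w: "w k = Polynomial.smult (\<pi> ^ k) (z k)" using pi_nz by (simp add: z_def)
  have Qt0: "poly.coeff Qt 0 = 0" using Q_0 by (simp add: Qt_coeff)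
  have "w (Suc k) = (\<Sum>i\<le>Polynomial.degree Qt. Polynomial.smult (poly.coeff Qt i) (w k ^ i))"
    using k by (simp add: pcompose_altdef poly_altdef degree_map_poly coeff_map_poly)
  also have "{..Polynomial.degree Qt} = insert 0 (insert 1 {2..Polynomial.degree Qt})"
    using le_degree[of Qt 1] pi_nz by (auto simp: Qt_coeff)
  also have "(\<Sum>i\<in>insert 0 (insert 1 {2..Polynomial.degree Qt}). Polynomial.smult (poly.coeff Qt i) (w k ^ i))
      = Polynomial.smult \<pi> (w k) + (\<Sum>i\<in>{2..Polynomial.degree Qt}. Polynomial.smult (poly.coeff Qt i) (w k ^ i))"
    using Qt0 by (simp add: Qt_coeff[of 1])
  finally have "z (Suc k) = Polynomial.smult (inverse (\<pi> ^ Suc k) * \<pi>) (w k)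
      + (\<Sum>i\<in>{2..Polynomial.degree Qt}. Polynomial.smult (inverse (\<pi> ^ Suc k) * poly.coeff Qt i) (w k ^ i))"
    unfolding z_def by (simp add: smult_add_right smult_sum_right del: power_Suc)
  also have "inverse (\<pi> ^ Suc k) * \<pi> = inverse (\<pi> ^ k)" using pi_nz by simp
  also have "Polynomial.smult (inverse (\<pi> ^ k)) (w k) = z k" by (simp add: z_def)
  finally have *: "z (Suc k) = z k
      + (\<Sum>i\<in>{2..Polynomial.degree Qt}. Polynomial.smult (inverse (\<pi> ^ Suc k) * poly.coeff Qt i) (w k ^ i))" .
  have "Polynomial.smult (inverse (\<pi> ^ Suc k) * poly.coeff Qt i) (w k ^ i)
      = Polynomial.smult (poly.coeff Qt i * \<pi> powi (int i * int k - int (Suc k))) (z k ^ i)" for i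
  proof -
    have "\<pi> powi (int i * int k - int (Suc k)) = inverse (\<pi> ^ Suc k) * (\<pi> ^ k) ^ i"
      using pi_nz by (simp add: power_int_diff power_int_mult field_simps del: of_nat_Suc flip: power_mult power_Suc)
    then have "inverse (\<pi> ^ Suc k) * poly.coeff Qt i * (\<pi> ^ k) ^ i
        = poly.coeff Qt i * \<pi> powi (int i * int k - int (Suc k))" by (simp only: mult_ac)
    then show ?thesis unfolding w smult_power smult_smult by (simp only: mult.assoc)
  qed
  then show ?thesis unfolding * by simp
qed

end

section \<open>Convergence at \<open>X = 1\<close> and approximation of the value\<close>

context lubin_tate_pair
begin

text \<open>Since \<open>z k\<close> has no constant term, the coefficient of degree
  \<open>Suc m\<close> in \<open>z k ^ i\<close> with \<open>i \<ge> 2\<close> involves only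
  coefficients up to \<open>m\<close> and at most \<open>Suc m\<close> factors. So a bound up to
  \<open>m\<close> gives geometrically small steps in degree \<open>Suc m\<close>, and these give
  the bound there.\<close>

lemma z_coeff_bounded: "\<exists>B\<ge>1. \<forall>k\<ge>2. \<forall>j\<le>m. nv (poly.coeff (z k) j) \<le> B"
  and z_coeff_step: "\<exists>C\<ge>0. \<forall>k\<ge>2. nv (poly.coeff (z (Suc k) - z k) m) \<le> C * nv \<pi> ^ (k - 1)"
proof (induction m)
  case 0
  { case 1 show ?case by (intro exI[of _ 1]) (simp add: z_coeff_0) }
  { case 2 show ?case by (intro exI[of _ 0]) (simp add: z_coeff_0) }
next
  case (Suc m)
  from Suc(1) obtain B where B: "1 \<le> B" "\<And>k j. 2 \<le> k \<Longrightarrow> j \<le> m \<Longrightarrow> nv (poly.coeff (z k) j) \<le> B"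
    by blast
  have pw: "nv (poly.coeff (z k ^ i) (Suc m)) \<le> B ^ Suc m" if k: "2 \<le> k" and i: "2 \<le> i" for k i
  proof -
    let ?f = "fps_of_poly (z k)"
    have f0: "?f $ 0 = 0" by (simp add: z_coeff_0)
    have c: "poly.coeff (z k ^ i) (Suc m) = (?f ^ i) $ Suc m" by (simp flip: fps_of_poly_power)
    show ?thesis
    proof (cases "i \<le> Suc m")
      case True
      have "(?f ^ i) $ Suc m = (fps_trunc (Suc m) ?f ^ i) $ Suc m"
        using f0 i by (intro fps_power_nth_cong_less) auto
      moreover have "nv ((fps_trunc (Suc m) ?f ^ i) $ Suc m) * 1 ^ Suc m \<le> B ^ i"
        using i B k by (intro fps_power_nth_bound) auto
      moreover have "B ^ i \<le> B ^ Suc m" using True B(1) by (intro power_increasing) auto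
      ultimately show ?thesis unfolding c by simp
    next
      case False
      then have "(?f ^ i) $ Suc m = 0" using startsby_zero_power_prefix[OF f0] by simp
      then show ?thesis unfolding c using B(1) by simp
    qed
  qed
  have step: "nv (poly.coeff (z (Suc k) - z k) (Suc m)) \<le> B ^ Suc m * nv \<pi> ^ (k - 1)" if k: "2 \<le> k" for k
    unfolding z_step[OF k] coeff_sum coeff_smult
  proof (rule nv_sum_le)
    fix i assume i: "i \<in> {2..Polynomial.degree Qt}"
    have "nv (poly.coeff Qt i) \<le> 1" using Qt_PI by (simp add: PI_def)
    \<comment> \<open>The exponent is smallest for \<open>i = 2\<close>, where it equals
      \<open>k - 1\<close>.\<close>
    moreover have "nv (\<pi> powi (int i * int k - int (Suc k))) \<le> nv \<pi> ^ (k - 1)"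
    proof -
      have "2 * k \<le> i * k" using i by (intro mult_right_mono) auto
      define j where "j = i * k - Suc k"
      have j: "i * k = Suc k + j" "k - 1 \<le> j"
        using \<open>2 * k \<le> i * k\<close> k unfolding j_def by linarith+
      have "int i * int k - int (Suc k) = int j" using j(1) by (simp flip: of_nat_mult)
      then show ?thesis using power_decreasing[OF j(2), of "nv \<pi>"] pi_lt_1 by (simp add: nv_power)
    qed
    ultimately have "nv (poly.coeff Qt i) * nv (\<pi> powi (int i * int k - int (Suc k))) \<le> 1 * nv \<pi> ^ (k - 1)"
      by (intro mult_mono) auto
    then have "nv (poly.coeff Qt i) * nv (\<pi> powi (int i * int k - int (Suc k))) * nv (poly.coeff (z k ^ i) (Suc m))
        \<le> nv \<pi> ^ (k - 1) * B ^ Suc m"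
      using pw[OF k, of i] i by (intro mult_mono) auto
    then show "nv (poly.coeff Qt i * \<pi> powi (int i * int k - int (Suc k)) * poly.coeff (z k ^ i) (Suc m))
        \<le> B ^ Suc m * nv \<pi> ^ (k - 1)" by (simp add: nv_mult mult.commute)
  qed (use B in auto)
  { case 2 show ?case using step B(1) by (intro exI[of _ "B ^ Suc m"]) auto }
  { case 1
    define B' where "B' = max (max B (B ^ Suc m)) (nv (poly.coeff (z 2) (Suc m)))"
    have "nv (poly.coeff (z k) (Suc m)) \<le> B'" if "2 \<le> k" for k
      using that
    proof (induction k rule: dec_induct)
      case (step k)
      have "nv \<pi> ^ (k - 1) \<le> 1" using pi_lt_1 by (intro power_le_one) auto
      then have "B ^ Suc m * nv \<pi> ^ (k - 1) \<le> B ^ Suc m" using B(1) by (intro mult_left_le) auto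
      then have "nv (poly.coeff (z (Suc k) - z k) (Suc m)) \<le> B'"
        using \<open>\<And>k. 2 \<le> k \<Longrightarrow> nv (poly.coeff (z (Suc k) - z k) (Suc m)) \<le> B ^ Suc m * nv \<pi> ^ (k - 1)\<close>[OF step.hyps(1)]
        by (simp add: B'_def le_max_iff_disj)
      from nv_add_le[OF this step.IH] show ?case by simp
    qed (simp add: B'_def)
    moreover have "B \<le> B'" by (simp add: B'_def)
    ultimately have "nv (poly.coeff (z k) j) \<le> B'" if "2 \<le> k" "j \<le> Suc m" for k j
      using that B(2)[of k j] by (cases "j = Suc m") (auto intro: order_trans)
    then show ?case using B(1) \<open>B \<le> B'\<close> by (intro exI[of _ B']) auto }
qed

lemma Y_null: "fps_swap Y $ m \<in> null_series"
  unfolding null_series_iff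
proof (intro allI impI)
  fix e' :: real assume e': "0 < e'"
  obtain C where C: "0 \<le> C" "\<And>k. 2 \<le> k \<Longrightarrow> nv (poly.coeff (z (Suc k) - z k) m) \<le> C * nv \<pi> ^ (k - 1)"
    using z_coeff_step by blast
  have "(\<lambda>k. C * nv \<pi> ^ k) \<longlonglongrightarrow> C * 0" using pi_lt_1 by (intro tendsto_intros) auto
  then have "\<forall>\<^sub>F k in sequentially. C * nv \<pi> ^ k < e'" using e' by (intro order_tendstoD(2)) auto
  then obtain k0 where k0: "\<And>k. k0 \<le> k \<Longrightarrow> C * nv \<pi> ^ k < e'" unfolding eventually_sequentially by blast
  \<comment> \<open>For \<open>n = q ^ k\<close> the coefficient is the step from
    \<open>z (k - 1)\<close> to \<open>z k\<close>; its bound needs \<open>k \<ge> 3\<close> and has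
    exponent \<open>k - 2\<close>.\<close>
  have "nv (fps_swap Y $ m $ n) < e'" if n: "q ^ (k0 + 3) \<le> n" for n
  proof (cases "\<exists>k. n = q ^ k")
    case True
    then obtain k where k: "n = q ^ k" by blast
    then have "k0 + 3 \<le> k" using n q_ge_2 by simp
    then obtain k' where k': "k = Suc k'" "k0 + 2 \<le> k'" by (cases k) auto
    have "nv (poly.coeff (Y $ n) m) \<le> C * nv \<pi> ^ (k' - 1)"
      unfolding k Y_pow using C(2)[of k'] k' by simp
    also have "\<dots> < e'" using k' by (intro k0) auto
    finally show ?thesis by simp
  qed (use e' in \<open>simp add: Y_other\<close>)
  then show "\<exists>N. \<forall>n\<ge>N. nv (fps_swap Y $ m $ n) < e'" by blast
qed

lemma Y_swap_power_null: "(fps_swap Y ^ i) $ m \<in> null_series"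
proof (induction i arbitrary: m)
  case 0
  show ?case using null_series_const[of 1] null_series_const[of 0] by (cases m) auto
next
  case (Suc i)
  then show ?case by (simp add: fps_mult_nth null_series_sum null_series_mult Y_null)
qed

lemma Y_coeff_0: "poly.coeff (Y $ n) 0 = 0"
proof (cases "\<exists>k. n = q ^ k")
  case True
  then show ?thesis by (auto simp: Y_pow z_coeff_0)
qed (simp add: Y_other)

text \<open>Every coefficient of \<open>Y\<close> is divisible by \<open>T\<close>, so
  \<open>T ^ m\<close> receives only the terms \<open>i \<le> m\<close> of \<open>e\<close>. These
  are finitely many, and the denominators of \<open>e\<close> do no harm.\<close>

lemma U_swap: "fps_swap U $ m = (\<Sum>i\<le>m. fps_const (e $ i) * (fps_swap Y ^ i) $ m)"
proof (rule fps_ext)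
  fix n
  have Y0: "fps_swap Y $ 0 = 0" by (rule fps_ext) (simp add: Y_coeff_0)
  let ?t = "\<lambda>i. e $ i * (fps_swap Y ^ i) $ m $ n"
  have z1: "?t i = 0" if "m < i" for i using startsby_zero_power_prefix[OF Y0] that by simp
  have z2: "?t i = 0" if "n < i" for i
    using startsby_zero_power_prefix[OF Y_0] that by (simp flip: fps_swap_power)
  have "fps_swap U $ m $ n = (\<Sum>i=0..n. ?t i)"
    unfolding U_def by (simp add: fps_compose_nth coeff_sum T_nth flip: fps_swap_power)
  also have "\<dots> = (\<Sum>i\<in>{0..n} \<inter> {..m}. ?t i)" 
    by (intro sum.mono_neutral_right ballI z1) auto
  also have "\<dots> = (\<Sum>i\<le>m. ?t i)" 
    by (intro sum.mono_neutral_left ballI z2) auto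
  finally show "fps_swap U $ m $ n = (\<Sum>i\<le>m. fps_const (e $ i) * (fps_swap Y ^ i) $ m) $ n"
    by (simp add: fps_sum_nth)
qed

lemma U_null: "fps_swap U $ m \<in> null_series"
  unfolding U_swap by (intro null_series_sum null_series_mult null_series_const Y_swap_power_null)

lemma U_coeff_0: "poly.coeff (U $ n) 0 = 0"
proof -
  have "fps_swap U $ 0 = 0" unfolding U_swap by (simp add: e_0)
  then show ?thesis by (metis fps_swap_nth fps_zero_nth)
qed

lemma U_coeff_1: "poly.coeff (U $ n) 1 = poly.coeff (Y $ n) 1"
proof -
  have "fps_swap U $ 1 = fps_swap Y $ 1"
    unfolding U_swap using e_0 e_1 by (simp add: atMost_Suc One_nat_def)
  then show ?thesis by (metis fps_swap_nth)
qed

lemma U_coeff_le: "nv (poly.coeff (U $ n) m) \<le> 1"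
  using U_PI[of n] by (simp add: PI_def)

text \<open>Integrality of \<open>U\<close> makes all powers of \<open>T\<close> above
  \<open>M\<close> small at \<open>\<omega>2\<close>, uniformly in the degree in \<open>X\<close>;
  \<open>U_null\<close> handles the finitely many remaining powers.\<close>

lemma E_null: "E \<in> null_series"
  unfolding null_series_iff
proof (intro allI impI)
  fix e' :: real assume e': "0 < e'"
  obtain M where M: "nv \<omega>2 ^ M < e'" using real_arch_pow_inv[OF e' om_lt(2)] by blast
  have "\<exists>N. \<forall>n\<ge>N. nv (poly.coeff (U $ n) m) < e'" for m
    using U_null[of m] e' unfolding null_series_iff by simp
  then obtain N where N: "\<And>m n. N m \<le> n \<Longrightarrow> nv (poly.coeff (U $ n) m) < e'" by metis
  have "nv (E $ n) < e'" if n: "Max (N ` {..M}) \<le> n" for n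
    unfolding E_nth poly_altdef
  proof (rule nv_sum_less)
    fix m
    show "nv (poly.coeff (U $ n) m * \<omega>2 ^ m) < e'"
    proof (cases "m \<le> M")
      case True
      then have "N m \<le> n" using n by (meson Max_ge finite_atMost finite_imageI imageI le_trans atMost_iff)
      moreover have "nv (poly.coeff (U $ n) m * \<omega>2 ^ m) \<le> nv (poly.coeff (U $ n) m)"
        using om_lt(2) by (simp add: nv_mult nv_power mult_left_le power_le_one)
      ultimately show ?thesis using N by (meson le_less_trans)
    next
      case False
      have "nv (poly.coeff (U $ n) m * \<omega>2 ^ m) \<le> nv \<omega>2 ^ M"
        using False om_lt(2) U_coeff_le[of n m] power_decreasing[of M m "nv \<omega>2"]
        by (intro nv_mult_le) (auto simp: nv_power)
      then show ?thesis using M by simp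
    qed
  qed (rule e')
  then show "\<exists>N. \<forall>n\<ge>N. nv (E $ n) < e'" by blast
qed

definition u :: 'a where "u = fps_total E"

lemma w_coeff_1: "poly.coeff (w k) 1 = (if k = 0 then 1 else if k = 1 then \<pi>' else \<pi> ^ (k - 2) * \<pi>' ^ 2)"
proof (induction k)
  case (Suc k)
  have c0: "poly.coeff (w k) 0 = 0"
    by (induction k) (simp_all add: pcompose_coeff_0 poly_0_coeff_0 Qt_coeff Q_0)
  have "poly.coeff (pcompose h (w k)) 1 = poly.coeff h 1 * poly.coeff (w k) 1" for h
  proof -
    have "fps_of_poly (pcompose h (w k)) = fps_of_poly h oo fps_of_poly (w k)"
      using c0 by (intro fps_of_poly_pcompose) (simp add: poly_0_coeff_0)
    then have "fps_of_poly (pcompose h (w k)) $ 1 = fps_of_poly h $ 0 * 0 + fps_of_poly h $ 1 * fps_of_poly (w k) $ 1"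
      by (simp add: fps_compose_nth atLeast0_atMost_Suc One_nat_def)
    then show ?thesis by simp
  qed
  then have *: "poly.coeff (w (Suc k)) 1 = (if k < 2 then \<pi>' else \<pi>) * poly.coeff (w k) 1"
    using Q_1 by (simp add: Qt_coeff)
  consider "k = 0" | "k = 1" | j where "k = j + 2"
    by (metis One_nat_def add.commute le_Suc_ex less_2_cases not_less)
  then show ?case unfolding * using Suc by cases (simp_all add: power2_eq_square)
qed (simp add: One_nat_def)

text \<open>The linear coefficients of \<open>z 0, z 1, z 2, z 3, ...\<close> are
  \<open>1, c, c ^ 2, c ^ 2, ...\<close> with \<open>c = \<pi>' / \<pi>\<close> congruent to
  \<open>1\<close>, so consecutive differences are small.\<close>

lemma Y_coeff_1: "nv (poly.coeff (Y $ n) 1 - of_bool (n = 1)) \<le> nv \<pi>"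
proof (cases "\<exists>k. n = q ^ k")
  case True
  then obtain k where k: "n = q ^ k" by blast
  define c where "c = \<pi>' / \<pi>"
  have c: "nv (c - 1) \<le> nv \<pi>" "nv c = 1"
  proof -
    have "c - 1 = (\<pi>' - \<pi>) / \<pi>" using pi_nz by (simp add: c_def field_simps)
    then have "nv (c - 1) = nv (\<pi> - \<pi>') / nv \<pi>" by (simp add: nv_divide nv_minus_commute)
    also have "\<dots> \<le> nv \<pi> ^ 3 / nv \<pi>" using pi'_close by (intro divide_right_mono) auto
    also have "\<dots> = nv \<pi> * nv \<pi>" using pi_nz by (simp add: power3_eq_cube)
    also have "\<dots> \<le> nv \<pi> * 1" using pi_lt_1 by (intro mult_left_mono) auto
    finally show "nv (c - 1) \<le> nv \<pi>" by simp
    show "nv c = 1" using nv_pi' pi_nz by (simp add: c_def nv_divide)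
  qed
  have z1: "poly.coeff (z k) 1 = (if k = 0 then 1 else if k = 1 then c else c ^ 2)" for k
  proof -
    have "\<pi> ^ (k - 2) = \<pi> ^ k / \<pi> ^ 2" if "2 \<le> k" using that pi_nz by (simp add: power_diff)
    then show ?thesis using pi_nz by (auto simp: z_def w_coeff_1 c_def field_simps)
  qed
  have "nv (c ^ 2 - c) \<le> nv \<pi>"
  proof -
    have "c ^ 2 - c = c * (c - 1)" by (simp add: power2_eq_square algebra_simps)
    then show ?thesis using c by (simp add: nv_mult)
  qed
  moreover have "q ^ k = 1 \<longleftrightarrow> k = 0" using q_pow_eq[of k 0] by simp
  ultimately show ?thesis
    unfolding k Y_pow using c z1[of k] z1[of "k - 1"] by (cases "k = 0"; cases "k = 1"; cases "k = 2") auto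
next
  case False
  then have "n \<noteq> 1" using power_0 by metis
  then show ?thesis using False by (simp add: Y_other)
qed

lemma om2_nz: "\<omega>2 \<noteq> 0"
  using om2 om1_nz Q_0 by (auto simp: poly_0_coeff_0)

lemma u_close: "nv (u - \<omega>2) < nv \<omega>2"
proof -
  \<comment> \<open>\<open>nv \<pi>\<close> bounds the deviation of the part linear in
    \<open>T\<close> from \<open>X\<close>, and \<open>nv \<omega>2\<close> accounts for all higher
    powers of \<open>T\<close>, whose coefficients are integral.\<close>
  define r where "r = max (nv \<pi>) (nv \<omega>2) * nv \<omega>2"
  let ?D = "E - fps_const \<omega>2 * fps_X"
  have X: "fps_X \<in> null_series" unfolding null_series_iff
    by (intro allI impI exI[of _ 2]) (auto simp: fps_X_def)
  have D: "?D = E + fps_const (- \<omega>2) * fps_X" by simp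
  have Xn: "fps_const (- \<omega>2) * fps_X \<in> null_series" by (intro null_series_mult null_series_const X)
  have bound: "nv (?D $ n) \<le> r" for n
  proof -
    have "poly (U $ n) \<omega>2 = (\<Sum>m\<le>max 1 (Polynomial.degree (U $ n)). poly.coeff (U $ n) m * \<omega>2 ^ m)"
      unfolding poly_altdef by (intro sum.mono_neutral_left) (auto simp: coeff_eq_0 not_le)
    also have "{..max 1 (Polynomial.degree (U $ n))} = insert 0 (insert 1 {2..max 1 (Polynomial.degree (U $ n))})"
      by auto
    finally have "E $ n = poly.coeff (U $ n) 1 * \<omega>2
        + (\<Sum>m\<in>{2..max 1 (Polynomial.degree (U $ n))}. poly.coeff (U $ n) m * \<omega>2 ^ m)"
      by (simp add: E_nth U_coeff_0)
    then have "?D $ n = (poly.coeff (Y $ n) 1 - of_bool (n = 1)) * \<omega>2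
        + (\<Sum>m\<in>{2..max 1 (Polynomial.degree (U $ n))}. poly.coeff (U $ n) m * \<omega>2 ^ m)"
      by (simp add: U_coeff_1 fps_X_def algebra_simps)
    also have "nv \<dots> \<le> r"
    proof (intro nv_add_le nv_sum_le)
      show "nv ((poly.coeff (Y $ n) 1 - of_bool (n = 1)) * \<omega>2) \<le> r"
        unfolding r_def nv_mult using Y_coeff_1[of n] by (intro mult_right_mono) auto
      fix m assume "m \<in> {2..max 1 (Polynomial.degree (U $ n))}"
      then have "nv (\<omega>2 ^ m) \<le> nv \<omega>2 ^ 2" unfolding nv_power using om_lt(2) by (intro power_decreasing) auto
      also have "\<dots> \<le> r" unfolding r_def power2_eq_square by (intro mult_right_mono) auto
      finally show "nv (poly.coeff (U $ n) m * \<omega>2 ^ m) \<le> r" using U_coeff_le by (intro nv_mult_le) auto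
    qed (simp add: r_def le_max_iff_disj)
    finally show ?thesis .
  qed
  have "?D \<in> null_series" unfolding D by (intro null_series_add E_null Xn)
  from fps_total_approx[OF complete_C this bound, of 0] have "nv (fps_total ?D) \<le> r"
    by (simp add: r_def le_max_iff_disj)
  moreover have "fps_total ?D = u - \<omega>2"
  proof -
    have "fps_total (fps_X :: 'a fps) = 1"
    proof (rule fps_total_eqI[OF complete_C], rule Lim_transform_eventually[OF tendsto_const])
      show "\<forall>\<^sub>F N in sequentially. 1 = (\<Sum>n<N. fps_X $ n :: 'a)"
        by (rule eventually_mono[OF eventually_gt_at_top[of 1]]) (simp add: fps_X_def)
    qed
    then show ?thesis
      unfolding D u_def using Xn X
      by (simp add: fps_total_add[OF complete_C E_null] fps_total_mult[OF complete_C null_series_const X]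
          fps_total_const[OF complete_C] del: fps_const_neg)
  qed
  moreover have "r < nv \<omega>2" using om_lt(2) om2_nz pi_lt_1 by (simp add: r_def)
  ultimately show ?thesis by simp
qed

end

section \<open>The value as a torsion point\<close>

context lubin_tate_pair
begin

lemma Q_decompose:
  assumes "nv x \<le> 1"
  shows "nv (poly Q x - (\<pi>' * x + poly.coeff Q q * x ^ q)) \<le> nv \<pi> * nv x ^ 2"
  using poly_decompose_bound[OF Q_0 q_ge_2 _ _ assms, of "nv \<pi>"] discrete[OF Q_K Q_small] Q_1 by simp

lemma nv_Q_q: "nv (poly.coeff Q q) = 1"
  using nv_eq_if_close[of "poly.coeff Q q" 1] Q_q by simp

text \<open>In \<open>poly Q \<omega>1 = 0\<close> every term other than those of degree
  \<open>1\<close> and \<open>q\<close> is smaller than the linear one, so these two have to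
  balance.\<close>

lemma nv_om1: "nv \<omega>1 ^ (q - 1) = nv \<pi>"
proof -
  have "nv (\<pi>' * \<omega>1 + poly.coeff Q q * \<omega>1 ^ q) \<le> nv \<pi> * nv \<omega>1 ^ 2"
    using Q_decompose[of \<omega>1] om1 om_lt nv_minus_commute[of 0 "\<pi>' * \<omega>1 + poly.coeff Q q * \<omega>1 ^ q"]
    by simp
  also have "\<dots> < nv (\<pi>' * \<omega>1)"
    using pi_nz om1_nz om_lt by (simp add: nv_mult nv_pi' power2_eq_square)
  finally have "nv (- (poly.coeff Q q * \<omega>1 ^ q)) = nv (\<pi>' * \<omega>1)"
    using nv_minus_commute[of "- (poly.coeff Q q * \<omega>1 ^ q)" "\<pi>' * \<omega>1"] by (intro nv_eq_if_close) simp
  then have "nv \<omega>1 ^ q = nv \<pi> * nv \<omega>1" by (simp add: nv_mult nv_pi' nv_Q_q nv_power)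
  moreover have "nv \<omega>1 ^ q = nv \<omega>1 ^ (q - 1) * nv \<omega>1" using q_ge_2 by (cases q) auto
  ultimately show ?thesis using om1_nz by simp
qed

lemma nv_pi_le_om1: "nv \<pi> \<le> nv \<omega>1"
proof -
  have "nv \<omega>1 ^ (q - 1) \<le> nv \<omega>1 ^ 1" using q_ge_2 om_lt by (intro power_decreasing) auto
  then show ?thesis using nv_om1 by simp
qed

text \<open>In \<open>poly Q \<omega>2 = \<omega>1\<close> all terms except that of degree
  \<open>q\<close> are smaller than \<open>\<omega>1\<close>.\<close>

lemma nv_om2: "nv \<omega>2 ^ q = nv \<omega>1"
proof -
  let ?r = "\<omega>1 - (\<pi>' * \<omega>2 + poly.coeff Q q * \<omega>2 ^ q)"
  have "nv ?r \<le> nv \<pi> * nv \<omega>2 ^ 2" using Q_decompose[of \<omega>2] om2 om_lt by simp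
  also have "\<dots> \<le> nv \<pi> * nv \<omega>2"
    using om_lt by (intro mult_left_mono) (auto simp: power2_eq_square mult_left_le)
  finally have "nv (\<pi>' * \<omega>2 + ?r) \<le> nv \<pi> * nv \<omega>2"
    by (intro nv_add_le) (simp_all add: nv_mult nv_pi')
  also have "\<dots> \<le> nv \<omega>1 * nv \<omega>2" using nv_pi_le_om1 by (intro mult_right_mono) auto
  also have "\<dots> < nv \<omega>1" using om_lt om1_nz by simp
  also have "\<pi>' * \<omega>2 + ?r = \<omega>1 - poly.coeff Q q * \<omega>2 ^ q" by simp
  finally have "nv (poly.coeff Q q * \<omega>2 ^ q) = nv \<omega>1"
    by (intro nv_eq_if_close) (simp add: nv_minus_commute)
  then show ?thesis by (simp add: nv_mult nv_power nv_Q_q)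
qed

lemma P_compose_e: "y $ 0 = 0 \<Longrightarrow> fps_of_poly P oo (e oo y) = e oo (fps_const \<pi> * y)"
proof -
  assume y: "y $ 0 = 0"
  have ey: "(e oo y) $ 0 = 0" by (simp add: fps_compose_nth e_0)
  have "fps_of_poly P oo (e oo y) = (e oo (fps_const \<pi> * l)) oo (e oo y)"
    using br_pi by (simp add: br_def)
  also have "\<dots> = e oo ((fps_const \<pi> * l) oo (e oo y))"
    by (rule fps_compose_assoc[symmetric]) (use ey l_0 in auto)
  also have "(fps_const \<pi> * l) oo (e oo y) = fps_const \<pi> * y"
    using fps_inverse_compose_const(1)[OF le el l_0 e_0 y] ey
    by (simp add: fps_compose_mult_distrib fps_const_compose)
  finally show ?thesis .
qed

text \<open>Thus \<open>e\<close> converges on the open disc of radius \<open>\<bar>\<omega>\<^sub>1\<bar>\<close>.\<close>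

lemma e_bound: "1 \<le> n \<Longrightarrow> nv (e $ n) * nv \<omega>1 ^ n \<le> nv \<omega>1"
proof (induction n rule: less_induct)
  case (less n)
  let ?s = "nv \<omega>1"
  show ?case
  proof (cases "n = 1")
    case False
    then have n: "2 \<le> n" using less.prems by simp
    have "fps_of_poly P oo e = e oo (fps_const \<pi> * fps_X)"
      using P_compose_e[of fps_X] by simp
    then have "(fps_of_poly P oo e) $ n = \<pi> ^ n * e $ n" by (simp add: fps_compose_linear)
    then have eq: "(\<pi> - \<pi> ^ n) * e $ n = - (\<Sum>i\<in>{2..n}. poly.coeff P i * (e ^ i) $ n)"
      using n fps_compose_nth_split[of "fps_of_poly P" e n] P_0 P_1 by (simp add: algebra_simps eq_neg_iff_add_eq_0)
    have s0: "0 < ?s ^ n" using om1_nz by simp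
    have "nv (- (\<Sum>i\<in>{2..n}. poly.coeff P i * (e ^ i) $ n)) \<le> nv \<pi> * ?s / ?s ^ n"
      unfolding nv_uminus
    proof (rule nv_sum_le)
      fix i assume i: "i \<in> {2..n}"
      have "(e ^ i) $ n = (fps_trunc n e ^ i) $ n"
        using i e_0 n by (intro fps_power_nth_cong_less) auto
      moreover have "nv (fps_trunc n e $ j) * ?s ^ j \<le> ?s" for j
        using less.IH[of j] e_0 by (cases "j = 0") auto
      ultimately have ei: "nv ((e ^ i) $ n) * ?s ^ n \<le> ?s ^ i"
        using i fps_power_nth_bound[of ?s ?s i n "fps_trunc n e"] by simp
      have "nv (poly.coeff P i) * ?s ^ i \<le> nv \<pi> * ?s"
      proof (cases "i = q")
        case True
        then show ?thesis using nv_om1 P_q q_ge_2 by (cases q) (auto simp: mult.commute)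
      next
        case False
        have "?s ^ i \<le> ?s ^ 1" using i om_lt by (intro power_decreasing) auto
        then show ?thesis using discrete[OF P_K P_small[OF False]] by (intro mult_mono) auto
      qed
      moreover have "nv (poly.coeff P i) * (nv ((e ^ i) $ n) * ?s ^ n) \<le> nv (poly.coeff P i) * ?s ^ i"
        using ei by (intro mult_left_mono) auto
      ultimately have "nv (poly.coeff P i * (e ^ i) $ n) * ?s ^ n \<le> nv \<pi> * ?s"
        by (simp add: nv_mult mult.assoc)
      then show "nv (poly.coeff P i * (e ^ i) $ n) \<le> nv \<pi> * ?s / ?s ^ n"
        using s0 by (simp add: le_divide_eq)
    qed simp
    then have "nv (\<pi> - \<pi> ^ n) * nv (e $ n) \<le> nv \<pi> * ?s / ?s ^ n"
      unfolding eq[symmetric] nv_mult .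
    moreover have "nv (\<pi> - \<pi> ^ n) = nv \<pi>"
    proof -
      have "nv \<pi> ^ n < nv \<pi> ^ 1" using n pi_lt_1 pi_nz by (intro power_strict_decreasing) auto
      then show ?thesis by (intro nv_eq_if_close) (simp add: nv_power)
    qed
    ultimately have "nv \<pi> * (nv (e $ n) * ?s ^ n) \<le> nv \<pi> * ?s" using s0 by (simp add: field_simps)
    then show ?thesis using pi_nz by simp
  qed (simp add: e_1)
qed

text \<open>The factor \<open>\<pi> ^ 2\<close> comes from applying \<open>P\<close> twice to
  \<open>E\<close>. It brings the coefficients into the disc on which \<open>e\<close>
  converges.\<close>

definition G :: "'a poly"
  where "G = [:\<pi> ^ 2:] * ([:\<omega>2:] * (Polynomial.monom 1 1 - Polynomial.monom 1 q)
    + [:\<omega>1 / \<pi>:] * (Polynomial.monom 1 q - Polynomial.monom 1 (q ^ 2)))"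

lemma fps_of_poly_G: "fps_of_poly G = fps_const \<pi> * (fps_const \<pi> * g)"
proof -
  have "fps_of_poly (Polynomial.monom 1 n) = (fps_X ^ n :: 'a fps)" for n
    by (simp add: fps_of_poly_monom)
  then have "fps_of_poly G = fps_const (\<pi> ^ 2) * g"
    unfolding G_def g_def by (simp only: fps_of_poly_mult fps_of_poly_add fps_of_poly_diff fps_of_poly_const
        power_one_right)
  then show ?thesis by (simp add: power2_eq_square mult.assoc[symmetric])
qed

lemma poly_G_1: "poly G 1 = 0"
  by (simp add: G_def poly_monom)

lemma nv_G: "nv (fps_of_poly G $ n) \<le> nv \<omega>1 * nv \<pi>"
proof -
  have a: "nv (\<pi> ^ 2 * \<omega>2) \<le> nv \<omega>1 * nv \<pi>"
  proof -
    have "nv (\<pi> ^ 2 * \<omega>2) = (nv \<pi> * nv \<omega>2) * nv \<pi>" by (simp add: nv_mult nv_power power2_eq_square)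
    also have "\<dots> \<le> nv \<omega>1 * nv \<pi>"
      using nv_pi_le_om1 om_lt mult_mono[of "nv \<pi>" "nv \<omega>1" "nv \<omega>2" 1] by (intro mult_right_mono) auto
    finally show ?thesis .
  qed
  have b: "nv (\<pi> * \<omega>1) \<le> nv \<omega>1 * nv \<pi>" by (simp add: nv_mult mult.commute)
  have "fps_of_poly G $ n = \<pi> ^ 2 * \<omega>2 * (of_bool (n = 1) - of_bool (n = q))
      + \<pi> * \<omega>1 * (of_bool (n = q) - of_bool (n = q ^ 2))"
    using pi_nz by (simp add: fps_of_poly_G g_def fps_X_power_nth power2_eq_square algebra_simps)
  also have "nv \<dots> \<le> nv \<omega>1 * nv \<pi>"
  proof (rule nv_add_le)
    have o: "nv (of_bool b - of_bool c :: 'a) \<le> 1" for b c by (intro nv_diff_le) auto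
    show "nv (\<pi> ^ 2 * \<omega>2 * (of_bool (n = 1) - of_bool (n = q))) \<le> nv \<omega>1 * nv \<pi>"
      by (subst mult.commute) (rule nv_mult_le[OF o a])
    show "nv (\<pi> * \<omega>1 * (of_bool (n = q) - of_bool (n = q ^ 2))) \<le> nv \<omega>1 * nv \<pi>"
      by (subst mult.commute) (rule nv_mult_le[OF o b])
  qed
  finally show ?thesis .
qed

text \<open>Within the disc of convergence the value at \<open>1\<close> may be computed as
  \<open>e\<close> of \<open>poly G 1 = 0\<close>. The argument does not apply to \<open>g\<close>,
  since \<open>\<omega>1 / \<pi>\<close> lies outside that disc, and indeed \<open>u\<close> is
  nonzero.\<close>

lemma total_e_G: "fps_total (e oo fps_of_poly G) = 0"
proof (rule fps_total_eqI[OF complete_C])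
  let ?G = "fps_of_poly G"
  have G0: "?G $ 0 = 0" using g_0 by (simp add: fps_of_poly_G)
  let ?D = "Polynomial.degree G"
  show "(\<lambda>N. \<Sum>n<N. (e oo ?G) $ n) \<longlonglongrightarrow> 0"
    unfolding nv_tendsto_0_iff[of "\<lambda>N. \<Sum>n<N. (e oo ?G) $ n"] LIMSEQ_iff
  proof (intro allI impI)
    fix r :: real assume r: "0 < r"
    obtain i0 where i0: "nv \<pi> ^ i0 < r" using real_arch_pow_inv[OF r pi_lt_1] by blast
    \<comment> \<open>For such \<open>N\<close> the powers \<open>G ^ i\<close> with
      \<open>i < i0\<close> are summed completely, which gives \<open>poly (G ^ i) 1 = 0\<close>;
      the other powers are small by \<open>e_bound\<close>.\<close>
    have "nv (\<Sum>n<N. (e oo ?G) $ n) < r" if N: "i0 * ?D < N" for N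
    proof -
      have "(\<Sum>n<N. (e oo ?G) $ n) = (\<Sum>n<N. \<Sum>i<N. e $ i * (?G ^ i) $ n)"
        unfolding fps_compose_nth using startsby_zero_power_prefix[OF G0]
        by (intro sum.cong sum.mono_neutral_left) auto
      also have "\<dots> = (\<Sum>i<N. e $ i * (\<Sum>n<N. (?G ^ i) $ n))"
        by (subst sum.swap) (simp add: sum_distrib_left)
      also have "nv \<dots> < r"
      proof (rule nv_sum_less[OF _ r])
        fix i
        show "nv (e $ i * (\<Sum>n<N. (?G ^ i) $ n)) < r"
        proof (cases "i = 0")
          case True
          then show ?thesis using r e_0 by simp
        next
          case i: False
          show ?thesis
          proof (cases "i < i0")
            case True
            have "Polynomial.degree (G ^ i) \<le> ?D * i" by (rule degree_power_le)
            also have "?D * i \<le> i0 * ?D" using True by simp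
            finally have d: "Polynomial.degree (G ^ i) < N" using N by simp
            have "(\<Sum>n<N. (?G ^ i) $ n) = (\<Sum>n<N. poly.coeff (G ^ i) n)"
              by (simp flip: fps_of_poly_power)
            also have "\<dots> = poly (G ^ i) 1"
              unfolding poly_altdef using d by (simp, intro sum.mono_neutral_right) (auto simp: coeff_eq_0)
            finally show ?thesis using r i by (simp add: poly_G_1 power_0_left)
          next
            case False
            let ?s = "nv \<omega>1"
            have Gi: "nv ((?G ^ i) $ n) \<le> (?s * nv \<pi>) ^ i" for n
              using fps_power_nth_bound[of 1 "?s * nv \<pi>" i n ?G] nv_G i by simp
            have "nv (e $ i * (\<Sum>n<N. (?G ^ i) $ n)) \<le> nv (e $ i) * (?s * nv \<pi>) ^ i"
              unfolding nv_mult using Gi by (intro mult_left_mono nv_sum_le) auto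
            also have "\<dots> = (nv (e $ i) * ?s ^ i) * nv \<pi> ^ i" by (simp add: power_mult_distrib)
            also have "\<dots> \<le> 1 * nv \<pi> ^ i"
              using e_bound[of i] i om_lt by (intro mult_right_mono) auto
            also have "\<dots> \<le> nv \<pi> ^ i0" using False pi_lt_1 by (simp add: power_decreasing)
            finally show ?thesis using i0 by simp
          qed
        qed
      qed
      finally show ?thesis .
    qed
    then show "\<exists>N0. \<forall>N\<ge>N0. norm (nv (\<Sum>n<N. (e oo ?G) $ n) - 0) < r"
      by (intro exI[of _ "Suc (i0 * ?D)"]) auto
  qed
qed

theorem u_torsion: "poly P (poly P u) = 0"
proof -
  have E0: "E $ 0 = 0" unfolding E_eq by (simp add: fps_compose_nth e_0)
  note 1 = fps_total_poly[OF complete_C E_null E0, of P]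
  have PE: "fps_of_poly P oo E = e oo (fps_const \<pi> * g)" unfolding E_eq by (rule P_compose_e[OF g_0])
  have PE0: "(fps_of_poly P oo E) $ 0 = 0" unfolding PE by (simp add: fps_compose_nth e_0)
  have "fps_of_poly P oo (fps_of_poly P oo E) = e oo fps_of_poly G"
    unfolding PE fps_of_poly_G by (rule P_compose_e) (simp add: g_0)
  then show ?thesis
    using fps_total_poly(2)[OF complete_C 1(1) PE0, of P] total_e_G 1(2) by (simp add: u_def)
qed

lemma nv_u: "nv u = nv \<omega>2"
  using u_close by (rule nv_eq_if_close)

lemma nv_u_power: "nv u ^ (q * (q - 1)) = nv \<pi>"
  using nv_om1 nv_om2 by (simp add: nv_u power_mult)

end

section \<open>Galois theory of subfields\<close>

lemma ambient_simps [simp]: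
  "carrier (ambient :: 'a::field ring) = UNIV" "x \<otimes>\<^bsub>(ambient :: 'a ring)\<^esub> y = x * y"
  "\<one>\<^bsub>(ambient :: 'a ring)\<^esub> = 1" "\<zero>\<^bsub>(ambient :: 'a ring)\<^esub> = 0" "x \<oplus>\<^bsub>(ambient :: 'a ring)\<^esub> y = x + y"
  by (simp_all add: ring_of_type_algebra_def)

text \<open>The carrier is arbitrary because \<open>Qp\<close> is given as a subfield of
  \<open>Qp_bar\<close>, whereas \<open>K\<close> and \<open>M\<close> are given inside the whole
  type.\<close>

lemma set_subfieldI:
  fixes K :: "'a::field set"
  assumes "subfield K (ambient\<lparr>carrier := C\<rparr>)" and "ring (ambient\<lparr>carrier := C\<rparr> :: 'a ring)"
  shows "set_subfield K"
proof -
  let ?R = "ambient\<lparr>carrier := C\<rparr> :: 'a ring"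
  interpret R: ring ?R by fact
  interpret K: subfield K ?R by fact
  note sub = subringE[OF K.subring_axioms]
  have neg: "- x \<in> K" if x: "x \<in> K" for x
  proof -
    have "x \<in> carrier ?R" using sub(1) x by auto
    then have "\<ominus>\<^bsub>?R\<^esub> x \<oplus>\<^bsub>?R\<^esub> x = \<zero>\<^bsub>?R\<^esub>" by (rule R.l_neg)
    then have "\<ominus>\<^bsub>?R\<^esub> x = - x" by (simp add: eq_neg_iff_add_eq_0)
    then show ?thesis using sub(5)[OF x] by simp
  qed
  show ?thesis
  proof
    show "1 \<in> K" using sub(3) by simp
    show "x - y \<in> K" if "x \<in> K" "y \<in> K" for x y using sub(7)[OF that(1) neg[OF that(2)]] by simp
    show "x * y \<in> K" if "x \<in> K" "y \<in> K" for x y using sub(6)[OF that] by simp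
    show "inverse x \<in> K" if "x \<in> K" for x
    proof (cases "x = 0")
      case False
      then have "x \<in> Units (?R\<lparr>carrier := K\<rparr>)" using K.subfield_Units that by simp
      then obtain y where "y \<in> K" "x * y = 1" by (auto simp: Units_def)
      then show ?thesis by (metis inverse_unique)
    qed (use that in simp)
  qed
qed

lemma set_subfield_ambient:
  fixes K :: "'a::field set"
  assumes "subfield K ambient" shows "set_subfield K"
proof (rule set_subfieldI[of K UNIV])
  have e: "ambient\<lparr>carrier := UNIV\<rparr> = (ambient :: 'a ring)" by (simp add: ring_of_type_algebra_def)
  show "subfield K (ambient\<lparr>carrier := UNIV\<rparr>)" unfolding e by fact
  show "ring (ambient\<lparr>carrier := UNIV\<rparr> :: 'a ring)" unfolding e by rule
qed

lemma line_extension_ambient: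
  "ring.line_extension (ambient :: 'a::field ring) K v E = {k * v + x | k x. k \<in> K \<and> x \<in> E}"
proof -
  interpret R: field "ambient :: 'a ring" by rule
  show ?thesis by (intro Set.set_eqI) (simp add: R.line_extension_mem_iff, blast)
qed

lemma dimension_basis:
  fixes K :: "'a::field set"
  assumes K: "set_subfield K" and d: "ring.dimension ambient n K E"
  shows "\<exists>b. (\<forall>i<n. b i \<in> E) \<and> E = {\<Sum>i<n. c i * b i | c. \<forall>i<n. c i \<in> K} \<and>
    (\<forall>c. (\<forall>i<n. c i \<in> K) \<longrightarrow> (\<Sum>i<n. c i * b i) = 0 \<longrightarrow> (\<forall>i<n. c i = 0))"
proof -
  interpret R: field "ambient :: 'a ring" by rule
  show ?thesis using d K
  proof (induction n K E rule: R.dimension.induct)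
    case (zero_dim K)
    then show ?case by auto
  next
    case (Suc_dim v E n K)
    then interpret K: set_subfield K by blast
    obtain b where b: "\<forall>i<n. b i \<in> E" "E = {\<Sum>i<n. c i * b i | c. \<forall>i<n. c i \<in> K}"
      "\<And>c. \<forall>i<n. c i \<in> K \<Longrightarrow> (\<Sum>i<n. c i * b i) = 0 \<Longrightarrow> \<forall>i<n. c i = 0"
      using Suc_dim.IH[OF Suc_dim.prems] by blast
    define b' where "b' = b(n := v)"
    have s: "(\<Sum>i<Suc n. c i * b' i) = c n * v + (\<Sum>i<n. c i * b i)" for c
      by (simp add: b'_def)
    have span: "R.line_extension K v E = {\<Sum>i<Suc n. c i * b' i | c. \<forall>i<Suc n. c i \<in> K}"
    proof (intro equalityI subsetI)
      fix x assume "x \<in> R.line_extension K v E"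
      then obtain k c where "k \<in> K" "x = k * v + (\<Sum>i<n. c i * b i)" "\<forall>i<n. c i \<in> K"
        unfolding line_extension_ambient b(2) by blast
      then show "x \<in> {\<Sum>i<Suc n. c i * b' i | c. \<forall>i<Suc n. c i \<in> K}"
        unfolding s by (intro CollectI exI[of _ "c(n := k)"]) (auto simp: less_Suc_eq)
    next
      fix x assume "x \<in> {\<Sum>i<Suc n. c i * b' i | c. \<forall>i<Suc n. c i \<in> K}"
      then obtain c where "x = c n * v + (\<Sum>i<n. c i * b i)" "\<forall>i<Suc n. c i \<in> K"
        unfolding s by blast
      moreover from this have "(\<Sum>i<n. c i * b i) \<in> E" unfolding b(2) by auto
      ultimately show "x \<in> R.line_extension K v E" unfolding line_extension_ambient by blast
    qed
    have mem: "b' i \<in> R.line_extension K v E" if "i < Suc n" for i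
    proof -
      have "b' i = (\<Sum>j<Suc n. (if j = i then 1 else 0) * b' j)"
        using that by (simp add: if_distrib[of "\<lambda>x. x * _"] cong: if_cong)
      then show ?thesis unfolding span using K.zero_mem K.one_mem by (intro CollectI exI conjI) auto
    qed
    have ind: "\<forall>i<Suc n. c i = 0" if c: "\<forall>i<Suc n. c i \<in> K" "(\<Sum>i<Suc n. c i * b' i) = 0" for c
    proof -
      have e: "c n * v + (\<Sum>i<n. c i * b i) = 0" using c(2) unfolding s .
      have "c n = 0"
      proof (rule ccontr)
        assume n: "c n \<noteq> 0"
        then have "v = - (\<Sum>i<n. c i * b i) / c n"
          using e by (simp add: field_simps eq_neg_iff_add_eq_0)
        also have "\<dots> = (\<Sum>i<n. (- c i / c n) * b i)"
          by (simp add: sum_negf sum_divide_distrib)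
        finally have "v \<in> E" unfolding b(2) using c(1)
            by (intro CollectI exI[of _ "\<lambda>i. - c i / c n"] conjI refl allI impI K.mems) auto
        then show False using Suc_dim.hyps by blast
      qed
      moreover from this have "(\<Sum>i<n. c i * b i) = 0" using e by simp
      then have "\<forall>i<n. c i = 0" using c(1) by (intro b(3)) auto
      ultimately show ?thesis by (metis less_Suc_eq)
    qed
    show ?case using span mem ind by (intro exI[of _ b']) blast
  qed
qed

text \<open>Gaussian elimination with pivot \<open>a i0 j0\<close>, carried out inside
  \<open>F\<close> so that the solution stays in the prescribed subfield.\<close>

lemma homogeneous_system:
  fixes F :: "'a::field set" and a :: "'i \<Rightarrow> 'j \<Rightarrow> 'a"
  assumes F: "set_subfield F"
    and "finite I" "finite J" "card I < card J" "\<And>i j. i \<in> I \<Longrightarrow> j \<in> J \<Longrightarrow> a i j \<in> F"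
  shows "\<exists>c. (\<forall>j\<in>J. c j \<in> F) \<and> (\<exists>j\<in>J. c j \<noteq> 0) \<and> (\<forall>i\<in>I. (\<Sum>j\<in>J. a i j * c j) = 0)"
  using assms(2-)
proof (induction I arbitrary: J a rule: finite_induct)
  case empty
  interpret F: set_subfield F by fact
  from empty obtain j where "j \<in> J" by fastforce
  then show ?case using F.one_mem by (intro exI[of _ "\<lambda>_. 1"]) auto
next
  case (insert i0 I)
  interpret F: set_subfield F by fact
  show ?case
  proof (cases "\<forall>j\<in>J. a i0 j = 0")
    case True
    have "card I < card J" using insert by simp
    then obtain c where "\<forall>j\<in>J. c j \<in> F" "\<exists>j\<in>J. c j \<noteq> 0" "\<forall>i\<in>I. (\<Sum>j\<in>J. a i j * c j) = 0"
      using insert.IH[of J a] insert.prems by auto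
    then show ?thesis using True by (intro exI[of _ c]) auto
  next
    case False
    then obtain j0 where j0: "j0 \<in> J" "a i0 j0 \<noteq> 0" by blast
    define a' where "a' = (\<lambda>i j. a i j - a i j0 * a i0 j / a i0 j0)"
    let ?J = "J - {j0}"
    have "card I < card ?J" using insert j0 by simp
    moreover have "a' i j \<in> F" if "i \<in> I" "j \<in> ?J" for i j
      using that insert.prems(3) j0 unfolding a'_def by (intro F.mems) auto
    ultimately obtain c where c: "\<forall>j\<in>?J. c j \<in> F" "\<exists>j\<in>?J. c j \<noteq> 0" "\<forall>i\<in>I. (\<Sum>j\<in>?J. a' i j * c j) = 0"
      using insert.IH[of ?J a'] insert.prems by auto
    define c' where "c' = c(j0 := - (\<Sum>j\<in>?J. a i0 j * c j) / a i0 j0)"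
    have split: "(\<Sum>j\<in>J. a i j * c' j) = a i j0 * c' j0 + (\<Sum>j\<in>?J. a i j * c j)" for i
      using sum.remove[OF insert.prems(1) j0(1), of "\<lambda>j. a i j * c' j"] by (simp add: c'_def)
    have "(\<Sum>j\<in>J. a i j * c' j) = 0" if "i \<in> insert i0 I" for i
    proof (cases "i = i0")
      case True
      then show ?thesis unfolding split using j0 by (simp add: c'_def)
    next
      case False
      then have "(\<Sum>j\<in>?J. a' i j * c j) = 0" using c that by blast
      moreover have "(\<Sum>j\<in>?J. a' i j * c j) = (\<Sum>j\<in>?J. a i j * c j) - a i j0 / a i0 j0 * (\<Sum>j\<in>?J. a i0 j * c j)"
        by (simp add: a'_def left_diff_distrib sum_subtractf sum_distrib_left mult.assoc)
      ultimately show ?thesis unfolding split by (simp add: c'_def)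
    qed
    moreover have "c' j \<in> F" if "j \<in> J" for j
    proof (cases "j = j0")
      case True
      have "(\<Sum>j\<in>?J. a i0 j * c j) \<in> F" using c insert.prems(3) by (intro F.mems) auto
      then show ?thesis using True insert.prems(3)[of i0 j0] j0 by (auto simp: c'_def intro!: F.mems)
    qed (use c that in \<open>auto simp: c'_def\<close>)
    moreover have "\<exists>j\<in>J. c' j \<noteq> 0" using c(2) by (auto simp: c'_def)
    ultimately show ?thesis by blast
  qed
qed

text \<open>The relation at \<open>x * y\<close> minus \<open>\<tau> y\<close> times the relation at
  \<open>x\<close> no longer involves \<open>\<tau>\<close>.\<close>

lemma dedekind_independence:
  fixes c :: "('a::field \<Rightarrow> 'a) \<Rightarrow> 'a"
  assumes "finite S" "1 \<in> M" "\<And>x y. x \<in> M \<Longrightarrow> y \<in> M \<Longrightarrow> x * y \<in> M"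
    and "\<And>\<sigma>. \<sigma> \<in> S \<Longrightarrow> \<sigma> 1 = 1" "\<And>\<sigma> x y. \<sigma> \<in> S \<Longrightarrow> x \<in> M \<Longrightarrow> y \<in> M \<Longrightarrow> \<sigma> (x * y) = \<sigma> x * \<sigma> y"
    and "\<And>\<sigma> \<tau>. \<sigma> \<in> S \<Longrightarrow> \<tau> \<in> S \<Longrightarrow> \<sigma> \<noteq> \<tau> \<Longrightarrow> \<exists>x\<in>M. \<sigma> x \<noteq> \<tau> x"
    and "\<And>x. x \<in> M \<Longrightarrow> (\<Sum>\<sigma>\<in>S. c \<sigma> * \<sigma> x) = 0"
  shows "\<forall>\<sigma>\<in>S. c \<sigma> = 0"
  using assms
proof (induction S arbitrary: c rule: finite_induct)
  case (insert \<tau> S)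
  have "\<forall>\<sigma>\<in>S. c \<sigma> * (\<sigma> y - \<tau> y) = 0" if y: "y \<in> M" for y
  proof (rule insert.IH)
    fix x assume x: "x \<in> M"
    have 1: "(\<Sum>\<sigma>\<in>S. c \<sigma> * \<sigma> x) = - (c \<tau> * \<tau> x)"
      using insert.prems(6)[OF x] insert.hyps by (simp add: eq_neg_iff_add_eq_0 add.commute)
    have 2: "(\<Sum>\<sigma>\<in>S. c \<sigma> * \<sigma> (x * y)) = - (c \<tau> * \<tau> (x * y))"
      using insert.prems(6)[OF insert.prems(2)[OF x y]] insert.hyps by (simp add: eq_neg_iff_add_eq_0 add.commute)
    have "(\<Sum>\<sigma>\<in>S. c \<sigma> * (\<sigma> y - \<tau> y) * \<sigma> x) = (\<Sum>\<sigma>\<in>S. c \<sigma> * \<sigma> (x * y) - \<tau> y * (c \<sigma> * \<sigma> x))"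
      using insert.prems(4) x y by (intro sum.cong) (auto simp: algebra_simps)
    also have "\<dots> = (\<Sum>\<sigma>\<in>S. c \<sigma> * \<sigma> (x * y)) - \<tau> y * (\<Sum>\<sigma>\<in>S. c \<sigma> * \<sigma> x)"
      by (simp add: sum_subtractf sum_distrib_left)
    also have "\<dots> = 0" unfolding 1 2 using insert.prems(4)[of \<tau> x y] x y by simp
    finally show "(\<Sum>\<sigma>\<in>S. c \<sigma> * (\<sigma> y - \<tau> y) * \<sigma> x) = 0" .
  qed (use insert.prems in blast)+
  then have S: "\<forall>\<sigma>\<in>S. c \<sigma> = 0"
    using insert.prems(5)[of _ \<tau>] insert.hyps(2)
    by (metis (no_types, lifting) insertCI mult_eq_0_iff right_minus_eq)
  then have "c \<tau> * \<tau> 1 = 0" using insert.prems(6)[OF insert.prems(1)] insert.hyps by simp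
  then show ?case using S insert.prems(3)[of \<tau>] by simp
qed simp

lemma GalI:
  assumes "bij_betw \<sigma> L L" "\<And>x y. x \<in> L \<Longrightarrow> y \<in> L \<Longrightarrow> \<sigma> (x + y) = \<sigma> x + \<sigma> y"
    "\<And>x y. x \<in> L \<Longrightarrow> y \<in> L \<Longrightarrow> \<sigma> (x * y) = \<sigma> x * \<sigma> y" "\<sigma> 1 = 1" "\<sigma> \<in> extensional L" "\<And>x. x \<in> K \<Longrightarrow> \<sigma> x = x"
  shows "(\<sigma> :: 'a::field \<Rightarrow> 'a) \<in> Gal K L"
  using assms by (auto simp: Gal_def ring_iso_def intro!: ring_hom_memI dest: bij_betwE)

lemma GalD:
  assumes "(\<sigma> :: 'a::field \<Rightarrow> 'a) \<in> Gal K L"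
  shows "bij_betw \<sigma> L L" "x \<in> L \<Longrightarrow> \<sigma> x \<in> L" "x \<in> L \<Longrightarrow> y \<in> L \<Longrightarrow> \<sigma> (x + y) = \<sigma> x + \<sigma> y"
    "x \<in> L \<Longrightarrow> y \<in> L \<Longrightarrow> \<sigma> (x * y) = \<sigma> x * \<sigma> y" "\<sigma> 1 = 1" "\<sigma> \<in> extensional L" "x \<in> K \<Longrightarrow> \<sigma> x = x"
proof -
  have h: "\<sigma> \<in> ring_hom (subring_struct L) (subring_struct L)" and b: "bij_betw \<sigma> L L"
    using assms by (auto simp: Gal_def ring_iso_def)
  show "bij_betw \<sigma> L L" by (rule b)
  show "x \<in> L \<Longrightarrow> \<sigma> x \<in> L" using b by (auto dest: bij_betwE)
  show "x \<in> L \<Longrightarrow> y \<in> L \<Longrightarrow> \<sigma> (x + y) = \<sigma> x + \<sigma> y" using ring_hom_add[OF h] by simp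
  show "x \<in> L \<Longrightarrow> y \<in> L \<Longrightarrow> \<sigma> (x * y) = \<sigma> x * \<sigma> y" using ring_hom_mult[OF h] by simp
  show "\<sigma> 1 = 1" using ring_hom_one[OF h] by simp
  show "\<sigma> \<in> extensional L" "x \<in> K \<Longrightarrow> \<sigma> x = x" using assms by (auto simp: Gal_def)
qed

lemma Gal_eqI:
  assumes "\<sigma> \<in> Gal K L" "\<tau> \<in> Gal K' L" "\<And>x. x \<in> L \<Longrightarrow> \<sigma> x = \<tau> x" shows "\<sigma> = (\<tau> :: 'a::field \<Rightarrow> 'a)"
  using assms by (intro extensionalityI[of _ L]) (auto dest: GalD)

lemma Gal_mono: "K \<subseteq> M \<Longrightarrow> Gal M L \<subseteq> Gal K L"
  by (auto simp: Gal_def)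

lemma Gal_compose:
  fixes \<sigma> :: "'a::field \<Rightarrow> 'a"
  assumes L: "set_subfield L" and KL: "K \<subseteq> L" and s: "\<sigma> \<in> Gal K L" and t: "\<tau> \<in> Gal K L"
  shows "compose L \<sigma> \<tau> \<in> Gal K L"
proof -
  interpret L: set_subfield L by fact
  note s = GalD[OF s] and t = GalD[OF t]
  show ?thesis
    by (rule GalI) (use bij_betw_compose[OF t(1) s(1)] s(2-7) t(2-7) L.add_mem L.mult_mem L.one_mem KL in
        \<open>auto simp: compose_eq subset_iff\<close>)
qed

lemma Gal_inverse:
  fixes \<sigma> :: "'a::field \<Rightarrow> 'a"
  assumes L: "set_subfield L" and KL: "K \<subseteq> L" and s: "\<sigma> \<in> Gal K L"
  shows "\<exists>\<tau>\<in>Gal K L. \<forall>x\<in>L. \<tau> (\<sigma> x) = x \<and> \<sigma> (\<tau> x) = x"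
proof -
  interpret L: set_subfield L by fact
  note s = GalD[OF s]
  define \<tau> where "\<tau> = restrict (inv_into L \<sigma>) L"
  have 1: "\<tau> (\<sigma> x) = x" "\<tau> x \<in> L" "\<sigma> (\<tau> x) = x" if "x \<in> L" for x
    using that s(1,2) bij_betw_inv_into_left[OF s(1)] bij_betw_inv_into_right[OF s(1)]
      bij_betw_imp_surj_on[OF s(1)] inv_into_into[of x \<sigma> L] by (auto simp: \<tau>_def)
  have eq: "\<tau> y = x" if "x \<in> L" "\<sigma> x = y" for x y using 1 that by blast
  have "\<tau> \<in> Gal K L"
  proof (rule GalI)
    show "bij_betw \<tau> L L" using bij_betw_inv_into[OF s(1)] unfolding \<tau>_def
      by (simp cong: bij_betw_cong)
    show "\<tau> (x + y) = \<tau> x + \<tau> y" if "x \<in> L" "y \<in> L" for x y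
      using 1 that s(3) by (intro eq) (auto intro: L.add_mem)
    show "\<tau> (x * y) = \<tau> x * \<tau> y" if "x \<in> L" "y \<in> L" for x y
      using 1 that s(4) by (intro eq) (auto intro: L.mult_mem)
    show "\<tau> 1 = 1" using s(5) by (intro eq L.one_mem)
    show "\<tau> x = x" if "x \<in> K" for x using s(7)[OF that] KL that by (intro eq) auto
  qed (simp add: \<tau>_def)
  then show ?thesis using 1 by blast
qed

lemma Gal_hom:
  fixes \<sigma> :: "'a::field \<Rightarrow> 'a"
  assumes L: "set_subfield L" and s: "\<sigma> \<in> Gal K L"
  shows "\<sigma> 0 = 0" "x \<in> L \<Longrightarrow> \<sigma> (- x) = - \<sigma> x" "x \<in> L \<Longrightarrow> y \<in> L \<Longrightarrow> \<sigma> (x - y) = \<sigma> x - \<sigma> y"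
    "(\<And>i. i \<in> I \<Longrightarrow> f i \<in> L) \<Longrightarrow> \<sigma> (\<Sum>i\<in>I. f i) = (\<Sum>i\<in>I. \<sigma> (f i))"
    "(\<And>i. i \<in> I \<Longrightarrow> f i \<in> L) \<Longrightarrow> \<sigma> (\<Prod>i\<in>I. f i) = (\<Prod>i\<in>I. \<sigma> (f i))"
    "x \<in> L \<Longrightarrow> \<sigma> (x ^ n) = \<sigma> x ^ n" "x \<in> L \<Longrightarrow> \<sigma> x = 0 \<longleftrightarrow> x = 0" "x \<in> L \<Longrightarrow> \<sigma> (inverse x) = inverse (\<sigma> x)"
proof -
  interpret L: set_subfield L by fact
  note s = GalD[OF s]
  have "\<sigma> 0 + \<sigma> 0 = \<sigma> 0" using s(3)[OF L.zero_mem L.zero_mem] by (simp only: add_0_left)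
  then have z: "\<sigma> 0 = 0" by (metis add_cancel_left_left)
  show "\<sigma> 0 = 0" by (rule z)
  have m: "\<sigma> (- x) = - \<sigma> x" if "x \<in> L" for x
    using s(3)[OF that L.uminus_mem[OF that]] z by (simp add: eq_neg_iff_add_eq_0 add.commute)
  show "x \<in> L \<Longrightarrow> \<sigma> (- x) = - \<sigma> x" by (rule m)
  show "x \<in> L \<Longrightarrow> y \<in> L \<Longrightarrow> \<sigma> (x - y) = \<sigma> x - \<sigma> y"
    using s(3)[of x "- y"] m[of y] L.uminus_mem by simp
  show "(\<And>i. i \<in> I \<Longrightarrow> f i \<in> L) \<Longrightarrow> \<sigma> (\<Sum>i\<in>I. f i) = (\<Sum>i\<in>I. \<sigma> (f i))"
    by (induction I rule: infinite_finite_induct) (auto simp: z s(3) L.sum_mem)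
  show "(\<And>i. i \<in> I \<Longrightarrow> f i \<in> L) \<Longrightarrow> \<sigma> (\<Prod>i\<in>I. f i) = (\<Prod>i\<in>I. \<sigma> (f i))"
    by (induction I rule: infinite_finite_induct) (auto simp: s(4,5) L.prod_mem)
  show "x \<in> L \<Longrightarrow> \<sigma> (x ^ n) = \<sigma> x ^ n" by (induction n) (auto simp: s(4,5) L.power_mem)
  show nz: "x \<in> L \<Longrightarrow> \<sigma> x = 0 \<longleftrightarrow> x = 0" for x
    using inj_onD[OF bij_betw_imp_inj_on[OF s(1)], of x 0] L.zero_mem z by auto
  show "\<sigma> (inverse x) = inverse (\<sigma> x)" if x: "x \<in> L"
  proof (cases "x = 0")
    case False
    then have "\<sigma> x * \<sigma> (inverse x) = 1" using s(4)[OF x L.inverse_mem[OF x]] s(5) by simp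
    then show ?thesis by (simp add: inverse_unique)
  qed (simp add: z)
qed

text \<open>Being Galois is expressed through the fixed field. Commutativity is included because it
  makes every intermediate field stable under the group, see \<open>gal_M_mem\<close>.\<close>

locale finite_galois = K: set_subfield K + L: set_subfield L for K L :: "'a::field set" +
  assumes KL: "K \<subseteq> L" and fin: "finite (Gal K L)"
    and fixed: "x \<in> L \<Longrightarrow> (\<And>\<sigma>. \<sigma> \<in> Gal K L \<Longrightarrow> \<sigma> x = x) \<Longrightarrow> x \<in> K"
    and comm: "\<sigma> \<in> Gal K L \<Longrightarrow> \<tau> \<in> Gal K L \<Longrightarrow> x \<in> L \<Longrightarrow> \<sigma> (\<tau> x) = \<tau> (\<sigma> x)"
begin

lemmas gal = GalD[of _ K L]
lemmas hom = Gal_hom[OF L.set_subfield_axioms, of _ K]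

lemma translation: assumes s: "\<sigma> \<in> Gal K L" shows "bij_betw (compose L \<sigma>) (Gal K L) (Gal K L)"
proof -
  have "inj_on (compose L \<sigma>) (Gal K L)"
  proof (rule inj_onI)
    fix \<tau> \<tau>' assume t: "\<tau> \<in> Gal K L" "\<tau>' \<in> Gal K L" "compose L \<sigma> \<tau> = compose L \<sigma> \<tau>'"
    show "\<tau> = \<tau>'"
    proof (rule Gal_eqI[OF t(1,2)])
      fix x assume x: "x \<in> L"
      then have "\<sigma> (\<tau> x) = \<sigma> (\<tau>' x)" using t(3) by (metis compose_eq)
      then show "\<tau> x = \<tau>' x"
        using inj_onD[OF bij_betw_imp_inj_on[OF gal(1)[OF s]]] gal(2) t x by blast
    qed
  qed
  moreover have "compose L \<sigma> ` Gal K L \<subseteq> Gal K L"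
    using Gal_compose[OF L.set_subfield_axioms KL s] by blast
  ultimately show ?thesis
    using fin by (simp add: bij_betw_def card_image card_subset_eq)
qed

lemma trace_translate:
  assumes "\<sigma> \<in> Gal K L" "x \<in> L" shows "\<sigma> (gal_trace K L x) = gal_trace K L x"
proof -
  have "\<sigma> (gal_trace K L x) = (\<Sum>\<tau>\<in>Gal K L. compose L \<sigma> \<tau> x)"
    unfolding gal_trace_def using assms gal(2) by (subst hom(4)) (auto simp: compose_eq)
  also have "\<dots> = gal_trace K L x"
    unfolding gal_trace_def by (rule sum.reindex_bij_betw[OF translation[OF assms(1)]])
  finally show ?thesis .
qed

lemma trace_mem_L: "x \<in> L \<Longrightarrow> gal_trace K L x \<in> L"
  unfolding gal_trace_def by (rule L.sum_mem) (rule gal(2))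

lemma trace_mem: "x \<in> L \<Longrightarrow> gal_trace K L x \<in> K"
  by (rule fixed[OF trace_mem_L]) (auto intro: trace_translate)

lemma norm_mem: assumes x: "x \<in> L" shows "(\<Prod>\<sigma>\<in>Gal K L. \<sigma> x) \<in> K"
proof (rule fixed)
  show "(\<Prod>\<sigma>\<in>Gal K L. \<sigma> x) \<in> L" by (rule L.prod_mem) (rule gal(2)[OF _ x])
  fix \<sigma> assume s: "\<sigma> \<in> Gal K L"
  have "\<sigma> (\<Prod>\<tau>\<in>Gal K L. \<tau> x) = (\<Prod>\<tau>\<in>Gal K L. compose L \<sigma> \<tau> x)"
    using s x gal(2) by (subst hom(5)) (auto simp: compose_eq)
  also have "\<dots> = (\<Prod>\<tau>\<in>Gal K L. \<tau> x)"
    by (rule prod.reindex_bij_betw[OF translation[OF s]])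
  finally show "\<sigma> (\<Prod>\<tau>\<in>Gal K L. \<tau> x) = (\<Prod>\<tau>\<in>Gal K L. \<tau> x)" .
qed

lemma trace_add: "x \<in> L \<Longrightarrow> y \<in> L \<Longrightarrow> gal_trace K L (x + y) = gal_trace K L x + gal_trace K L y"
  unfolding gal_trace_def sum.distrib[symmetric] by (rule sum.cong[OF refl gal(3)])

lemma trace_scale: "c \<in> K \<Longrightarrow> x \<in> L \<Longrightarrow> gal_trace K L (c * x) = c * gal_trace K L x"
  unfolding gal_trace_def sum_distrib_left
proof (rule sum.cong[OF refl])
  fix \<sigma> assume "c \<in> K" "x \<in> L" "\<sigma> \<in> Gal K L"
  then show "\<sigma> (c * x) = c * \<sigma> x" using gal(4)[of \<sigma> c x] gal(7)[of \<sigma> c] KL by auto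
qed

lemma trace_const: "c \<in> K \<Longrightarrow> gal_trace K L c = of_nat (card (Gal K L)) * c"
proof -
  assume c: "c \<in> K"
  have "(\<Sum>\<sigma>\<in>Gal K L. \<sigma> c) = (\<Sum>\<sigma>\<in>Gal K L. c)" by (rule sum.cong[OF refl gal(7)[OF _ c]])
  then show ?thesis by (simp add: gal_trace_def)
qed

text \<open>Artin's argument: a nonzero solution of minimal support is Galois invariant after normalization.\<close>

lemma card_conjugate_tuples:
  assumes J: "finite J" and x: "\<And>j. j \<in> J \<Longrightarrow> x j \<in> L"
    and ind: "\<And>c. (\<And>j. j \<in> J \<Longrightarrow> c j \<in> K) \<Longrightarrow> (\<Sum>j\<in>J. c j * x j) = 0 \<Longrightarrow> \<forall>j\<in>J. c j = 0"
  shows "card J \<le> card ((\<lambda>\<sigma>. restrict (\<lambda>j. \<sigma> (x j)) J) ` Gal K L)"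
proof (rule ccontr)
  let ?T = "(\<lambda>\<sigma>. restrict (\<lambda>j. \<sigma> (x j)) J) ` Gal K L"
  assume "\<not> card J \<le> card ?T"
  then have lt: "card ?T < card J" by simp
  have mem: "t j \<in> L" if t: "t \<in> ?T" and j: "j \<in> J" for t j
  proof -
    obtain \<sigma> where "\<sigma> \<in> Gal K L" "t = restrict (\<lambda>j. \<sigma> (x j)) J" using t by blast
    then show ?thesis using gal(2)[OF _ x[OF j]] j by simp
  qed
  have "\<exists>c. (\<forall>j\<in>J. c j \<in> L) \<and> (\<exists>j\<in>J. c j \<noteq> 0) \<and> (\<forall>t\<in>?T. (\<Sum>j\<in>J. t j * c j) = 0)"
    by (rule homogeneous_system[OF L.set_subfield_axioms finite_imageI[OF fin] J lt mem])
  then obtain c where c': "\<forall>j\<in>J. c j \<in> L" "\<exists>j\<in>J. c j \<noteq> 0" "\<forall>t\<in>?T. (\<Sum>j\<in>J. t j * c j) = 0"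
    by (elim exE conjE)
  have "(\<Sum>j\<in>J. \<sigma> (x j) * c j) = 0" if "\<sigma> \<in> Gal K L" for \<sigma>
  proof -
    have "(\<Sum>j\<in>J. \<sigma> (x j) * c j) = (\<Sum>j\<in>J. restrict (\<lambda>j. \<sigma> (x j)) J j * c j)"
      by (rule sum.cong) simp_all
    also have "\<dots> = 0" by (rule bspec[OF c'(3) imageI[OF that]])
    finally show ?thesis .
  qed
  from c'(1,2) this have c: "\<forall>j\<in>J. c j \<in> L" "\<exists>j\<in>J. c j \<noteq> 0"
    "\<forall>\<sigma>\<in>Gal K L. (\<Sum>j\<in>J. \<sigma> (x j) * c j) = 0" by blast+
  define sol where "sol = (\<lambda>c :: 'b \<Rightarrow> 'a. (\<forall>j\<in>J. c j \<in> L) \<and> (\<forall>\<sigma>\<in>Gal K L. (\<Sum>j\<in>J. \<sigma> (x j) * c j) = 0))"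
  define supp where "supp = (\<lambda>c :: 'b \<Rightarrow> 'a. {j\<in>J. c j \<noteq> 0})"
  have "sol c \<longrightarrow> supp c = {}" for c
  proof (induction "card (supp c)" arbitrary: c rule: less_induct)
    case less
    show ?case
    proof (intro impI, rule ccontr)
      assume s: "sol c" and "supp c \<noteq> {}"
      then obtain j0 where j0: "j0 \<in> J" "c j0 \<noteq> 0" by (auto simp: supp_def)
      define c' where "c' = (\<lambda>j. c j / c j0)"
      have s': "sol c'"
        using s j0(1) unfolding sol_def c'_def
        by (auto simp: L.divide_mem simp flip: sum_divide_distrib)
      have sL: "c' j \<in> L" if "j \<in> J" for j using s' that by (simp add: sol_def)
      have sz: "(\<Sum>j\<in>J. \<sigma> (x j) * c' j) = 0" if "\<sigma> \<in> Gal K L" for \<sigma>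
        using s' that by (simp add: sol_def)
      have fixd: "\<tau> (c' j) = c' j" if t: "\<tau> \<in> Gal K L" and j: "j \<in> J" for \<tau> j
      proof -
        define c'' where "c'' = (\<lambda>j. \<tau> (c' j) - c' j)"
        have "(\<Sum>j\<in>J. \<sigma> (x j) * \<tau> (c' j)) = 0" if sg: "\<sigma> \<in> Gal K L" for \<sigma>
        proof -
          have "\<sigma> \<in> compose L \<tau> ` Gal K L"
            using bij_betw_imp_surj_on[OF translation[OF t]] sg by simp
          then obtain \<rho> where r: "\<rho> \<in> Gal K L" "compose L \<tau> \<rho> = \<sigma>" by (auto elim: imageE)
          have "(\<Sum>j\<in>J. \<sigma> (x j) * \<tau> (c' j)) = (\<Sum>j\<in>J. \<tau> (\<rho> (x j) * c' j))"
          proof (rule sum.cong)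
            fix j assume j: "j \<in> J"
            have "\<sigma> (x j) = \<tau> (\<rho> (x j))" unfolding r(2)[symmetric] by (rule compose_eq[OF x[OF j]])
            then show "\<sigma> (x j) * \<tau> (c' j) = \<tau> (\<rho> (x j) * c' j)"
              using gal(4)[OF t, of "\<rho> (x j)" "c' j"] gal(2)[OF r(1) x[OF j]] sL[OF j] by simp
          qed simp
          also have "\<dots> = \<tau> (\<Sum>j\<in>J. \<rho> (x j) * c' j)"
            by (rule hom(4)[OF t, symmetric], rule L.mult_mem, rule gal(2)[OF r(1) x], assumption, rule sL)
          also have "\<dots> = 0" unfolding sz[OF r(1)] by (rule hom(1)[OF t])
          finally show ?thesis .
        qed
        then have s'': "sol c''"
          using sz L.diff_mem[OF gal(2)[OF t sL] sL]
          by (simp add: sol_def c''_def right_diff_distrib sum_subtractf)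
        have "supp c'' \<subseteq> supp c - {j0}"
          using j0 hom(1)[OF t] gal(5)[OF t] by (auto simp: supp_def c''_def c'_def)
        moreover have "card (supp c - {j0}) < card (supp c)"
          using j0 J by (intro psubset_card_mono) (auto simp: supp_def)
        moreover have "finite (supp c - {j0})" using J by (simp add: supp_def)
        ultimately have "card (supp c'') < card (supp c)" by (meson card_mono le_less_trans)
        then have "supp c'' = {}" using less s'' by blast
        then show ?thesis using j by (auto simp: supp_def c''_def)
      qed
      have K: "c' j \<in> K" if "j \<in> J" for j
        by (rule fixed[of "c' j"], rule sL[OF that], rule fixd[OF _ that])
      \<comment> \<open>At the identity automorphism the invariant solution becomes a linear
        relation over \<open>K\<close>, which \<open>ind\<close> forbids.\<close>
      define \<iota> where "\<iota> = restrict (\<lambda>x. x) L"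
      have "\<iota> \<in> Gal K L"
        using KL L.add_mem L.mult_mem L.one_mem
        by (intro GalI) (auto simp: \<iota>_def bij_betw_def inj_on_def)
      then have "(\<Sum>j\<in>J. \<iota> (x j) * c' j) = 0" using s' by (simp add: sol_def)
      then have "(\<Sum>j\<in>J. c' j * x j) = 0" using x by (simp add: \<iota>_def mult.commute)
      then have "c' j0 = 0" using ind[of c'] K j0(1) by blast
      then show False using j0 by (simp add: c'_def)
    qed
  qed
  moreover have "sol c" using c by (simp add: sol_def)
  ultimately show False using c(2) by (auto simp: supp_def)
qed

end

text \<open>Dedekind's independence of characters bounds the number of embeddings by the degree.\<close>

lemma card_embeddings_le:
  fixes K M :: "'a::field set"
  assumes K: "set_subfield K" and M: "set_subfield M" and KM: "K \<subseteq> M" and d: "ring.dimension ambient n K M"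
    and S: "finite S"
    and one: "\<And>\<sigma>. \<sigma> \<in> S \<Longrightarrow> \<sigma> 1 = 1"
    and add: "\<And>\<sigma> x y. \<sigma> \<in> S \<Longrightarrow> x \<in> M \<Longrightarrow> y \<in> M \<Longrightarrow> \<sigma> (x + y) = \<sigma> x + \<sigma> y"
    and mult: "\<And>\<sigma> x y. \<sigma> \<in> S \<Longrightarrow> x \<in> M \<Longrightarrow> y \<in> M \<Longrightarrow> \<sigma> (x * y) = \<sigma> x * \<sigma> y"
    and fixK: "\<And>\<sigma> x. \<sigma> \<in> S \<Longrightarrow> x \<in> K \<Longrightarrow> \<sigma> x = x"
    and dist: "\<And>\<sigma> \<tau>. \<sigma> \<in> S \<Longrightarrow> \<tau> \<in> S \<Longrightarrow> \<sigma> \<noteq> \<tau> \<Longrightarrow> \<exists>x\<in>M. \<sigma> x \<noteq> \<tau> x"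
  shows "card S \<le> n"
proof (rule ccontr)
  assume "\<not> card S \<le> n"
  then have n: "card {..<n} < card S" by simp
  interpret K: set_subfield K by fact
  interpret M: set_subfield M by fact
  obtain b where b: "\<forall>i<n. b i \<in> M" "M = {\<Sum>i<n. c i * b i | c. \<forall>i<n. c i \<in> K}"
    using dimension_basis[OF K d] by blast
  have "set_subfield (UNIV :: 'a set)" by unfold_locales auto
  from homogeneous_system[OF this finite_lessThan S n, of "\<lambda>i \<sigma>. \<sigma> (b i)"]
  obtain c where c: "\<exists>\<sigma>\<in>S. c \<sigma> \<noteq> 0" "\<forall>i<n. (\<Sum>\<sigma>\<in>S. \<sigma> (b i) * c \<sigma>) = 0" by auto
  have "(\<Sum>\<sigma>\<in>S. c \<sigma> * \<sigma> x) = 0" if xM: "x \<in> M" for x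
  proof -
    obtain k where k: "x = (\<Sum>i<n. k i * b i)" "\<forall>i<n. k i \<in> K" using subsetD[OF equalityD1[OF b(2)] xM] by blast
    have eq: "\<sigma> x = (\<Sum>i<n. k i * \<sigma> (b i))" if s: "\<sigma> \<in> S" for \<sigma>
    proof -
      have "\<sigma> (\<Sum>i\<in>I. k i * b i) = (\<Sum>i\<in>I. k i * \<sigma> (b i))" if "I \<subseteq> {..<n}" for I
        using finite_subset[OF that finite_lessThan] that
      proof (induction I rule: finite_induct)
        case empty
        show ?case using fixK[OF s K.zero_mem] by simp
      next
        case (insert i I)
        then have m: "k i \<in> M" "b i \<in> M" "k i \<in> K" using k(2) b(1) KM by auto
        moreover have "(\<Sum>i\<in>I. k i * b i) \<in> M"
          using insert.prems k(2) b(1) KM by (intro M.sum_mem M.mult_mem) auto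
        ultimately show ?case
          using insert add[OF s M.mult_mem[OF m(1,2)]] mult[OF s m(1,2)] fixK[OF s m(3)] by simp
      qed
      then show ?thesis unfolding k by simp
    qed
    have "c \<sigma> * \<sigma> x = (\<Sum>i<n. k i * (\<sigma> (b i) * c \<sigma>))" if "\<sigma> \<in> S" for \<sigma>
      unfolding eq[OF that] by (simp add: sum_distrib_left mult_ac)
    then have "(\<Sum>\<sigma>\<in>S. c \<sigma> * \<sigma> x) = (\<Sum>\<sigma>\<in>S. \<Sum>i<n. k i * (\<sigma> (b i) * c \<sigma>))"
      by (intro sum.cong refl)
    also have "\<dots> = (\<Sum>i<n. k i * (\<Sum>\<sigma>\<in>S. \<sigma> (b i) * c \<sigma>))"
      by (subst sum.swap) (simp add: sum_distrib_left)
    also have "\<dots> = 0" using c(2) by simp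
    finally show ?thesis .
  qed
  then have z: "\<And>x. x \<in> M \<Longrightarrow> (\<Sum>\<sigma>\<in>S. c \<sigma> * \<sigma> x) = 0" .
  have "\<forall>\<sigma>\<in>S. c \<sigma> = 0"
  proof (rule dedekind_independence[where S = S and M = M and c = c])
    show "\<sigma> 1 = 1" if "\<sigma> \<in> S" for \<sigma> by (rule one[OF that])
    show "\<sigma> (x * y) = \<sigma> x * \<sigma> y" if "\<sigma> \<in> S" "x \<in> M" "y \<in> M" for \<sigma> x y by (rule mult[OF that])
    show "\<exists>x\<in>M. \<sigma> x \<noteq> \<tau> x" if "\<sigma> \<in> S" "\<tau> \<in> S" "\<sigma> \<noteq> \<tau>" for \<sigma> \<tau> by (rule dist[OF that])
  qed (rule S M.one_mem M.mult_mem z; assumption)+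
  then show False using c(1) by blast
qed

section \<open>Restriction to an intermediate field\<close>

locale galois_intermediate = finite_galois K L + M: set_subfield M
  for K L M :: "'a::field set" +
  fixes n :: nat
  assumes KsM: "K \<subseteq> M" and MsL: "M \<subseteq> L" and dim_M: "ring.dimension ambient n K M"
begin

definition res :: "('a \<Rightarrow> 'a) \<Rightarrow> 'a \<Rightarrow> 'a" where "res \<sigma> = restrict \<sigma> M"

lemma res_eq: "x \<in> M \<Longrightarrow> res \<sigma> x = \<sigma> x" by (simp add: res_def)

lemma card_res_le: "card (res ` Gal K L) \<le> n"
proof (rule card_embeddings_le[OF K.set_subfield_axioms M.set_subfield_axioms KsM dim_M])
  show "finite (res ` Gal K L)" using fin by simp
  show "\<exists>x\<in>M. \<sigma> x \<noteq> \<tau> x" if "\<sigma> \<in> res ` Gal K L" "\<tau> \<in> res ` Gal K L" "\<sigma> \<noteq> \<tau>" for \<sigma> \<tau>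
    using that extensionalityI[of \<sigma> M \<tau>] by (auto simp: res_def)
qed (use gal MsL KsM M.one_mem M.add_mem M.mult_mem in \<open>auto simp: res_eq subset_iff\<close>)

lemma Gal_M_L: "Gal M L \<subseteq> Gal K L" by (rule Gal_mono[OF KsM])

lemma res_fiber:
  assumes s: "\<sigma> \<in> Gal K L" and t: "\<tau> \<in> Gal K L" and eq: "res \<sigma> = res \<tau>"
  shows "\<exists>h\<in>Gal M L. \<tau> = compose L \<sigma> h"
proof -
  obtain \<rho> where r: "\<rho> \<in> Gal K L" "\<And>x. x \<in> L \<Longrightarrow> \<rho> (\<sigma> x) = x \<and> \<sigma> (\<rho> x) = x"
    using Gal_inverse[OF L.set_subfield_axioms KL s] by blast
  define h where "h = compose L \<rho> \<tau>"
  have hK: "h \<in> Gal K L" unfolding h_def by (rule Gal_compose[OF L.set_subfield_axioms KL r(1) t])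
  have hx: "h x = \<rho> (\<tau> x)" if "x \<in> L" for x using that by (simp add: h_def compose_eq)
  have "h x = x" if x: "x \<in> M" for x
  proof -
    have "\<tau> x = \<sigma> x" using eq x res_eq by metis
    then show ?thesis using hx r(2) x MsL by auto
  qed
  then have "h \<in> Gal M L" using hK by (auto simp: Gal_def)
  moreover have "\<tau> = compose L \<sigma> h"
  proof (rule Gal_eqI[OF t])
    show "compose L \<sigma> h \<in> Gal K L" by (rule Gal_compose[OF L.set_subfield_axioms KL s hK])
    show "\<tau> x = compose L \<sigma> h x" if "x \<in> L" for x
      using that r(2)[OF gal(2)[OF t that]] by (simp add: compose_eq hx)
  qed
  ultimately show ?thesis by blast
qed

text \<open>If \<open>y\<close> were outside \<open>M\<close>, a basis of \<open>M\<close> together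
  with \<open>y\<close> would be independent and have at least \<open>n + 1\<close> tuples of
  conjugates. But automorphisms with the same restriction to \<open>M\<close> differ by an element
  of \<open>Gal M L\<close>, which fixes \<open>y\<close> too, so the tuples are at most as many as
  the restrictions, that is, at most \<open>n\<close>.\<close>

lemma fixed_field_M:
  assumes y: "y \<in> L" and H: "\<And>h. h \<in> Gal M L \<Longrightarrow> h y = y" shows "y \<in> M"
proof (rule ccontr)
  assume yM: "y \<notin> M"
  obtain b where b: "\<forall>i<n. b i \<in> M" "M = {\<Sum>i<n. c i * b i | c. \<forall>i<n. c i \<in> K}"
    "\<And>c. \<forall>i<n. c i \<in> K \<Longrightarrow> (\<Sum>i<n. c i * b i) = 0 \<Longrightarrow> \<forall>i<n. c i = 0"
    using dimension_basis[OF K.set_subfield_axioms dim_M] by blast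
  define x where "x = b(n := y)"
  let ?J = "{..<Suc n}"
  have xL: "x j \<in> L" if "j \<in> ?J" for j
    using that b(1) MsL y by (auto simp: x_def less_Suc_eq)
  have "card ?J \<le> card ((\<lambda>\<sigma>. restrict (\<lambda>j. \<sigma> (x j)) ?J) ` Gal K L)"
  proof (rule card_conjugate_tuples[OF _ xL])
    fix c assume c: "\<And>j. j \<in> ?J \<Longrightarrow> c j \<in> K" "(\<Sum>j<Suc n. c j * x j) = 0"
    have s: "c n * y + (\<Sum>i<n. c i * b i) = 0" using c(2) by (simp add: x_def add.commute)
    have "c n = 0"
    proof (rule ccontr)
      assume cn: "c n \<noteq> 0"
      then have "y = - (\<Sum>i<n. c i * b i) / c n"
        using s by (simp add: field_simps eq_neg_iff_add_eq_0)
      moreover have "(\<Sum>i<n. c i * b i) \<in> M" using c(1) b(1) KsM by (intro M.sum_mem M.mult_mem) auto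
      moreover have "c n \<in> M" using c(1)[of n] KsM by auto
      ultimately show False using yM by (auto intro: M.divide_mem M.uminus_mem)
    qed
    moreover from this have "(\<Sum>i<n. c i * b i) = 0" using s by simp
    then have "\<forall>i<n. c i = 0" using c(1) by (intro b(3)) auto
    ultimately show "\<forall>j\<in>?J. c j = 0" by (metis lessThan_iff less_Suc_eq)
  qed simp
  also have "(\<lambda>\<sigma>. restrict (\<lambda>j. \<sigma> (x j)) ?J) ` Gal K L
      \<subseteq> (\<lambda>r. restrict (\<lambda>j. (SOME \<sigma>. \<sigma> \<in> Gal K L \<and> res \<sigma> = r) (x j)) ?J) ` (res ` Gal K L)"
  proof
    fix t assume "t \<in> (\<lambda>\<sigma>. restrict (\<lambda>j. \<sigma> (x j)) ?J) ` Gal K L"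
    then obtain \<sigma> where s: "\<sigma> \<in> Gal K L" "t = restrict (\<lambda>j. \<sigma> (x j)) ?J" by blast
    define \<tau> where "\<tau> = (SOME \<tau>. \<tau> \<in> Gal K L \<and> res \<tau> = res \<sigma>)"
    have t: "\<tau> \<in> Gal K L" "res \<tau> = res \<sigma>"
      using someI[of "\<lambda>\<tau>. \<tau> \<in> Gal K L \<and> res \<tau> = res \<sigma>" \<sigma>] s(1) by (auto simp: \<tau>_def)
    obtain h where h: "h \<in> Gal M L" "\<sigma> = compose L \<tau> h" using res_fiber[OF t(1) s(1) t(2)] by blast
    have "h (x j) = x j" if "j \<in> ?J" for j
      using that b(1) GalD(7)[OF h(1)] H[OF h(1)] by (auto simp: x_def less_Suc_eq)
    then have "t = restrict (\<lambda>j. \<tau> (x j)) ?J"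
      unfolding s(2) h(2) using xL by (auto simp: compose_eq restrict_def)
    then show "t \<in> (\<lambda>r. restrict (\<lambda>j. (SOME \<sigma>. \<sigma> \<in> Gal K L \<and> res \<sigma> = r) (x j)) ?J) ` (res ` Gal K L)"
      using s(1) unfolding \<tau>_def by blast
  qed
  then have "card ((\<lambda>\<sigma>. restrict (\<lambda>j. \<sigma> (x j)) ?J) ` Gal K L) \<le> card (res ` Gal K L)"
    using fin by (meson card_mono card_image_le finite_imageI le_trans)
  finally show False using card_res_le by simp
qed

lemma card_res: "card (res ` Gal K L) = n"
proof (rule antisym[OF card_res_le])
  obtain b where b: "\<forall>i<n. b i \<in> M" "M = {\<Sum>i<n. c i * b i | c. \<forall>i<n. c i \<in> K}"
    "\<And>c. \<forall>i<n. c i \<in> K \<Longrightarrow> (\<Sum>i<n. c i * b i) = 0 \<Longrightarrow> \<forall>i<n. c i = 0"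
    using dimension_basis[OF K.set_subfield_axioms dim_M] by blast
  have "card {..<n} \<le> card ((\<lambda>\<sigma>. restrict (\<lambda>j. \<sigma> (b j)) {..<n}) ` Gal K L)"
    using b(1,3) MsL by (intro card_conjugate_tuples) auto
  also have "(\<lambda>\<sigma>. restrict (\<lambda>j. \<sigma> (b j)) {..<n}) ` Gal K L = (\<lambda>r. restrict (\<lambda>j. r (b j)) {..<n}) ` (res ` Gal K L)"
    using b(1) by (auto simp: image_image res_eq intro!: image_cong restrict_ext)
  also have "card \<dots> \<le> card (res ` Gal K L)" using fin by (intro card_image_le) simp
  finally show "n \<le> card (res ` Gal K L)" by simp
qed

lemma gal_M_mem: assumes s: "\<sigma> \<in> Gal K L" and y: "y \<in> M" shows "\<sigma> y \<in> M"
proof (rule fixed_field_M)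
  show "\<sigma> y \<in> L" using gal(2)[OF s] y MsL by blast
  fix h assume h: "h \<in> Gal M L"
  then have "h (\<sigma> y) = \<sigma> (h y)" using comm[of h \<sigma> y] s y Gal_M_L MsL by blast
  then show "h (\<sigma> y) = \<sigma> y" using GalD(7)[OF h y] by simp
qed

lemma res_Gal: assumes s: "\<sigma> \<in> Gal K L" shows "res \<sigma> \<in> Gal K M"
proof (rule GalI)
  obtain \<rho> where r: "\<rho> \<in> Gal K L" "\<And>x. x \<in> L \<Longrightarrow> \<rho> (\<sigma> x) = x \<and> \<sigma> (\<rho> x) = x"
    using Gal_inverse[OF L.set_subfield_axioms KL s] by blast
  have "res \<sigma> ` M = M"
  proof
    show "res \<sigma> ` M \<subseteq> M" using gal_M_mem[OF s] by (auto simp: res_eq)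
    show "M \<subseteq> res \<sigma> ` M"
    proof
      fix x assume x: "x \<in> M"
      then have "x = res \<sigma> (\<rho> x)" using r(2)[of x] gal_M_mem[OF r(1) x] MsL by (auto simp: res_eq)
      then show "x \<in> res \<sigma> ` M" using gal_M_mem[OF r(1) x] by blast
    qed
  qed
  moreover have "inj_on (res \<sigma>) M"
    using inj_on_subset[OF bij_betw_imp_inj_on[OF gal(1)[OF s]] MsL] by (auto simp: inj_on_def res_eq)
  ultimately show "bij_betw (res \<sigma>) M M" by (simp add: bij_betw_def)
qed (use gal[OF s] MsL KsM M.one_mem M.add_mem M.mult_mem in \<open>auto simp: res_eq subset_iff\<close>,
    simp add: res_def)

text \<open>The restrictions already provide \<open>n\<close> automorphisms of \<open>M\<close>, and
  Dedekind's bound leaves no room for others.\<close>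

lemma Gal_K_M: "Gal K M = res ` Gal K L" "finite (Gal K M)" "card (Gal K M) = n"
proof -
  have le: "card S \<le> n" if S: "finite S" "S \<subseteq> Gal K M" for S
  proof (rule card_embeddings_le[OF K.set_subfield_axioms M.set_subfield_axioms KsM dim_M S(1)])
    show "\<exists>x\<in>M. \<sigma> x \<noteq> \<tau> x" if "\<sigma> \<in> S" "\<tau> \<in> S" "\<sigma> \<noteq> \<tau>" for \<sigma> \<tau>
      using that S(2) Gal_eqI[of \<sigma> K M \<tau> K] by blast
  qed (use S(2) GalD[of _ K M] in blast)+
  have f': "finite (Gal K M) \<and> card (Gal K M) \<le> n"
    by (rule finite_if_finite_subsets_card_bdd) (use le in blast)
  then show f: "finite (Gal K M)" by simp
  have sub: "res ` Gal K L \<subseteq> Gal K M" using res_Gal by blast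
  show "Gal K M = res ` Gal K L"
    using card_seteq[OF f sub] le[OF f] card_res by simp
  then show "card (Gal K M) = n" using card_res by simp
qed

lemma Gal_M_L_fin: "finite (Gal M L)"
  using finite_subset[OF Gal_M_L fin] .

sublocale bot: finite_galois K M
proof
  show "x \<in> K" if "x \<in> M" "\<And>\<sigma>. \<sigma> \<in> Gal K M \<Longrightarrow> \<sigma> x = x" for x
  proof (rule fixed)
    show "x \<in> L" using that(1) MsL by blast
    show "\<sigma> x = x" if s: "\<sigma> \<in> Gal K L" for \<sigma>
      using \<open>\<And>\<sigma>. \<sigma> \<in> Gal K M \<Longrightarrow> \<sigma> x = x\<close>[of "res \<sigma>"] s \<open>x \<in> M\<close> by (simp add: Gal_K_M(1) res_eq)
  qed
  show "\<sigma> (\<tau> x) = \<tau> (\<sigma> x)" if "\<sigma> \<in> Gal K M" "\<tau> \<in> Gal K M" "x \<in> M" for \<sigma> \<tau> x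
    using that comm MsL gal_M_mem by (auto simp: Gal_K_M(1) res_eq)
qed (use KsM Gal_K_M in auto)

sublocale top: finite_galois M L
proof
  show "\<sigma> (\<tau> x) = \<tau> (\<sigma> x)" if "\<sigma> \<in> Gal M L" "\<tau> \<in> Gal M L" "x \<in> L" for \<sigma> \<tau> x
    using that comm Gal_M_L by blast
qed (use MsL Gal_M_L_fin fixed_field_M in auto)

lemma fiber_eq:
  assumes "\<sigma> \<in> Gal K L"
  shows "{\<tau> \<in> Gal K L. res \<tau> = res \<sigma>} = compose L \<sigma> ` Gal M L" and "inj_on (compose L \<sigma>) (Gal M L)"
proof -
  show "{\<tau> \<in> Gal K L. res \<tau> = res \<sigma>} = compose L \<sigma> ` Gal M L"
  proof (intro equalityI subsetI)
    fix \<tau> assume "\<tau> \<in> {\<tau> \<in> Gal K L. res \<tau> = res \<sigma>}"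
    then show "\<tau> \<in> compose L \<sigma> ` Gal M L" using res_fiber[of \<sigma> \<tau>] assms by auto
  next
    fix \<tau> assume "\<tau> \<in> compose L \<sigma> ` Gal M L"
    then obtain h where h: "h \<in> Gal M L" "\<tau> = compose L \<sigma> h" by blast
    have "\<tau> \<in> Gal K L" using Gal_compose[OF L.set_subfield_axioms KL assms] h Gal_M_L by blast
    moreover have "res \<tau> = res \<sigma>"
    proof -
      have "compose L \<sigma> h x = \<sigma> x" if "x \<in> M" for x
        using that GalD(7)[OF h(1) that] MsL by (simp add: compose_eq subset_iff)
      then show ?thesis unfolding res_def h(2) by (simp add: restrict_def fun_eq_iff)
    qed
    ultimately show "\<tau> \<in> {\<tau> \<in> Gal K L. res \<tau> = res \<sigma>}" by blast
  qed
  show "inj_on (compose L \<sigma>) (Gal M L)"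
    using inj_on_subset[OF bij_betw_imp_inj_on[OF translation[OF assms]] Gal_M_L] .
qed

lemma sum_fibers:
  "sum f (Gal K L) = (\<Sum>\<rho>\<in>Gal K M. \<Sum>\<tau>\<in>{\<tau> \<in> Gal K L. res \<tau> = \<rho>}. f \<tau>)"
  unfolding Gal_K_M(1) by (rule sum.group[symmetric]) (use fin in auto)

lemma trace_tower:
  assumes x: "x \<in> L" shows "gal_trace K M (gal_trace M L x) = gal_trace K L x"
proof -
  have "gal_trace K L x = (\<Sum>\<rho>\<in>Gal K M. \<Sum>\<tau>\<in>{\<tau> \<in> Gal K L. res \<tau> = \<rho>}. \<tau> x)"
    unfolding gal_trace_def by (rule sum_fibers)
  also have "\<dots> = (\<Sum>\<rho>\<in>Gal K M. \<rho> (gal_trace M L x))"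
  proof (rule sum.cong)
    fix \<rho> assume "\<rho> \<in> Gal K M"
    then obtain \<sigma> where s: "\<sigma> \<in> Gal K L" "\<rho> = res \<sigma>" by (auto simp: Gal_K_M(1))
    have "(\<Sum>\<tau>\<in>{\<tau> \<in> Gal K L. res \<tau> = \<rho>}. \<tau> x) = (\<Sum>h\<in>Gal M L. \<sigma> (h x))"
      unfolding s(2) fiber_eq(1)[OF s(1)] sum.reindex[OF fiber_eq(2)[OF s(1)]]
      using x by (simp add: compose_eq)
    also have "\<dots> = \<sigma> (gal_trace M L x)"
      unfolding gal_trace_def using GalD(2)[of _ M L] x by (intro hom(4)[OF s(1), symmetric]) auto
    also have "\<dots> = \<rho> (gal_trace M L x)" unfolding s(2) using top.trace_mem[OF x] by (simp add: res_eq)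
    finally show "(\<Sum>\<tau>\<in>{\<tau> \<in> Gal K L. res \<tau> = \<rho>}. \<tau> x) = \<rho> (gal_trace M L x)" .
  qed simp
  finally show ?thesis by (simp add: gal_trace_def)
qed

lemma card_tower: "card (Gal K L) = n * card (Gal M L)"
proof -
  have "card (Gal K L) = (\<Sum>\<rho>\<in>Gal K M. \<Sum>\<tau>\<in>{\<tau> \<in> Gal K L. res \<tau> = \<rho>}. 1)"
    using sum_fibers[of "\<lambda>_. 1 :: nat"] by simp
  also have "\<dots> = (\<Sum>\<rho>\<in>Gal K M. card (Gal M L))"
  proof (rule sum.cong)
    fix \<rho> assume "\<rho> \<in> Gal K M"
    then obtain \<sigma> where s: "\<sigma> \<in> Gal K L" "\<rho> = res \<sigma>" by (auto simp: Gal_K_M(1))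
    show "(\<Sum>\<tau>\<in>{\<tau> \<in> Gal K L. res \<tau> = \<rho>}. 1) = card (Gal M L)"
      unfolding s(2) fiber_eq(1)[OF s(1)] using card_image[OF fiber_eq(2)[OF s(1)]] by simp
  qed simp
  finally show ?thesis using Gal_K_M(3) by simp
qed

lemma trace_of_M:
  assumes x: "x \<in> M" shows "gal_trace K L x = of_nat (card (Gal M L)) * gal_trace K M x"
proof -
  have xL: "x \<in> L" using x MsL by blast
  have "gal_trace K L x = gal_trace K M (of_nat (card (Gal M L)) * x)"
    using trace_tower[OF xL] top.trace_const[OF x] by simp
  then show ?thesis using bot.trace_scale[OF K.of_nat_mem x] by simp
qed

end

section \<open>The field generated by a primitive torsion point\<close>

definition polys_over :: "'a::comm_ring_1 set \<Rightarrow> 'a poly set"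
  where "polys_over K = {h. \<forall>i. poly.coeff h i \<in> K}"

lemma degree_lessI:
  fixes p :: "'b::zero poly"
  assumes "Polynomial.degree p \<le> n" "poly.coeff p n = 0" "0 < n" shows "Polynomial.degree p < n"
  using assms by (metis degree_0 leading_coeff_0_iff le_neq_implies_less)

context set_subfield
begin

lemma polys_over_0: "0 \<in> polys_over K" by (simp add: polys_over_def zero_mem)
lemma polys_over_add: "f \<in> polys_over K \<Longrightarrow> g \<in> polys_over K \<Longrightarrow> f + g \<in> polys_over K"
  by (simp add: polys_over_def add_mem)
lemma polys_over_diff: "f \<in> polys_over K \<Longrightarrow> g \<in> polys_over K \<Longrightarrow> f - g \<in> polys_over K"
  by (simp add: polys_over_def diff_mem)
lemma polys_over_mult:
  assumes "f \<in> polys_over K" "g \<in> polys_over K" shows "f * g \<in> polys_over K"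
proof -
  have "poly.coeff (f * g) n \<in> K" for n
    unfolding coeff_mult by (rule sum_mem, rule mult_mem) (use assms in \<open>auto simp: polys_over_def\<close>)
  then show ?thesis by (simp add: polys_over_def)
qed
lemma polys_over_const: "c \<in> K \<Longrightarrow> [:c:] \<in> polys_over K"
  by (auto simp: polys_over_def coeff_pCons zero_mem split: nat.split)
lemma polys_over_monom: "c \<in> K \<Longrightarrow> Polynomial.monom c n \<in> polys_over K"
  by (auto simp: polys_over_def zero_mem)
lemma polys_over_power: "f \<in> polys_over K \<Longrightarrow> f ^ n \<in> polys_over K"
  using polys_over_const[OF one_mem] by (induction n) (auto simp: polys_over_mult one_pCons)
lemma polys_over_sum: "(\<And>i. i \<in> A \<Longrightarrow> f i \<in> polys_over K) \<Longrightarrow> sum f A \<in> polys_over K"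
  by (induction A rule: infinite_finite_induct) (auto simp: polys_over_0 polys_over_add)
lemma polys_over_pcompose:
  assumes f: "f \<in> polys_over K" and g: "g \<in> polys_over K" shows "pcompose f g \<in> polys_over K"
  unfolding pcompose_altdef poly_altdef
proof (rule polys_over_sum, rule polys_over_mult[OF _ polys_over_power[OF g]])
  fix i
  have "poly.coeff f i \<in> K" using f by (simp add: polys_over_def)
  then show "poly.coeff (map_poly (\<lambda>x. [:x:]) f) i \<in> polys_over K"
    by (simp add: coeff_map_poly polys_over_const)
qed

lemma polys_over_division:
  assumes F: "F \<in> polys_over K" "Polynomial.lead_coeff F = 1" "0 < Polynomial.degree F"
  shows "f \<in> polys_over K \<Longrightarrow> \<exists>s r. f = F * s + r \<and> r \<in> polys_over K \<and> Polynomial.degree r < Polynomial.degree F"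
proof (induction "Polynomial.degree f" arbitrary: f rule: less_induct)
  case less
  let ?d = "Polynomial.degree F" and ?n = "Polynomial.degree f"
  show ?case
  proof (cases "?n < ?d")
    case True
    then show ?thesis using less.prems by (intro exI[of _ 0] exI[of _ f]) auto
  next
    case False
    define m where "m = Polynomial.monom (Polynomial.lead_coeff f) (?n - ?d)"
    have f0: "f \<noteq> 0" "F \<noteq> 0" using False F(3) by auto
    have m: "m \<in> polys_over K" unfolding m_def using less.prems by (intro polys_over_monom) (simp add: polys_over_def)
    have dm1: "Polynomial.degree (F * m) = ?n"
      using False f0 by (simp add: m_def degree_mult_eq degree_monom_eq)
    have "Polynomial.lead_coeff (F * m) = Polynomial.lead_coeff f"
      by (simp only: lead_coeff_mult F(2)) (simp add: m_def degree_monom_eq f0)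
    note dm = dm1 this[unfolded dm1]
    have "Polynomial.degree (f - F * m) < ?n"
    proof (rule degree_lessI)
      show "Polynomial.degree (f - F * m) \<le> ?n" using dm by (intro degree_diff_le) auto
      show "poly.coeff (f - F * m) ?n = 0" using dm by simp
      show "0 < ?n" using False F(3) by simp
    qed
    then obtain s r where "f - F * m = F * s + r" "r \<in> polys_over K" "Polynomial.degree r < ?d"
      using less.hyps polys_over_diff[OF less.prems polys_over_mult[OF F(1) m]] by blast
    then show ?thesis by (intro exI[of _ "s + m"] exI[of _ r]) (auto simp: algebra_simps)
  qed
qed

end

lemma monic_eq_prod_roots:
  fixes f :: "'a::field poly"
  assumes "finite R" "card R = Polynomial.degree f" "Polynomial.lead_coeff f = 1" "\<And>r. r \<in> R \<Longrightarrow> poly f r = 0"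
  shows "f = (\<Prod>r\<in>R. [:- r, 1:])"
proof (rule ccontr)
  let ?p = "\<Prod>r\<in>R. [:- r, 1:]"
  assume ne: "f \<noteq> ?p"
  have dp: "Polynomial.degree ?p = card R"
    by (subst degree_prod_eq_sum_degree) auto
  have lp: "Polynomial.lead_coeff ?p = 1" by (simp add: lead_coeff_prod)
  have "Polynomial.degree (f - ?p) < card R"
  proof (rule degree_lessI)
    show "Polynomial.degree (f - ?p) \<le> card R" using dp assms(2) by (intro degree_diff_le) auto
    show "poly.coeff (f - ?p) (card R) = 0" using dp lp assms(2,3) by simp
    show "0 < card R"
    proof (rule ccontr)
      assume "\<not> 0 < card R"
      then have "R = {}" "Polynomial.degree f = 0" using assms(1,2) by auto
      then obtain c where "f = [:c:]" using degree_eq_zeroE by blast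
      then show False using ne assms(3) \<open>R = {}\<close> by (simp add: one_pCons)
    qed
  qed
  moreover have "card R \<le> card {x. poly (f - ?p) x = 0}"
    using assms ne by (intro card_mono poly_roots_finite) (auto simp: poly_prod)
  moreover have "card {x. poly (f - ?p) x = 0} \<le> Polynomial.degree (f - ?p)"
    using ne by (intro card_poly_roots_bound) simp
  ultimately show False by simp
qed

text \<open>Stated for any torsion point of this absolute value, so that every conjugate can take
  the place of \<open>u\<close>, as in \<open>conj_same_field\<close> and
  \<open>sg_Gal\<close>.\<close>

locale torsion_point = lubin_tate K \<pi> q P l e
  for K :: "'a::nonarch_valued_field set" and \<pi> :: 'a and q :: nat and P :: "'a poly" and l e :: "'a fps" +
  fixes u :: 'a
  assumes u_lt: "nv u < 1" and nv_u_power: "nv u ^ (q * (q - 1)) = nv \<pi>" and u_torsion: "poly P (poly P u) = 0"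
begin

definition d :: nat where "d = q * (q - 1)"

lemma nv_u_d: "nv u ^ d = nv \<pi>" using nv_u_power by (simp add: d_def)

lemma d_pos: "0 < d" using q_ge_2 by (simp add: d_def)

lemma q_le_d: "q \<le> d" using q_ge_2 by (simp add: d_def)

lemma u_nz: "u \<noteq> 0" using nv_u_d d_pos pi_nz by (auto simp: power_0_left)

lemma P_decompose:
  assumes "nv x \<le> 1"
  shows "nv (poly P x - (\<pi> * x + x ^ q)) \<le> nv \<pi> * nv x ^ 2"
  using poly_decompose_bound[OF P_0 q_ge_2 _ _ assms, of "nv \<pi>"] discrete[OF P_K P_small] P_1 P_q by simp

lemma nv_P_u: "nv (poly P u) = nv u ^ q"
proof -
  have lt: "nv \<pi> * nv u < nv u ^ q"
  proof -
    have "nv \<pi> * nv u = nv u ^ (d + 1)" by (simp add: power_add nv_u_d)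
    also have "\<dots> < nv u ^ q" using q_le_d u_lt u_nz by (intro power_strict_decreasing) auto
    finally show ?thesis .
  qed
  have "nv \<pi> * nv u ^ 2 \<le> nv \<pi> * nv u"
    using u_lt by (intro mult_left_mono) (auto simp: power2_eq_square mult_left_le)
  then have "nv (poly P u - (\<pi> * u + u ^ q)) < nv u ^ q" using P_decompose[of u] u_lt lt by simp
  moreover have "nv (\<pi> * u) < nv u ^ q" using lt by (simp add: nv_mult)
  ultimately have "nv ((poly P u - (\<pi> * u + u ^ q)) + \<pi> * u) < nv (u ^ q)"
    unfolding nv_power by (rule nv_add_less)
  then show ?thesis using nv_eq_if_close[of "poly P u" "u ^ q"] by (simp add: nv_power algebra_simps)
qed

lemma P_u_nz: "poly P u \<noteq> 0" using nv_P_u u_nz by (metis nv_0 nv_eq_0_iff power_eq_0_iff)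

text \<open>The powers \<open>1, u, \<dots>, u\<^bsup>d-1\<^esup>\<close> have valuations in distinct classes modulo the value group of \<open>K\<close>.\<close>

lemma nv_terms_distinct:
  assumes ab: "a \<in> K" "a \<noteq> 0" "b \<in> K" "b \<noteq> 0" and ij: "i < d" "j < d" "i \<noteq> j"
  shows "nv (a * u ^ i) \<noteq> nv (b * u ^ j)"
proof
  assume eq: "nv (a * u ^ i) = nv (b * u ^ j)"
  obtain m n where mn: "nv a = nv \<pi> powi m" "nv b = nv \<pi> powi n"
    using nv_discrete ab by metis
  have "nv (a * u ^ i) = nv u powi (int d * m + int i)" "nv (b * u ^ j) = nv u powi (int d * n + int j)"
    unfolding nv_mult mn nv_power using u_nz
    by (simp_all add: power_int_add power_int_mult flip: nv_u_d)
  then have "nv u powi (int d * m + int i) = nv u powi (int d * n + int j)" using eq by simp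
  then have e: "int d * m + int i = int d * n + int j"
    using u_lt u_nz power_int_strict_decreasing[of "int d * m + int i" "int d * n + int j" "nv u"]
      power_int_strict_decreasing[of "int d * n + int j" "int d * m + int i" "nv u"]
    by (cases "int d * m + int i" "int d * n + int j" rule: linorder_cases) auto
  then have "(int d * m + int i) mod int d = (int d * n + int j) mod int d" by simp
  then have "int i mod int d = int j mod int d" by simp
  then show False using ij by simp
qed

text \<open>The nonzero terms have pairwise distinct absolute values, so the largest one is that of
  the sum. This orthogonality replaces irreducibility of \<open>\<Phi>\<close> and uniqueness of
  extended valuations.\<close>

lemma nv_poly_u:
  assumes h: "h \<in> polys_over K" and deg: "Polynomial.degree h < d"
  shows "nv (poly.coeff h i * u ^ i) \<le> nv (poly h u)"
proof -
  let ?t = "\<lambda>i. poly.coeff h i * u ^ i"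
  define I where "I = {i. poly.coeff h i \<noteq> 0}"
  have I: "finite I" "I \<subseteq> {..<d}"
    using deg le_degree[of h] finite_subset[of I "{..<d}"] by (auto simp: I_def intro: le_less_trans)
  have dist: "nv (?t i) \<noteq> nv (?t j)" if "i \<in> I" "j \<in> I" "i \<noteq> j" for i j
    using that h I by (intro nv_terms_distinct) (auto simp: I_def polys_over_def)
  show ?thesis
  proof (cases "I = {}")
    case True
    then show ?thesis by (auto simp: I_def)
  next
    case False
    obtain j where j: "j \<in> I" "\<And>i. i \<in> I \<Longrightarrow> nv (?t i) \<le> nv (?t j)"
      using obtains_MAX[OF I(1) False, of "\<lambda>i. nv (?t i)"] I(1) by (metis (no_types, lifting) Max_ge finite_imageI imageI)
    have "poly h u = sum ?t I"
      unfolding poly_altdef by (intro sum.mono_neutral_right) (auto simp: I_def le_degree)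
    also have "nv \<dots> = nv (?t j)"
    proof (rule nv_sum_dominant[OF I(1) j(1)])
      fix i assume "i \<in> I" "i \<noteq> j"
      then show "nv (?t i) < nv (?t j)" using j dist by (metis le_neq_trans)
    qed
    finally have "nv (poly h u) = nv (?t j)" .
    then show ?thesis using j(2)[of i] by (cases "i \<in> I") (auto simp: I_def)
  qed
qed

lemma nv_poly_u_le:
  assumes "h \<in> polys_over K" "Polynomial.degree h < d" "nv (poly h u) \<le> nv u ^ n"
  shows "nv (poly.coeff h i) * nv u ^ i \<le> nv u ^ n"
  using nv_poly_u[OF assms(1,2), of i] assms(3) by (simp add: nv_mult nv_power)

lemma poly_u_eq_0:
  assumes "h \<in> polys_over K" "Polynomial.degree h < d" "poly h u = 0" shows "h = 0"
proof (rule poly_eqI)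
  fix i
  show "poly.coeff h i = poly.coeff 0 i" using nv_poly_u[OF assms(1,2), of i] assms(3) u_nz by simp
qed

text \<open>The inner sum is \<open>P\<close> divided by \<open>X\<close>, so this is
  \<open>pcompose P P\<close> divided by \<open>P\<close>. By \<open>Phi_divides\<close> it is the
  minimal polynomial of \<open>u\<close> over \<open>K\<close>.\<close>

definition \<Phi> :: "'a poly"
  where "\<Phi> = pcompose (\<Sum>i<q. Polynomial.monom (poly.coeff P (Suc i)) i) P"

lemma P_over: "P \<in> polys_over K" using P_K by (simp add: polys_over_def)

lemma P_factor: "P = (\<Sum>i<q. Polynomial.monom (poly.coeff P (Suc i)) i) * [:0, 1:]"
proof (rule poly_eqI)
  fix n
  have c: "poly.coeff (\<Sum>i<q. Polynomial.monom (poly.coeff P (Suc i)) i) m = (if m < q then poly.coeff P (Suc m) else 0)" for m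
    by (simp add: coeff_sum)
  show "poly.coeff P n = poly.coeff ((\<Sum>i<q. Polynomial.monom (poly.coeff P (Suc i)) i) * [:0, 1:]) n"
  proof (cases n)
    case (Suc m)
    then show ?thesis using c[of m] deg_P by (simp add: mult.commute[of _ "[:0, 1:]"] coeff_eq_0)
  qed (simp add: P_0 coeff_mult_0)
qed

lemma Phi_P: "pcompose P P = \<Phi> * P"
proof -
  have "pcompose P P = pcompose ((\<Sum>i<q. Polynomial.monom (poly.coeff P (Suc i)) i) * [:0, 1:]) P"
    using P_factor by simp
  then show ?thesis unfolding \<Phi>_def by (simp only: pcompose_mult T_pcompose)
qed

lemma Phi_over: "\<Phi> \<in> polys_over K"
  unfolding \<Phi>_def by (intro polys_over_pcompose polys_over_sum polys_over_monom P_K P_over)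

lemma lead_P: "Polynomial.lead_coeff P = 1" using deg_P P_q by simp

lemma P_nz: "P \<noteq> 0" using lead_P by auto

lemma Phi_monic: "Polynomial.lead_coeff \<Phi> = 1" "Polynomial.degree \<Phi> = d"
proof -
  have l: "Polynomial.lead_coeff (pcompose P P) = 1"
    using lead_coeff_comp[of P P] deg_P q_ge_2 lead_P by simp
  have dg: "Polynomial.degree (pcompose P P) = q * q" by (simp add: degree_pcompose deg_P)
  have nz: "\<Phi> \<noteq> 0" using l Phi_P by auto
  show "Polynomial.lead_coeff \<Phi> = 1" using l unfolding Phi_P by (simp add: lead_coeff_mult lead_P)
  have "Polynomial.degree \<Phi> + q = q * q"
    using dg unfolding Phi_P degree_mult_eq[OF nz P_nz] deg_P .
  then show "Polynomial.degree \<Phi> = d" unfolding d_def by (simp add: right_diff_distrib' algebra_simps)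
qed

lemma Phi_root: "poly P (poly P r) = 0 \<Longrightarrow> poly P r \<noteq> 0 \<Longrightarrow> poly \<Phi> r = 0"
  using arg_cong[OF Phi_P, of "\<lambda>f. poly f r"] by (simp add: poly_pcompose)

lemma Phi_u: "poly \<Phi> u = 0" by (rule Phi_root[OF u_torsion P_u_nz])

lemma Phi_divides:
  assumes h: "h \<in> polys_over K" "poly h u = 0" shows "\<exists>s. h = \<Phi> * s"
proof -
  obtain s r where sr: "h = \<Phi> * s + r" "r \<in> polys_over K" "Polynomial.degree r < d"
    using polys_over_division[OF Phi_over Phi_monic(1) _ h(1)] d_pos Phi_monic(2) by auto
  have "poly r u = 0" using h(2) sr(1) Phi_u by simp
  then have "r = 0" using poly_u_eq_0 sr by blast
  then show ?thesis using sr by auto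
qed

definition L :: "'a set" where "L = (\<lambda>h. poly h u) ` polys_over K"

lemma L_reduced:
  assumes "x \<in> L"
  shows "\<exists>h. h \<in> polys_over K \<and> Polynomial.degree h < d \<and> x = poly h u"
proof -
  obtain h where h: "h \<in> polys_over K" "x = poly h u" using assms by (auto simp: L_def)
  obtain s r where sr: "h = \<Phi> * s + r" "r \<in> polys_over K" "Polynomial.degree r < d"
    using polys_over_division[OF Phi_over Phi_monic(1) _ h(1)] d_pos Phi_monic(2) by auto
  then have "x = poly r u" using h(2) Phi_u by simp
  then show ?thesis using sr by blast
qed

definition rd :: "'a \<Rightarrow> 'a poly"
  where "rd x = (SOME h. h \<in> polys_over K \<and> Polynomial.degree h < d \<and> x = poly h u)"

lemma rd: "x \<in> L \<Longrightarrow> rd x \<in> polys_over K" "x \<in> L \<Longrightarrow> Polynomial.degree (rd x) < d" "x \<in> L \<Longrightarrow> poly (rd x) u = x"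
  using someI_ex[OF L_reduced[of x]] unfolding rd_def[symmetric] by auto

lemma L_mem: "h \<in> polys_over K \<Longrightarrow> poly h u \<in> L" by (auto simp: L_def)

lemma K_L: "K \<subseteq> L"
  using L_mem[OF polys_over_const] by fastforce

lemma u_L: "u \<in> L"
  using L_mem[OF polys_over_monom[OF one_mem, of 1]] by (simp add: poly_monom)

text \<open>By orthogonality the coordinates of a convergent sequence are Cauchy sequences in the
  closed set \<open>K\<close>.\<close>

lemma L_closed_seq:
  assumes x: "\<And>n. x n \<in> L" and lim: "x \<longlonglongrightarrow> y"
  shows "y \<in> L"
proof -
  let ?c = "\<lambda>i n. poly.coeff (rd (x n)) i"
  have "\<exists>c\<in>K. ?c i \<longlonglongrightarrow> c" for i
  proof -
    have "Cauchy (?c i)"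
    proof (rule metric_CauchyI)
      fix r :: real assume r: "0 < r"
      have "Cauchy x" using lim by (rule LIMSEQ_imp_Cauchy)
      moreover have "0 < r * nv u ^ i" using r u_nz by simp
      ultimately obtain N where N: "\<And>m n. m \<ge> N \<Longrightarrow> n \<ge> N \<Longrightarrow> nv (x m - x n) < r * nv u ^ i"
        unfolding Cauchy_def dist_eq_nv by blast
      have "nv (?c i m - ?c i n) < r" if "m \<ge> N" "n \<ge> N" for m n
      proof -
        have "nv (poly.coeff (rd (x m) - rd (x n)) i * u ^ i) \<le> nv (poly (rd (x m) - rd (x n)) u)"
          using rd[OF x] by (intro nv_poly_u polys_over_diff degree_diff_less) auto
        also have "\<dots> < r * nv u ^ i" using rd(3)[OF x] N[OF that] by simp
        finally show ?thesis using u_nz by (simp add: nv_mult nv_power)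
      qed
      then show "\<exists>M. \<forall>m\<ge>M. \<forall>n\<ge>M. dist (?c i m) (?c i n) < r" by (auto simp: dist_eq_nv)
    qed
    then obtain c where c: "?c i \<longlonglongrightarrow> c" using complete_C unfolding complete_def by auto
    have "?c i n \<in> K" for n using rd(1)[OF x] by (simp add: polys_over_def)
    then have "c \<in> K" using closed_sequentially[OF closed_K _ c] by blast
    then show ?thesis using c by blast
  qed
  then obtain c where c: "\<And>i. c i \<in> K" "\<And>i. ?c i \<longlonglongrightarrow> c i" by metis
  have "poly (rd (x n)) u = (\<Sum>i<d. ?c i n * u ^ i)" for n
    unfolding poly_altdef using rd(2)[OF x, of n] by (intro sum.mono_neutral_left) (auto simp: coeff_eq_0)
  then have e: "x n = (\<Sum>i<d. u ^ i * ?c i n)" for n using rd(3)[OF x] by (simp add: mult.commute)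
  have "(\<lambda>n. \<Sum>i<d. u ^ i * ?c i n) \<longlonglongrightarrow> (\<Sum>i<d. u ^ i * c i)"
    by (rule nv_tendsto_sum) (rule nv_tendsto_cmult[OF c(2)])
  then have "x \<longlonglongrightarrow> (\<Sum>i<d. u ^ i * c i)" by (simp only: e[symmetric])
  then have "y = (\<Sum>i<d. u ^ i * c i)" using lim LIMSEQ_unique by blast
  also have "\<dots> = poly (\<Sum>i<d. Polynomial.monom (c i) i) u"
    by (simp add: poly_sum poly_monom mult.commute)
  also have "\<dots> \<in> L" by (intro L_mem polys_over_sum polys_over_monom c)
  finally show ?thesis .
qed

lemma L_add:
  assumes "x \<in> L" "y \<in> L" shows "x + y \<in> L"
  using L_mem[OF polys_over_add[OF rd(1)[OF assms(1)] rd(1)[OF assms(2)]]] by (simp add: rd(3) assms)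
lemma L_diff:
  assumes "x \<in> L" "y \<in> L" shows "x - y \<in> L"
  using L_mem[OF polys_over_diff[OF rd(1)[OF assms(1)] rd(1)[OF assms(2)]]] by (simp add: rd(3) assms)
lemma L_mult:
  assumes "x \<in> L" "y \<in> L" shows "x * y \<in> L"
  using L_mem[OF polys_over_mult[OF rd(1)[OF assms(1)] rd(1)[OF assms(2)]]] by (simp add: rd(3) assms)
lemma L_0: "0 \<in> L" by (rule subsetD[OF K_L zero_mem])
lemma L_1: "1 \<in> L" by (rule subsetD[OF K_L one_mem])
lemma L_power: "x \<in> L \<Longrightarrow> x ^ n \<in> L"
  by (induction n) (simp_all add: L_1 L_mult)
lemma L_sum: "(\<And>i. i \<in> A \<Longrightarrow> f i \<in> L) \<Longrightarrow> sum f A \<in> L"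
  by (induction A rule: infinite_finite_induct) (simp_all add: L_0 L_add)

lemma L_inverse_u: "inverse u \<in> L"
proof -
  have c0: "poly.coeff \<Phi> 0 = \<pi>"
  proof -
    have "poly.coeff \<Phi> 0 = poly \<Phi> 0" by (simp add: poly_0_coeff_0)
    also have "\<dots> = poly (\<Sum>i<q. Polynomial.monom (poly.coeff P (Suc i)) i) 0"
      unfolding \<Phi>_def poly_pcompose using P_0 by (simp add: poly_0_coeff_0)
    also have "\<dots> = (\<Sum>i<q. if i = 0 then \<pi> else 0)"
      unfolding poly_sum poly_monom using P_1 by (intro sum.cong) (auto simp: power_0_left One_nat_def)
    also have "\<dots> = \<pi>" using q_ge_2 by simp
    finally show ?thesis .
  qed
  obtain a g where ag: "\<Phi> = pCons a g" by (cases \<Phi>)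
  then have "a = \<pi>" using c0 by simp
  then have "\<pi> + u * poly g u = 0" using Phi_u ag by simp
  then have "inverse u = - (poly g u / \<pi>)"
    using u_nz pi_nz by (simp add: field_simps) (metis add.commute eq_neg_iff_add_eq_0 minus_minus)
  also have "\<dots> = poly (Polynomial.smult (- inverse \<pi>) g) u" by (simp add: divide_inverse mult.commute)
  also have "\<dots> \<in> L"
  proof (rule L_mem)
    have "poly.coeff \<Phi> (Suc i) \<in> K" for i using Phi_over by (simp add: polys_over_def)
    then have "g \<in> polys_over K" by (simp add: ag polys_over_def)
    then show "Polynomial.smult (- inverse \<pi>) g \<in> polys_over K"
      using pi_K by (simp add: polys_over_def mems)
  qed
  finally show ?thesis .
qed

lemma L_leading:
  assumes x: "x \<in> L" "x \<noteq> 0"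
  shows "\<exists>a\<in>K. \<exists>j<d. a \<noteq> 0 \<and> nv (x - a * u ^ j) < nv x \<and> nv x = nv (a * u ^ j)"
proof -
  let ?h = "rd x"
  note h = rd[OF x(1)]
  let ?t = "\<lambda>i. poly.coeff ?h i * u ^ i"
  have "poly ?h u = (\<Sum>i<d. ?t i)"
    unfolding poly_altdef using h(2) by (intro sum.mono_neutral_left) (auto simp: coeff_eq_0)
  then have s: "(\<Sum>i<d. ?t i) = x" using h(3) by simp
  have le: "nv (?t i) \<le> nv x" for i using nv_poly_u[OF h(1,2)] h(3) by simp
  have ex: "\<exists>j<d. nv (?t j) = nv x"
  proof (rule ccontr)
    assume "\<not> (\<exists>j<d. nv (?t j) = nv x)"
    then have "nv (?t j) < nv x" if "j < d" for j using le[of j] that by (metis le_neq_trans)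
    then have "nv (\<Sum>i<d. ?t i) < nv x" using x(2) by (intro nv_sum_less) auto
    then show False unfolding s by simp
  qed
  then obtain j where j: "j < d" "nv (?t j) = nv x" by blast
  have "(\<Sum>i<d. ?t i) - ?t j = (\<Sum>i\<in>{..<d} - {j}. ?t i)" using j by (simp add: sum.remove[of _ j])
  then have "x - ?t j = (\<Sum>i\<in>{..<d} - {j}. ?t i)" unfolding s .
  moreover have "nv (?t i) < nv x" if i: "i \<in> {..<d} - {j}" for i
  proof (cases "poly.coeff ?h i = 0")
    case True
    then show ?thesis using x(2) by simp
  next
    case False
    moreover have "poly.coeff ?h j \<noteq> 0" using j(2) x(2) by auto
    ultimately have "nv (?t i) \<noteq> nv (?t j)"
      using h(1) i j(1) by (intro nv_terms_distinct) (auto simp: polys_over_def)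
    then show ?thesis using le[of i] j(2) by simp
  qed
  ultimately have "nv (x - ?t j) < nv x" using x(2) by (simp, intro nv_sum_less) auto
  then show ?thesis using j x(2) h(1) by (intro bexI[of _ "poly.coeff ?h j"] exI[of _ j]) (auto simp: polys_over_def)
qed

text \<open>After division by its leading term \<open>a * u ^ j\<close>, the element becomes
  \<open>1 - y\<close> with \<open>nv y < 1\<close>; the geometric series for its inverse converges
  in the closed set \<open>L\<close>.\<close>

lemma L_inverse:
  assumes x: "x \<in> L" shows "inverse x \<in> L"
proof (cases "x = 0")
  case False
  obtain a j where aj: "a \<in> K" "a \<noteq> 0" "nv (x - a * u ^ j) < nv x" "nv x = nv (a * u ^ j)"
    using L_leading[OF x False] by blast
  define c where "c = inverse a * inverse u ^ j"
  have c: "c \<in> L" unfolding c_def using aj(1) K_L inverse_mem L_inverse_u by (intro L_mult L_power) auto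
  have c': "c * (a * u ^ j) = 1" using aj(2) u_nz by (simp add: c_def field_simps)
  have cnz: "c \<noteq> 0" using c' by auto
  define y where "y = 1 - c * x"
  have yL: "y \<in> L" unfolding y_def using c x one_mem K_L by (intro L_diff L_mult) auto
  have "y = c * (a * u ^ j - x)" using c' by (simp add: y_def right_diff_distrib)
  then have "nv y = nv c * nv (x - a * u ^ j)" by (simp add: nv_mult nv_minus_commute)
  also have "\<dots> < nv c * nv x" using aj(3) c' by (intro mult_strict_left_mono) (auto simp: nv_pos_iff)
  also have "\<dots> = 1" using arg_cong[OF c', of nv] aj(4) by (simp add: nv_mult)
  finally have y: "nv y < 1" .
  have xc: "1 - y = c * x" by (simp add: y_def)
  have "nv (1 - y) = 1" using nv_add_eq[of "- y" 1] y by simp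
  have "(\<lambda>N. \<Sum>n<N. y ^ n) \<longlonglongrightarrow> inverse (1 - y)"
  proof -
    have "nv ((\<Sum>n<N. y ^ n) - inverse (1 - y)) = nv y ^ N" for N
    proof -
      have "(1 - y) * (\<Sum>n<N. y ^ n) = 1 - y ^ N" by (rule one_diff_power_eq[symmetric])
      moreover have "1 - y \<noteq> 0" using \<open>nv (1 - y) = 1\<close> by (metis nv_0 zero_neq_one)
      ultimately have "(\<Sum>n<N. y ^ n) = (1 - y ^ N) / (1 - y)" by (simp add: eq_divide_eq mult.commute)
      then have "(\<Sum>n<N. y ^ n) - inverse (1 - y) = - (y ^ N) * inverse (1 - y)"
        by (simp add: divide_inverse left_diff_distrib)
      then show ?thesis using \<open>nv (1 - y) = 1\<close> by (simp add: nv_mult nv_power nv_inverse)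
    qed
    then show ?thesis
      using y by (simp add: tendsto_nv_iff[of "\<lambda>N. \<Sum>n<N. y ^ n"] LIMSEQ_realpow_zero)
  qed
  then have "inverse (1 - y) \<in> L"
    by (rule L_closed_seq[rotated]) (intro L_sum L_power yL)
  then have m: "inverse (c * x) * c \<in> L" unfolding xc using c by (rule L_mult)
  have "inverse (c * x) * c = inverse x" using False cnz by (simp add: field_simps)
  then show ?thesis using m by (simp only:)
qed (simp add: L_0)

sublocale LF: set_subfield L
  by unfold_locales (use K_L one_mem L_diff L_mult L_inverse in auto)

lemma act_u_L: "a \<in> OK \<Longrightarrow> x \<in> L \<Longrightarrow> nv x < 1 \<Longrightarrow> act a x \<in> L"
proof -
  assume a: "a \<in> OK" and x: "x \<in> L" "nv x < 1"
  show ?thesis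
  proof (rule L_closed_seq)
    show "(\<lambda>N. \<Sum>n<N. br a $ n * x ^ n) \<longlonglongrightarrow> act a x"
      unfolding act_def by (rule fps_at_tendsto[OF complete_C br_integral[OF a] x(2)])
    show "(\<Sum>n<N. br a $ n * x ^ n) \<in> L" for N
    proof (rule L_sum)
      fix n
      have "br a $ n \<in> K" using br_OK[OF a] by (simp add: O_iff)
      then show "br a $ n * x ^ n \<in> L" using K_L L_power[OF x(1)] by (intro L_mult) auto
    qed
  qed
qed

end

section \<open>The endomorphisms attached to units congruent to \<open>1\<close> modulo
  \<open>\<pi>\<close>\<close>

context lubin_tate
begin

definition unit_reps :: "'a set" where "unit_reps = reps - {rep 0}"

lemma unit_reps: "x \<in> unit_reps \<Longrightarrow> x \<in> reps" "x \<in> unit_reps \<Longrightarrow> nv x = 1" "x \<in> unit_reps \<Longrightarrow> x \<in> OK"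
  "finite unit_reps" "card unit_reps = q - 1"
proof -
  have r0: "rep 0 \<in> reps" "nv (rep 0) < 1" using rep[OF O_zero] by auto
  show 1: "x \<in> unit_reps \<Longrightarrow> x \<in> reps" by (simp add: unit_reps_def)
  show 2: "x \<in> unit_reps \<Longrightarrow> x \<in> OK" using 1 reps_O by blast
  show "nv x = 1" if x: "x \<in> unit_reps"
  proof -
    have "nv (x - rep 0) = 1" using reps_diff[of x "rep 0"] x r0(1) by (simp add: unit_reps_def)
    then have "nv ((x - rep 0) + rep 0) = 1" using nv_add_eq[of "rep 0" "x - rep 0"] r0(2) by simp
    then show ?thesis by simp
  qed
  show "finite unit_reps" "card unit_reps = q - 1" using reps(2,3) r0(1) by (simp_all add: unit_reps_def)
qed

lemma fps_power_nth_cong_mod: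
  fixes f g :: "'a fps"
  assumes "f $ 0 = 0" "g $ 0 = 0" "2 \<le> i"
    "\<And>j. nv (f $ j) \<le> 1" "\<And>j. nv (g $ j) \<le> 1" "\<And>j. j < n \<Longrightarrow> nv (f $ j - g $ j) \<le> r" "0 \<le> r"
  shows "nv ((f ^ i) $ n - (g ^ i) $ n) \<le> r"
proof -
  let ?f = "fps_trunc n f" and ?g = "fps_trunc n g"
  have e: "(f ^ i) $ n = (?f ^ i) $ n" "(g ^ i) $ n = (?g ^ i) $ n"
    using assms(1-3) by (intro fps_power_nth_cong_less; simp)+
  have int: "?f \<in> integral_series" "?g \<in> integral_series" using assms(4,5) by (auto simp: integral_series_def)
  have "nv ((?f ^ i - ?g ^ i) $ n) \<le> r"
    unfolding power_diff_sumr2 fps_mult_nth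
  proof (rule nv_sum_le)
    fix j
    have "nv ((\<Sum>k<i. ?g ^ (i - Suc k) * ?f ^ k) $ (n - j)) \<le> 1"
      unfolding fps_sum_nth
      by (rule nv_sum_le) (use integral_seriesD[OF integral_series_mult[OF integral_series_power[OF int(2)]
            integral_series_power[OF int(1)]]] in auto)
    moreover have "nv ((?f - ?g) $ j) \<le> r" using assms(6,7) by simp
    ultimately show "nv ((?f - ?g) $ j * (\<Sum>k<i. ?g ^ (i - Suc k) * ?f ^ k) $ (n - j)) \<le> r"
      using nv_mult_le by (subst mult.commute) blast
  qed (rule assms(7))
  then show ?thesis unfolding e by simp
qed

text \<open>Compare coefficients in \<open>P \<circ> [a] = [a] \<circ> P\<close> modulo \<open>\<pi>\<^sup>2\<close>.\<close>

lemma br_one_plus_pi: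
  assumes c: "c \<in> OK"
  defines "a \<equiv> 1 + \<pi> * c"
  shows "2 \<le> n \<Longrightarrow> n \<le> q \<Longrightarrow> nv (br a $ n - of_bool (n = q) * c) \<le> nv \<pi>"
proof (induction n rule: less_induct)
  case (less n)
  let ?f = "br a" and ?P = "fps_of_poly P" and ?p = "nv \<pi>"
  have a: "a \<in> OK" unfolding a_def using c by (intro O_add O_one O_mult O_pi)
  have am1: "nv (a - 1) \<le> ?p" using c mult_left_mono[of "nv c" 1 "nv \<pi>"] by (simp add: a_def nv_mult O_iff)
  have p1: "?p \<le> 1" using pi_lt_1 by simp
  have pp: "?p ^ 2 \<le> ?p" using p1 by (simp add: power2_eq_square mult_left_le)
  have f: "nv (?f $ j) \<le> 1" for j using integral_seriesD[OF br_integral[OF a]] .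
  have Pj: "nv (?P $ j) \<le> ?p" if "j \<noteq> q" for j using discrete[OF P_K P_small[OF that]] by simp
  have comm: "?P oo ?f = ?f oo ?P"
    using br_mult[of \<pi> a] br_mult[of a \<pi>] by (simp add: br_pi mult.commute)
  have n0: "n \<noteq> 0" using less.prems by simp
  have L: "(?P oo ?f) $ n = \<pi> * ?f $ n + (\<Sum>i\<in>{2..n}. ?P $ i * (?f ^ i) $ n)"
    using fps_compose_nth_split[of ?P ?f n] P_0 P_1 n0 by simp
  have R: "(?f oo ?P) $ n = a * ?P $ n + (\<Sum>i\<in>{2..n}. ?f $ i * (?P ^ i) $ n)"
    using fps_compose_nth_split[of ?f ?P n] br_0 br_1 n0 by simp
  \<comment> \<open>For \<open>i \<ge> 2\<close> only coefficients of \<open>P\<close> below degree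
    \<open>n \<le> q\<close> are involved; all are divisible by \<open>\<pi>\<close>, and at least
    two are multiplied.\<close>
  have R2: "nv (\<Sum>i\<in>{2..n}. ?f $ i * (?P ^ i) $ n) \<le> ?p ^ 2"
  proof (rule nv_sum_le)
    fix i assume i: "i \<in> {2..n}"
    have "(?P ^ i) $ n = (fps_trunc n ?P ^ i) $ n"
      using i P_0 by (intro fps_power_nth_cong_less) auto
    moreover have "nv ((fps_trunc n ?P ^ i) $ n) * 1 ^ n \<le> ?p ^ i"
      using i less.prems Pj by (intro fps_power_nth_bound) auto
    moreover have "?p ^ i \<le> ?p ^ 2" using i p1 by (intro power_decreasing) auto
    ultimately show "nv (?f $ i * (?P ^ i) $ n) \<le> ?p ^ 2" using f by (intro nv_mult_le) auto
  qed simp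
  let ?g = "fps_const a * fps_X"
  have gi: "(?g ^ i) $ n = (if n = i then a ^ i else 0)" for i
    by (simp add: power_mult_distrib fps_const_power fps_X_power_nth)
  have diff_i: "nv ((?f ^ i) $ n - (?g ^ i) $ n) \<le> ?p" if "i \<in> {2..n}" for i
  proof (rule fps_power_nth_cong_mod)
    show "nv (?f $ j - ?g $ j) \<le> ?p" if j: "j < n" for j
    proof -
      consider "j = 0" | "j = 1" | "2 \<le> j" by linarith
      then show ?thesis
      proof cases
        case 3
        then show ?thesis using less.IH[OF j 3] less.prems j by (simp add: fps_X_def)
      qed (simp_all add: br_0 br_1)
    qed
    show "nv (?g $ j) \<le> 1" for j using a by (auto simp: fps_X_def O_iff)
  qed (use that f br_0 in auto)
  \<comment> \<open>Replacing \<open>br a\<close> by its linear part costs a factor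
    \<open>\<pi>\<close> by induction, and \<open>P $ i\<close> supplies another. The index
    \<open>i = q\<close> occurs only for \<open>n = q\<close>, where both powers have the
    coefficient \<open>a ^ q\<close>.\<close>
  have S: "nv ((\<Sum>i\<in>{2..n}. ?P $ i * (?f ^ i) $ n) - ?P $ n * a ^ n) \<le> ?p ^ 2"
  proof -
    have "(\<Sum>i\<in>{2..n}. ?P $ i * (?f ^ i) $ n) - ?P $ n * a ^ n
        = (\<Sum>i\<in>{2..n}. ?P $ i * ((?f ^ i) $ n - (?g ^ i) $ n))"
    proof -
      have "(\<Sum>i\<in>{2..n}. ?P $ i * (?g ^ i) $ n) = (\<Sum>i\<in>{2..n}. if i = n then ?P $ n * a ^ n else 0)"
        unfolding gi by (intro sum.cong) auto
      then show ?thesis using less.prems by (simp add: right_diff_distrib sum_subtractf)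
    qed
    also have "nv \<dots> \<le> ?p ^ 2"
    proof (rule nv_sum_le)
      fix i assume i: "i \<in> {2..n}"
      show "nv (?P $ i * ((?f ^ i) $ n - (?g ^ i) $ n)) \<le> ?p ^ 2"
      proof (cases "i = q")
        case True
        then have "n = q" using i less.prems by simp
        then have "(?f ^ i) $ n = a ^ q"
          using True startsby_zero_power_nth_same[OF br_0, of a q] br_1[of a] by (simp add: One_nat_def)
        then show ?thesis unfolding gi using True \<open>n = q\<close> by simp
      next
        case False
        then show ?thesis
          using mult_mono[OF Pj[OF False] diff_i[OF i]] by (simp add: nv_mult power2_eq_square)
      qed
    qed simp
    finally show ?thesis .
  qed
  have main: "nv (\<pi> * ?f $ n - ?P $ n * (a - a ^ n)) \<le> ?p ^ 2"
  proof -
    have "\<pi> * ?f $ n - ?P $ n * (a - a ^ n)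
        = (\<Sum>i\<in>{2..n}. ?f $ i * (?P ^ i) $ n) - ((\<Sum>i\<in>{2..n}. ?P $ i * (?f ^ i) $ n) - ?P $ n * a ^ n)"
      using arg_cong[OF comm, of "\<lambda>f. f $ n"] unfolding L R by (simp add: algebra_simps)
    then show ?thesis using nv_diff_le[OF R2 S] by simp
  qed
  have an: "nv (a ^ n - 1) \<le> ?p"
  proof -
    have "nv (\<Sum>i<n. a ^ i) \<le> 1" using a by (intro nv_sum_le) (auto simp: nv_power O_iff power_le_one)
    then show ?thesis using nv_mult_le[OF _ am1, of "\<Sum>i<n. a ^ i"] unfolding power_diff_1_eq
      by (simp add: mult.commute)
  qed
  have "nv (\<pi> * ?f $ n - \<pi> * (of_bool (n = q) * c)) \<le> ?p ^ 2"
  proof (cases "n = q")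
    case False
    have "a - a ^ n = (a - 1) - (a ^ n - 1)" by simp
    then have "nv (a - a ^ n) \<le> ?p" using nv_diff_le[OF am1 an] by simp
    then have "nv (?P $ n * (a - a ^ n)) \<le> ?p ^ 2"
      using mult_mono[OF Pj[OF False]] by (simp add: nv_mult power2_eq_square)
    from nv_add_le[OF main this] False show ?thesis by simp
  next
    case True
    \<comment> \<open>The quotient of \<open>a ^ q - 1\<close> by \<open>a - 1\<close> is congruent
      to \<open>q\<close>, hence to \<open>0\<close>, modulo \<open>\<pi>\<close>. So
      \<open>a - a ^ q\<close> is \<open>\<pi> * c\<close> modulo \<open>\<pi> ^ 2\<close>.\<close>
    have aq: "nv (a ^ q - 1) \<le> ?p ^ 2"
    proof -
      have "nv (\<Sum>i<q. a ^ i) \<le> ?p"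
      proof -
        have "nv ((\<Sum>i<q. a ^ i) - of_nat q) \<le> ?p"
        proof -
          have "(\<Sum>i<q. a ^ i) - of_nat q = (\<Sum>i<q. a ^ i - 1)" by (simp add: sum_subtractf)
          also have "nv \<dots> \<le> ?p"
          proof (rule nv_sum_le)
            fix i
            have "nv (\<Sum>k<i. a ^ k) \<le> 1" using a by (intro nv_sum_le) (auto simp: nv_power O_iff power_le_one)
            then show "nv (a ^ i - 1) \<le> ?p" using nv_mult_le[OF _ am1, of "\<Sum>k<i. a ^ k"]
              unfolding power_diff_1_eq by (simp add: mult.commute)
          qed simp
          finally show ?thesis .
        qed
        moreover have "nv (of_nat q :: 'a) \<le> ?p" using discrete[OF of_nat_mem q_small] .
        ultimately show ?thesis using nv_add_le by fastforce
      qed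
      then show ?thesis unfolding power_diff_1_eq nv_mult power2_eq_square using am1 by (intro mult_mono) auto
    qed
    have e: "?P $ n * (a - a ^ n) = \<pi> * c - (a ^ q - 1)" using True P_q by (simp add: a_def)
    from nv_diff_le[OF main[unfolded e] aq]
    have "nv ((\<pi> * ?f $ n - (\<pi> * c - (a ^ q - 1))) - (a ^ q - 1)) \<le> ?p ^ 2" .
    then show ?thesis using True by (simp add: algebra_simps)
  qed
  then have "?p * nv (?f $ n - of_bool (n = q) * c) \<le> ?p * ?p"
    by (simp add: nv_mult power2_eq_square flip: right_diff_distrib)
  then show ?case using pi_nz by simp
qed

end

section \<open>The conjugates of \<open>u\<close>\<close>

context torsion_point
begin

text \<open>Modulo \<open>\<pi>\<close> the series is \<open>X + c X ^ q\<close> through degree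
  \<open>q\<close>. As \<open>nv \<pi> = nv u ^ d\<close> with \<open>d \<ge> q\<close>, terms
  divisible by \<open>\<pi>\<close> are absorbed by the bound.\<close>

lemma act_one_plus_pi:
  assumes c: "c \<in> OK" shows "nv (act (1 + \<pi> * c) u - u - c * u ^ q) \<le> nv u ^ (q + 1)"
proof -
  let ?a = "1 + \<pi> * c"
  have a: "?a \<in> OK" using c by (intro O_add O_one O_mult O_pi)
  have small: "nv \<pi> * nv u ^ j \<le> nv u ^ (q + 1)" if "1 \<le> j" for j
  proof -
    have "nv \<pi> * nv u ^ j = nv u ^ (d + j)" by (simp add: power_add nv_u_d)
    also have "\<dots> \<le> nv u ^ (q + 1)" using that q_le_d u_lt by (intro power_decreasing) auto
    finally show ?thesis .
  qed
  have "nv (act ?a u - (\<Sum>n<q + 1. br ?a $ n * u ^ n)) \<le> nv u ^ (q + 1)"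
    unfolding act_def by (rule fps_at_approx[OF complete_C br_integral[OF a] u_lt])
  moreover have "nv ((\<Sum>n<q + 1. br ?a $ n * u ^ n) - u - c * u ^ q) \<le> nv u ^ (q + 1)"
  proof -
    have "{..<q + 1} = insert 0 (insert 1 {2..q})" using q_ge_2 by auto
    moreover have "(\<Sum>n\<in>{2..q}. of_bool (n = q) * c * u ^ n) = (\<Sum>n\<in>{2..q}. if n = q then c * u ^ q else 0)"
      by (intro sum.cong) auto
    ultimately have "(\<Sum>n<q + 1. br ?a $ n * u ^ n) - u - c * u ^ q
        = \<pi> * c * u + (\<Sum>n\<in>{2..q}. (br ?a $ n - of_bool (n = q) * c) * u ^ n)"
      using q_ge_2 by (simp add: br_0 br_1 algebra_simps sum_subtractf)
    also have "nv \<dots> \<le> nv u ^ (q + 1)"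
    proof (intro nv_add_le nv_sum_le)
      have "nv (\<pi> * c * u) \<le> nv \<pi> * nv u ^ 1"
        using c mult_left_le[of "nv c" "nv \<pi>"] by (auto simp: nv_mult O_iff intro!: mult_right_mono)
      then show "nv (\<pi> * c * u) \<le> nv u ^ (q + 1)" using small[of 1] by simp
      fix n assume n: "n \<in> {2..q}"
      have "nv ((br ?a $ n - of_bool (n = q) * c) * u ^ n) \<le> nv \<pi> * nv u ^ n"
        unfolding nv_mult nv_power using br_one_plus_pi[OF c, of n] n by (intro mult_right_mono) auto
      then show "nv ((br ?a $ n - of_bool (n = q) * c) * u ^ n) \<le> nv u ^ (q + 1)" using small[of n] n by simp
    qed simp
    finally show ?thesis .
  qed
  ultimately have "nv ((act ?a u - (\<Sum>n<q + 1. br ?a $ n * u ^ n)) + ((\<Sum>n<q + 1. br ?a $ n * u ^ n) - u - c * u ^ q))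
      \<le> nv u ^ (q + 1)" by (rule nv_add_le)
  then show ?thesis by (simp only: diff_add_cancel add_diff_eq)
qed

text \<open>The linear approximation first gives congruence modulo \<open>\<pi>\<close>, so
  \<open>a = b (1 + \<pi> c)\<close>. After the isometry \<open>act b\<close> is cancelled, the term
  \<open>c * u ^ q\<close> forces \<open>c\<close> to be small.\<close>

lemma act_u_eqD:
  assumes a: "a \<in> OK" "nv a = 1" and b: "b \<in> OK" "nv b = 1" and eq: "act a u = act b u"
  shows "nv (a - b) < nv \<pi>"
proof -
  have ab: "a - b \<in> OK" using a b O_diff by blast
  have "(a - b) * u = (act b u - b * u) - (act a u - a * u)" using eq by (simp add: algebra_simps)
  then have "nv ((a - b) * u) \<le> nv u ^ 2"
    using nv_diff_le[OF act_approx[OF b(1) u_lt] act_approx[OF a(1) u_lt]] by simp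
  then have "nv (a - b) \<le> nv u" using u_nz by (simp add: nv_mult power2_eq_square)
  then have "nv (a - b) < 1" using u_lt by simp
  then have le: "nv (a - b) \<le> nv \<pi>" using discrete ab by (simp add: O_iff)
  define c where "c = (a - b) / (\<pi> * b)"
  have bn: "b \<noteq> 0" using b by auto
  have c: "c \<in> OK" using le a b pi_K pi_nz by (simp add: c_def O_iff mems nv_divide nv_mult divide_le_eq)
  have ae: "a = b * (1 + \<pi> * c)" using pi_nz bn by (simp add: c_def field_simps)
  have a': "1 + \<pi> * c \<in> OK" using c by (intro O_add O_one O_mult O_pi)
  have "act b (act (1 + \<pi> * c) u) = act b u"
    using act_act[OF b(1) a' u_lt] eq ae by simp
  then have "act (1 + \<pi> * c) u = u"
    using act_unit_dilation[OF b act_lt_1[OF a' u_lt] u_lt] by simp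
  then have "nv (c * u ^ q) \<le> nv u ^ (q + 1)" using act_one_plus_pi[OF c] by simp
  then have "nv c \<le> nv u" using u_nz by (simp add: nv_mult nv_power power_add mult.commute)
  then have "nv c < 1" using u_lt by simp
  then have "nv (\<pi> * b * c) < nv \<pi>" using b pi_nz by (simp add: nv_mult)
  moreover have "\<pi> * b * c = a - b" using pi_nz bn by (simp add: c_def)
  ultimately show ?thesis by simp
qed

text \<open>Representatives of the units of \<open>OK\<close> modulo
  \<open>\<pi> ^ 2\<close>.\<close>

definition conj_index :: "'a set" where "conj_index = (\<lambda>(x, y). x + \<pi> * y) ` (unit_reps \<times> reps)"

definition conjs :: "'a set" where "conjs = (\<lambda>a. act a u) ` conj_index"

lemma conj_index: "a \<in> conj_index \<Longrightarrow> a \<in> OK" "a \<in> conj_index \<Longrightarrow> nv a = 1"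
proof -
  assume "a \<in> conj_index"
  then obtain x y where xy: "a = x + \<pi> * y" "x \<in> unit_reps" "y \<in> reps" by (auto simp: conj_index_def)
  show "a \<in> OK" unfolding xy using unit_reps xy reps_O by (intro O_add O_mult O_pi) auto
  have "nv (\<pi> * y) < 1" using nv_mult_less_1[OF pi_lt_1] reps(4) xy by simp
  then show "nv a = 1" unfolding xy using unit_reps(2)[OF xy(2)] nv_add_eq[of "\<pi> * y" x] by simp
qed

lemma card_conjs: "finite conjs" "card conjs = d"
proof -
  let ?f = "\<lambda>(x, y). act (x + \<pi> * y) u"
  have inj: "inj_on ?f (unit_reps \<times> reps)"
  proof (rule inj_onI, clarify)
    fix x y x' y' assume xy: "x \<in> unit_reps" "y \<in> reps" "x' \<in> unit_reps" "y' \<in> reps"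
      and eq: "act (x + \<pi> * y) u = act (x' + \<pi> * y') u"
    have "nv ((x + \<pi> * y) - (x' + \<pi> * y')) < nv \<pi>"
      using xy eq by (intro act_u_eqD conj_index) (auto simp: conj_index_def)
    then have lt: "nv ((x - x') + \<pi> * (y - y')) < nv \<pi>" by (simp add: algebra_simps)
    have "nv (y - y') \<le> 1" using reps(4) xy by (intro nv_diff_le) auto
    then have "nv (\<pi> * (y - y')) < 1" using nv_mult_less_1[OF pi_lt_1] by blast
    moreover have "nv ((x - x') + \<pi> * (y - y')) < 1" using lt pi_lt_1 by simp
    ultimately have "nv (((x - x') + \<pi> * (y - y')) - \<pi> * (y - y')) < 1" by (intro nv_diff_less)
    then have x: "x = x'" using reps(5) unit_reps(1) xy by simp
    then have "nv \<pi> * nv (y - y') < nv \<pi> * 1" using lt by (simp add: nv_mult)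
    then have "nv (y - y') < 1" using pi_nz by simp
    then show "x = x' \<and> y = y'" using x reps(5) xy by simp
  qed
  have e: "conjs = ?f ` (unit_reps \<times> reps)"
    unfolding conjs_def conj_index_def image_image by (intro image_cong) auto
  show "finite conjs" unfolding e using unit_reps(4) reps(2) by simp
  show "card conjs = d"
    unfolding e card_image[OF inj] by (simp add: card_cartesian_product unit_reps(5) reps(3) d_def mult.commute)
qed

lemma act_unit:
  assumes a: "a \<in> OK" "nv a = 1"
  shows "nv (act a u) = nv u" "poly P (poly P (act a u)) = 0" "poly P (act a u) \<noteq> 0" "poly \<Phi> (act a u) = 0"
proof -
  have PuL: "nv (poly P u) < 1" using nv_P_u u_lt q_ge_2 by (simp add: power_less_one_iff)
  show n: "nv (act a u) = nv u" using act_unit_dilation[OF a u_lt, of 0] act_0[OF a(1)] by simp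
  show t: "poly P (poly P (act a u)) = 0"
    using act_P[OF a(1) u_lt] act_P[OF a(1) PuL] u_torsion act_0[OF a(1)] by simp
  show p: "poly P (act a u) \<noteq> 0"
    using act_P[OF a(1) u_lt] act_unit_dilation[OF a PuL, of 0] act_0[OF a(1)] P_u_nz by auto
  show "poly \<Phi> (act a u) = 0" by (rule Phi_root[OF t p])
qed

lemma Phi_eq_prod: "\<Phi> = (\<Prod>r\<in>conjs. [:- r, 1:])"
  using card_conjs Phi_monic act_unit(4) conj_index
  by (intro monic_eq_prod_roots) (auto simp: conjs_def)

lemma Phi_roots: "poly \<Phi> r = 0 \<longleftrightarrow> r \<in> conjs"
  unfolding Phi_eq_prod poly_prod prod_zero_iff[OF card_conjs(1)] by simp

lemma conjs_L: "r \<in> conjs \<Longrightarrow> r \<in> L"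
  unfolding conjs_def using act_u_L[OF _ u_L u_lt] conj_index by auto

lemma conjs_torsion: "r \<in> conjs \<Longrightarrow> torsion_point K \<pi> q P l e r"
  using act_unit(1,2) conj_index u_lt nv_u_power unfolding conjs_def by unfold_locales auto

end

section \<open>The Galois group of \<open>L\<close> over \<open>K\<close>\<close>

context torsion_point
begin

lemma poly_conj_eq:
  assumes r: "r \<in> conjs" and h: "h \<in> polys_over K" and k: "k \<in> polys_over K" and eq: "poly h u = poly k u"
  shows "poly h r = poly k r"
proof -
  obtain s where "h - k = \<Phi> * s" using Phi_divides[OF polys_over_diff[OF h k]] eq by auto
  then have "poly (h - k) r = 0" using Phi_roots r by simp
  then show ?thesis by simp
qed

lemma u_act_conj:
  assumes r: "r \<in> conjs" shows "\<exists>b\<in>OK. act b r = u"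
proof -
  obtain a where a: "a \<in> OK" "nv a = 1" "r = act a u"
    using r conj_index by (auto simp: conjs_def)
  have b: "inverse a \<in> OK" using a by (simp add: O_iff mems nv_inverse)
  have "act (inverse a) r = act (inverse a * a) u" unfolding a(3) by (rule act_act[OF b a(1) u_lt])
  also have "inverse a * a = 1" using a(2) by (intro left_inverse) auto
  also have "act 1 u = u"
  proof -
      have lim: "(\<lambda>N. \<Sum>n<N. fps_X $ n * u ^ n) \<longlonglongrightarrow> act 1 u"
        unfolding act_def br_one by (rule fps_at_tendsto[OF complete_C fps_X_integral u_lt])
      have "(\<lambda>N. \<Sum>n<N. fps_X $ n * u ^ n) \<longlonglongrightarrow> u"
      proof (rule Lim_transform_eventually[OF tendsto_const])
        show "\<forall>\<^sub>F N in sequentially. u = (\<Sum>n<N. fps_X $ n * u ^ n)"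
        proof (rule eventually_mono[OF eventually_gt_at_top[of 1]])
          fix N :: nat assume "1 < N"
          moreover have "fps_X $ n * u ^ n = (if n = 1 then u else 0)" for n by (simp add: fps_X_def)
          ultimately show "u = (\<Sum>n<N. fps_X $ n * u ^ n)" by simp
        qed
      qed
      then show ?thesis using lim LIMSEQ_unique by blast
  qed
  finally show ?thesis using b by blast
qed

text \<open>The inverse unit carries \<open>r\<close> back to \<open>u\<close>, and both fields are
  stable under the action because they are closed.\<close>

lemma conj_same_field:
  assumes r: "r \<in> conjs" shows "torsion_point.L K r = L"
proof -
  interpret R: torsion_point K \<pi> q P l e r by (rule conjs_torsion[OF r])
  have "R.L \<subseteq> L"
  proof
    fix x assume "x \<in> R.L"
    then obtain h where "h \<in> polys_over K" "x = poly h r" by (auto simp: R.L_def)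
    then show "x \<in> L" using conjs_L[OF r] K_L by (auto intro!: LF.poly_mem simp: polys_over_def)
  qed
  moreover have "L \<subseteq> R.L"
  proof
    fix x assume "x \<in> L"
    then obtain h where h: "h \<in> polys_over K" "x = poly h u" by (auto simp: L_def)
    obtain b where b: "b \<in> OK" "act b r = u" using u_act_conj[OF r] by blast
    have "u \<in> R.L" using R.act_u_L[OF b(1) R.u_L R.u_lt] b(2) by simp
    then show "x \<in> R.L" using h R.K_L by (auto intro!: R.LF.poly_mem simp: polys_over_def)
  qed
  ultimately show ?thesis by blast
qed

definition sg :: "'a \<Rightarrow> 'a \<Rightarrow> 'a" where "sg r = restrict (\<lambda>x. poly (rd x) r) L"

lemma sg_poly: "r \<in> conjs \<Longrightarrow> h \<in> polys_over K \<Longrightarrow> sg r (poly h u) = poly h r"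
  using L_mem[of h] rd[OF L_mem[of h]] poly_conj_eq[of r "rd (poly h u)" h] by (simp add: sg_def)

lemma sg_u: "r \<in> conjs \<Longrightarrow> sg r u = r"
  using sg_poly[OF _ polys_over_monom[OF one_mem, of 1]] by (simp add: poly_monom)

text \<open>Conjugates have the same absolute value, so each term of \<open>rd x\<close> keeps its
  size when \<open>u\<close> is replaced by \<open>r\<close>, and at \<open>u\<close> no term
  exceeds \<open>x\<close>.\<close>

lemma nv_sg_le:
  assumes r: "r \<in> conjs" and x: "x \<in> L" shows "nv (sg r x) \<le> nv x"
proof -
  note h = rd[OF x]
  have nr: "nv r = nv u" using r act_unit(1) conj_index by (auto simp: conjs_def)
  have "sg r x = poly (rd x) r" using x by (simp add: sg_def)
  also have "nv \<dots> \<le> nv x"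
    unfolding poly_altdef
  proof (rule nv_sum_le)
    fix i
    show "nv (poly.coeff (rd x) i * r ^ i) \<le> nv x"
      using nv_poly_u[OF h(1,2), of i] h(3) by (simp add: nv_mult nv_power nr)
  qed simp
  finally show ?thesis .
qed

lemma sg_Gal: assumes r: "r \<in> conjs" shows "sg r \<in> Gal K L"
proof (rule GalI)
  interpret R: torsion_point K \<pi> q P l e r by (rule conjs_torsion[OF r])
  have rep: "\<exists>h\<in>polys_over K. x = poly h u" if "x \<in> L" for x using that by (auto simp: L_def)
  show "sg r (x + y) = sg r x + sg r y" if "x \<in> L" "y \<in> L" for x y
  proof -
    obtain h k where hk: "h \<in> polys_over K" "k \<in> polys_over K" "x = poly h u" "y = poly k u"
      using rep[OF \<open>x \<in> L\<close>] rep[OF \<open>y \<in> L\<close>] by blast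
    have "sg r (x + y) = sg r (poly (h + k) u)" using hk by simp
    also have "\<dots> = poly (h + k) r" by (rule sg_poly[OF r polys_over_add[OF hk(1,2)]])
    finally show ?thesis using hk sg_poly[OF r] by simp
  qed
  show "sg r (x * y) = sg r x * sg r y" if "x \<in> L" "y \<in> L" for x y
  proof -
    obtain h k where hk: "h \<in> polys_over K" "k \<in> polys_over K" "x = poly h u" "y = poly k u"
      using rep[OF \<open>x \<in> L\<close>] rep[OF \<open>y \<in> L\<close>] by blast
    have "sg r (x * y) = sg r (poly (h * k) u)" using hk by simp
    also have "\<dots> = poly (h * k) r" by (rule sg_poly[OF r polys_over_mult[OF hk(1,2)]])
    finally show ?thesis using hk sg_poly[OF r] by simp
  qed
  show c: "sg r x = x" if "x \<in> K" for x using sg_poly[OF r polys_over_const[OF that]] by simp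
  show "sg r 1 = 1" by (rule c[OF one_mem])
  show "sg r \<in> extensional L" by (simp add: sg_def)
  show "bij_betw (sg r) L L"
    unfolding bij_betw_def
  proof
    show "inj_on (sg r) L"
    proof (rule inj_onI)
      fix x y assume xy: "x \<in> L" "y \<in> L" "sg r x = sg r y"
      obtain h k where hk: "h \<in> polys_over K" "k \<in> polys_over K" "x = poly h u" "y = poly k u"
        using rep[OF xy(1)] rep[OF xy(2)] by blast
      then have "poly (h - k) r = 0" using xy(3) sg_poly[OF r] by simp
      then obtain s where "h - k = R.\<Phi> * s"
        using R.Phi_divides[OF polys_over_diff[OF hk(1,2)]] by blast
      then have "poly (h - k) u = 0" using Phi_u by simp
      then show "x = y" using hk by simp
    qed
    show "sg r ` L = L"
    proof
      show "sg r ` L \<subseteq> L"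
      proof
        fix y assume "y \<in> sg r ` L"
        then obtain h where "h \<in> polys_over K" "y = poly h r" using rep sg_poly[OF r] by force
        then show "y \<in> L" unfolding conj_same_field[OF r, symmetric] by (auto simp: R.L_def)
      qed
      show "L \<subseteq> sg r ` L"
      proof
        fix y assume "y \<in> L"
        then obtain h where "h \<in> polys_over K" "y = poly h r"
          unfolding conj_same_field[OF r, symmetric] by (auto simp: R.L_def)
        then show "y \<in> sg r ` L" using sg_poly[OF r] L_mem by (metis image_eqI)
      qed
    qed
  qed
qed

lemma Gal_poly:
  assumes t: "\<tau> \<in> Gal K L" and h: "h \<in> polys_over K" and x: "x \<in> L"
  shows "\<tau> (poly h x) = poly h (\<tau> x)"
proof -
  have hL: "poly.coeff h i \<in> L" for i using h K_L by (auto simp: polys_over_def)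
  have "\<tau> (poly h x) = (\<Sum>i\<le>Polynomial.degree h. \<tau> (poly.coeff h i * x ^ i))"
    unfolding poly_altdef
    by (rule Gal_hom(4)[OF LF.set_subfield_axioms t]) (intro L_mult L_power hL x)
  also have "\<dots> = (\<Sum>i\<le>Polynomial.degree h. poly.coeff h i * \<tau> x ^ i)"
  proof (rule sum.cong[OF refl])
    fix i
    have "\<tau> (poly.coeff h i) = poly.coeff h i" using h by (intro GalD(7)[OF t]) (simp add: polys_over_def)
    then show "\<tau> (poly.coeff h i * x ^ i) = poly.coeff h i * \<tau> x ^ i"
      using GalD(4)[OF t hL[of i] L_power[OF x, of i]] Gal_hom(6)[OF LF.set_subfield_axioms t x] by simp
  qed
  finally show ?thesis by (simp add: poly_altdef)
qed

lemma Gal_u_conj: assumes t: "\<tau> \<in> Gal K L" shows "\<tau> u \<in> conjs"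
proof -
  have "poly \<Phi> (\<tau> u) = \<tau> (poly \<Phi> u)" by (rule Gal_poly[OF t Phi_over u_L, symmetric])
  also have "\<dots> = 0" unfolding Phi_u by (rule Gal_hom(1)[OF LF.set_subfield_axioms t])
  finally show ?thesis by (simp add: Phi_roots)
qed

lemma Gal_eq_sg: assumes t: "\<tau> \<in> Gal K L" shows "\<tau> = sg (\<tau> u)"
proof (rule Gal_eqI[OF t sg_Gal[OF Gal_u_conj[OF t]]])
  fix x assume "x \<in> L"
  then obtain h where h: "h \<in> polys_over K" "x = poly h u" by (auto simp: L_def)
  then show "\<tau> x = sg (\<tau> u) x" using Gal_poly[OF t h(1) u_L] sg_poly[OF Gal_u_conj[OF t] h(1)] by simp
qed

lemma Gal_K_L: "Gal K L = sg ` conjs"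
  using sg_Gal Gal_eq_sg Gal_u_conj by blast

lemma sg_inj: "inj_on sg conjs"
  by (rule inj_onI) (metis sg_u)

lemma card_Gal: "finite (Gal K L)" "card (Gal K L) = d"
  unfolding Gal_K_L using card_conjs card_image[OF sg_inj] by auto

lemma nv_Gal: assumes t: "\<tau> \<in> Gal K L" and x: "x \<in> L" shows "nv (\<tau> x) = nv x"
proof (rule antisym)
  have le: "nv (\<tau> x) \<le> nv x" if "\<tau> \<in> Gal K L" "x \<in> L" for \<tau> x
    using nv_sg_le[OF Gal_u_conj[OF that(1)] that(2)] Gal_eq_sg[OF that(1)] by metis
  show "nv (\<tau> x) \<le> nv x" by (rule le[OF t x])
  obtain \<rho> where r: "\<rho> \<in> Gal K L" "\<rho> (\<tau> x) = x"
    using Gal_inverse[OF LF.set_subfield_axioms K_L t] x by blast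
  show "nv x \<le> nv (\<tau> x)" using le[OF r(1) GalD(2)[OF t x]] r(2) by simp
qed

text \<open>Automorphisms are isometries, so they commute with convergent series over
  \<open>K\<close>.\<close>

lemma Gal_act:
  assumes t: "\<tau> \<in> Gal K L" and b: "b \<in> OK" and x: "x \<in> L" "nv x < 1"
  shows "\<tau> (act b x) = act b (\<tau> x)"
proof -
  let ?S = "\<lambda>x N. \<Sum>n<N. br b $ n * x ^ n"
  have bK: "br b $ n \<in> K" for n using br_OK[OF b] by (simp add: O_iff)
  have SL: "?S x N \<in> L" for N
    by (rule L_sum, rule L_mult) (use bK K_L L_power[OF x(1)] in auto)
  have St: "\<tau> (?S x N) = ?S (\<tau> x) N" for N
  proof -
    have "?S y N = poly (\<Sum>n<N. Polynomial.monom (br b $ n) n) y" for y by (simp add: poly_sum poly_monom)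
    then show ?thesis using Gal_poly[OF t _ x(1)] bK by (simp add: polys_over_sum polys_over_monom)
  qed
  have aL: "act b x \<in> L" by (rule act_u_L[OF b x])
  have "?S x \<longlonglongrightarrow> act b x"
    unfolding act_def by (rule fps_at_tendsto[OF complete_C br_integral[OF b] x(2)])
  then have "(\<lambda>N. nv (?S x N - act b x)) \<longlonglongrightarrow> 0" by (simp add: tendsto_nv_iff[of "?S x"])
  moreover have "nv (?S x N - act b x) = nv (?S (\<tau> x) N - \<tau> (act b x))" for N
    using nv_Gal[OF t L_diff[OF SL aL]] Gal_hom(3)[OF LF.set_subfield_axioms t SL aL] St by simp
  ultimately have "?S (\<tau> x) \<longlonglongrightarrow> \<tau> (act b x)" by (simp add: tendsto_nv_iff[of "?S (\<tau> x)"])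
  moreover have "?S (\<tau> x) \<longlonglongrightarrow> act b (\<tau> x)"
    unfolding act_def using nv_Gal[OF t x(1)] x(2)
    by (intro fps_at_tendsto[OF complete_C br_integral[OF b]]) simp
  ultimately show ?thesis by (rule LIMSEQ_unique)
qed

text \<open>Automorphisms act on the generator \<open>u\<close> through the series
  \<open>br a\<close>, which commute under composition.\<close>

lemma Gal_comm:
  assumes s: "\<sigma> \<in> Gal K L" and t: "\<tau> \<in> Gal K L" and x: "x \<in> L"
  shows "\<sigma> (\<tau> x) = \<tau> (\<sigma> x)"
proof -
  obtain a b where ab: "a \<in> OK" "\<sigma> u = act a u" "b \<in> OK" "\<tau> u = act b u"
    using Gal_u_conj[OF s] Gal_u_conj[OF t] conj_index(1) by (auto simp: conjs_def)
  have "\<sigma> (\<tau> u) = act b (act a u)" using Gal_act[OF s ab(3) u_L u_lt] ab by simp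
  also have "\<dots> = act a (act b u)"
    using act_act[OF ab(1,3) u_lt] act_act[OF ab(3,1) u_lt] by (simp add: mult.commute)
  also have "\<dots> = \<tau> (\<sigma> u)" using Gal_act[OF t ab(1) u_L u_lt] ab by simp
  finally have u: "\<sigma> (\<tau> u) = \<tau> (\<sigma> u)" .
  obtain h where h: "h \<in> polys_over K" "x = poly h u" using x by (auto simp: L_def)
  show ?thesis
    unfolding h(2) Gal_poly[OF t h(1) u_L] Gal_poly[OF s h(1) u_L]
      Gal_poly[OF s h(1) GalD(2)[OF t u_L]] Gal_poly[OF t h(1) GalD(2)[OF s u_L]] u ..
qed

text \<open>The polynomial \<open>rd x - [:x:]\<close> has degree below \<open>d\<close> but
  vanishes at all \<open>d\<close> conjugates of \<open>u\<close>. Hence it is zero, and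
  \<open>x\<close> is a coefficient of \<open>rd x\<close>.\<close>

lemma Gal_fixed:
  assumes x: "x \<in> L" and fx: "\<And>\<sigma>. \<sigma> \<in> Gal K L \<Longrightarrow> \<sigma> x = x" shows "x \<in> K"
proof -
  define h where "h = rd x - [:x:]"
  have "poly h r = 0" if r: "r \<in> conjs" for r
    using fx[OF sg_Gal[OF r]] x by (simp add: h_def sg_def)
  then have sub: "conjs \<subseteq> {r. poly h r = 0}" by blast
  have deg: "Polynomial.degree h < d"
    unfolding h_def using rd(2)[OF x] d_pos by (intro degree_diff_less) auto
  have "h = 0"
  proof (rule ccontr)
    assume h: "h \<noteq> 0"
    have "card conjs \<le> card {r. poly h r = 0}" by (rule card_mono[OF poly_roots_finite[OF h] sub])
    also have "\<dots> \<le> Polynomial.degree h" by (rule card_poly_roots_bound[OF h])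
    finally show False using deg card_conjs(2) by simp
  qed
  then have "rd x = [:x:]" by (simp add: h_def)
  then have "poly.coeff (rd x) 0 = x" by simp
  then show ?thesis using rd(1)[OF x] unfolding polys_over_def by (metis mem_Collect_eq)
qed

sublocale galois: finite_galois K L
  by unfold_locales (use K_L card_Gal Gal_fixed Gal_comm in auto)

text \<open>All roots of \<open>P\<close>, obtained by letting units act on the nonzero root
  \<open>poly P u\<close>.\<close>

definition torsion1 :: "'a set" where "torsion1 = insert 0 ((\<lambda>a. act a (poly P u)) ` unit_reps)"

lemma nv_P_u_lt: "nv (poly P u) < 1" using nv_P_u u_lt q_ge_2 by (simp add: power_less_one_iff)

lemma P_u_L: "poly P u \<in> L" by (rule L_mem[OF P_over])

lemma torsion1: "finite torsion1" "card torsion1 = q" "x \<in> torsion1 \<Longrightarrow> poly P x = 0" "x \<in> torsion1 \<Longrightarrow> x \<in> L"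
proof -
  let ?v = "poly P u"
  show "finite torsion1" using unit_reps(4) by (simp add: torsion1_def)
  have inj: "inj_on (\<lambda>a. act a ?v) unit_reps"
  proof (rule inj_onI)
    fix a b assume ab: "a \<in> unit_reps" "b \<in> unit_reps" "act a ?v = act b ?v"
    have "(a - b) * ?v = (act b ?v - b * ?v) - (act a ?v - a * ?v)" using ab by (simp add: algebra_simps)
    then have "nv ((a - b) * ?v) \<le> nv ?v ^ 2"
      using nv_diff_le[OF act_approx[OF unit_reps(3)[OF ab(2)] nv_P_u_lt] act_approx[OF unit_reps(3)[OF ab(1)] nv_P_u_lt]]
      by simp
    then have "nv (a - b) \<le> nv ?v" using P_u_nz by (simp add: nv_mult power2_eq_square)
    then show "a = b" using nv_P_u_lt reps(5) unit_reps(1) ab by (meson le_less_trans)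
  qed
  have nz: "act a ?v \<noteq> 0" if a: "a \<in> unit_reps" for a
    using act_unit_dilation[OF unit_reps(3)[OF a] unit_reps(2)[OF a] nv_P_u_lt, of 0] act_0[OF unit_reps(3)[OF a]] P_u_nz
    by auto
  show "card torsion1 = q"
    unfolding torsion1_def using nz unit_reps(4,5) q_ge_2
    by (subst card_insert_disjoint) (auto simp: card_image[OF inj])
  show "poly P x = 0" if x: "x \<in> torsion1"
  proof (cases "x = 0")
    case True
    then show ?thesis using P_0 by (simp add: poly_0_coeff_0)
  next
    case False
    then obtain a where a: "a \<in> unit_reps" "x = act a ?v" using x by (auto simp: torsion1_def)
    then show ?thesis using act_P[OF unit_reps(3)[OF a(1)] nv_P_u_lt] u_torsion act_0[OF unit_reps(3)[OF a(1)]] by simp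
  qed
  show "x \<in> L" if x: "x \<in> torsion1"
    using x act_u_L[OF unit_reps(3) P_u_L nv_P_u_lt] L_0 by (auto simp: torsion1_def)
qed

lemma P_eq_prod: "P = (\<Prod>r\<in>torsion1. [:- r, 1:])"
  using torsion1(1-3) deg_P lead_P by (intro monic_eq_prod_roots) auto

lemma P_roots: "poly P x = 0 \<Longrightarrow> x \<in> torsion1"
proof -
  assume "poly P x = 0"
  then have "(\<Prod>r\<in>torsion1. x - r) = 0" by (subst (asm) P_eq_prod) (simp add: poly_prod)
  then show ?thesis using torsion1(1) by auto
qed

lemma L_eq_ext2: "lubin_tate_ext2 K P = L"
proof
  let ?H = "K \<union> {x. 0 < val x \<and> poly P (poly P x) = 0}"
  interpret A: field "ambient :: 'a ring" by rule
  have HL: "?H \<subseteq> L"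
  proof
    fix x assume x: "x \<in> ?H"
    show "x \<in> L"
    proof (cases "x \<in> K")
      case False
      then have t: "poly P (poly P x) = 0" using x by blast
      show ?thesis
      proof (cases "poly P x = 0")
        case True
        then show ?thesis using P_roots torsion1(4) by blast
      next
        case False
        then show ?thesis using Phi_root[OF t] Phi_roots conjs_L by blast
      qed
    qed (use K_L in auto)
  qed
  show "lubin_tate_ext2 K P \<subseteq> L"
  proof
    fix x assume "x \<in> lubin_tate_ext2 K P"
    then have "x \<in> generate_field ambient ?H" by (simp add: lubin_tate_ext2_def)
    then show "x \<in> L"
    proof (induction rule: generate_field.induct)
      case (a_inv h)
      have "\<ominus>\<^bsub>ambient\<^esub> h \<oplus>\<^bsub>ambient\<^esub> h = \<zero>\<^bsub>(ambient :: 'a ring)\<^esub>" by (rule A.l_neg) simp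
      then have "\<ominus>\<^bsub>ambient\<^esub> h = - h" by (simp add: eq_neg_iff_add_eq_0)
      then show ?case using LF.uminus_mem[OF a_inv.IH] by simp
    next
      case (m_inv h)
      have "h \<in> Units (ambient :: 'a ring)" using m_inv.hyps A.field_Units by simp
      then have "inv\<^bsub>ambient\<^esub> h \<otimes>\<^bsub>ambient\<^esub> h = \<one>\<^bsub>(ambient :: 'a ring)\<^esub>" by (rule A.Units_l_inv)
      then have "inv\<^bsub>ambient\<^esub> h = inverse h" by (metis ambient_simps(2,3) inverse_unique mult.commute)
      then show ?case using LF.inverse_mem[OF m_inv.IH] by simp
    qed (use HL in \<open>auto intro: L_1 L_add L_mult\<close>)
  qed
  show "L \<subseteq> lubin_tate_ext2 K P"
  proof
    fix x assume "x \<in> L"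
    then obtain h where h: "h \<in> polys_over K" "x = poly h u" by (auto simp: L_def)
    have "subfield (generate_field ambient ?H) ambient" by (rule A.generate_field_is_subfield) simp
    then interpret G: set_subfield "generate_field ambient ?H" by (rule set_subfield_ambient)
    have "u \<in> generate_field ambient ?H"
      using u_lt u_torsion by (intro generate_field.incl) (simp add: val_pos_iff)
    moreover have "poly.coeff h i \<in> generate_field ambient ?H" for i
      using h(1) by (intro generate_field.incl) (simp add: polys_over_def)
    ultimately show "x \<in> lubin_tate_ext2 K P"
      unfolding h(2) lubin_tate_ext2_def by (intro G.poly_mem)
  qed
qed

end

section \<open>Power sums of torsion points\<close>

text \<open>
  Newton's identities in terms of the cofactors \<open>f/(X - r)\<close>: the sums
  \<open>\<Sum>\<^sub>r r\<^sup>m [X\<^sup>k] f/(X - r)\<close> are computed by recursion on \<open>m\<close>, starting from \<open>f'\<close>.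
\<close>

locale root_product =
  fixes R :: "'a::field set" and f :: "'a poly"
  assumes fin: "finite R" and f_eq: "f = (\<Prod>r\<in>R. [:- r, 1:])"
begin

definition cof :: "'a \<Rightarrow> nat \<Rightarrow> 'a"
  where "cof r k = poly.coeff (\<Prod>s\<in>R - {r}. [:- s, 1:]) k"

lemma cof_recursion:
  assumes r: "r \<in> R"
  shows "r * cof r 0 = - poly.coeff f 0" "r * cof r (Suc k) = cof r k - poly.coeff f (Suc k)"
proof -
  have "f = [:- r, 1:] * (\<Prod>s\<in>R - {r}. [:- s, 1:])" unfolding f_eq using fin r by (simp add: prod.remove)
  then have e: "f = Polynomial.smult (- r) (\<Prod>s\<in>R - {r}. [:- s, 1:]) + pCons 0 (\<Prod>s\<in>R - {r}. [:- s, 1:])"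
    by simp
  show "r * cof r 0 = - poly.coeff f 0" unfolding cof_def by (subst e) simp
  show "r * cof r (Suc k) = cof r k - poly.coeff f (Suc k)" unfolding cof_def by (subst e) simp
qed

lemma cof_top: "r \<in> R \<Longrightarrow> cof r (card R - 1) = 1"
proof -
  assume r: "r \<in> R"
  let ?g = "\<Prod>s\<in>R - {r}. [:- s, 1:]"
  have "Polynomial.degree ?g = card R - 1"
    using fin r by (subst degree_prod_eq_sum_degree) auto
  moreover have "Polynomial.lead_coeff ?g = 1" by (simp add: lead_coeff_prod)
  ultimately show ?thesis by (simp add: cof_def)
qed

lemma sum_cof: "(\<Sum>r\<in>R. cof r k) = of_nat (Suc k) * poly.coeff f (Suc k)"
proof -
  have "pderiv f = (\<Sum>r\<in>R. \<Prod>s\<in>R - {r}. [:- s, 1:])"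
    unfolding f_eq pderiv_prod by (intro sum.cong) (auto simp: pderiv_pCons one_pCons)
  then have "poly.coeff (pderiv f) k = (\<Sum>r\<in>R. cof r k)" by (simp add: cof_def coeff_sum)
  then show ?thesis by (simp add: coeff_pderiv)
qed

lemma sum_roots:
  assumes "2 \<le> card R" shows "(\<Sum>r\<in>R. r) = - poly.coeff f (card R - 1)"
proof -
  obtain m where m: "card R = Suc (Suc m)" using assms by (metis add_2_eq_Suc le_Suc_ex)
  have "r = cof r m - poly.coeff f (Suc m)" if "r \<in> R" for r
    using cof_recursion(2)[OF that, of m] cof_top[OF that] m by (simp add: One_nat_def)
  then have "(\<Sum>r\<in>R. r) = (\<Sum>r\<in>R. cof r m - poly.coeff f (Suc m))" by (rule sum.cong[OF refl])
  also have "\<dots> = (\<Sum>r\<in>R. cof r m) - of_nat (card R) * poly.coeff f (Suc m)"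
    by (simp add: sum_subtractf)
  also have "\<dots> = - poly.coeff f (Suc m)" unfolding sum_cof m by (simp add: algebra_simps)
  finally show ?thesis using m by (simp add: One_nat_def)
qed

lemma sum_cof_power_recursion:
  "(\<Sum>r\<in>R. cof r 0 * r ^ Suc m) = - poly.coeff f 0 * (\<Sum>r\<in>R. r ^ m)"
  "(\<Sum>r\<in>R. cof r (Suc k) * r ^ Suc m) = (\<Sum>r\<in>R. cof r k * r ^ m) - poly.coeff f (Suc k) * (\<Sum>r\<in>R. r ^ m)"
proof -
  have "cof r 0 * r ^ Suc m = - poly.coeff f 0 * r ^ m" if "r \<in> R" for r
    using arg_cong[OF cof_recursion(1)[OF that], of "\<lambda>x. x * r ^ m"] by (simp add: mult_ac)
  then show "(\<Sum>r\<in>R. cof r 0 * r ^ Suc m) = - poly.coeff f 0 * (\<Sum>r\<in>R. r ^ m)"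
    unfolding sum_distrib_left by (rule sum.cong[OF refl])
  have "cof r (Suc k) * r ^ Suc m = cof r k * r ^ m - poly.coeff f (Suc k) * r ^ m" if "r \<in> R" for r
    using arg_cong[OF cof_recursion(2)[OF that, of k], of "\<lambda>x. x * r ^ m"] by (simp add: algebra_simps)
  then show "(\<Sum>r\<in>R. cof r (Suc k) * r ^ Suc m) = (\<Sum>r\<in>R. cof r k * r ^ m) - poly.coeff f (Suc k) * (\<Sum>r\<in>R. r ^ m)"
    unfolding sum_distrib_left sum_subtractf[symmetric] by (rule sum.cong[OF refl])
qed

end

text \<open>The bound is proved for all mixed sums of \<open>cof r k * r ^ m\<close>: for
  \<open>m = 0\<close> they are the coefficients of the derivative, and the recursion preserves the
  bound. The top cofactor is \<open>1\<close>, so the power sums are among them.\<close>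

lemma nv_power_sum_le:
  fixes R :: "'a::nonarch_valued_field set"
  assumes R: "root_product R f" and int: "\<And>k. nv (poly.coeff f k) \<le> 1"
    and der: "\<And>k. nv (poly.coeff (pderiv f) k) \<le> c"
  shows "nv (\<Sum>r\<in>R. r ^ m) \<le> c"
proof -
  interpret root_product R f by (rule R)
  have c0: "0 \<le> c" using der[of 0] nv_nonneg order_trans by blast
  have top: "nv (\<Sum>r\<in>R. r ^ m) \<le> c" if "\<And>k. nv (\<Sum>r\<in>R. cof r k * r ^ m) \<le> c" for m
    using that[of "card R - 1"] cof_top by simp
  have "nv (\<Sum>r\<in>R. cof r k * r ^ m) \<le> c" for k m
  proof (induction m arbitrary: k)
    case 0
    then show ?case using der[of k] by (simp add: sum_cof coeff_pderiv)
  next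
    case (Suc m)
    note p = top[OF Suc.IH]
    have fp: "nv (poly.coeff f k * (\<Sum>r\<in>R. r ^ m)) \<le> c" for k by (rule nv_mult_le[OF int p])
    show ?case
    proof (cases k)
      case 0
      then show ?thesis unfolding 0 sum_cof_power_recursion using fp[of 0] by simp
    next
      case (Suc k')
      then show ?thesis unfolding Suc sum_cof_power_recursion using nv_diff_le[OF Suc.IH fp] by blast
    qed
  qed
  then show ?thesis by (rule top)
qed

definition coeffs_le :: "real \<Rightarrow> 'a::nonarch_valued_field poly \<Rightarrow> bool"
  where "coeffs_le c f \<longleftrightarrow> (\<forall>k. nv (poly.coeff f k) \<le> c)"

lemma coeffs_le_mult:
  assumes "coeffs_le a f" "coeffs_le b g" shows "coeffs_le (a * b) (f * g)"
proof -
  have a0: "0 \<le> a" "0 \<le> b" using assms nv_nonneg order_trans unfolding coeffs_le_def by blast+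
  have "nv (poly.coeff (f * g) k) \<le> a * b" for k
    unfolding coeff_mult
  proof (rule nv_sum_le)
    fix i
    show "nv (poly.coeff f i * poly.coeff g (k - i)) \<le> a * b"
      using assms a0 unfolding nv_mult coeffs_le_def by (intro mult_mono) auto
  qed (use a0 in simp)
  then show ?thesis by (simp add: coeffs_le_def)
qed

lemma coeffs_le_pcompose:
  assumes g: "coeffs_le 1 g" shows "coeffs_le c f \<Longrightarrow> coeffs_le c (pcompose f g)"
proof (induction f)
  case (pCons a f)
  have c: "nv a \<le> c" "coeffs_le c f"
  proof -
    have "nv (poly.coeff (pCons a f) 0) \<le> c" using pCons.prems unfolding coeffs_le_def by blast
    then show "nv a \<le> c" by simp
    have "nv (poly.coeff (pCons a f) (Suc k)) \<le> c" for k using pCons.prems unfolding coeffs_le_def by blast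
    then show "coeffs_le c f" by (simp add: coeffs_le_def)
  qed
  have "0 \<le> c" using c(1) nv_nonneg order_trans by blast
  have m: "coeffs_le c (g * pcompose f g)" using coeffs_le_mult[OF g pCons.IH[OF c(2)]] by simp
  have "nv (poly.coeff [:a:] k) \<le> c" for k
    using c(1) \<open>0 \<le> c\<close> by (auto simp: coeff_pCons split: nat.split)
  then have "nv (poly.coeff ([:a:] + g * pcompose f g) k) \<le> c" for k
    using m unfolding coeff_add coeffs_le_def by (intro nv_add_le) auto
  then show ?case unfolding pcompose_pCons by (simp add: coeffs_le_def)
qed (simp add: coeffs_le_def)

context torsion_point
begin

lemma coeffs_P: "coeffs_le 1 P" "coeffs_le (nv \<pi>) (pderiv P)"
proof -
  have sm: "nv (poly.coeff P k) \<le> nv \<pi>" if "k \<noteq> q" for k using discrete[OF P_K P_small[OF that]] .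
  have le1: "nv (poly.coeff P k) \<le> 1" for k
    using sm[of k] P_q pi_lt_1 by (cases "k = q") auto
  then show "coeffs_le 1 P" by (simp add: coeffs_le_def)
  have "nv (poly.coeff (pderiv P) k) \<le> nv \<pi>" for k
  proof (cases "Suc k = q")
    case True
    then show ?thesis using discrete[OF of_nat_mem q_small] P_q by (simp add: coeff_pderiv del: of_nat_Suc)
  next
    case False
    then show ?thesis unfolding coeff_pderiv using sm by (intro nv_mult_le nv_of_nat_le_1)
  qed
  then show "coeffs_le (nv \<pi>) (pderiv P)" by (simp add: coeffs_le_def)
qed

lemma torsion1_power_sum: "nv (\<Sum>r\<in>torsion1. r ^ m) \<le> nv \<pi>"
  using coeffs_P torsion1(1) P_eq_prod
  by (intro nv_power_sum_le[of torsion1 P]) (auto simp: coeffs_le_def root_product_def)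

text \<open>The equation \<open>poly P r = 0\<close> expresses \<open>r ^ q\<close> by lower powers
  with coefficients divisible by \<open>\<pi>\<close>, which adds one factor to
  \<open>torsion1_power_sum\<close>.\<close>

lemma torsion1_power_sum_ge_q:
  assumes "q \<le> m" shows "nv (\<Sum>r\<in>torsion1. r ^ m) \<le> nv \<pi> ^ 2"
proof -
  have rq: "r ^ m = - (\<Sum>j<q. poly.coeff P j * r ^ (m - q + j))" if r: "r \<in> torsion1" for r
  proof -
    have "(\<Sum>j<q. poly.coeff P j * r ^ j) + r ^ q = 0"
      using torsion1(3)[OF r] P_q unfolding poly_altdef deg_P by (simp flip: lessThan_Suc_atMost)
    then have "r ^ q = - (\<Sum>j<q. poly.coeff P j * r ^ j)" by (simp add: eq_neg_iff_add_eq_0 add.commute)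
    then have "r ^ (m - q) * r ^ q = - (\<Sum>j<q. poly.coeff P j * r ^ (m - q + j))"
      by (simp add: sum_distrib_left power_add mult_ac)
    then show ?thesis using assms by (simp flip: power_add)
  qed
  have "(\<Sum>r\<in>torsion1. r ^ m) = (\<Sum>r\<in>torsion1. - (\<Sum>j<q. poly.coeff P j * r ^ (m - q + j)))"
    by (rule sum.cong[OF refl rq])
  also have "\<dots> = - (\<Sum>j<q. poly.coeff P j * (\<Sum>r\<in>torsion1. r ^ (m - q + j)))"
    unfolding sum_negf sum_distrib_left by (subst sum.swap) simp
  also have "nv \<dots> \<le> nv \<pi> ^ 2"
    unfolding nv_uminus
  proof (rule nv_sum_le)
    fix j assume "j \<in> {..<q}"
    then show "nv (poly.coeff P j * (\<Sum>r\<in>torsion1. r ^ (m - q + j))) \<le> nv \<pi> ^ 2"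
      using discrete[OF P_K P_small[of j]] torsion1_power_sum unfolding nv_mult power2_eq_square
      by (intro mult_mono) auto
  qed simp
  finally show ?thesis .
qed

lemma torsion1_sum: "(\<Sum>r\<in>torsion1. r) = - poly.coeff P (q - 1)"
  using root_product.sum_roots[of torsion1 P] torsion1(1,2) P_eq_prod q_ge_2
  by (simp add: root_product_def)

text \<open>Together these are the roots of \<open>pcompose P P\<close>, whose derivative is by the
  chain rule a product of two polynomials divisible by \<open>\<pi>\<close>.\<close>

lemma conjs_torsion1_power_sum: "nv ((\<Sum>r\<in>conjs. r ^ m) + (\<Sum>r\<in>torsion1. r ^ m)) \<le> nv \<pi> ^ 2"
proof -
  have "conjs \<inter> torsion1 = {}"
    using act_unit(3) conj_index torsion1(3) by (fastforce simp: conjs_def)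
  note un = sum.union_disjoint[OF card_conjs(1) torsion1(1) this] prod.union_disjoint[OF card_conjs(1) torsion1(1) this]
  have "pcompose P P = (\<Prod>r\<in>conjs \<union> torsion1. [:- r, 1:])"
    unfolding un Phi_P by (simp only: Phi_eq_prod[symmetric] P_eq_prod[symmetric])
  then have "root_product (conjs \<union> torsion1) (pcompose P P)"
    using card_conjs(1) torsion1(1) by (simp add: root_product_def)
  moreover have "coeffs_le 1 (pcompose P P)" by (rule coeffs_le_pcompose[OF coeffs_P(1) coeffs_P(1)])
  moreover have "coeffs_le (nv \<pi> * nv \<pi>) (pderiv (pcompose P P))"
    unfolding pderiv_pcompose by (rule coeffs_le_mult[OF coeffs_le_pcompose[OF coeffs_P] coeffs_P(2)])
  ultimately have "nv (\<Sum>r\<in>conjs \<union> torsion1. r ^ m) \<le> nv \<pi> * nv \<pi>"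
    by (intro nv_power_sum_le) (auto simp: coeffs_le_def)
  then show ?thesis unfolding un by (simp add: power2_eq_square)
qed

lemma nv_pi_sq_less: "nv \<pi> ^ 2 < nv \<pi>"
  using pi_nz pi_lt_1 by (simp add: power2_eq_square)

lemma conjs_power_sum: "nv (\<Sum>r\<in>conjs. r ^ m) \<le> nv \<pi>"
proof -
  have "nv ((\<Sum>r\<in>conjs. r ^ m) + (\<Sum>r\<in>torsion1. r ^ m)) \<le> nv \<pi>"
    using conjs_torsion1_power_sum[of m] nv_pi_sq_less by linarith
  from nv_diff_le[OF this torsion1_power_sum[of m]] show ?thesis by simp
qed

lemma conjs_power_sum_ge_q: "q \<le> m \<Longrightarrow> nv (\<Sum>r\<in>conjs. r ^ m) \<le> nv \<pi> ^ 2"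
  using nv_diff_le[OF conjs_torsion1_power_sum torsion1_power_sum_ge_q, of m m] by simp

lemma trace_poly:
  assumes h: "h \<in> polys_over K"
  shows "gal_trace K L (poly h u) = (\<Sum>i\<le>Polynomial.degree h. poly.coeff h i * (\<Sum>r\<in>conjs. r ^ i))"
proof -
  have "gal_trace K L (poly h u) = (\<Sum>r\<in>conjs. sg r (poly h u))"
    unfolding gal_trace_def Gal_K_L by (simp add: sum.reindex[OF sg_inj])
  also have "\<dots> = (\<Sum>r\<in>conjs. poly h r)" by (rule sum.cong[OF refl sg_poly[OF _ h]])
  finally show ?thesis unfolding poly_altdef sum_distrib_left by (simp only: sum.swap[of _ _ conjs])
qed

text \<open>Modulo \<open>\<pi> ^ 2\<close> the trace is minus the sum of the roots of
  \<open>P\<close>, that is, the coefficient of degree \<open>q - 1\<close>.\<close>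

lemma nv_trace_u:
  assumes "nv (poly.coeff P (q - 1)) = nv \<pi>" shows "nv (gal_trace K L u) = nv \<pi>"
proof -
  have "gal_trace K L u = (\<Sum>r\<in>conjs. r)"
    unfolding gal_trace_def Gal_K_L by (simp add: sum.reindex[OF sg_inj] sg_u)
  then have "nv (gal_trace K L u - poly.coeff P (q - 1)) \<le> nv \<pi> ^ 2"
    using conjs_torsion1_power_sum[of 1] torsion1_sum by simp
  then have "nv (gal_trace K L u - poly.coeff P (q - 1)) < nv (poly.coeff P (q - 1))"
    using nv_pi_sq_less assms by linarith
  then show ?thesis using nv_eq_if_close assms by metis
qed

text \<open>Below degree \<open>q\<close> the coordinates of \<open>x\<close> are divisible by
  \<open>\<pi>\<close>, and so are the power sums. From degree \<open>q\<close> on the coordinates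
  are still integral, and the power sums are divisible by \<open>\<pi> ^ 2\<close>.\<close>

lemma nv_trace_le:
  assumes x: "x \<in> L" and le: "nv x \<le> nv u ^ q"
  shows "nv (gal_trace K L x) \<le> nv \<pi> ^ 2"
proof -
  let ?h = "rd x"
  note h = rd[OF x]
  have hK: "poly.coeff ?h i \<in> K" for i using h(1) by (simp add: polys_over_def)
  have c: "nv (poly.coeff ?h i) * nv u ^ i \<le> nv u ^ q" for i
    using nv_poly_u_le[OF h(1,2), of q i] h(3) le by simp
  have u0: "0 < nv u" using u_nz by simp
  have "gal_trace K L x = (\<Sum>i\<le>Polynomial.degree ?h. poly.coeff ?h i * (\<Sum>r\<in>conjs. r ^ i))"
    using trace_poly[OF h(1)] h(3) by simp
  also have "nv \<dots> \<le> nv \<pi> ^ 2"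
  proof (rule nv_sum_le)
    fix i assume "i \<in> {..Polynomial.degree ?h}"
    then have i: "i < d" using h(2) by simp
    show "nv (poly.coeff ?h i * (\<Sum>r\<in>conjs. r ^ i)) \<le> nv \<pi> ^ 2"
    proof (cases "i < q")
      case True
      have "nv u ^ q < nv u ^ i" using True u0 u_lt by (intro power_strict_decreasing) auto
      then have "nv (poly.coeff ?h i) * nv u ^ i < 1 * nv u ^ i" using c[of i] by linarith
      then have "nv (poly.coeff ?h i) < 1" using u0 by simp
      then have "nv (poly.coeff ?h i) \<le> nv \<pi>" using discrete hK by blast
      then show ?thesis unfolding nv_mult power2_eq_square using conjs_power_sum by (intro mult_mono) auto
    next
      case False
      have "nv (\<pi> * poly.coeff ?h i) * nv u ^ i \<le> nv u ^ d * nv u ^ q"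
        using mult_left_mono[OF c[of i], of "nv \<pi>"] by (simp add: nv_mult nv_u_d mult_ac)
      also have "\<dots> < nv u ^ i"
        using i u0 u_lt q_ge_2 unfolding power_add[symmetric] by (intro power_strict_decreasing) auto
      finally have "nv (\<pi> * poly.coeff ?h i) < 1" using u0 by simp
      then have "nv (\<pi> * poly.coeff ?h i) \<le> nv \<pi>" using discrete mult_mem[OF pi_K hK] by blast
      then have "nv (poly.coeff ?h i) \<le> 1" using pi_nz by (simp add: nv_mult)
      then show ?thesis using conjs_power_sum_ge_q[of i] False by (intro nv_mult_le) auto
    qed
  qed simp
  finally show ?thesis .
qed

end

section \<open>The subextension of degree \<open>q\<close>\<close>

locale degree_q_subextension = torsion_point K \<pi> q P l e u + M: set_subfield M
  for K :: "'a::nonarch_valued_field set" and \<pi> :: 'a and q :: nat and P :: "'a poly" and l e :: "'a fps"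
    and u :: 'a and M :: "'a set" +
  assumes KsM: "K \<subseteq> M" and MsL: "M \<subseteq> L" and dim_M: "ring.dimension ambient q K M"
    and coeff_P: "nv (poly.coeff P (q - 1)) = nv \<pi>"
begin

sublocale mid: galois_intermediate K L M q
  by unfold_locales (rule KsM MsL dim_M)+

definition t :: 'a where "t = gal_trace M L u"

text \<open>The absolute value of a uniformizer of \<open>M\<close>, because \<open>L\<close> is
  totally ramified of degree \<open>q - 1\<close> over \<open>M\<close>.\<close>

definition \<rho> :: real where "\<rho> = nv u ^ (q - 1)"

lemma rho: "0 < \<rho>" "\<rho> < 1" "\<rho> ^ q = nv \<pi>" "\<rho> ^ 2 < \<rho>"
proof -
  show 0: "0 < \<rho>" using u_nz by (simp add: \<rho>_def)
  show 1: "\<rho> < 1" unfolding \<rho>_def using u_lt q_ge_2 by (simp add: power_less_one_iff)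
  show "\<rho> ^ q = nv \<pi>" using nv_u_power by (simp add: \<rho>_def mult.commute flip: power_mult)
  show "\<rho> ^ 2 < \<rho>" using 0 1 by (simp add: power2_eq_square)
qed

lemma nv_pi_le_rho: "nv \<pi> \<le> \<rho>"
  using power_decreasing[of 1 q \<rho>] rho q_ge_2 by simp

lemma card_Gal_M_L: "card (Gal M L) = q - 1"
proof -
  have "q * card (Gal M L) = q * (q - 1)" using mid.card_tower card_Gal(2) by (simp only: d_def)
  then show ?thesis using q_ge_2 by (metis mult_cancel1 not_numeral_le_zero)
qed

lemma nv_Gal_M: assumes s: "\<sigma> \<in> Gal K M" and x: "x \<in> M" shows "nv (\<sigma> x) = nv x"
proof -
  obtain \<tau> where t: "\<tau> \<in> Gal K L" "\<sigma> = mid.res \<tau>" using s unfolding mid.Gal_K_M(1) by blast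
  have "x \<in> L" using x MsL by blast
  then show ?thesis using nv_Gal[OF t(1)] x by (simp add: t(2) mid.res_eq)
qed

text \<open>The norm to \<open>K\<close> has absolute value \<open>nv x ^ q\<close>, which is a
  power of \<open>nv \<pi> = \<rho> ^ q\<close>.\<close>

lemma value_group_M:
  assumes x: "x \<in> M" "x \<noteq> 0" shows "\<exists>k. nv x = \<rho> powi k"
proof -
  let ?N = "\<Prod>\<sigma>\<in>Gal K M. \<sigma> x"
  have N: "nv ?N = nv x ^ q"
  proof -
    have "nv ?N = (\<Prod>\<sigma>\<in>Gal K M. nv x)"
      unfolding nv_prod by (rule prod.cong[OF refl nv_Gal_M[OF _ x(1)]])
    then show ?thesis by (simp add: mid.Gal_K_M(3))
  qed
  then have "nv ?N \<noteq> 0" using x(2) by simp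
  then have "?N \<noteq> 0" by (simp only: nv_eq_0_iff not_False_eq_True)
  then obtain k where "nv ?N = nv \<pi> powi k" using nv_discrete[OF mid.bot.norm_mem[OF x(1)]] by blast
  then have "nv x ^ q = (\<rho> powi k) ^ q"
    using N by (simp add: power_int_power power_int_power' mult.commute flip: rho(3))
  then have "nv x = \<rho> powi k"
    using power_eq_imp_eq_base[of "nv x" q "\<rho> powi k"] rho(1) q_ge_2 by simp
  then show ?thesis by blast
qed

lemma nv_M_le:
  assumes x: "x \<in> M" and lt: "nv x < \<rho> ^ n" shows "nv x \<le> \<rho> ^ Suc n"
proof (cases "x = 0")
  case False
  obtain k where k: "nv x = \<rho> powi k" using value_group_M[OF x False] by blast
  have "int n < k"
  proof (rule ccontr)
    assume "\<not> int n < k"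
    then have "\<rho> powi int n \<le> \<rho> powi k" using rho by (intro power_int_decreasing) auto
    then show False using lt k by simp
  qed
  then have "\<rho> powi k \<le> \<rho> powi int (Suc n)" using rho by (intro power_int_decreasing) auto
  then show ?thesis using k by (simp only: power_int_of_nat)
qed (use rho in simp)

lemma u_M_trace: "t \<in> M"
  unfolding t_def by (rule mid.top.trace_mem[OF u_L])

lemma nv_q_minus_1: "nv (of_nat (q - 1) :: 'a) = 1"
proof -
  have "nv (- 1 + of_nat q :: 'a) = nv (- 1 :: 'a)" by (rule nv_add_eq) (simp add: q_small)
  then show ?thesis using q_ge_2 by (simp add: of_nat_diff)
qed

lemma nv_trace_M_le:
  assumes x: "x \<in> M" and le: "nv x \<le> \<rho> ^ 2" shows "nv (gal_trace K M x) \<le> nv \<pi> ^ 2"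
proof -
  have "nv (gal_trace K L x) = nv (gal_trace K M x)"
    unfolding mid.trace_of_M[OF x] card_Gal_M_L nv_mult nv_q_minus_1 by simp
  \<comment> \<open>This is the inequality \<open>2 * (q - 1) \<ge> q\<close>.\<close>
  moreover have "\<rho> ^ 2 \<le> nv u ^ q"
    unfolding \<rho>_def power_mult[symmetric] using u_lt q_ge_2 by (intro power_decreasing) auto
  then have "nv (gal_trace K L x) \<le> nv \<pi> ^ 2" using x MsL le by (intro nv_trace_le) auto
  ultimately show ?thesis by simp
qed

lemma nv_trace_M_le_self: assumes x: "x \<in> M" shows "nv (gal_trace K M x) \<le> nv x"
  unfolding gal_trace_def by (rule nv_sum_le) (use nv_Gal_M[OF _ x] in auto)

lemma nv_trace_t: "nv (gal_trace K M t) = nv \<pi>"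
  unfolding t_def mid.trace_tower[OF u_L] by (rule nv_trace_u[OF coeff_P])

text \<open>An element of \<open>M\<close> smaller than \<open>\<rho>\<close> has absolute value at
  most \<open>\<rho> ^ 2\<close>, and its trace would then lie in \<open>\<pi> ^ 2 OK\<close>,
  contrary to \<open>nv_trace_t\<close>.\<close>

lemma nv_t: "nv t = \<rho>"
proof (rule antisym)
  have "nv t \<le> nv u"
    unfolding t_def gal_trace_def
  proof (rule nv_sum_le)
    fix \<sigma> assume "\<sigma> \<in> Gal M L"
    then have "\<sigma> \<in> Gal K L" using mid.Gal_M_L by blast
    then show "nv (\<sigma> u) \<le> nv u" using nv_Gal[OF _ u_L] by simp
  qed simp
  then show "nv t \<le> \<rho>" using nv_M_le[OF u_M_trace, of 0] u_lt by simp
  show "\<rho> \<le> nv t"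
  proof (rule ccontr)
    assume "\<not> \<rho> \<le> nv t"
    then have "nv t \<le> \<rho> ^ 2" using nv_M_le[OF u_M_trace, of 1] by (simp add: numeral_2_eq_2 One_nat_def)
    from nv_trace_M_le[OF u_M_trace this] show False using nv_trace_t nv_pi_sq_less by simp
  qed
qed

lemma t_nz: "t \<noteq> 0" using nv_t rho(1) by auto

lemma val_ring_iff: "x \<in> val_ring F \<longleftrightarrow> x \<in> F \<and> nv x \<le> 1"
  by (simp add: val_ring_def val_nonneg_iff)

lemma max_ideal_iff: "x \<in> max_ideal F \<longleftrightarrow> x \<in> F \<and> nv x < 1"
  by (simp add: max_ideal_def val_pos_iff)

lemma uniformizer_t: "uniformizer M t"
  unfolding uniformizer_def
proof
  show "max_ideal M = PIdl\<^bsub>subring_struct (val_ring M)\<^esub> t"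
  proof (intro Set.set_eqI iffI)
    fix x assume "x \<in> max_ideal M"
    then have x: "x \<in> M" "nv x < \<rho> ^ 0" by (simp_all add: max_ideal_iff)
    have "nv x \<le> nv t" using nv_M_le[OF x] nv_t by simp
    then have "x / t \<in> val_ring M"
      using x(1) u_M_trace t_nz by (simp add: val_ring_iff M.divide_mem nv_divide divide_le_eq)
    moreover have "x = x / t * t" using t_nz by simp
    ultimately show "x \<in> PIdl\<^bsub>subring_struct (val_ring M)\<^esub> t"
      unfolding cgenideal_def by (intro CollectI exI[of _ "x / t"]) simp
  next
    fix x assume "x \<in> PIdl\<^bsub>subring_struct (val_ring M)\<^esub> t"
    then obtain y where y: "x = y * t" "y \<in> M" "nv y \<le> 1" unfolding cgenideal_def by (auto simp: val_ring_iff)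
    have "nv (t * y) < 1" using nv_mult_less_1[of t y] nv_t rho(2) y(3) by simp
    then show "x \<in> max_ideal M" using y M.mult_mem u_M_trace by (simp add: max_ideal_iff mult.commute)
  qed
qed (rule u_M_trace)

text \<open>The leading term \<open>a * u ^ j\<close> of a unit has \<open>j = 0\<close>, as
  otherwise its absolute value is not one attained on \<open>K\<close>.\<close>

lemma residue_M:
  assumes x: "x \<in> M" "nv x \<le> 1" shows "\<exists>c\<in>OK. nv (x - c) < 1"
proof (cases "nv x < 1")
  case True
  then show ?thesis using O_zero by (intro bexI[of _ 0]) auto
next
  case False
  then have n1: "nv x = 1" using x(2) by simp
  then have "x \<in> L" "x \<noteq> 0" using x MsL by auto
  then obtain a j where a: "a \<in> K" "j < d" "a \<noteq> 0" "nv (x - a * u ^ j) < nv x" "nv x = nv (a * u ^ j)"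
    using L_leading by blast
  have "j = 0" using nv_terms_distinct[OF a(1,3) one_mem _ a(2) d_pos] a(5) n1 by force
  then show ?thesis using a n1 by (intro bexI[of _ a]) (auto simp: O_iff)
qed

text \<open>One direction is the trace bound \<open>nv_trace_M_le\<close>. That nothing larger
  belongs to the inverse different is witnessed by \<open>t\<close>, whose trace is not divisible by
  \<open>\<pi> ^ 2\<close>.\<close>

lemma inverse_different_iff: "x \<in> inverse_different K M \<longleftrightarrow> x \<in> M \<and> nv (\<pi> ^ 2 * x) \<le> \<rho> ^ 2"
proof (intro iffI conjI)
  assume "x \<in> inverse_different K M"
  then have x: "x \<in> M" "\<And>y. y \<in> M \<Longrightarrow> nv y \<le> 1 \<Longrightarrow> nv (gal_trace K M (x * y)) \<le> 1"
    by (auto simp: inverse_different_def val_ring_iff)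
  show "x \<in> M" by fact
  have pM: "\<pi> ^ 2 * x \<in> M" using pi_K KsM x(1) by (intro M.mult_mem M.power_mem) auto
  show "nv (\<pi> ^ 2 * x) \<le> \<rho> ^ 2"
  proof (rule ccontr)
    assume n: "\<not> nv (\<pi> ^ 2 * x) \<le> \<rho> ^ 2"
    then have "\<not> nv (\<pi> ^ 2 * x) < \<rho> ^ 1" using nv_M_le[OF pM, of 1] by (auto simp: numeral_2_eq_2 One_nat_def)
    then have ge: "nv t \<le> nv (\<pi> ^ 2 * x)" using nv_t by simp
    have x0: "x \<noteq> 0" using n rho(1) by auto
    \<comment> \<open>Chosen integral with \<open>x * y = t / \<pi> ^ 2\<close>, an element whose
      trace has absolute value \<open>1 / nv \<pi>\<close>.\<close>
    define y where "y = t / (\<pi> ^ 2 * x)"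
    have "y \<in> M" unfolding y_def by (rule M.divide_mem[OF u_M_trace pM])
    moreover have "nv y \<le> 1" unfolding y_def nv_divide using ge x0 pi_nz by (simp add: divide_le_eq)
    ultimately have "nv (gal_trace K M (x * y)) \<le> 1" by (rule x(2))
    moreover have "x * y = inverse (\<pi> ^ 2) * t" using x0 pi_nz by (simp add: y_def field_simps)
    moreover have "gal_trace K M (inverse (\<pi> ^ 2) * t) = inverse (\<pi> ^ 2) * gal_trace K M t"
      by (rule mid.bot.trace_scale[OF inverse_mem[OF power_mem[OF pi_K]] u_M_trace])
    ultimately have "inverse (nv \<pi> ^ 2) * nv \<pi> \<le> 1"
      using nv_trace_t by (simp add: nv_mult nv_inverse nv_power)
    then have "nv \<pi> \<le> nv \<pi> ^ 2" using pi_nz by (simp add: field_simps)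
    then show False using nv_pi_sq_less by simp
  qed
next
  assume x: "x \<in> M \<and> nv (\<pi> ^ 2 * x) \<le> \<rho> ^ 2"
  have "gal_trace K M (x * y) \<in> val_ring K" if y: "y \<in> M" "nv y \<le> 1" for y
  proof -
    have xy: "x * y \<in> M" using x y M.mult_mem by blast
    have "nv (y * (\<pi> ^ 2 * x)) \<le> \<rho> ^ 2" by (rule nv_mult_le) (use x y in auto)
    then have "nv (\<pi> ^ 2 * (x * y)) \<le> \<rho> ^ 2" by (simp add: mult_ac)
    moreover have p2: "\<pi> ^ 2 \<in> K" by (rule power_mem[OF pi_K])
    moreover from this have "\<pi> ^ 2 * (x * y) \<in> M" using KsM xy by (intro M.mult_mem[of "\<pi> ^ 2" "x * y"]) auto
    ultimately have "nv (\<pi> ^ 2 * gal_trace K M (x * y)) \<le> nv \<pi> ^ 2"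
      using nv_trace_M_le mid.bot.trace_scale[OF p2 xy] by metis
    then have "nv (gal_trace K M (x * y)) \<le> 1" using pi_nz by (simp add: nv_mult nv_power)
    then show ?thesis using mid.bot.trace_mem[OF xy] by (simp add: val_ring_iff)
  qed
  then show "x \<in> inverse_different K M" using x by (auto simp: inverse_different_def val_ring_iff)
qed

text \<open>Squares of elements of \<open>A\<close> lie in the inverse different, which bounds
  \<open>A\<close> from above. If all of \<open>A\<close> satisfied the next smaller bound, products
  would be too small to produce \<open>(t / \<pi>) ^ 2\<close>. No factorization of ideals is
  involved.\<close>

lemma sqrt_inverse_different:
  assumes A: "fractional_ideal M A" and AA: "fideal_prod A A = inverse_different K M"
  shows "A = {x \<in> M. nv (\<pi> * x) \<le> \<rho>}"
proof -
  have AM: "A \<subseteq> M" and mult: "\<And>a x. a \<in> val_ring M \<Longrightarrow> x \<in> A \<Longrightarrow> a * x \<in> A"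
    using A by (auto simp: fractional_ideal_def)
  have piM: "\<pi> \<in> M" using pi_K KsM by blast
  have le: "nv (\<pi> * x) \<le> \<rho>" if x: "x \<in> A" for x
  proof -
    have "x \<otimes>\<^bsub>ambient\<^esub> x \<in> fideal_prod A A" by (rule ideal_prod.prod[OF x x])
    then have "nv (\<pi> ^ 2 * (x * x)) \<le> \<rho> ^ 2" unfolding AA inverse_different_iff by simp
    then have "nv (\<pi> * x) ^ 2 \<le> \<rho> ^ 2" by (simp add: nv_mult nv_power power2_eq_square mult_ac)
    then show ?thesis using rho(1) by (simp add: power2_le_iff_abs_le)
  qed
  have "\<exists>x\<in>A. \<not> nv (\<pi> * x) \<le> \<rho> ^ 2"
  proof (rule ccontr)
    assume "\<not> (\<exists>x\<in>A. \<not> nv (\<pi> * x) \<le> \<rho> ^ 2)"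
    then have sm: "nv (\<pi> * x) \<le> \<rho> ^ 2" if "x \<in> A" for x using that by blast
    have small: "nv (\<pi> ^ 2 * z) \<le> \<rho> ^ 4" if "z \<in> fideal_prod A A" for z
      using that
    proof (induction rule: ideal_prod.induct)
      case (prod i j)
      have "nv (\<pi> * i) * nv (\<pi> * j) \<le> \<rho> ^ 2 * \<rho> ^ 2"
        using sm[OF prod(1)] sm[OF prod(2)] by (intro mult_mono) auto
      then show ?case by (simp add: nv_mult nv_power power2_eq_square power4_eq_xxxx mult_ac)
    next
      case (sum a b)
      then show ?case using nv_add_le[of "\<pi> ^ 2 * a" "\<rho> ^ 4" "\<pi> ^ 2 * b"] by (simp add: distrib_left)
    qed
    have "\<pi> ^ 2 * (t / \<pi>) ^ 2 = t ^ 2" using pi_nz by (simp add: power_divide)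
    moreover have "(t / \<pi>) ^ 2 \<in> M" by (rule M.power_mem[OF M.divide_mem[OF u_M_trace piM]])
    ultimately have "(t / \<pi>) ^ 2 \<in> fideal_prod A A"
      unfolding AA inverse_different_iff by (simp add: nv_power nv_t)
    from small[OF this] have "\<rho> ^ 2 \<le> \<rho> ^ 4" using pi_nz by (simp add: power_divide nv_power nv_t)
    moreover have "\<rho> ^ 4 < \<rho> ^ 2" using rho by (intro power_strict_decreasing) auto
    ultimately show False by simp
  qed
  then obtain x0 where x0: "x0 \<in> A" "\<not> nv (\<pi> * x0) \<le> \<rho> ^ 2" by blast
  have x0M: "x0 \<in> M" using x0(1) AM by blast
  have ge: "\<rho> \<le> nv (\<pi> * x0)"
    using nv_M_le[OF M.mult_mem[OF piM x0M], of 1] x0(2) by (force simp: numeral_2_eq_2 One_nat_def)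
  have nz: "x0 \<noteq> 0" using x0(2) rho(1) by auto
  have "x \<in> A" if x: "x \<in> M" "nv (\<pi> * x) \<le> \<rho>" for x
  proof -
    have "nv \<pi> * nv x \<le> nv \<pi> * nv x0" using x(2) ge unfolding nv_mult by linarith
    then have "nv x \<le> nv x0" using pi_nz by simp
    then have "x / x0 \<in> val_ring M"
      using nz x(1) x0M by (simp add: val_ring_iff M.divide_mem nv_divide divide_le_eq)
    from mult[OF this x0(1)] show ?thesis using nz by simp
  qed
  then show ?thesis using le AM by blast
qed

end

section \<open>Normal integral bases\<close>

text \<open>
  A finite commutative group of order \<open>q\<close> acts unipotently on functions with values in the residue field:
  \<open>(T - 1)\<^sup>q \<equiv> T\<^sup>q - 1 = 0\<close> for every translation \<open>T\<close>. Hence a set of functions that is stable under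
  differences contains a translation invariant one; take one whose stabilizer is maximal.
\<close>

definition (in monoid) trans_diff :: "'a \<Rightarrow> ('a \<Rightarrow> 'c::ab_group_add) \<Rightarrow> 'a \<Rightarrow> 'c"
  where "trans_diff \<tau> f = (\<lambda>\<sigma>. f (\<sigma> \<otimes> \<tau>) - f \<sigma>)"

lemma (in monoid) trans_diff_apply: "trans_diff \<tau> f \<sigma> = f (\<sigma> \<otimes> \<tau>) - f \<sigma>"
  by (simp add: trans_diff_def)

text \<open>The powers of \<open>[:- 1, 1:]\<close> expand the iterates of translation minus
  identity, so their coefficients are signed binomial coefficients.\<close>

lemma (in comm_group) trans_diff_funpow:
  fixes f :: "'a \<Rightarrow> 'c::comm_ring_1"
  assumes t: "\<tau> \<in> carrier G"
  shows "\<sigma> \<in> carrier G \<Longrightarrow>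
    (trans_diff \<tau> ^^ k) f \<sigma> = (\<Sum>i\<le>k. poly.coeff ([:- 1, 1:] ^ k) i * f (\<sigma> \<otimes> \<tau> [^] i))"
proof (induction k arbitrary: \<sigma>)
  case 0
  then show ?case by simp
next
  case (Suc k)
  let ?h = "[:- 1, 1:] ^ k :: 'c poly"
  have z: "poly.coeff ?h (Suc k) = 0"
    by (rule coeff_eq_0) (use degree_power_le[of "[:- 1, 1:] :: 'c poly" k] in simp)
  have sh: "\<sigma> \<otimes> \<tau> \<otimes> \<tau> [^] i = \<sigma> \<otimes> \<tau> [^] Suc i" for i
    using Suc.prems t by (simp add: m_assoc m_comm[of \<tau>] nat_pow_Suc)
  have e: "[:- 1, 1:] ^ Suc k = pCons 0 ?h - ?h" by simp
  have "(trans_diff \<tau> ^^ Suc k) f \<sigma>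
      = (\<Sum>i\<le>k. poly.coeff ?h i * f (\<sigma> \<otimes> \<tau> [^] Suc i)) - (\<Sum>i\<le>k. poly.coeff ?h i * f (\<sigma> \<otimes> \<tau> [^] i))"
    by (simp only: funpow.simps o_apply trans_diff_apply Suc.IH[OF m_closed[OF Suc.prems t]] Suc.IH[OF Suc.prems] sh)
  also have "(\<Sum>i\<le>k. poly.coeff ?h i * f (\<sigma> \<otimes> \<tau> [^] i)) = (\<Sum>i\<le>Suc k. poly.coeff ?h i * f (\<sigma> \<otimes> \<tau> [^] i))"
    using z by simp
  also have "(\<Sum>i\<le>k. poly.coeff ?h i * f (\<sigma> \<otimes> \<tau> [^] Suc i))
      = (\<Sum>i\<le>Suc k. poly.coeff (pCons 0 ?h) i * f (\<sigma> \<otimes> \<tau> [^] i))"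
    unfolding sum.atMost_Suc_shift by (simp del: nat_pow_Suc)
  finally show ?case unfolding e by (simp only: coeff_diff left_diff_distrib sum_subtractf)
qed

context local_subfield
begin

lemma trans_diff_funpow_q:
  fixes G (structure) and f :: "'g \<Rightarrow> 'a"
  assumes G: "comm_group G" "finite (carrier G)" "order G = q" and t: "\<tau> \<in> carrier G"
    and f: "\<And>\<sigma>. \<sigma> \<in> carrier G \<Longrightarrow> f \<sigma> \<in> OK" and s: "\<sigma> \<in> carrier G"
  shows "nv ((monoid.trans_diff G \<tau> ^^ q) f \<sigma>) < 1"
proof -
  interpret G: comm_group G by (rule G(1))
  let ?c = "poly.coeff ([:- 1, 1:] ^ q :: 'a poly)"
  have c: "?c i = of_nat (q choose i) * (- 1) ^ (q - i)" if "i \<le> q" for i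
    using coeff_linear_poly_power[OF that, of "- 1" 1] by simp
  have fm: "f (\<sigma> \<otimes> \<tau> [^] i) \<in> OK" for i :: nat by (intro f G.m_closed G.nat_pow_closed s t)
  have "\<tau> [^] q = \<one>" using G.pow_order_eq_1[OF t] G(3) by simp
  then have tq: "\<sigma> \<otimes> \<tau> [^] q = \<sigma>" using s by simp
  have "{..q} = insert 0 (insert q {0<..<q})" using q_ge_2 by auto
  then have "(monoid.trans_diff G \<tau> ^^ q) f \<sigma>
      = ?c 0 * f \<sigma> + (?c q * f \<sigma> + (\<Sum>i\<in>{0<..<q}. ?c i * f (\<sigma> \<otimes> \<tau> [^] i)))"
    unfolding G.trans_diff_funpow[OF t s] using q_ge_2 tq s by simp
  \<comment> \<open>The two extreme terms meet because the order of \<open>\<tau>\<close> divides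
    \<open>q\<close>. Written this way their coefficient is small by \<open>frobenius\<close> at
    \<open>- 1\<close>, in every residue characteristic.\<close>
  also have "\<dots> = ((- 1) ^ q - (- 1)) * f \<sigma> + (\<Sum>i\<in>{0<..<q}. ?c i * f (\<sigma> \<otimes> \<tau> [^] i))"
    using c[of 0] c[of q] by (simp add: algebra_simps)
  also have "nv \<dots> < 1"
  proof (rule nv_add_less)
    have "- 1 \<in> OK" using O_uminus[OF O_one] .
    from frobenius[OF this] show "nv (((- 1) ^ q - (- 1)) * f \<sigma>) < 1"
      using f[OF s] by (intro nv_mult_less_1) (auto simp: O_iff)
    show "nv (\<Sum>i\<in>{0<..<q}. ?c i * f (\<sigma> \<otimes> \<tau> [^] i)) < 1"
    proof (rule nv_sum_less)
      fix i assume i: "i \<in> {0<..<q}"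
      have "nv ((of_nat (q choose i) :: 'a) * (- 1) ^ (q - i)) < 1"
        using binom_small[of i] i by (intro nv_mult_less_1) (auto simp: nv_power)
      then have "nv (?c i) < 1" using c[of i] i by simp
      then show "nv (?c i * f (\<sigma> \<otimes> \<tau> [^] i)) < 1" using fm by (intro nv_mult_less_1) (auto simp: O_iff)
    qed simp
  qed
  finally show ?thesis .
qed

text \<open>If \<open>\<tau>\<close> does not stabilize \<open>f\<close>, take the last iterate of
  \<open>trans_diff \<tau>\<close> on \<open>f\<close> that is not small everywhere. It lies in
  \<open>S\<close> and is stabilized by \<open>\<tau>\<close> and, by commutativity, by everything
  that stabilizes \<open>f\<close>, against maximality.\<close>

lemma translation_invariant_mod:
  fixes G (structure) and S :: "('g \<Rightarrow> 'a) set"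
  assumes G: "comm_group G" "finite (carrier G)" "order G = q"
    and ne: "f0 \<in> S" and int: "\<And>f \<sigma>. f \<in> S \<Longrightarrow> \<sigma> \<in> carrier G \<Longrightarrow> f \<sigma> \<in> OK"
    and unit: "\<And>f. f \<in> S \<Longrightarrow> \<exists>\<sigma>\<in>carrier G. nv (f \<sigma>) = 1"
    and diff: "\<And>f \<sigma> \<tau>. f \<in> S \<Longrightarrow> \<tau> \<in> carrier G \<Longrightarrow> \<sigma> \<in> carrier G \<Longrightarrow> nv (monoid.trans_diff G \<tau> f \<sigma>) = 1 \<Longrightarrow>
      monoid.trans_diff G \<tau> f \<in> S"
  shows "\<exists>f\<in>S. \<forall>\<sigma>\<in>carrier G. \<forall>\<tau>\<in>carrier G. nv (f (\<sigma> \<otimes> \<tau>) - f \<sigma>) < 1"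
proof -
  interpret G: comm_group G by (rule G(1))
  define stab where "stab = (\<lambda>f :: 'g \<Rightarrow> 'a. {\<tau> \<in> carrier G. \<forall>\<sigma>\<in>carrier G. nv (G.trans_diff \<tau> f \<sigma>) < 1})"
  have fs: "finite (stab f)" for f using G(2) by (simp add: stab_def)
  have bd: "card (stab f) \<le> card (carrier G)" for f
    by (rule card_mono[OF G(2)]) (auto simp: stab_def)
  have "\<exists>f. f \<in> S \<and> (\<forall>g. g \<in> S \<longrightarrow> card (stab g) \<le> card (stab f))"
    by (rule ex_has_greatest_nat[of "\<lambda>f. f \<in> S" f0 "\<lambda>f. card (stab f)" "Suc (card (carrier G))"])
      (use ne bd in \<open>auto simp: less_Suc_eq_le\<close>)
  then obtain f where f: "f \<in> S" "\<And>g. g \<in> S \<Longrightarrow> card (stab g) \<le> card (stab f)" by blast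
  have "\<tau> \<in> stab f" if t: "\<tau> \<in> carrier G" for \<tau>
  proof (rule ccontr)
    assume nt: "\<tau> \<notin> stab f"
    define g where "g k = (G.trans_diff \<tau> ^^ k) f" for k
    define small where "small k \<longleftrightarrow> (\<forall>\<sigma>\<in>carrier G. nv (g k \<sigma>) < 1)" for k
    have g_Suc: "g (Suc k) = G.trans_diff \<tau> (g k)" for k by (simp add: g_def)
    have "small q" unfolding small_def g_def
  proof
    show "nv ((G.trans_diff \<tau> ^^ q) f \<sigma>) < 1" if "\<sigma> \<in> carrier G" for \<sigma>
      by (rule trans_diff_funpow_q[OF G t _ that]) (rule int[OF f(1)])
  qed
    define k where "k = (LEAST k. small k)"
    have sk: "small k" unfolding k_def by (rule LeastI) fact
    have before: "\<not> small j" if "j < k" for j using not_less_Least[of j small] that unfolding k_def by blast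
    have s0: "\<not> small 0" using unit[OF f(1)] by (force simp: small_def g_def)
    have s1: "\<not> small 1" using nt t by (auto simp: small_def g_def stab_def One_nat_def)
    have "k \<noteq> 0" "k \<noteq> 1" using sk s0 s1 by metis+
    then obtain n where k: "k = Suc (Suc n)" by (metis One_nat_def not0_implies_Suc)
    have step: "g j \<in> S \<and> stab f \<subseteq> stab (g j)" if "j < k" for j
      using that
    proof (induction j)
      case 0
      then show ?case using f(1) by (simp add: g_def)
    next
      case (Suc j)
      then have IH: "g j \<in> S" "stab f \<subseteq> stab (g j)" by auto
      obtain \<sigma> where s: "\<sigma> \<in> carrier G" "\<not> nv (g (Suc j) \<sigma>) < 1"
        using before[OF Suc.prems] by (auto simp: small_def)
      have "nv (g (Suc j) \<sigma>) \<le> 1"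
        unfolding g_Suc G.trans_diff_def using int[OF IH(1)] s(1) t by (intro nv_diff_le) (auto simp: O_iff)
      then have "nv (G.trans_diff \<tau> (g j) \<sigma>) = 1" using s(2) by (simp add: g_Suc)
      then have "g (Suc j) \<in> S" unfolding g_Suc by (rule diff[OF IH(1) t s(1)])
      moreover have "\<tau>' \<in> stab (g (Suc j))" if t': "\<tau>' \<in> stab (g j)" for \<tau>'
      proof -
        have tc: "\<tau>' \<in> carrier G" using t' by (simp add: stab_def)
        have "nv (G.trans_diff \<tau>' (g (Suc j)) \<sigma>) < 1" if s: "\<sigma> \<in> carrier G" for \<sigma>
        proof -
          have "\<sigma> \<otimes> \<tau> \<otimes> \<tau>' = \<sigma> \<otimes> \<tau>' \<otimes> \<tau>" using s t tc by (simp add: G.m_ac)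
          then have "G.trans_diff \<tau>' (g (Suc j)) \<sigma> = G.trans_diff \<tau>' (g j) (\<sigma> \<otimes> \<tau>) - G.trans_diff \<tau>' (g j) \<sigma>"
            by (simp add: g_Suc G.trans_diff_def)
          moreover have "nv (G.trans_diff \<tau>' (g j) (\<sigma> \<otimes> \<tau>)) < 1" "nv (G.trans_diff \<tau>' (g j) \<sigma>) < 1"
            using t' s t by (simp_all add: stab_def)
          ultimately show ?thesis by (simp add: nv_diff_less)
        qed
        then show ?thesis using tc by (simp add: stab_def)
      qed
      ultimately show ?case using IH(2) by blast
    qed
    let ?g = "g (Suc n)"
    have gs: "?g \<in> S" "stab f \<subseteq> stab ?g" using step[of "Suc n"] k by auto
    have "\<tau> \<in> stab ?g" using sk t unfolding k small_def stab_def g_Suc by simp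
    then have "stab f \<subset> stab ?g" using gs(2) nt by blast
    then have "card (stab f) < card (stab ?g)" by (rule psubset_card_mono[OF fs])
    then show False using f(2)[OF gs(1)] by simp
  qed
  then show ?thesis using f(1) by (intro bexI[of _ f]) (auto simp: stab_def G.trans_diff_def)
qed

end

context finite_galois
begin

definition Gal_group :: "('a \<Rightarrow> 'a) monoid"
  where "Gal_group = \<lparr>carrier = Gal K L, mult = compose L, one = restrict (\<lambda>x. x) L\<rparr>"

lemma Gal_group_simps [simp]:
  "carrier Gal_group = Gal K L" "\<sigma> \<otimes>\<^bsub>Gal_group\<^esub> \<tau> = compose L \<sigma> \<tau>" "\<one>\<^bsub>Gal_group\<^esub> = restrict (\<lambda>x. x) L"
  by (simp_all add: Gal_group_def)

lemma id_Gal: "restrict (\<lambda>x. x) L \<in> Gal K L"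
  using KL by (intro GalI) (auto simp: bij_betw_def inj_on_def L.add_mem L.mult_mem L.one_mem)

lemma comm_group_Gal: "comm_group Gal_group"
proof (rule comm_groupI)
  fix x y z assume "x \<in> carrier Gal_group" "y \<in> carrier Gal_group" "z \<in> carrier Gal_group"
  then have m: "x \<in> Gal K L" "y \<in> Gal K L" "z \<in> Gal K L" by simp_all
  show "x \<otimes>\<^bsub>Gal_group\<^esub> y \<in> carrier Gal_group" using Gal_compose[OF L.set_subfield_axioms KL m(1,2)] by simp
  show "x \<otimes>\<^bsub>Gal_group\<^esub> y \<otimes>\<^bsub>Gal_group\<^esub> z = x \<otimes>\<^bsub>Gal_group\<^esub> (y \<otimes>\<^bsub>Gal_group\<^esub> z)"
    using gal(2)[OF m(3)] by (auto simp: compose_def)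
  show "x \<otimes>\<^bsub>Gal_group\<^esub> y = y \<otimes>\<^bsub>Gal_group\<^esub> x" using comm[OF m(1,2)] by (auto simp: compose_def)
next
  fix x assume "x \<in> carrier Gal_group"
  then have x: "x \<in> Gal K L" by simp
  show "\<one>\<^bsub>Gal_group\<^esub> \<otimes>\<^bsub>Gal_group\<^esub> x = x"
    using gal(2)[OF x] gal(6)[OF x] by (auto simp: compose_def extensional_def)
  obtain y where "y \<in> Gal K L" "\<forall>z\<in>L. y (x z) = z" using Gal_inverse[OF L.set_subfield_axioms KL x] by blast
  then show "\<exists>y\<in>carrier Gal_group. y \<otimes>\<^bsub>Gal_group\<^esub> x = \<one>\<^bsub>Gal_group\<^esub>"
    by (intro bexI[of _ y]) (auto simp: compose_def)
qed (use id_Gal in simp)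

end

section \<open>Generators over the integral group ring and over the associated order\<close>

context degree_q_subextension
begin

abbreviation "G \<equiv> Gal K M"

definition comb :: "(('a \<Rightarrow> 'a) \<Rightarrow> 'a) \<Rightarrow> 'a \<Rightarrow> 'a" where "comb f x = (\<Sum>\<sigma>\<in>G. f \<sigma> * \<sigma> x)"

lemma G_mem: "\<sigma> \<in> G \<Longrightarrow> x \<in> M \<Longrightarrow> \<sigma> x \<in> M" by (rule mid.bot.gal(2))

lemma comb_mem:
  assumes "\<And>\<sigma>. \<sigma> \<in> G \<Longrightarrow> f \<sigma> \<in> K" "x \<in> M" shows "comb f x \<in> M"
  unfolding comb_def by (rule M.sum_mem, rule M.mult_mem) (use assms KsM G_mem in auto)

text \<open>Applying \<open>\<tau>\<close> undoes the translation of the coefficients, and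
  \<open>\<tau>\<close> is an isometry.\<close>

lemma nv_comb_translate:
  assumes t: "\<tau> \<in> G" and f: "\<And>\<sigma>. \<sigma> \<in> G \<Longrightarrow> f \<sigma> \<in> K" and x: "x \<in> M"
  shows "nv (comb (\<lambda>\<sigma>. f (compose M \<sigma> \<tau>)) x) = nv (comb f x)"
proof -
  have ts: "compose M \<tau> \<sigma> = compose M \<sigma> \<tau>" if "\<sigma> \<in> G" for \<sigma>
    using mid.bot.comm[OF t that] by (auto simp: compose_def)
  have cG: "compose M \<tau> \<sigma> \<in> G" if "\<sigma> \<in> G" for \<sigma>
    by (rule Gal_compose[OF M.set_subfield_axioms KsM t that])
  have m: "comb (\<lambda>\<sigma>. f (compose M \<sigma> \<tau>)) x \<in> M"
    by (rule comb_mem[OF _ x]) (use f cG ts in metis)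
  have "\<tau> (comb (\<lambda>\<sigma>. f (compose M \<sigma> \<tau>)) x) = (\<Sum>\<sigma>\<in>G. \<tau> (f (compose M \<sigma> \<tau>) * \<sigma> x))"
    unfolding comb_def
  proof (rule mid.bot.hom(4)[OF t])
    fix \<sigma> assume s: "\<sigma> \<in> G"
    have "f (compose M \<sigma> \<tau>) \<in> K" using f[OF cG[OF s]] ts[OF s] by simp
    then show "f (compose M \<sigma> \<tau>) * \<sigma> x \<in> M" using KsM G_mem[OF s x] by (intro M.mult_mem) auto
  qed
  also have "\<dots> = (\<Sum>\<sigma>\<in>G. f (compose M \<tau> \<sigma>) * compose M \<tau> \<sigma> x)"
  proof (rule sum.cong[OF refl])
    fix \<sigma> assume s: "\<sigma> \<in> G"
    have k: "f (compose M \<tau> \<sigma>) \<in> K" using f[OF cG[OF s]] .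
    then have "f (compose M \<tau> \<sigma>) \<in> M" using KsM by blast
    then have "\<tau> (f (compose M \<tau> \<sigma>) * \<sigma> x) = f (compose M \<tau> \<sigma>) * \<tau> (\<sigma> x)"
      using mid.bot.gal(4)[OF t _ G_mem[OF s x]] mid.bot.gal(7)[OF t k] by simp
    then show "\<tau> (f (compose M \<sigma> \<tau>) * \<sigma> x) = f (compose M \<tau> \<sigma>) * compose M \<tau> \<sigma> x"
      unfolding ts[OF s, symmetric] by (simp only: compose_eq[OF x])
  qed
  also have "\<dots> = comb f x"
    unfolding comb_def by (rule sum.reindex_bij_betw[OF mid.bot.translation[OF t]])
  finally have "\<tau> (comb (\<lambda>\<sigma>. f (compose M \<sigma> \<tau>)) x) = comb f x" .
  then show ?thesis using nv_Gal_M[OF t m] by simp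
qed

text \<open>By \<open>sqrt_inverse_different\<close>, the only possible square root of the inverse
  different.\<close>

definition AI :: "'a set" where "AI = {x \<in> M. nv (\<pi> * x) \<le> \<rho>}"

lemma nv_comb_unit:
  assumes x: "x \<in> AI" and tr: "nv (gal_trace K M x) = 1"
    and f: "\<And>\<sigma>. \<sigma> \<in> G \<Longrightarrow> f \<sigma> \<in> OK" "\<sigma>0 \<in> G" "nv (f \<sigma>0) = 1"
  shows "1 \<le> nv (comb f x)"
proof (rule ccontr)
  assume n: "\<not> 1 \<le> nv (comb f x)"
  have xM: "x \<in> M" using x by (simp add: AI_def)
  let ?G = "mid.bot.Gal_group"
  interpret GG: comm_group ?G by (rule mid.bot.comm_group_Gal)
  define S where "S = {g. (\<forall>\<sigma>\<in>G. g \<sigma> \<in> OK) \<and> (\<exists>\<sigma>\<in>G. nv (g \<sigma>) = 1) \<and> nv (comb g x) < 1}"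
  have "\<exists>g\<in>S. \<forall>\<sigma>\<in>carrier ?G. \<forall>\<tau>\<in>carrier ?G. nv (g (\<sigma> \<otimes>\<^bsub>?G\<^esub> \<tau>) - g \<sigma>) < 1"
  proof (rule translation_invariant_mod[where S = S, OF mid.bot.comm_group_Gal])
    show "finite (carrier ?G)" using mid.bot.fin by simp
    show "order ?G = q" by (simp add: order_def mid.Gal_K_M(3))
    show "f \<in> S" using f n by (auto simp: S_def)
    show "g \<sigma> \<in> OK" if "g \<in> S" "\<sigma> \<in> carrier ?G" for g \<sigma> using that by (simp add: S_def)
    show "\<exists>\<sigma>\<in>carrier ?G. nv (g \<sigma>) = 1" if "g \<in> S" for g using that by (simp add: S_def)
    show "GG.trans_diff \<tau> g \<in> S"
      if g: "g \<in> S" and t: "\<tau> \<in> carrier ?G" and s: "\<sigma> \<in> carrier ?G" "nv (GG.trans_diff \<tau> g \<sigma>) = 1" for g \<sigma> \<tau>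
    proof -
      have t': "\<tau> \<in> G" using t by simp
      have gO: "g \<sigma> \<in> OK" if "\<sigma> \<in> G" for \<sigma> using g that by (simp add: S_def)
      have gK: "g \<sigma> \<in> K" if "\<sigma> \<in> G" for \<sigma> using gO[OF that] by (simp add: O_iff)
      have "comb (GG.trans_diff \<tau> g) x = comb (\<lambda>\<sigma>. g (compose M \<sigma> \<tau>)) x - comb g x"
        by (simp add: comb_def GG.trans_diff_def left_diff_distrib sum_subtractf)
      moreover have "nv (comb (\<lambda>\<sigma>. g (compose M \<sigma> \<tau>)) x) = nv (comb g x)"
        using nv_comb_translate[where f = g, OF t' _ xM] gK by blast
      moreover have "nv (comb g x) < 1" using g by (simp add: S_def)
      ultimately have "nv (comb (GG.trans_diff \<tau> g) x) < 1" by (simp add: nv_diff_less)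
      moreover have "GG.trans_diff \<tau> g \<sigma> \<in> OK" if "\<sigma> \<in> G" for \<sigma>
        using gO Gal_compose[OF M.set_subfield_axioms KsM that t'] that by (simp add: GG.trans_diff_def O_diff)
      ultimately show ?thesis using s by (auto simp: S_def)
    qed
  qed
  then obtain g where g: "g \<in> S" "\<And>\<sigma> \<tau>. \<sigma> \<in> G \<Longrightarrow> \<tau> \<in> G \<Longrightarrow> nv (g (compose M \<sigma> \<tau>) - g \<sigma>) < 1" by auto
  define \<iota> where "\<iota> = restrict (\<lambda>x. x) M"
  have i: "\<iota> \<in> G" unfolding \<iota>_def by (rule mid.bot.id_Gal)
  have gO: "g \<sigma> \<in> OK" if "\<sigma> \<in> G" for \<sigma> using g(1) that by (simp add: S_def)
  have close: "nv (g \<sigma> - g \<iota>) \<le> nv \<pi>" if s: "\<sigma> \<in> G" for \<sigma>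
  proof -
    have "compose M \<iota> \<sigma> = \<sigma>"
      using mid.bot.gal(2,6)[OF s] by (auto simp: compose_def extensional_def \<iota>_def)
    then have "nv (g \<sigma> - g \<iota>) < 1" using g(2)[OF i s] by simp
    moreover have "g \<sigma> - g \<iota> \<in> K" using O_diff[OF gO[OF s] gO[OF i]] by (simp add: O_iff)
    ultimately show ?thesis using discrete by blast
  qed
  obtain \<sigma> where s: "\<sigma> \<in> G" "nv (g \<sigma>) = 1" using g(1) by (auto simp: S_def)
  have "nv (g \<iota> - g \<sigma>) < nv (g \<sigma>)" using close[OF s(1)] pi_lt_1 s(2) nv_minus_commute[of "g \<iota>" "g \<sigma>"] by simp
  then have gi: "nv (g \<iota>) = 1" using nv_eq_if_close s(2) by metis
  \<comment> \<open>The element \<open>x\<close> need not be integral, but the differences of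
    coefficients are divisible by \<open>\<pi>\<close> and
    \<open>nv (\<pi> * x) \<le> \<rho> < 1\<close>. So \<open>comb g x\<close> is a unit multiple of
    the trace up to a small error.\<close>
  have "comb g x - g \<iota> * gal_trace K M x = (\<Sum>\<sigma>\<in>G. (g \<sigma> - g \<iota>) * \<sigma> x)"
    by (simp add: comb_def gal_trace_def sum_distrib_left sum_subtractf left_diff_distrib)
  also have "nv \<dots> \<le> \<rho>"
  proof (rule nv_sum_le)
    fix \<sigma> assume s: "\<sigma> \<in> G"
    have "nv ((g \<sigma> - g \<iota>) * \<sigma> x) \<le> nv \<pi> * nv x"
      unfolding nv_mult nv_Gal_M[OF s xM] using close[OF s] by (rule mult_right_mono) simp
    then show "nv ((g \<sigma> - g \<iota>) * \<sigma> x) \<le> \<rho>" using x by (simp add: AI_def nv_mult)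
  qed (use rho in simp)
  finally have "nv (comb g x - g \<iota> * gal_trace K M x) < nv (g \<iota> * gal_trace K M x)"
    using rho(2) gi tr by (simp add: nv_mult)
  then have "nv (comb g x) = 1" using nv_eq_if_close gi tr by (metis nv_mult mult_1)
  then show False using g(1) by (simp add: S_def)
qed

text \<open>Dividing by the largest coefficient reduces this to \<open>nv_comb_unit\<close>. It
  yields both independence of the conjugates of \<open>x\<close> and control of
  coefficients.\<close>

lemma nv_coeff_le_comb:
  assumes x: "x \<in> AI" and tr: "nv (gal_trace K M x) = 1"
    and f: "\<And>\<sigma>. \<sigma> \<in> G \<Longrightarrow> f \<sigma> \<in> K" and s: "\<sigma> \<in> G"
  shows "nv (f \<sigma>) \<le> nv (comb f x)"
proof -
  have "finite (nv ` f ` G)" "nv ` f ` G \<noteq> {}" using mid.bot.fin s by auto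
  then have "Max (nv ` f ` G) \<in> nv ` f ` G" by (rule Max_in)
  then obtain \<sigma>0 where s0: "\<sigma>0 \<in> G" "nv (f \<sigma>0) = Max (nv ` f ` G)" by auto
  have mx: "nv (f \<sigma>) \<le> nv (f \<sigma>0)" if "\<sigma> \<in> G" for \<sigma>
    unfolding s0(2) using mid.bot.fin that by (intro Max_ge) auto
  have "nv (f \<sigma>0) \<le> nv (comb f x)"
  proof (cases "f \<sigma>0 = 0")
    case False
    define g where "g \<sigma> = f \<sigma> / f \<sigma>0" for \<sigma>
    have "1 \<le> nv (comb g x)"
    proof (rule nv_comb_unit[OF x tr _ s0(1)])
      show "g \<sigma> \<in> OK" if "\<sigma> \<in> G" for \<sigma>
        using f[OF that] f[OF s0(1)] mx[OF that] False by (simp add: g_def O_iff mems nv_divide)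
      show "nv (g \<sigma>0) = 1" using False by (simp add: g_def)
    qed
    moreover have "comb g x = comb f x / f \<sigma>0" by (simp add: comb_def g_def sum_divide_distrib)
    ultimately show ?thesis using False by (simp add: nv_divide le_divide_eq)
  qed simp
  then show ?thesis using mx[OF s] by simp
qed

text \<open>A dimension count gives a relation between \<open>y\<close> and the conjugates of
  \<open>x\<close>; the coefficient of \<open>y\<close> is nonzero because
  \<open>nv_coeff_le_comb\<close> makes the conjugates independent.\<close>

lemma comb_surj:
  assumes x: "x \<in> AI" and tr: "nv (gal_trace K M x) = 1" and y: "y \<in> M"
  shows "\<exists>f. (\<forall>\<sigma>\<in>G. f \<sigma> \<in> K) \<and> y = comb f x"
proof -
  have xM: "x \<in> M" using x by (simp add: AI_def)
  obtain b where b: "\<forall>i<q. b i \<in> M" "M = {\<Sum>i<q. c i * b i | c. \<forall>i<q. c i \<in> K}"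
    using dimension_basis[OF set_subfield_axioms dim_M] by blast
  have "\<exists>c. (\<forall>i<q. c i \<in> K) \<and> z = (\<Sum>i<q. c i * b i)" if "z \<in> M" for z
    using that b(2) by blast
  then obtain co where co: "\<And>z i. z \<in> M \<Longrightarrow> i < q \<Longrightarrow> co z i \<in> K" "\<And>z. z \<in> M \<Longrightarrow> (\<Sum>i<q. co z i * b i) = z"
    by metis
  \<comment> \<open>\<open>None\<close> stands for \<open>y\<close> and \<open>Some \<sigma>\<close>
    for \<open>\<sigma> x\<close>: these are \<open>q + 1\<close> vectors in a space of dimension
    \<open>q\<close>.\<close>
  define J where "J = insert None (Some ` G)"
  define v where "v j = (case j of None \<Rightarrow> y | Some \<sigma> \<Rightarrow> \<sigma> x)" for j :: "('a \<Rightarrow> 'a) option"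
  have vM: "v j \<in> M" if "j \<in> J" for j using that y G_mem[OF _ xM] by (auto simp: J_def v_def)
  have J: "finite J" "card {..<q} < card J"
    using mid.Gal_K_M(2,3) by (auto simp: J_def card_image)
  obtain c where c: "\<forall>j\<in>J. c j \<in> K" "\<exists>j\<in>J. c j \<noteq> 0" "\<forall>i\<in>{..<q}. (\<Sum>j\<in>J. co (v j) i * c j) = 0"
    using homogeneous_system[OF set_subfield_axioms finite_lessThan J, of "\<lambda>i j. co (v j) i"] co(1) vM by auto
  have "(\<Sum>j\<in>J. c j * v j) = (\<Sum>j\<in>J. \<Sum>i<q. co (v j) i * c j * b i)"
  proof (rule sum.cong[OF refl])
    fix j assume "j \<in> J"
    then have "c j * v j = c j * (\<Sum>i<q. co (v j) i * b i)" using co(2) vM by simp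
    then show "c j * v j = (\<Sum>i<q. co (v j) i * c j * b i)" by (simp add: sum_distrib_left mult_ac)
  qed
  also have "\<dots> = (\<Sum>i<q. (\<Sum>j\<in>J. co (v j) i * c j) * b i)" by (subst sum.swap) (simp add: sum_distrib_right)
  also have "\<dots> = 0" using c(3) by simp
  finally have "c None * y + comb (\<lambda>\<sigma>. c (Some \<sigma>)) x = 0"
    using mid.bot.fin by (simp add: J_def v_def sum.reindex comb_def)
  then have e: "comb (\<lambda>\<sigma>. c (Some \<sigma>)) x = - (c None * y)" by (simp add: eq_neg_iff_add_eq_0 add.commute)
  have cK: "c (Some \<sigma>) \<in> K" if "\<sigma> \<in> G" for \<sigma> using c(1) that by (simp add: J_def)
  have c0: "c None \<noteq> 0"
  proof
    assume z: "c None = 0"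
    then have "nv (c (Some \<sigma>)) \<le> 0" if "\<sigma> \<in> G" for \<sigma>
      using nv_coeff_le_comb[where f = "\<lambda>\<sigma>. c (Some \<sigma>)", OF x tr cK that] e by simp
    then show False using c(2) z by (auto simp: J_def)
  qed
  have ye: "y = comb (\<lambda>\<sigma>. c (Some \<sigma>) * (- inverse (c None))) x"
  proof -
    have "comb (\<lambda>\<sigma>. c (Some \<sigma>) * (- inverse (c None))) x = - inverse (c None) * comb (\<lambda>\<sigma>. c (Some \<sigma>)) x"
      unfolding comb_def sum_distrib_left by (simp add: mult_ac)
    then show ?thesis unfolding e using c0 by simp
  qed
  have "c (Some \<sigma>) * (- inverse (c None)) \<in> K" if "\<sigma> \<in> G" for \<sigma>
    using cK[OF that] c(1) by (intro mult_mem uminus_mem inverse_mem) (auto simp: J_def)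
  then show ?thesis using ye by (intro exI[of _ "\<lambda>\<sigma>. c (Some \<sigma>) * (- inverse (c None))"]) simp
qed

text \<open>The coefficients are bounded by \<open>nv y\<close>, which may exceed \<open>1\<close>
  but is below \<open>1 / nv \<pi>\<close>; no absolute value of \<open>K\<close> lies strictly
  between \<open>1\<close> and that bound.\<close>

lemma AI_coeffs:
  assumes x: "x \<in> AI" and tr: "nv (gal_trace K M x) = 1" and y: "y \<in> AI"
  shows "\<exists>f. (\<forall>\<sigma>\<in>G. f \<sigma> \<in> OK) \<and> y = comb f x"
proof -
  have yM: "y \<in> M" "nv (\<pi> * y) \<le> \<rho>" using y by (simp_all add: AI_def)
  obtain f where f: "\<forall>\<sigma>\<in>G. f \<sigma> \<in> K" "y = comb f x" using comb_surj[OF x tr yM(1)] by blast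
  have "f \<sigma> \<in> OK" if s: "\<sigma> \<in> G" for \<sigma>
  proof -
    have "nv (f \<sigma>) \<le> nv y" unfolding f(2) using f(1) by (intro nv_coeff_le_comb[OF x tr _ s]) blast
    then have "nv \<pi> * nv (f \<sigma>) \<le> nv \<pi> * nv y" by (rule mult_left_mono) simp
    then have "nv (\<pi> * f \<sigma>) < 1" using yM(2) rho(2) by (simp add: nv_mult)
    moreover have "\<pi> * f \<sigma> \<in> K" using f(1) s pi_K mult_mem by blast
    ultimately have "nv (\<pi> * f \<sigma>) \<le> nv \<pi>" using discrete by blast
    then show ?thesis using f(1) s pi_nz by (simp add: O_iff nv_mult)
  qed
  then show ?thesis using f(2) by blast
qed

lemma val_ring_eqs: "val_ring K = OK"
  by (auto simp: val_ring_iff O_iff)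

lemma group_ring_act_eq: "group_ring_act K M f x = comb f x"
  by (simp add: group_ring_act_def comb_def)

lemma comb_cong: "(\<And>\<sigma>. \<sigma> \<in> G \<Longrightarrow> f \<sigma> = g \<sigma>) \<Longrightarrow> comb f x = comb g x"
  by (simp add: comb_def)

lemma AI_generator:
  assumes x: "x \<in> AI" and tr: "nv (gal_trace K M x) = 1"
  shows "is_generator K M (group_ring (val_ring K) K M) AI x"
  unfolding is_generator_def group_ring_act_eq
proof (intro conjI x equalityI subsetI)
  fix y assume "y \<in> AI"
  then obtain f where f: "\<forall>\<sigma>\<in>G. f \<sigma> \<in> OK" "y = comb f x" using AI_coeffs[OF x tr] by blast
  have "y = comb (restrict f G) x" unfolding f(2) by (rule comb_cong) simp
  moreover have "restrict f G \<in> group_ring (val_ring K) K M"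
    using f(1) by (auto simp: group_ring_def val_ring_eqs)
  ultimately show "y \<in> (\<lambda>f. comb f x) ` group_ring (val_ring K) K M" by blast
next
  fix y assume "y \<in> (\<lambda>f. comb f x) ` group_ring (val_ring K) K M"
  then obtain f where f: "\<And>\<sigma>. \<sigma> \<in> G \<Longrightarrow> f \<sigma> \<in> OK" "y = comb f x"
    by (auto simp: group_ring_def val_ring_eqs)
  have xM: "x \<in> M" "nv (\<pi> * x) \<le> \<rho>" using x by (simp_all add: AI_def)
  have "y \<in> M" unfolding f(2) using f(1) xM(1) by (intro comb_mem) (auto simp: O_iff)
  moreover have "nv (\<pi> * y) \<le> \<rho>"
    unfolding f(2) comb_def sum_distrib_left
  proof (rule nv_sum_le)
    fix \<sigma> assume s: "\<sigma> \<in> G"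
    have "nv (f \<sigma> * (\<pi> * \<sigma> x)) \<le> \<rho>"
      using f(1)[OF s] xM nv_Gal_M[OF s xM(1)] by (intro nv_mult_le[of "f \<sigma>" "\<pi> * \<sigma> x"]) (auto simp: O_iff nv_mult)
    then show "nv (\<pi> * (f \<sigma> * \<sigma> x)) \<le> \<rho>" by (simp add: mult_ac)
  qed (use rho in simp)
  ultimately show "y \<in> AI" by (simp add: AI_def)
qed

lemma t_over_pi: "t / \<pi> \<in> AI" "gal_trace K M (t / \<pi>) = gal_trace K M t / \<pi>" "nv (gal_trace K M (t / \<pi>)) = 1"
proof -
  have piM: "\<pi> \<in> M" using pi_K KsM by blast
  show "t / \<pi> \<in> AI"
    using M.divide_mem[OF u_M_trace piM] pi_nz by (simp add: AI_def nv_t)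
  show e: "gal_trace K M (t / \<pi>) = gal_trace K M t / \<pi>"
    using mid.bot.trace_scale[OF inverse_mem[OF pi_K] u_M_trace] by (simp add: divide_inverse mult.commute)
  show "nv (gal_trace K M (t / \<pi>)) = 1" unfolding e nv_divide nv_trace_t using pi_nz by simp
qed

text \<open>The summand \<open>q / \<pi>\<close> is integral and lies in \<open>K\<close>, so it
  changes the trace only by \<open>q\<close> times itself, which is small.\<close>

lemma t_plus_q_over_pi: "(t + of_nat q) / \<pi> \<in> AI" "nv (gal_trace K M ((t + of_nat q) / \<pi>)) = 1"
proof -
  have piM: "\<pi> \<in> M" using pi_K KsM by blast
  have q: "nv (of_nat q :: 'a) \<le> nv \<pi>" using discrete[OF of_nat_mem q_small] .
  have "nv (t + of_nat q) \<le> \<rho>" using nv_t q nv_pi_le_rho by (intro nv_add_le) auto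
  then show "(t + of_nat q) / \<pi> \<in> AI"
    using M.divide_mem[OF M.add_mem[OF u_M_trace M.of_nat_mem] piM] pi_nz by (simp add: AI_def)
  have qK: "of_nat q / \<pi> \<in> K" by (rule divide_mem[OF of_nat_mem pi_K])
  have "gal_trace K M ((t + of_nat q) / \<pi>) = gal_trace K M (t / \<pi>) + of_nat q * (of_nat q / \<pi>)"
    using mid.bot.trace_add[of "t / \<pi>" "of_nat q / \<pi>"] t_over_pi(1) qK KsM mid.bot.trace_const[OF qK]
    by (auto simp: AI_def mid.Gal_K_M(3) add_divide_distrib)
  moreover have "nv (of_nat q / \<pi>) \<le> 1" using q pi_nz by (simp add: nv_divide)
  then have "nv (of_nat q * (of_nat q / \<pi>)) < 1" using nv_mult_less_1[OF q_small] by blast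
  ultimately show "nv (gal_trace K M ((t + of_nat q) / \<pi>)) = 1"
    using nv_add_eq[of "of_nat q * (of_nat q / \<pi>)" "gal_trace K M (t / \<pi>)"] t_over_pi(3) by simp
qed

text \<open>Modulo the maximal ideal an integer of \<open>M\<close> is an element of
  \<open>OK\<close>, whose trace is a multiple of \<open>q\<close>. Consequently the trace divided
  by the trace of \<open>t\<close> preserves the valuation ring of \<open>M\<close>.\<close>

lemma nv_trace_integral:
  assumes x: "x \<in> M" "nv x \<le> 1" shows "nv (gal_trace K M x) \<le> nv \<pi>"
proof -
  obtain c where c: "c \<in> OK" "nv (x - c) < 1" using residue_M[OF x] by blast
  have cK: "c \<in> K" using c(1) by (simp add: O_iff)
  then have xc: "x - c \<in> M" "c \<in> M" using x(1) KsM M.diff_mem by auto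
  have "gal_trace K M x = gal_trace K M (x - c) + of_nat q * c"
    using mid.bot.trace_add[OF xc] mid.bot.trace_const[OF cK] by (simp add: mid.Gal_K_M(3))
  moreover have "nv (gal_trace K M (x - c)) < 1" using nv_trace_M_le_self[OF xc(1)] c(2) by simp
  then have "nv (gal_trace K M (x - c)) \<le> nv \<pi>" using discrete mid.bot.trace_mem[OF xc(1)] by blast
  moreover have "nv (c * of_nat q) \<le> nv \<pi>"
    using c(1) discrete[OF of_nat_mem q_small] by (intro nv_mult_le) (auto simp: O_iff)
  ultimately show ?thesis by (simp add: nv_add_le mult.commute)
qed

lemma associated_order_generator: "is_generator K M (associated_order K M) (val_ring M) t"
  unfolding is_generator_def group_ring_act_eq
proof (intro conjI equalityI subsetI)
  show tv: "t \<in> val_ring M" using u_M_trace nv_t rho(2) by (simp add: val_ring_iff)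
  show "y \<in> val_ring M" if "y \<in> (\<lambda>f. comb f t) ` associated_order K M" for y
    using that tv by (auto simp: associated_order_def group_ring_act_eq)
  fix y assume "y \<in> val_ring M"
  then have y: "y \<in> M" "nv y \<le> 1" by (simp_all add: val_ring_iff)
  obtain c where c: "c \<in> OK" "nv (y - c) < 1" using residue_M[OF y] by blast
  have cK: "c \<in> K" using c(1) by (simp add: O_iff)
  have yc: "y - c \<in> M" using y(1) cK KsM M.diff_mem by blast
  have piM: "\<pi> \<in> M" using pi_K KsM by blast
  have "nv (y - c) \<le> \<rho>" using nv_M_le[OF yc, of 0] c(2) by (simp add: One_nat_def)
  \<comment> \<open>The maximal ideal of \<open>M\<close> is \<open>\<pi>\<close> times
    \<open>AI\<close>, so generation of \<open>AI\<close> by \<open>t / \<pi>\<close> says that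
    \<open>t\<close> generates the maximal ideal over the integral group ring.\<close>
  then have "(y - c) / \<pi> \<in> AI" using M.divide_mem[OF yc piM] pi_nz by (simp add: AI_def)
  then obtain f where f: "\<forall>\<sigma>\<in>G. f \<sigma> \<in> OK" "(y - c) / \<pi> = comb f (t / \<pi>)"
    using AI_coeffs[OF t_over_pi(1,3)] by blast
  have "comb f (t / \<pi>) = comb f t / \<pi>"
    unfolding comb_def sum_divide_distrib
  proof (rule sum.cong[OF refl])
    fix \<sigma> assume s: "\<sigma> \<in> G"
    have "\<sigma> (t * inverse \<pi>) = \<sigma> t * inverse \<pi>"
      using mid.bot.gal(4)[OF s u_M_trace M.inverse_mem[OF piM]] mid.bot.gal(7)[OF s inverse_mem[OF pi_K]] by simp
    then show "f \<sigma> * \<sigma> (t / \<pi>) = f \<sigma> * \<sigma> t / \<pi>" by (simp add: divide_inverse)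
  qed
  then have fe: "comb f t = y - c" using f(2) pi_nz by simp
  define T where "T = gal_trace K M t"
  have T: "T \<in> K" "T \<noteq> 0" "nv T = nv \<pi>"
    using mid.bot.trace_mem[OF u_M_trace] nv_trace_t pi_nz by (auto simp: T_def)
  define g where "g = restrict (\<lambda>\<sigma>. f \<sigma> + c / T) G"
  have ge: "comb g z = comb f z + c / T * gal_trace K M z" for z
    by (simp add: comb_def g_def gal_trace_def distrib_right sum.distrib sum_distrib_left)
  have "comb g t = y" unfolding ge fe T_def[symmetric] using T(2) by simp
  moreover have "g \<in> associated_order K M"
    unfolding associated_order_def group_ring_act_eq
  proof (intro CollectI conjI ballI)
    show "g \<in> group_ring K K M"
      using f(1) T(1) cK by (auto simp: group_ring_def g_def O_iff intro!: add_mem divide_mem)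
    fix z assume "z \<in> val_ring M"
    then have z: "z \<in> M" "nv z \<le> 1" by (simp_all add: val_ring_iff)
    have "comb g z \<in> M"
      by (rule comb_mem[OF _ z(1)]) (use f(1) T(1) cK in \<open>auto simp: g_def O_iff intro!: add_mem divide_mem\<close>)
    moreover have "nv (comb f z) \<le> 1"
      unfolding comb_def
    proof (rule nv_sum_le)
      fix \<sigma> assume s: "\<sigma> \<in> G"
      then show "nv (f \<sigma> * \<sigma> z) \<le> 1" using f(1) nv_Gal_M[OF s z(1)] z(2) by (intro nv_mult_le) (auto simp: O_iff)
    qed simp
    moreover have "nv (c * (gal_trace K M z / T)) \<le> 1"
      using c(1) nv_trace_integral[OF z] T pi_nz by (intro nv_mult_le) (auto simp: O_iff nv_divide)
    ultimately show "comb g z \<in> val_ring M" unfolding ge by (simp add: val_ring_iff nv_add_le)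
  qed
  ultimately show "y \<in> (\<lambda>f. comb f t) ` associated_order K M" by blast
qed

end

section \<open>Subfields of \<open>\<complex>\<^sub>p\<close>\<close>

lemma Qp_subfield:
  assumes "is_Cp p TYPE('a::nonarch_valued_field)" shows "set_subfield (Qp :: 'a set)"
proof -
  interpret A: algebraic_closure "subring_struct (Qp_bar :: 'a set)" Qp
    using assms by (simp add: is_Cp_def)
  show ?thesis by (rule set_subfieldI[OF A.subfield_axioms A.ring_axioms])
qed

text \<open>A new vector \<open>v\<close> has positive distance \<open>r\<close> from the closed
  space \<open>E\<close>. Hence the coordinate along \<open>v\<close> is at most the absolute value
  of the vector divided by \<open>r\<close>, and the coordinates of a convergent sequence are
  Cauchy.\<close>

lemma closed_finite_dimension:
  fixes F E :: "'a::nonarch_valued_field set"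
  assumes C: "complete (UNIV :: 'a set)" and d: "ring.dimension ambient n F E"
    and F: "set_subfield F" "closed F"
  shows "closed E \<and> 0 \<in> E \<and> (\<forall>x\<in>E. \<forall>y\<in>E. x - y \<in> E) \<and> (\<forall>k\<in>F. \<forall>x\<in>E. k * x \<in> E)"
proof -
  interpret R: field "ambient :: 'a ring" by rule
  show ?thesis using d F
  proof (induction n F E rule: R.dimension.induct)
    case (zero_dim F)
    then show ?case by auto
  next
    case (Suc_dim v E n F)
    interpret F: set_subfield F by fact
    from Suc_dim.IH[OF Suc_dim.prems] have E: "closed E" "0 \<in> E" "\<And>x y. x \<in> E \<Longrightarrow> y \<in> E \<Longrightarrow> x - y \<in> E"
      "\<And>k x. k \<in> F \<Longrightarrow> x \<in> E \<Longrightarrow> k * x \<in> E" by auto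
    have Em: "- x \<in> E" if "x \<in> E" for x using E(3)[OF E(2) that] by simp
    let ?V = "{k * v + x | k x. k \<in> F \<and> x \<in> E}"
    obtain r where r: "0 < r" "\<And>x. x \<in> E \<Longrightarrow> r \<le> nv (v - x)"
    proof -
      have "v \<in> - E" using Suc_dim.hyps by simp
      then obtain r where r: "0 < r" "ball v r \<subseteq> - E" using E(1) open_contains_ball[of "- E"] by auto
      have "r \<le> nv (v - x)" if "x \<in> E" for x
        using r(2) that by (force simp: dist_eq_nv)
      then show ?thesis using r(1) that by blast
    qed
    have bound: "nv k * r \<le> nv (k * v + x)" if "k \<in> F" "x \<in> E" for k x
    proof (cases "k = 0")
      case False
      have "- (inverse k * x) \<in> E" using E(4)[OF F.inverse_mem[OF that(1)] that(2)] by (rule Em)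
      from r(2)[OF this] have "r \<le> nv (v + inverse k * x)" by simp
      moreover have "k * v + x = k * (v + inverse k * x)" using False by (simp add: distrib_left)
      ultimately show ?thesis by (simp only: nv_mult) (simp add: mult_left_mono)
    qed simp
    have "closed ?V"
      unfolding closed_sequential_limits
    proof (intro allI impI, elim conjE)
      fix y l assume y: "\<forall>n. y n \<in> ?V" and lim: "y \<longlonglongrightarrow> l"
      have "\<exists>k x. y n = k * v + x \<and> k \<in> F \<and> x \<in> E" for n using y by blast
      then obtain k x where kx: "\<And>n. y n = k n * v + x n" "\<And>n. k n \<in> F" "\<And>n. x n \<in> E" by metis
      have "Cauchy k"
      proof (rule metric_CauchyI)
        fix s :: real assume s: "0 < s"
        have "Cauchy y" using lim by (rule LIMSEQ_imp_Cauchy)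
        moreover have "0 < s * r" using s r(1) by simp
        ultimately obtain N where N: "\<And>m n. m \<ge> N \<Longrightarrow> n \<ge> N \<Longrightarrow> nv (y m - y n) < s * r"
          unfolding Cauchy_def dist_eq_nv by blast
        have "nv (k m - k n) < s" if "m \<ge> N" "n \<ge> N" for m n
        proof -
          have "nv (k m - k n) * r \<le> nv ((k m - k n) * v + (x m - x n))"
            by (intro bound F.diff_mem E(3) kx)
          also have "(k m - k n) * v + (x m - x n) = y m - y n" by (simp add: kx(1) algebra_simps)
          finally have "nv (k m - k n) * r < s * r" using N[OF that] by simp
          then show ?thesis using r(1) by simp
        qed
        then show "\<exists>M. \<forall>m\<ge>M. \<forall>n\<ge>M. dist (k m) (k n) < s" by (auto simp: dist_eq_nv)
      qed
      then obtain k0 where k0: "k \<longlonglongrightarrow> k0" using C unfolding complete_def by auto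
      have k0F: "k0 \<in> F" using closed_sequentially[OF Suc_dim.prems(2) _ k0] kx(2) by blast
      have "(\<lambda>n. y n - v * k n) \<longlonglongrightarrow> l - v * k0"
        by (rule nv_tendsto_diff[OF lim nv_tendsto_cmult[OF k0]])
      moreover have "y n - v * k n = x n" for n by (simp add: kx(1) mult.commute)
      ultimately have "x \<longlonglongrightarrow> l - v * k0" by simp
      then have "l - v * k0 \<in> E" using closed_sequentially[OF E(1)] kx(3) by blast
      moreover have "l = k0 * v + (l - v * k0)" by (simp add: mult.commute)
      ultimately show "l \<in> ?V" using k0F by blast
    qed
    moreover have "0 \<in> ?V" using F.zero_mem E(2) by force
    moreover have "a - b \<in> ?V" if ab: "a \<in> ?V" "b \<in> ?V" for a b
    proof -
      obtain k x k' x' where "a = k * v + x" "b = k' * v + x'" "k \<in> F" "x \<in> E" "k' \<in> F" "x' \<in> E" using ab by blast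
      moreover from this have "a - b = (k - k') * v + (x - x')" by (simp add: algebra_simps)
      ultimately show ?thesis using F.diff_mem E(3) by blast
    qed
    moreover have "c * a \<in> ?V" if c: "c \<in> F" and a: "a \<in> ?V" for c a
    proof -
      obtain k x where "a = k * v + x" "k \<in> F" "x \<in> E" using a by blast
      moreover from this have "c * a = (c * k) * v + c * x" by (simp add: algebra_simps)
      ultimately show ?thesis using F.mult_mem[OF c] E(4)[OF c] by blast
    qed
    ultimately show ?case unfolding line_extension_ambient by blast
  qed
qed

lemma uniformizerD:
  fixes K :: "'a::nonarch_valued_field set"
  assumes K: "set_subfield K" and u: "uniformizer K \<pi>"
  shows "\<pi> \<in> K" "nv \<pi> < 1" "x \<in> K \<Longrightarrow> nv x < 1 \<Longrightarrow> nv x \<le> nv \<pi>"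
proof -
  interpret set_subfield K by fact
  have m: "{x \<in> K. nv x < 1} = {a * \<pi> | a. a \<in> K \<and> nv a \<le> 1}"
    using u by (simp add: uniformizer_def cgenideal_def max_ideal_def val_ring_def val_pos_iff val_nonneg_iff)
  show "\<pi> \<in> K" using u by (simp add: uniformizer_def)
  have "1 * \<pi> \<in> {a * \<pi> | a. a \<in> K \<and> nv a \<le> 1}" using one_mem by (intro CollectI exI conjI) auto
  then show "nv \<pi> < 1" unfolding m[symmetric] by simp
  show "nv x \<le> nv \<pi>" if "x \<in> K" "nv x < 1"
  proof -
    have "x \<in> {a * \<pi> | a. a \<in> K \<and> nv a \<le> 1}" using that unfolding m[symmetric] by simp
    then show ?thesis using nv_mult_le[OF _ order_refl, of _ \<pi>] by auto
  qed
qed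

lemma residue_representatives:
  fixes K :: "'a::nonarch_valued_field set"
  assumes K: "set_subfield K" and fin: "finite (carrier (residue_field K))"
  shows "\<exists>R\<subseteq>K. finite R \<and> card R = card (carrier (residue_field K)) \<and> (\<forall>r\<in>R. nv r \<le> 1) \<and>
      (\<forall>r\<in>R. \<forall>s\<in>R. nv (r - s) < 1 \<longrightarrow> r = s) \<and> (\<forall>x\<in>K. nv x \<le> 1 \<longrightarrow> (\<exists>r\<in>R. nv (x - r) < 1))"
proof -
  interpret set_subfield K by fact
  define f where "f a = (\<lambda>h. h + a) ` max_ideal K" for a :: 'a
  have c: "carrier (residue_field K) = f ` val_ring K"
    by (auto simp: FactRing_def A_RCOSETS_def' a_r_coset_def' f_def)
  have f_eq: "f a = f b \<longleftrightarrow> nv (a - b) < 1" if ab: "a \<in> K" "b \<in> K" for a b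
  proof
    assume "f a = f b"
    moreover have "0 + a \<in> f a" unfolding f_def by (intro imageI) (simp add: max_ideal_def zero_mem val_pos_iff)
    ultimately have "a \<in> f b" by simp
    then obtain h where "h \<in> max_ideal K" "a = h + b" by (auto simp: f_def)
    then show "nv (a - b) < 1" by (simp add: max_ideal_def val_pos_iff)
  next
    have sub: "f a \<subseteq> f b" if ab: "a \<in> K" "b \<in> K" "nv (a - b) < 1" for a b
    proof
      fix x assume "x \<in> f a"
      then obtain h where h: "h \<in> K" "nv h < 1" "x = h + a" by (auto simp: f_def max_ideal_def val_pos_iff)
      then have "x = (h + (a - b)) + b" by simp
      moreover have "h + (a - b) \<in> max_ideal K"
        using h ab nv_add_less[OF h(2) ab(3)] by (simp add: max_ideal_def val_pos_iff add_mem diff_mem)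
      ultimately show "x \<in> f b" unfolding f_def by (rule image_eqI)
    qed
    assume lt: "nv (a - b) < 1"
    show "f a = f b"
    proof
      show "f a \<subseteq> f b" by (rule sub[OF ab lt])
      show "f b \<subseteq> f a" using sub[of b a] ab lt nv_minus_commute[of a b] by simp
    qed
  qed
  obtain R where R: "R \<subseteq> val_ring K" "inj_on f R" "carrier (residue_field K) = f ` R"
    using subset_image_inj[of "carrier (residue_field K)" f "val_ring K"] c by auto
  have RK: "r \<in> K" "nv r \<le> 1" if "r \<in> R" for r using R(1) that by (auto simp: val_ring_def val_nonneg_iff)
  show ?thesis
  proof (intro exI[of _ R] conjI ballI impI)
    show "R \<subseteq> K" using RK by blast
    show "finite R" using fin R(2,3) by (simp add: finite_image_iff)
    show "card R = card (carrier (residue_field K))" using R(2,3) by (simp add: card_image)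
    show "nv r \<le> 1" if "r \<in> R" for r using RK that by blast
    show "r = s" if "r \<in> R" "s \<in> R" "nv (r - s) < 1" for r s
      using f_eq[OF RK(1)[OF that(1)] RK(1)[OF that(2)]] that R(2) by (simp add: inj_on_eq_iff)
    show "\<exists>r\<in>R. nv (x - r) < 1" if x: "x \<in> K" "nv x \<le> 1" for x
    proof -
      have "f x \<in> f ` R" unfolding R(3)[symmetric] c using x by (simp add: val_ring_def val_nonneg_iff)
      then obtain r where "r \<in> R" "f x = f r" by blast
      then show ?thesis using f_eq[OF x(1) RK(1)] by blast
    qed
  qed
qed

lemma fps_inv_mem:
  fixes e :: "'a::field fps"
  assumes K: "set_subfield K" and e: "\<And>i. e $ i \<in> K" "e $ 0 = 0" "e $ 1 = 1"
  shows "fps_inv e $ n \<in> K"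
proof -
  interpret set_subfield K by fact
  have pw: "(e ^ i) $ n \<in> K" for i n
  proof (induction i arbitrary: n)
    case (Suc i)
    show ?case unfolding power_Suc fps_mult_nth by (rule sum_mem, rule mult_mem) (use e(1) Suc.IH in auto)
  qed (simp add: mems)
  show ?thesis
  proof (induction n rule: less_induct)
    case (less n)
    show ?case unfolding fps_inv_nth[OF e(2,3), of n]
      by (intro diff_mem sum_mem mult_mem less.IH pw) (auto simp: mems)
  qed
qed

lemma lubin_tate_polyD:
  fixes K :: "'a::nonarch_valued_field set"
  assumes lt: "lubin_tate_poly K q \<pi> P" and pi: "nv \<pi> < 1"
  shows "poly.coeff P i \<in> K" "poly.coeff P 0 = 0" "poly.coeff P 1 = \<pi>"
    "nv (poly.coeff P q - 1) < 1" "i \<noteq> q \<Longrightarrow> nv (poly.coeff P i) < 1"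
proof -
  show "poly.coeff P i \<in> K" "poly.coeff P 0 = 0" "poly.coeff P 1 = \<pi>"
    using lt by (auto simp: lubin_tate_poly_def val_ring_def)
  have s: "nv (poly.coeff (P - Polynomial.monom 1 q) i) < 1" for i
  proof -
    obtain a where "poly.coeff (P - Polynomial.monom 1 q) i = \<pi> * a" "nv a \<le> 1"
      using lt by (auto simp: lubin_tate_poly_def val_ring_def val_nonneg_iff simp del: coeff_diff)
    then show ?thesis using nv_mult_less_1[OF pi] by simp
  qed
  show "nv (poly.coeff P q - 1) < 1" using s[of q] by simp
  show "nv (poly.coeff P i) < 1" if "i \<noteq> q" using s[of i] that by simp
qed

lemma fideal_prod_max_ideal_cube:
  fixes K :: "'a::nonarch_valued_field set"
  assumes disc: "\<And>x. x \<in> K \<Longrightarrow> nv x < 1 \<Longrightarrow> nv x \<le> r" and r: "0 \<le> r"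
    and z: "z \<in> fideal_prod (max_ideal K) (fideal_prod (max_ideal K) (max_ideal K))"
  shows "nv z \<le> r ^ 3"
proof -
  have m: "nv x \<le> r" if "x \<in> max_ideal K" for x
    using that disc by (simp add: max_ideal_def val_pos_iff)
  have prod: "nv z \<le> a * b" if I: "\<And>x. x \<in> I \<Longrightarrow> nv x \<le> a" and J: "\<And>x. x \<in> J \<Longrightarrow> nv x \<le> b"
    and a: "0 \<le> a" and z: "z \<in> fideal_prod I J" for I J :: "'a set" and a b z
    using z
  proof (induction rule: ideal_prod.induct)
    case (prod i j)
    then show ?case using mult_mono[OF I[OF prod(1)] J[OF prod(2)] a] by (simp add: nv_mult)
  next
    case (sum s1 s2)
    then show ?case using nv_add_le by simp
  qed
  have "nv x \<le> r * r" if "x \<in> fideal_prod (max_ideal K) (max_ideal K)" for x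
    by (rule prod[OF m m r that])
  from prod[OF m this r z] have "nv z \<le> r * (r * r)" .
  then show ?thesis by (simp add: power3_eq_cube)
qed

theorem theorem2:
  fixes p q :: nat
    and K M A :: "'a::nonarch_valued_field set"
    and \<pi> \<pi>' t :: 'a
    and P Q :: "'a poly"
    and F :: "'a fps fps"
    and e :: "'a fps"
    and \<omega> :: "nat \<Rightarrow> 'a"
  assumes "is_Cp p TYPE('a)"
    and "subfield K ambient" and "Qp \<subseteq> K" and "K \<subseteq> Qp_bar"
    and "ring.finite_dimension ambient Qp K"
    and "q = card (carrier (residue_field K))"
    and "uniformizer K \<pi>"
    and "lubin_tate_poly K q \<pi> P"
    and "Polynomial.degree P = q" and "poly.coeff P q = 1"
    and "lubin_tate_group K P F"
    and "formal_exp K F e"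
    and "subfield M ambient" and "K \<subseteq> M" and "M \<subseteq> lubin_tate_ext2 K P"
    and "ring.dimension ambient q K M"
    and "fractional_ideal M A"
    and "fideal_prod A A = inverse_different K M"
    and "uniformizer K \<pi>'"
    and "\<pi> - \<pi>' \<in> fideal_prod (max_ideal K) (fideal_prod (max_ideal K) (max_ideal K))"
    and "lubin_tate_poly K q \<pi>' Q"
    and "coherent_roots Q \<omega>"
    and "val (poly.coeff P (q - 1)) = val \<pi>"
    and "t = gal_trace M (lubin_tate_ext2 K P) (E2_value q \<pi> e \<omega>)"
  shows "uniformizer M t \<and> is_generator K M (associated_order K M) (val_ring M) t \<and>
    (odd p \<longrightarrow>
      is_generator K M (group_ring (val_ring K) K M) A (t / \<pi>) \<and>
      is_generator K M (group_ring (val_ring K) K M) A ((t + of_nat q) / \<pi>))"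
proof -
  interpret R: field "ambient :: 'a ring" by rule
  have C: "complete (UNIV :: 'a set)" and valp: "val (of_nat p :: 'a) = 1"
    using assms(1) by (auto simp: is_Cp_def)
  have K: "set_subfield K" and M: "set_subfield M"
    using assms(2,13) by (auto intro: set_subfield_ambient)
  interpret K: set_subfield K by (rule K)
  have "closed K"
  proof -
    obtain n where "ring.dimension ambient n Qp K" using assms(5) by (auto simp: R.finite_dimension_def)
    moreover have "closed (Qp :: 'a set)" by (simp add: Qp_def)
    ultimately show ?thesis using closed_finite_dimension[OF C _ Qp_subfield[OF assms(1)]] by blast
  qed
  note pi = uniformizerD[OF K assms(7)] and pi' = uniformizerD[OF K assms(19)]
  \<comment> \<open>A valuation that is trivial on \<open>K\<close> would make \<open>0\<close> a
    uniformizer; the nonzero element \<open>p\<close> of the maximal ideal excludes this.\<close>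
  have "val (of_nat p :: 'a) \<noteq> \<infinity>" using valp by simp
  then have p0: "(of_nat p :: 'a) \<noteq> 0" by (simp add: val_eq_infty_iff)
  have "nv (of_nat p :: 'a) < 1" using valp by (simp flip: val_pos_iff)
  then have "nv (of_nat p :: 'a) \<le> nv \<pi>" by (rule pi(3)[OF K.of_nat_mem])
  then have pi_nz: "\<pi> \<noteq> 0" using p0 by auto
  note P = lubin_tate_polyD[OF assms(8) pi(2)] and Q = lubin_tate_polyD[OF assms(21) pi'(2)]
  \<comment> \<open>An infinite residue field would give \<open>q = 0\<close> by the convention for
    \<open>card\<close>. A polynomial \<open>P\<close> of degree \<open>0\<close> has no linear
    coefficient \<open>\<pi>\<close>, so this also proves the residue field finite.\<close>
  have q0: "q \<noteq> 0"
  proof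
    assume "q = 0"
    then have "poly.coeff P 1 = 0" using assms(9) by (intro coeff_eq_0) simp
    then show False using P(3) pi_nz by simp
  qed
  have "q \<noteq> 1" using P(3) assms(10) pi(2) by auto
  then have q2: "2 \<le> q" using q0 by linarith
  have fin: "finite (carrier (residue_field K))" using q0 assms(6) card.infinite by force
  have e: "\<And>i. e $ i \<in> K" "e $ 0 = 0" "e $ 1 = 1"
    "subst1 e (var_X + var_Y) = subst2 F (subst1 e var_X) (subst1 e var_Y)"
    using assms(12) by (auto simp: formal_exp_def)
  define l where "l = fps_inv e"
  have "lubin_tate K \<pi> q P l e"
  proof (intro lubin_tate.intro local_subfield.intro local_subfield_axioms.intro lubin_tate_axioms.intro)
    show "\<exists>R\<subseteq>K. finite R \<and> card R = q \<and> (\<forall>r\<in>R. nv r \<le> 1) \<and>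
      (\<forall>r\<in>R. \<forall>s\<in>R. nv (r - s) < 1 \<longrightarrow> r = s) \<and> (\<forall>x\<in>K. nv x \<le> 1 \<longrightarrow> (\<exists>r\<in>R. nv (x - r) < 1))"
      unfolding assms(6) by (rule residue_representatives[OF K fin])
    show "l $ i \<in> K" for i unfolding l_def by (rule fps_inv_mem[OF K e(1-3)])
    show "l $ 0 = 0" "l $ 1 = 1"
      unfolding l_def using fps_inv_nth[OF e(2,3), of 0] fps_inv_nth[OF e(2,3), of 1] e(2)
      by (simp_all add: One_nat_def)
    show "l oo e = fps_X" unfolding l_def using e by (intro fps_inv) auto
    show "e oo l = fps_X" unfolding l_def using e by (intro fps_inv_right) auto
    have F: "comm_formal_group (val_ring K) F"
      "subst1 (fps_of_poly P) (subst2 F var_X var_Y) = subst2 F (subst1 (fps_of_poly P) var_X) (subst1 (fps_of_poly P) var_Y)"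
      using assms(11) by (simp_all add: lubin_tate_group_def)
    have F': "subst2 F var_X 0 = var_X" "subst2 F 0 var_Y = var_Y"
      using F(1) by (simp_all add: comm_formal_group_def)
    have "fps_of_poly P $ 0 = 0" using P(2) by simp
    from formal_log_of_group[OF F' this F(2) e(2-4)]
    show "l oo fps_of_poly P = fps_const \<pi> * l" unfolding l_def using P(3) by simp
  qed (use C K pi \<open>closed K\<close> pi_nz q2 P assms(9,10) e in auto)
  then interpret LT: lubin_tate K \<pi> q P l e .
  have om: "nv (\<omega> 1) < 1" "nv (\<omega> 2) < 1" "\<omega> 1 \<noteq> 0" "poly Q (\<omega> 1) = 0" "poly Q (\<omega> 2) = \<omega> 1"
    using assms(22) by (auto simp: coherent_roots_def val_pos_iff numeral_2_eq_2 One_nat_def)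
  interpret LP: lubin_tate_pair K \<pi> q P l e \<pi>' Q "\<omega> 1" "\<omega> 2"
  proof
    show "nv (\<pi> - \<pi>') \<le> nv \<pi> ^ 3" by (rule fideal_prod_max_ideal_cube[OF pi(3) nv_nonneg assms(20)])
  qed (use Q om in auto)
  \<comment> \<open>\<open>E2_series\<close> reads the sequence only at the indices \<open>1\<close>
    and \<open>2\<close>, so it may be replaced by a sequence with two values.\<close>
  have u: "E2_value q \<pi> e \<omega> = LP.u"
    unfolding LP.u_def LP.E_def fps_total_def E2_value_def by (simp add: E2_series_def)
  interpret T: torsion_point K \<pi> q P l e LP.u
    by unfold_locales (use LP.nv_u LP.nv_u_power LP.u_torsion om in auto)
  have L: "lubin_tate_ext2 K P = T.L" by (rule T.L_eq_ext2)
  interpret D: degree_q_subextension K \<pi> q P l e LP.u M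
    by (intro degree_q_subextension.intro degree_q_subextension_axioms.intro T.torsion_point_axioms M)
      (use assms(14-16) L assms(23) in \<open>auto simp: nv_eq_iff_val\<close>)
  have t: "t = D.t" unfolding assms(24) L u D.t_def ..
  have A: "A = D.AI"
    unfolding D.AI_def by (rule D.sqrt_inverse_different[OF assms(17,18)])
  show ?thesis
    unfolding t A using D.uniformizer_t D.associated_order_generator D.AI_generator D.t_over_pi(1,3)
      D.t_plus_q_over_pi by blast
qed

end
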